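(* Let $\Omega\subset\mathbb{R}^3$ be open and bounded with continuous boundary, and let $m$ be the number of connected components of $\mathbb{R}^3\setminus\overline{\Omega}$. Let $$\mathcal{H}:=\ker(\mathring{\operatorname{CurlCurl}}{}^\top_{\mathbb{S}})\cap\ker(\operatorname{Div}_{\mathbb{S}})\subset L^{2,3\times3}_{\mathbb{S}}(\Omega).$$ Then $\dim\mathcal{H}=6(m-1)$, and a basis of $\mathcal{H}$ is given by $$\big\{\operatorname{symGrad}v_{\ell,j}:\ell\in\{1,\dots,m-1\},\ j\in\{1,\dots,6\}\big\},$$ where $v_{\ell,j}=\xi_{\ell,j}-\psi_{\ell,j}\in H^{1,3}(\Omega)$ are the vector fields constructed in the context.
   Context: All function spaces are real. $L^{2,3}(\Omega)$, $H^{1,3}(\Omega)$, $H^{1,3}_0(\Omega)$: vector fields with components in $L^2$, $H^1$, $H^1_0$. $L^{2,3\times3}_{\mathbb{S}}(\Omega)$: symmetric $3\times3$ tensor fields with $L^2$ entries. $\operatorname{Grad}v$ is the Jacobian matrix; $\operatorname{Curl}$, $\operatorname{Div}$ act row-wise; $\operatorname{symGrad}v=\frac12(\operatorname{Grad}v+(\operatorname{Grad}v)^\top)$; $\operatorname{CurlCurl}^\top S:=\operatorname{Curl}\big((\operatorname{Curl}S)^\top\big)$. $\mathring{\operatorname{symGrad}}$ is the closure of $\operatorname{symGrad}$ on smooth compactly supported vector fields, $L^{2,3}(\Omega)\to L^{2,3\times3}_{\mathbb{S}}(\Omega)$ (its domain is $H^{1,3}_0(\Omega)$ and its range is closed); $\operatorname{Div}_{\mathbb{S}}:=-(\mathring{\operatorname{symGrad}})^*$;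 $\mathring{\operatorname{CurlCurl}}{}^\top_{\mathbb{S}}$ is the closure of $\operatorname{CurlCurl}^\top$ on smooth compactly supported symmetric fields, $L^{2,3\times3}_{\mathbb{S}}(\Omega)\to L^{2,3\times3}_{\mathbb{S}}(\Omega)$. Continuous boundary: the boundary is locally the graph of a continuous function (equivalently, $\Omega$ has the segment property). Construction. Let $\Xi_0$ be the unbounded and $\Xi_1,\dots,\Xi_{m-1}$ the remaining connected components of $\mathbb{R}^3\setminus\overline{\Omega}$. Let $\xi_\ell\in C^\infty_c(\mathbb{R}^3)$, $\ell\in\{1,\dots,m-1\}$, have pairwise disjoint supports with $\xi_\ell=1$ in a neighbourhood of $\Xi_\ell$ and $\xi_\ell=0$ in a neighbourhood of $\Xi_k$ for all $k\in\{0,\dots,m-1\}\setminus\{\ell\}$. Let $\widehat{r}_j(x):=e^j\times x$ and $\widehat{r}_{j+3}(x):=e^j$ (unit vectors) for $j\in\{1,2,3\}$, and $\xi_{\ell,j}:=\xi_\ell\widehat{r}_j$ for $j\in\{1,\dots,6\}$. Let $\pi$ be the orthogonal projector in $L^{2,3\times3}_{\mathbb{S}}(\Omega)=\operatorname{ran}(\mathring{\operatorname{symGrad}})\oplus\ker(\operatorname{Div}_{\mathbb{S}})$ onto $\ker(\operatorname{Div}_{\mathbb{S}})$. Then $\psi_{\ell,j}\in H^{1,3}_0(\Omega)$ is the unique vector field with $\pi\operatorname{symGrad}\xi_{\ell,j}=\operatorname{symGrad}(\xi_{\ell,j}-\psi_{\ell,j})$ in $\Omega$. *)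

theory Defs
  imports "HOL-Analysis.Analysis"
begin

section \<open>Real \<open>L\<^sup>2\<close> spaces of vector-valued functions\<close>

definition sq_integrable :: "('a::euclidean_space \<Rightarrow> 'b::euclidean_space) \<Rightarrow> bool" where
  "sq_integrable f \<longleftrightarrow>
     f \<in> borel_measurable lebesgue \<and> integrable lebesgue (\<lambda>x. (norm (f x))\<^sup>2)"

definition ae_rel :: "('a::euclidean_space \<Rightarrow> 'b::euclidean_space) \<Rightarrow> ('a \<Rightarrow> 'b) \<Rightarrow> bool" where
  "ae_rel f g \<longleftrightarrow> sq_integrable f \<and> sq_integrable g \<and> (AE x in lebesgue. f x = g x)"

lemma sq_integrable_zero: "sq_integrable (\<lambda>x. 0)"
  by (simp add: sq_integrable_def)

lemma sq_integrable_add: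
  assumes "sq_integrable f" "sq_integrable g"
  shows "sq_integrable (\<lambda>x. f x + g x)"
proof -
  have [measurable]: "f \<in> borel_measurable lebesgue" "g \<in> borel_measurable lebesgue"
    using assms by (auto simp: sq_integrable_def)
  have "integrable lebesgue (\<lambda>x. 2 * (norm (f x))\<^sup>2 + 2 * (norm (g x))\<^sup>2)"
    using assms by (auto simp: sq_integrable_def)
  moreover have "(norm (f x + g x))\<^sup>2 \<le> 2 * (norm (f x))\<^sup>2 + 2 * (norm (g x))\<^sup>2" for x
  proof -
    have "(norm (f x + g x))\<^sup>2 \<le> (norm (f x) + norm (g x))\<^sup>2"
      by (intro power_mono norm_triangle_ineq) auto
    also have "\<dots> \<le> 2 * (norm (f x))\<^sup>2 + 2 * (norm (g x))\<^sup>2"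
      using sum_squares_bound[of "norm (f x)" "norm (g x)"] by (simp add: power2_sum)
    finally show ?thesis .
  qed
  ultimately have "integrable lebesgue (\<lambda>x. (norm (f x + g x))\<^sup>2)"
    by (elim Bochner_Integration.integrable_bound) (auto intro!: AE_I2)
  then show ?thesis
    by (simp add: sq_integrable_def)
qed

lemma sq_integrable_scaleR:
  assumes "sq_integrable f"
  shows "sq_integrable (\<lambda>x. c *\<^sub>R f x)"
  using assms by (auto simp: sq_integrable_def power_mult_distrib)

lemma sq_integrable_uminus:
  assumes "sq_integrable f"
  shows "sq_integrable (\<lambda>x. - f x)"
  using sq_integrable_scaleR[OF assms, of "-1"] by simp

lemma sq_integrable_diff:
  assumes "sq_integrable f" "sq_integrable g"
  shows "sq_integrable (\<lambda>x. f x - g x)"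
  using sq_integrable_add[OF assms(1) sq_integrable_uminus[OF assms(2)]] by simp

lemma integrable_inner_sq:
  assumes "sq_integrable f" "sq_integrable g"
  shows "integrable lebesgue (\<lambda>x. f x \<bullet> g x)"
proof -
  have [measurable]: "f \<in> borel_measurable lebesgue" "g \<in> borel_measurable lebesgue"
    using assms by (auto simp: sq_integrable_def)
  have "integrable lebesgue (\<lambda>x. (norm (f x))\<^sup>2 + (norm (g x))\<^sup>2)"
    using assms by (auto simp: sq_integrable_def)
  moreover have "\<bar>f x \<bullet> g x\<bar> \<le> (norm (f x))\<^sup>2 + (norm (g x))\<^sup>2" for x
  proof -
    have "\<bar>f x \<bullet> g x\<bar> \<le> norm (f x) * norm (g x)"
      by (rule Cauchy_Schwarz_ineq2)
    also have "\<dots> \<le> (norm (f x))\<^sup>2 + (norm (g x))\<^sup>2"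
      using sum_squares_bound[of "norm (f x)" "norm (g x)"]
        mult_nonneg_nonneg[OF norm_ge_zero norm_ge_zero, of "f x" "g x"] by linarith
    finally show ?thesis .
  qed
  ultimately show ?thesis
    by (elim Bochner_Integration.integrable_bound) (auto intro!: AE_I2)
qed

text \<open>\<open>('a, 'b) L2\<close> is $L^2$ of the whole space; the spaces over a domain \<open>\<Omega>\<close> are identified below
  with the subspaces of elements that vanish outside of \<open>\<Omega>\<close>.\<close>

quotient_type (overloaded) ('a, 'b) L2 = "'a::euclidean_space \<Rightarrow> 'b::euclidean_space" / partial: ae_rel
proof (rule part_equivpI)
  show "\<exists>f. ae_rel f f"
    using sq_integrable_zero by (auto simp: ae_rel_def)
  show "symp ae_rel"
    by (rule sympI) (auto simp: ae_rel_def elim: AE_mp)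
  show "transp ae_rel"
    by (rule transpI) (auto simp: ae_rel_def elim!: AE_mp)
qed

instantiation L2 :: (euclidean_space, euclidean_space) real_vector
begin

lift_definition zero_L2 :: "('a, 'b) L2" is "\<lambda>x. 0"
  by (simp add: ae_rel_def sq_integrable_zero)

lift_definition plus_L2 :: "('a, 'b) L2 \<Rightarrow> ('a, 'b) L2 \<Rightarrow> ('a, 'b) L2" is "\<lambda>f g x. f x + g x"
  by (auto simp: ae_rel_def sq_integrable_add elim!: AE_mp)

lift_definition minus_L2 :: "('a, 'b) L2 \<Rightarrow> ('a, 'b) L2 \<Rightarrow> ('a, 'b) L2" is "\<lambda>f g x. f x - g x"
  by (auto simp: ae_rel_def sq_integrable_diff elim!: AE_mp)

lift_definition uminus_L2 :: "('a, 'b) L2 \<Rightarrow> ('a, 'b) L2" is "\<lambda>f x. - f x"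
  by (auto simp: ae_rel_def sq_integrable_uminus elim!: AE_mp)

lift_definition scaleR_L2 :: "real \<Rightarrow> ('a, 'b) L2 \<Rightarrow> ('a, 'b) L2" is "\<lambda>c f x. c *\<^sub>R f x"
  by (auto simp: ae_rel_def sq_integrable_scaleR elim!: AE_mp)

instance
proof
  fix u v w :: "('a, 'b) L2" and r s :: real
  show "u + v + w = u + (v + w)"
    by transfer (simp add: ae_rel_def sq_integrable_add add.assoc)
  show "u + v = v + u"
    by transfer (simp add: ae_rel_def sq_integrable_add add.commute)
  show "0 + u = u"
    by transfer (simp add: ae_rel_def)
  show "- u + u = 0"
    by transfer (simp add: ae_rel_def sq_integrable_zero)
  show "u - v = u + - v"
    by transfer (simp add: ae_rel_def sq_integrable_diff)
  show "r *\<^sub>R (u + v) = r *\<^sub>R u + r *\<^sub>R v"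
    by transfer (simp add: ae_rel_def sq_integrable_add sq_integrable_scaleR scaleR_add_right)
  show "(r + s) *\<^sub>R u = r *\<^sub>R u + s *\<^sub>R u"
    by transfer (simp add: ae_rel_def sq_integrable_add sq_integrable_scaleR scaleR_add_left)
  show "r *\<^sub>R s *\<^sub>R u = (r * s) *\<^sub>R u"
    by transfer (simp add: ae_rel_def sq_integrable_scaleR)
  show "1 *\<^sub>R u = u"
    by transfer (simp add: ae_rel_def)
qed

end

instantiation L2 :: (euclidean_space, euclidean_space) real_inner
begin

lift_definition inner_L2 :: "('a, 'b) L2 \<Rightarrow> ('a, 'b) L2 \<Rightarrow> real"
  is "\<lambda>f g. integral\<^sup>L lebesgue (\<lambda>x. f x \<bullet> g x)"
proof -
  fix f f' g g' :: "'a \<Rightarrow> 'b"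
  assume *: "ae_rel f f'" "ae_rel g g'"
  then have [measurable]: "f \<in> borel_measurable lebesgue" "g \<in> borel_measurable lebesgue"
    "f' \<in> borel_measurable lebesgue" "g' \<in> borel_measurable lebesgue"
    by (auto simp: ae_rel_def sq_integrable_def)
  show "integral\<^sup>L lebesgue (\<lambda>x. f x \<bullet> g x) = integral\<^sup>L lebesgue (\<lambda>x. f' x \<bullet> g' x)"
    by (rule integral_cong_AE) (use * in \<open>auto simp: ae_rel_def elim!: AE_mp\<close>)
qed

definition norm_L2 :: "('a, 'b) L2 \<Rightarrow> real" where
  "norm_L2 u = sqrt (u \<bullet> u)"

definition sgn_L2 :: "('a, 'b) L2 \<Rightarrow> ('a, 'b) L2" where
  "sgn_L2 u = u /\<^sub>R norm u"

definition dist_L2 :: "('a, 'b) L2 \<Rightarrow> ('a, 'b) L2 \<Rightarrow> real" where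
  "dist_L2 u v = norm (u - v)"

definition uniformity_L2 :: "(('a, 'b) L2 \<times> ('a, 'b) L2) filter" where
  "uniformity_L2 = (INF e\<in>{0<..}. principal {(u, v). dist u v < e})"

definition open_L2 :: "('a, 'b) L2 set \<Rightarrow> bool" where
  "open_L2 U \<longleftrightarrow> (\<forall>u\<in>U. \<forall>\<^sub>F (u', v) in uniformity. u' = u \<longrightarrow> v \<in> U)"

instance
proof
  fix u v w :: "('a, 'b) L2" and r :: real
  show "dist u v = norm (u - v)"
    by (rule dist_L2_def)
  show "sgn u = u /\<^sub>R norm u"
    by (rule sgn_L2_def)
  show "(uniformity :: (('a, 'b) L2 \<times> ('a, 'b) L2) filter)
      = (INF e\<in>{0<..}. principal {(u, v). dist u v < e})"
    by (rule uniformity_L2_def)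
  show "open U \<longleftrightarrow> (\<forall>u\<in>U. \<forall>\<^sub>F (u', v) in uniformity. u' = u \<longrightarrow> v \<in> U)"
    for U :: "('a, 'b) L2 set"
    by (rule open_L2_def)
  show "u \<bullet> v = v \<bullet> u"
    by transfer (simp add: inner_commute)
  show "(u + v) \<bullet> w = u \<bullet> w + v \<bullet> w"
    by transfer (simp add: ae_rel_def inner_add_left integrable_inner_sq)
  show "(r *\<^sub>R u) \<bullet> v = r * (u \<bullet> v)"
    by transfer simp
  show "0 \<le> u \<bullet> u"
    by transfer simp
  show "u \<bullet> u = 0 \<longleftrightarrow> u = 0"
  proof (transfer)
    fix f :: "'a \<Rightarrow> 'b"
    assume "ae_rel f f"
    then have f: "sq_integrable f"
      by (simp add: ae_rel_def)
    have "integral\<^sup>L lebesgue (\<lambda>x. f x \<bullet> f x) = 0 \<longleftrightarrow> (AE x in lebesgue. f x \<bullet> f x = 0)"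
      by (intro integral_nonneg_eq_0_iff_AE integrable_inner_sq f) auto
    also have "\<dots> \<longleftrightarrow> ae_rel f (\<lambda>x. 0)"
      using f by (simp add: ae_rel_def sq_integrable_zero)
    finally show "integral\<^sup>L lebesgue (\<lambda>x. f x \<bullet> f x) = 0 \<longleftrightarrow> ae_rel f (\<lambda>x. 0)" .
  qed
  show "norm u = sqrt (u \<bullet> u)"
    by (rule norm_L2_def)
qed

end

type_synonym vec_field = "real^3 \<Rightarrow> real^3"
type_synonym ten_field = "real^3 \<Rightarrow> real^3^3"
type_synonym vec_L2 = "(real^3, real^3) L2"
type_synonym ten_L2 = "(real^3, real^3^3) L2"

definition L2_on :: "'a::euclidean_space set \<Rightarrow> ('a, 'b::euclidean_space) L2 set" where
  "L2_on \<Omega> = {u. AE x in lebesgue. x \<notin> \<Omega> \<longrightarrow> rep_L2 u x = 0}"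

definition L2_sym :: "(real^3) set \<Rightarrow> ten_L2 set" where
  "L2_sym \<Omega> = {S \<in> L2_on \<Omega>. AE x in lebesgue. transpose (rep_L2 S x) = rep_L2 S x}"

text \<open>The class in $L^2(\Omega)$ of the restriction of \<open>f\<close> to \<open>\<Omega>\<close>; meaningful only if this
  restriction is square integrable.\<close>

definition to_L2 :: "'a::euclidean_space set \<Rightarrow> ('a \<Rightarrow> 'b::euclidean_space) \<Rightarrow> ('a, 'b) L2" where
  "to_L2 \<Omega> f = abs_L2 (\<lambda>x. if x \<in> \<Omega> then f x else 0)"


section \<open>Test fields and classical differential operators\<close>

definition supp :: "('a::topological_space \<Rightarrow> 'b::zero) \<Rightarrow> 'a set" where
  "supp f = closure {x. f x \<noteq> 0}"

primrec Ck :: "nat \<Rightarrow> ('a::euclidean_space \<Rightarrow> 'b::real_normed_vector) \<Rightarrow> bool" where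
  "Ck 0 f \<longleftrightarrow> continuous_on UNIV f"
| "Ck (Suc k) f \<longleftrightarrow> (\<forall>x. f differentiable (at x)) \<and>
     (\<forall>b\<in>Basis. Ck k (\<lambda>x. frechet_derivative f (at x) b))"

definition Cc_inf :: "'a::euclidean_space set \<Rightarrow> ('a \<Rightarrow> 'b::real_normed_vector) set" where
  "Cc_inf \<Omega> = {f. (\<forall>k. Ck k f) \<and> compact (supp f) \<and> supp f \<subseteq> \<Omega>}"

definition Cc_inf_sym :: "(real^3) set \<Rightarrow> ten_field set" where
  "Cc_inf_sym \<Omega> = {S \<in> Cc_inf \<Omega>. \<forall>x. transpose (S x) = S x}"

definition sym_part :: "real^3^3 \<Rightarrow> real^3^3" where
  "sym_part A = (1/2) *\<^sub>R (A + transpose A)"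

definition grad_c :: "vec_field \<Rightarrow> ten_field" where
  "grad_c v x = jacobian v (at x)"

definition symgrad_c :: "vec_field \<Rightarrow> ten_field" where
  "symgrad_c v x = sym_part (grad_c v x)"

definition curl_c :: "vec_field \<Rightarrow> vec_field" where
  "curl_c v x = (let J = grad_c v x in
     vector [J $ 3 $ 2 - J $ 2 $ 3, J $ 1 $ 3 - J $ 3 $ 1, J $ 2 $ 1 - J $ 1 $ 2])"

definition Div_c :: "ten_field \<Rightarrow> vec_field" where
  "Div_c S x = (\<chi> i. trace (grad_c (\<lambda>y. S y $ i) x))"

definition Curl_c :: "ten_field \<Rightarrow> ten_field" where
  "Curl_c S x = (\<chi> i. curl_c (\<lambda>y. S y $ i) x)"

definition CurlCurlT_c :: "ten_field \<Rightarrow> ten_field" where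
  "CurlCurlT_c S = Curl_c (\<lambda>x. transpose (Curl_c S x))"


section \<open>Closed operators, represented by their graphs\<close>

definition ker_graph :: "('a \<times> 'b::zero) set \<Rightarrow> 'a set" where
  "ker_graph T = {x. (x, 0) \<in> T}"

text \<open>Hilbert space adjoint of an operator from the subspace \<open>X\<close> to the subspace \<open>Y\<close>.\<close>

definition adjoint_graph ::
  "'a::real_inner set \<Rightarrow> 'b::real_inner set \<Rightarrow> ('a \<times> 'b) set \<Rightarrow> ('b \<times> 'a) set" where
  "adjoint_graph X Y T = {(y, x). y \<in> Y \<and> x \<in> X \<and> (\<forall>(u, w)\<in>T. w \<bullet> y = u \<bullet> x)}"

definition symGrad_ring :: "(real^3) set \<Rightarrow> (vec_L2 \<times> ten_L2) set" where
  "symGrad_ring \<Omega> = closure ((\<lambda>\<phi>. (to_L2 \<Omega> \<phi>, to_L2 \<Omega> (symgrad_c \<phi>))) ` Cc_inf \<Omega>)"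

definition Div_S :: "(real^3) set \<Rightarrow> (ten_L2 \<times> vec_L2) set" where
  "Div_S \<Omega> = {(S, - f) | S f. (S, f) \<in> adjoint_graph (L2_on \<Omega>) (L2_sym \<Omega>) (symGrad_ring \<Omega>)}"

definition CurlCurlT_ring :: "(real^3) set \<Rightarrow> (ten_L2 \<times> ten_L2) set" where
  "CurlCurlT_ring \<Omega> = closure ((\<lambda>\<Phi>. (to_L2 \<Omega> \<Phi>, to_L2 \<Omega> (CurlCurlT_c \<Phi>))) ` Cc_inf_sym \<Omega>)"

definition harmonic_fields :: "(real^3) set \<Rightarrow> ten_L2 set" where
  "harmonic_fields \<Omega> = ker_graph (CurlCurlT_ring \<Omega>) \<inter> ker_graph (Div_S \<Omega>)"


section \<open>Sobolev spaces\<close>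

text \<open>Graph of the weak Jacobian in $L^2(\Omega)$.\<close>

definition weak_Grad :: "(real^3) set \<Rightarrow> (vec_L2 \<times> ten_L2) set" where
  "weak_Grad \<Omega> = {(v, G). v \<in> L2_on \<Omega> \<and> G \<in> L2_on \<Omega> \<and>
     (\<forall>\<Phi>\<in>Cc_inf \<Omega>. G \<bullet> to_L2 \<Omega> \<Phi> = - (v \<bullet> to_L2 \<Omega> (Div_c \<Phi>)))}"

definition H1 :: "(real^3) set \<Rightarrow> vec_L2 set" where
  "H1 \<Omega> = Domain (weak_Grad \<Omega>)"

definition Grad :: "(real^3) set \<Rightarrow> vec_L2 \<Rightarrow> ten_L2" where
  "Grad \<Omega> v = (THE G. (v, G) \<in> weak_Grad \<Omega>)"

definition symGrad :: "(real^3) set \<Rightarrow> vec_L2 \<Rightarrow> ten_L2" where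
  "symGrad \<Omega> v = abs_L2 (\<lambda>x. sym_part (rep_L2 (Grad \<Omega> v) x))"

text \<open>Closure of the test fields with respect to the norm of $H^1(\Omega)$, i.e. the graph norm
  of the Jacobian.\<close>

definition H10 :: "(real^3) set \<Rightarrow> vec_L2 set" where
  "H10 \<Omega> = Domain (closure ((\<lambda>\<phi>. (to_L2 \<Omega> \<phi>, to_L2 \<Omega> (grad_c \<phi>))) ` Cc_inf \<Omega>))"


section \<open>The domain and the construction of the basis\<close>

text \<open>Near each boundary point \<open>\<Omega>\<close> is, in suitable orthonormal coordinates, the open subgraph of a
  continuous function; in particular it lies on one side of its boundary, as the segment
  property requires. Taking \<open>g\<close> on the whole plane is no restriction: a continuous function on a
  closed disc extends continuously.\<close>

definition continuous_boundary :: "(real^3) set \<Rightarrow> bool" where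
  "continuous_boundary \<Omega> \<longleftrightarrow>
     (\<forall>p\<in>frontier \<Omega>. \<exists>U (Q :: real^3 \<Rightarrow> real^3) (g :: real \<times> real \<Rightarrow> real).
        open U \<and> p \<in> U \<and> orthogonal_transformation Q \<and> continuous_on UNIV g \<and>
        \<Omega> \<inter> U = {x \<in> U. Q x $ 3 < g (Q x $ 1, Q x $ 2)})"

definition orth_proj :: "'a::real_inner set \<Rightarrow> 'a \<Rightarrow> 'a" where
  "orth_proj M x = (THE y. y \<in> M \<and> (\<forall>z\<in>M. (x - y) \<bullet> z = 0))"

definition exterior_enumeration :: "(real^3) set \<Rightarrow> nat \<Rightarrow> (nat \<Rightarrow> (real^3) set) \<Rightarrow> bool" where
  "exterior_enumeration \<Omega> m \<Xi> \<longleftrightarrow>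
     bij_betw \<Xi> {0..m - 1} (components (- closure \<Omega>)) \<and> \<not> bounded (\<Xi> 0)"

text \<open>The components \<open>\<Xi> l\<close> are open, hence neighbourhoods of themselves. Cut-offs that are locally
  constant near the closures of the components are a special case.\<close>

definition is_cutoff_family ::
  "nat \<Rightarrow> (nat \<Rightarrow> (real^3) set) \<Rightarrow> (nat \<Rightarrow> real^3 \<Rightarrow> real) \<Rightarrow> bool" where
  "is_cutoff_family m \<Xi> \<xi> \<longleftrightarrow>
     (\<forall>l\<in>{1..m - 1}. \<xi> l \<in> Cc_inf UNIV) \<and>
     (\<forall>l\<in>{1..m - 1}. \<forall>k\<in>{1..m - 1}. l \<noteq> k \<longrightarrow> supp (\<xi> l) \<inter> supp (\<xi> k) = {}) \<and>
     (\<forall>l\<in>{1..m - 1}. \<exists>U. open U \<and> \<Xi> l \<subseteq> U \<and> (\<forall>x\<in>U. \<xi> l x = 1)) \<and>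
     (\<forall>l\<in>{1..m - 1}. \<forall>k\<in>{0..m - 1} - {l}. \<exists>U. open U \<and> \<Xi> k \<subseteq> U \<and> (\<forall>x\<in>U. \<xi> l x = 0))"

text \<open>For \<open>j \<le> 3\<close> this is $e^j \times x$, for \<open>4 \<le> j \<le> 6\<close> the constant $e^{j-3}$; the index type
  \<open>3\<close> is cyclic, so that \<open>of_nat 3 = (3 :: 3)\<close>.\<close>

definition rigid_field :: "nat \<Rightarrow> vec_field" where
  "rigid_field j x = (if j \<le> 3 then cross3 (axis (of_nat j) 1) x else axis (of_nat (j - 3)) 1)"

definition xi_field :: "(real^3) set \<Rightarrow> (real^3 \<Rightarrow> real) \<Rightarrow> nat \<Rightarrow> vec_L2" where
  "xi_field \<Omega> \<eta> j = to_L2 \<Omega> (\<lambda>x. \<eta> x *\<^sub>R rigid_field j x)"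

definition psi_field :: "(real^3) set \<Rightarrow> (real^3 \<Rightarrow> real) \<Rightarrow> nat \<Rightarrow> vec_L2" where
  "psi_field \<Omega> \<eta> j = (THE \<psi>. \<psi> \<in> H10 \<Omega> \<and>
     orth_proj (ker_graph (Div_S \<Omega>)) (symGrad \<Omega> (xi_field \<Omega> \<eta> j))
       = symGrad \<Omega> (xi_field \<Omega> \<eta> j - \<psi>))"

definition v_field :: "(real^3) set \<Rightarrow> (real^3 \<Rightarrow> real) \<Rightarrow> nat \<Rightarrow> vec_L2" where
  "v_field \<Omega> \<eta> j = xi_field \<Omega> \<eta> j - psi_field \<Omega> \<eta> j"

end

theory Submission
  imports Defs
begin

text \<open>A field \<open>S\<close> in the kernel of the minimal operator $\operatorname{Curl}\operatorname{Curl}^\top$, extended by zero and mollified, is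
  $\operatorname{symGrad}$ of a compactly supported smooth field by the explicit Saint-Venant potential; Korn's and
  Poincare's inequalities let the potentials converge, so $S = \operatorname{symGrad}v$ with \<open>v\<close> in $H^1_0$ of a
  large ball. Outside $\overline{\Omega}$ the field \<open>v\<close> is locally a rigid motion, hence a single one on each
  $\Xi_\ell$, and it vanishes on $\Xi_0$. Subtracting cut-off rigid motions leaves a field that vanishes
  outside $\overline{\Omega}$; the segment property puts it into $H^1_0(\Omega)$, and there it is invisible
  modulo the range of the minimal $\operatorname{symGrad}$, which gives the spanning property. Conversely, if a
  combination of the $\operatorname{symGrad}v_{\ell,j}$ vanishes, Korn's inequality on the whole space kills the
  extended field, and its values on $\Xi_\ell$ are the rigid motions, so all coefficients vanish.\<close>

section \<open>Smooth functions\<close>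

text \<open>Over a merely continuous boundary, Korn's inequality and extension operators fail in
  general on H^1(\<Omega>). All estimates are therefore made for fields with zero boundary values,
  where Korn's inequality is one integration by parts with a constant independent of the domain, and
  spaces over \<Omega> sit inside those over R^3 through extension by zero. An element of H^1_0 is
  carried as a pair (field, Jacobian) in the closure of the test pairs, so that a closed condition
  is checked on test fields only. Mollification is forced because the kernel of the closed operator
  only provides test fields whose Curl Curl^T tends to zero, whereas the Saint-Venant potential asks
  for exactly zero; the price is a support slightly larger than \<Omega>, which is why the potential
  is controlled only away from the closure of \<Omega>. The boundary enters through three facts: the
  exterior has finitely many components with disjoint closures, its closure is the complement of
  \<Omega>, and fields vanishing on it can be pushed into \<Omega>.\<close>

definition smooth :: "('a::euclidean_space \<Rightarrow> 'b::real_normed_vector) \<Rightarrow> bool" where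
  "smooth f \<longleftrightarrow> (\<forall>k. Ck k f)"

definition dird :: "'a::euclidean_space \<Rightarrow> ('a \<Rightarrow> 'b::real_normed_vector) \<Rightarrow> 'a \<Rightarrow> 'b" where
  "dird a f x = frechet_derivative f (at x) a"

lemma dird_eq: "(f has_derivative f') (at x) \<Longrightarrow> dird a f x = f' a"
  unfolding dird_def using frechet_derivative_at by metis

lemma Ck_SucI:
  assumes "\<And>x. (f has_derivative D x) (at x)" "\<And>b. b \<in> Basis \<Longrightarrow> Ck k (\<lambda>x. D x b)"
  shows "Ck (Suc k) f"
proof -
  have "frechet_derivative f (at x) = D x" for x
    using assms(1) frechet_derivative_at by metis
  then show ?thesis
    using assms by (auto simp: differentiable_def)
qed

lemma Ck_SucE:
  assumes "Ck (Suc k) f"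
  shows "\<exists>D. (\<forall>x. (f has_derivative D x) (at x)) \<and> (\<forall>b\<in>Basis. Ck k (\<lambda>x. D x b))"
  using assms by (intro exI[of _ "\<lambda>x. frechet_derivative f (at x)"]) (auto simp: frechet_derivative_works)

lemma Ck_Suc_imp: "Ck (Suc k) f \<Longrightarrow> Ck k f"
proof (induction k arbitrary: f)
  case 0
  then show ?case
    by (auto intro!: continuous_at_imp_continuous_on differentiable_imp_continuous_within)
next
  case (Suc k)
  then show ?case by (metis Ck.simps(2))
qed

lemma Ck_const: "Ck k (\<lambda>x. c)"
  by (induction k arbitrary: c) auto

lemma Ck_bounded_linear_compose:
  assumes "bounded_linear L"
  shows "Ck k f \<Longrightarrow> Ck k (\<lambda>x. L (f x))"
proof (induction k arbitrary: f)
  case 0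
  then show ?case using assms by (auto intro: bounded_linear.continuous_on)
next
  case (Suc k)
  obtain D where D: "\<And>x. (f has_derivative D x) (at x)" "\<And>b. b \<in> Basis \<Longrightarrow> Ck k (\<lambda>x. D x b)"
    using Ck_SucE[OF Suc.prems] by blast
  show ?case
    by (rule Ck_SucI[where D="\<lambda>x h. L (D x h)"])
       (auto intro: bounded_linear.has_derivative[OF assms] D Suc.IH)
qed

lemma Ck_add: "Ck k f \<Longrightarrow> Ck k g \<Longrightarrow> Ck k (\<lambda>x. f x + g x)"
proof (induction k arbitrary: f g)
  case 0
  then show ?case by (auto intro: continuous_intros)
next
  case (Suc k)
  obtain D where D: "\<And>x. (f has_derivative D x) (at x)" "\<And>b. b \<in> Basis \<Longrightarrow> Ck k (\<lambda>x. D x b)"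
    using Ck_SucE[OF Suc.prems(1)] by blast
  obtain E where E: "\<And>x. (g has_derivative E x) (at x)" "\<And>b. b \<in> Basis \<Longrightarrow> Ck k (\<lambda>x. E x b)"
    using Ck_SucE[OF Suc.prems(2)] by blast
  show ?case
    by (rule Ck_SucI[where D="\<lambda>x h. D x h + E x h"]) (auto intro!: derivative_intros D E Suc.IH)
qed

text \<open>The product rule stays within products of the same kind, so one induction in the locale
  serves scalar multiples, real products and inner products alike.\<close>

lemma (in bounded_bilinear) Ck_prod:
  "Ck k f \<Longrightarrow> Ck k g \<Longrightarrow> Ck k (\<lambda>x. prod (f x) (g x))"
proof (induction k arbitrary: f g)
  case 0
  then show ?case by (auto intro: continuous_on)
next
  case (Suc k)
  obtain D where D: "\<And>x. (f has_derivative D x) (at x)" "\<And>b. b \<in> Basis \<Longrightarrow> Ck k (\<lambda>x. D x b)"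
    using Ck_SucE[OF Suc.prems(1)] by blast
  obtain E where E: "\<And>x. (g has_derivative E x) (at x)" "\<And>b. b \<in> Basis \<Longrightarrow> Ck k (\<lambda>x. E x b)"
    using Ck_SucE[OF Suc.prems(2)] by blast
  show ?case
    by (rule Ck_SucI[where D="\<lambda>x h. prod (f x) (E x h) + prod (D x h) (g x)"])
       (use Suc.prems in \<open>auto intro!: FDERIV D E Suc.IH Ck_add simp del: Ck.simps dest: Ck_Suc_imp\<close>)
qed

lemmas Ck_scaleR = bounded_bilinear.Ck_prod[OF bounded_bilinear_scaleR]
lemmas Ck_mult = bounded_bilinear.Ck_prod[OF bounded_bilinear_mult]
lemmas Ck_inner = bounded_bilinear.Ck_prod[OF bounded_bilinear_inner]

lemma Ck_bounded_linear: "bounded_linear f \<Longrightarrow> Ck k f"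
proof (cases k)
  case 0
  then show "bounded_linear f \<Longrightarrow> ?thesis"
    by (simp add: linear_continuous_on)
next
  case (Suc j)
  then show "bounded_linear f \<Longrightarrow> ?thesis"
    using Ck_SucI[where D="\<lambda>x. f" and f=f and k=j]
    by (auto simp del: Ck.simps intro: Ck_const bounded_linear_imp_has_derivative)
qed

lemma Ck_shift: "Ck k f \<Longrightarrow> Ck k (\<lambda>x. f (x + a))"
proof (induction k arbitrary: f)
  case 0
  then show ?case by (auto intro!: continuous_intros intro: continuous_on_compose2)
next
  case (Suc k)
  obtain D where D: "\<And>x. (f has_derivative D x) (at x)" "\<And>b. b \<in> Basis \<Longrightarrow> Ck k (\<lambda>x. D x b)"
    using Ck_SucE[OF Suc.prems(1)] by blast
  have "((\<lambda>x. f (x + a)) has_derivative D (x + a)) (at x)" for x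
    by (rule has_derivative_compose[where f="\<lambda>x. x + a" and f'="\<lambda>h. h"])
       (auto intro!: derivative_eq_intros D)
  then show ?case
    by (rule Ck_SucI) (use D Suc.IH in auto)
qed

lemma Ck_compose_real:
  fixes g :: "real \<Rightarrow> 'b::real_normed_vector" and f :: "'a::euclidean_space \<Rightarrow> real"
  shows "Ck k g \<Longrightarrow> Ck k f \<Longrightarrow> Ck k (\<lambda>x. g (f x))"
proof (induction k arbitrary: f g)
  case 0
  then show ?case by (auto intro: continuous_on_compose2)
next
  case (Suc k)
  obtain D where D: "\<And>x. (f has_derivative D x) (at x)" "\<And>b. b \<in> Basis \<Longrightarrow> Ck k (\<lambda>x. D x b)"
    using Ck_SucE[OF Suc.prems(2)] by blast
  obtain E where E: "\<And>x. (g has_derivative E x) (at x)" "\<And>b. b \<in> Basis \<Longrightarrow> Ck k (\<lambda>x. E x b)"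
    using Ck_SucE[OF Suc.prems(1)] by blast
  \<comment> \<open>A derivative on the real line is fixed by its value at 1; the chain rule thereby
    becomes a product, to which \<open>Ck_scaleR\<close> applies.\<close>
  have lin: "E x h = h *\<^sub>R E x 1" for x h
    using linear_scale[OF has_derivative_linear[OF E(1)], of x h 1] by simp
  have "((\<lambda>x. g (f x)) has_derivative (\<lambda>h. E (f x) (D x h))) (at x)" for x
    by (rule has_derivative_compose[OF D(1) E(1)])
  then have "((\<lambda>x. g (f x)) has_derivative (\<lambda>h. D x h *\<^sub>R E (f x) 1)) (at x)" for x
    by (metis (no_types, lifting) lin ext)
  then show ?case
    by (rule Ck_SucI)
       (use Suc.prems in \<open>auto intro!: Ck_scaleR D E(2) Suc.IH simp del: Ck.simps dest: Ck_Suc_imp\<close>)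
qed

lemma Ck_inverse:
  fixes f :: "'a::euclidean_space \<Rightarrow> real"
  assumes "\<And>x. f x \<noteq> 0"
  shows "Ck k f \<Longrightarrow> Ck k (\<lambda>x. inverse (f x))"
proof (induction k)
  case 0
  then show ?case using assms by (auto intro!: continuous_intros)
next
  case (Suc k)
  obtain D where D: "\<And>x. (f has_derivative D x) (at x)" "\<And>b. b \<in> Basis \<Longrightarrow> Ck k (\<lambda>x. D x b)"
    using Ck_SucE[OF Suc.prems(1)] by blast
  \<comment> \<open>Written with \<open>inverse (f x)\<close> as the only nonlinear factor, so that
    the induction hypothesis for the same \<open>f\<close> covers the derivative.\<close>
  have "((\<lambda>x. inverse (f x)) has_derivative (\<lambda>h. - 1 * (inverse (f x) * D x h * inverse (f x)))) (at x)" for x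
    using Deriv.has_derivative_inverse[OF assms D(1)] by simp
  then show ?case
    by (rule Ck_SucI) (intro Ck_mult Ck_const D(2) Suc.IH Ck_Suc_imp[OF Suc.prems])
qed

lemma Ck_sum: "(\<And>i. i \<in> I \<Longrightarrow> Ck k (f i)) \<Longrightarrow> Ck k (\<lambda>x. \<Sum>i\<in>I. f i x)"
  by (induction I rule: infinite_finite_induct) (auto intro: Ck_const Ck_add)

lemma smooth_const [simp]: "smooth (\<lambda>x. c)"
  by (simp add: smooth_def Ck_const)

lemma smooth_add: "smooth f \<Longrightarrow> smooth g \<Longrightarrow> smooth (\<lambda>x. f x + g x)"
  by (simp add: smooth_def Ck_add)

lemma smooth_bounded_linear_compose: "bounded_linear L \<Longrightarrow> smooth f \<Longrightarrow> smooth (\<lambda>x. L (f x))"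
  by (simp add: smooth_def Ck_bounded_linear_compose)

lemma smooth_bounded_linear: "bounded_linear f \<Longrightarrow> smooth f"
  by (simp add: smooth_def Ck_bounded_linear)

lemma smooth_scaleR: "smooth f \<Longrightarrow> smooth g \<Longrightarrow> smooth (\<lambda>x. f x *\<^sub>R g x)"
  by (simp add: smooth_def Ck_scaleR)

lemma smooth_mult:
  fixes f :: "'a::euclidean_space \<Rightarrow> real"
  shows "smooth f \<Longrightarrow> smooth g \<Longrightarrow> smooth (\<lambda>x. f x * g x)"
  by (simp add: smooth_def Ck_mult)

lemma smooth_inner: "smooth f \<Longrightarrow> smooth g \<Longrightarrow> smooth (\<lambda>x. f x \<bullet> g x)"
  by (simp add: smooth_def Ck_inner)

lemma smooth_shift: "smooth f \<Longrightarrow> smooth (\<lambda>x. f (x + a))"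
  by (simp add: smooth_def Ck_shift)

lemma smooth_minus: "smooth f \<Longrightarrow> smooth (\<lambda>x. - f x)"
  by (rule smooth_bounded_linear_compose[OF bounded_linear_minus[OF bounded_linear_ident]])

lemma smooth_diff: "smooth f \<Longrightarrow> smooth g \<Longrightarrow> smooth (\<lambda>x. f x - g x)"
  using smooth_add[OF _ smooth_minus, of f g] by simp

lemma smooth_sum: "(\<And>i. i \<in> I \<Longrightarrow> smooth (f i)) \<Longrightarrow> smooth (\<lambda>x. \<Sum>i\<in>I. f i x)"
  by (simp add: smooth_def Ck_sum)

lemma smooth_compose_real: "smooth (g :: real \<Rightarrow> _) \<Longrightarrow> smooth f \<Longrightarrow> smooth (\<lambda>x. g (f x))"
  by (simp add: smooth_def Ck_compose_real)

lemma smooth_inverse: "smooth f \<Longrightarrow> (\<And>x. f x \<noteq> (0::real)) \<Longrightarrow> smooth (\<lambda>x. inverse (f x))"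
  by (simp add: smooth_def Ck_inverse)

lemma smooth_differentiable: "smooth f \<Longrightarrow> f differentiable (at x)"
  unfolding smooth_def by (metis Ck.simps(2))

lemma smooth_has_derivative: "smooth f \<Longrightarrow> (f has_derivative (\<lambda>a. dird a f x)) (at x)"
  using smooth_differentiable frechet_derivative_works unfolding dird_def by blast

lemma smooth_continuous: "smooth f \<Longrightarrow> continuous_on S f"
  using Ck.simps(1) continuous_on_subset unfolding smooth_def by blast

lemma dird_sum_Basis:
  assumes "smooth f" shows "dird a f x = (\<Sum>b\<in>Basis. (a \<bullet> b) *\<^sub>R dird b f x)"
proof -
  interpret linear "\<lambda>a. dird a f x"
    using has_derivative_linear[OF smooth_has_derivative[OF assms]] .
  show ?thesis
    by (subst (1) euclidean_representation[symmetric]) (simp add: sum scale)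
qed

lemma smooth_dird:
  assumes "smooth f" shows "smooth (dird a f)"
proof -
  have 1: "smooth (dird b f)" if "b \<in> Basis" for b
    using assms that unfolding smooth_def dird_def[abs_def] by (metis Ck.simps(2))
  have "dird a f = (\<lambda>x. \<Sum>b\<in>Basis. (a \<bullet> b) *\<^sub>R dird b f x)"
    using dird_sum_Basis[OF assms] by blast
  then show ?thesis
    by (auto intro!: smooth_sum smooth_scaleR 1)
qed

lemma smooth_coinduct_derivative:
  assumes "\<And>x. (f has_derivative D x) (at x)" "\<And>b. smooth (\<lambda>x. D x b)"
  shows "smooth f"
proof -
  have "Ck k f" for k
    by (rule Ck_Suc_imp, rule Ck_SucI[OF assms(1)]) (use assms(2) in \<open>auto simp: smooth_def\<close>)
  then show ?thesis by (simp add: smooth_def)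
qed

lemma linear_dird: "smooth f \<Longrightarrow> linear (\<lambda>a. dird a f x)"
  using has_derivative_linear[OF smooth_has_derivative] .

lemma dird_add: "smooth f \<Longrightarrow> smooth g \<Longrightarrow> dird a (\<lambda>x. f x + g x) x = dird a f x + dird a g x"
  by (rule dird_eq) (auto intro!: derivative_eq_intros smooth_has_derivative)

lemma dird_bounded_linear:
  "bounded_linear L \<Longrightarrow> smooth f \<Longrightarrow> dird a (\<lambda>x. L (f x)) x = L (dird a f x)"
  by (rule dird_eq) (rule bounded_linear.has_derivative[OF _ smooth_has_derivative])

lemma (in bounded_bilinear) dird_prod:
  "smooth f \<Longrightarrow> smooth g \<Longrightarrow> dird a (\<lambda>x. prod (f x) (g x)) x = prod (f x) (dird a g x) + prod (dird a f x) (g x)"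
  by (rule dird_eq) (auto intro!: FDERIV smooth_has_derivative)

lemmas dird_scaleR = bounded_bilinear.dird_prod[OF bounded_bilinear_scaleR]
lemmas dird_mult = bounded_bilinear.dird_prod[OF bounded_bilinear_mult]
lemmas dird_inner = bounded_bilinear.dird_prod[OF bounded_bilinear_inner]

lemma dird_shift: "smooth f \<Longrightarrow> dird a (\<lambda>x. f (x + c)) x = dird a f (x + c)"
  by (rule dird_eq, rule has_derivative_compose[where f="\<lambda>x. x + c" and f'="\<lambda>h. h"])
     (auto intro!: derivative_eq_intros smooth_has_derivative)

lemma dird_transform_open:
  assumes "smooth f" "open U" "x \<in> U" "\<And>y. y \<in> U \<Longrightarrow> f y = g y"
  shows "dird a f x = dird a g x"
  unfolding dird_def using frechet_derivative_transform_within_open[OF smooth_differentiable] assms by metis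

lemma smooth_line_vector_derivative:
  assumes "smooth g"
  shows "((\<lambda>s. g (y + s *\<^sub>R c)) has_vector_derivative dird c g (y + s *\<^sub>R c)) (at s)"
proof -
  have "((\<lambda>s. g (y + s *\<^sub>R c)) has_derivative (\<lambda>h. dird (h *\<^sub>R c) g (y + s *\<^sub>R c))) (at s)"
    by (rule has_derivative_compose[where f="\<lambda>s. y + s *\<^sub>R c" and f'="\<lambda>h. h *\<^sub>R c"])
       (auto intro!: derivative_eq_intros smooth_has_derivative assms)
  then show ?thesis
    using linear_scale[OF linear_dird[OF assms]] by (simp add: has_vector_derivative_def)
qed

lemma smooth_line_deriv:
  fixes g :: "'a::euclidean_space \<Rightarrow> real"
  assumes "smooth g"
  shows "((\<lambda>s. g (y + s *\<^sub>R c)) has_real_derivative dird c g (y + s *\<^sub>R c)) (at s)"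
  using smooth_line_vector_derivative[OF assms] by (simp add: has_real_derivative_iff_has_vector_derivative)

text \<open>Schwarz's theorem by second differences: over a parallelogram of side h, two mean value
  theorems taken in either order express the same second difference as h^2 times a mixed derivative
  at a nearby point. Continuity of both mixed derivatives then gives equality as h tends to
  0.\<close>

lemma dird_commute_real:
  fixes f :: "'a::euclidean_space \<Rightarrow> real"
  assumes f: "smooth f"
  shows "dird a (dird b f) x = dird b (dird a f) x"
proof -
  have key: "\<exists>\<xi> \<eta>. 0 < \<xi> \<and> \<xi> < h \<and> 0 < \<eta> \<and> \<eta> < h \<and>
      f (x + h *\<^sub>R b + h *\<^sub>R c) - f (x + h *\<^sub>R b) - (f (x + h *\<^sub>R c) - f x)
        = h * h * dird c (dird b f) (x + \<xi> *\<^sub>R b + \<eta> *\<^sub>R c)" if "h > 0" for h b c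
  proof -
    have "\<exists>\<xi>. 0 < \<xi> \<and> \<xi> < h \<and> (f (x + h *\<^sub>R c + h *\<^sub>R b) - f (x + h *\<^sub>R b)) - (f (x + h *\<^sub>R c + 0 *\<^sub>R b) - f (x + 0 *\<^sub>R b))
       = (h - 0) * (dird b f (x + h *\<^sub>R c + \<xi> *\<^sub>R b) - dird b f (x + \<xi> *\<^sub>R b))"
      by (rule MVT2[of 0 h "\<lambda>s. f (x + h *\<^sub>R c + s *\<^sub>R b) - f (x + s *\<^sub>R b)"
            "\<lambda>s. dird b f (x + h *\<^sub>R c + s *\<^sub>R b) - dird b f (x + s *\<^sub>R b)"])
         (use that smooth_line_deriv[OF f] in \<open>auto intro!: DERIV_diff\<close>)
    then obtain \<xi> where xi: "0 < \<xi>" "\<xi> < h" "(f (x + h *\<^sub>R c + h *\<^sub>R b) - f (x + h *\<^sub>R b)) - (f (x + h *\<^sub>R c) - f x)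
       = h * (dird b f (x + h *\<^sub>R c + \<xi> *\<^sub>R b) - dird b f (x + \<xi> *\<^sub>R b))"
      by auto
    have "\<exists>\<eta>. 0 < \<eta> \<and> \<eta> < h \<and> dird b f (x + \<xi> *\<^sub>R b + h *\<^sub>R c) - dird b f (x + \<xi> *\<^sub>R b + 0 *\<^sub>R c)
       = (h - 0) * dird c (dird b f) (x + \<xi> *\<^sub>R b + \<eta> *\<^sub>R c)"
      by (rule MVT2[of 0 h "\<lambda>s. dird b f (x + \<xi> *\<^sub>R b + s *\<^sub>R c)"])
         (use that smooth_line_deriv[OF smooth_dird[OF f]] in auto)
    then obtain \<eta> where "0 < \<eta>" "\<eta> < h" "dird b f (x + \<xi> *\<^sub>R b + h *\<^sub>R c) - dird b f (x + \<xi> *\<^sub>R b)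
       = h * dird c (dird b f) (x + \<xi> *\<^sub>R b + \<eta> *\<^sub>R c)"
      by auto
    moreover have e: "x + h *\<^sub>R c + h *\<^sub>R b = x + h *\<^sub>R b + h *\<^sub>R c" "x + h *\<^sub>R c + \<xi> *\<^sub>R b = x + \<xi> *\<^sub>R b + h *\<^sub>R c"
      by (simp_all add: algebra_simps)
    ultimately show ?thesis
      using xi(1,2) xi(3)[unfolded e] by - (rule exI[of _ \<xi>], rule exI[of _ \<eta>], simp add: mult.assoc)
  qed
  define h where "h n = 1 / real (Suc n)" for n
  have hpos: "h n > 0" for n by (simp add: h_def)
  have h0: "h \<longlonglongrightarrow> 0" unfolding h_def by (rule LIMSEQ_Suc[OF lim_1_over_n])
  obtain \<xi> \<eta> where 1: "\<And>n. 0 < \<xi> n \<and> \<xi> n < h n \<and> 0 < \<eta> n \<and> \<eta> n < h n \<and>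
      f (x + h n *\<^sub>R b + h n *\<^sub>R a) - f (x + h n *\<^sub>R b) - (f (x + h n *\<^sub>R a) - f x)
        = h n * h n * dird a (dird b f) (x + \<xi> n *\<^sub>R b + \<eta> n *\<^sub>R a)"
    using key[OF hpos, of _ b a] by metis
  obtain \<xi>' \<eta>' where 2: "\<And>n. 0 < \<xi>' n \<and> \<xi>' n < h n \<and> 0 < \<eta>' n \<and> \<eta>' n < h n \<and>
      f (x + h n *\<^sub>R a + h n *\<^sub>R b) - f (x + h n *\<^sub>R a) - (f (x + h n *\<^sub>R b) - f x)
        = h n * h n * dird b (dird a f) (x + \<xi>' n *\<^sub>R a + \<eta>' n *\<^sub>R b)"
    using key[OF hpos, of _ a b] by metis
  have tz: "s \<longlonglongrightarrow> 0" if "\<And>n. 0 < s n \<and> s n < h n" for s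
    by (rule tendsto_sandwich[OF _ _ tendsto_const h0]) (use that in \<open>auto intro!: always_eventually less_imp_le\<close>)
  have lim: "(\<lambda>n. dird a' (dird b' f) (x + s n *\<^sub>R b' + t n *\<^sub>R a')) \<longlonglongrightarrow> dird a' (dird b' f) x"
    if "s \<longlonglongrightarrow> 0" "t \<longlonglongrightarrow> 0" for s t a' b'
  proof -
    have "(\<lambda>n. x + s n *\<^sub>R b' + t n *\<^sub>R a') \<longlonglongrightarrow> x + 0 *\<^sub>R b' + 0 *\<^sub>R a'"
      by (intro tendsto_intros that)
    moreover have "isCont (dird a' (dird b' f)) x"
      using smooth_continuous[OF smooth_dird[OF smooth_dird[OF f]], of UNIV] continuous_on_eq_continuous_at by blast
    ultimately show ?thesis
      using isCont_tendsto_compose[of x "dird a' (dird b' f)"] by simp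
  qed
  have hh: "h n * h n * dird a (dird b f) (x + \<xi> n *\<^sub>R b + \<eta> n *\<^sub>R a)
      = h n * h n * dird b (dird a f) (x + \<xi>' n *\<^sub>R a + \<eta>' n *\<^sub>R b)" for n
    using 1[of n] 2[of n] by (simp add: algebra_simps)
  have eq: "dird a (dird b f) (x + \<xi> n *\<^sub>R b + \<eta> n *\<^sub>R a) = dird b (dird a f) (x + \<xi>' n *\<^sub>R a + \<eta>' n *\<^sub>R b)" for n
    using hh[of n] hpos[of n] by auto
  have i: "\<And>n. 0 < \<xi> n \<and> \<xi> n < h n" "\<And>n. 0 < \<eta> n \<and> \<eta> n < h n"
     "\<And>n. 0 < \<xi>' n \<and> \<xi>' n < h n" "\<And>n. 0 < \<eta>' n \<and> \<eta>' n < h n"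
    using 1 2 by blast+
  show ?thesis
    by (rule LIMSEQ_unique[OF lim[OF tz[OF i(1)] tz[OF i(2)], of a b, unfolded eq] lim[OF tz[OF i(3)] tz[OF i(4)], of b a]])
qed

lemma dird_commute:
  fixes f :: "'a::euclidean_space \<Rightarrow> 'b::euclidean_space"
  assumes f: "smooth f"
  shows "dird a (dird b f) x = dird b (dird a f) x"
proof (rule euclidean_eqI)
  fix i :: 'b
  have bl: "bounded_linear (\<lambda>y. y \<bullet> i)" by (rule bounded_linear_inner_left)
  have d: "dird c (dird d f) x \<bullet> i = dird c (dird d (\<lambda>x. f x \<bullet> i)) x" for c d
    using dird_bounded_linear[OF bl f, of d] dird_bounded_linear[OF bl smooth_dird[OF f], of c d x] by presburger
  show "dird a (dird b f) x \<bullet> i = dird b (dird a f) x \<bullet> i"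
    unfolding d by (rule dird_commute_real) (rule smooth_bounded_linear_compose[OF bl f])
qed

section \<open>Cut-off functions\<close>

text \<open>The extra power of t in the denominator makes the family closed under differentiation:
  each derivative is a combination of two other members.\<close>

definition flat :: "nat \<Rightarrow> real \<Rightarrow> real" where
  "flat n t = (if t > 0 then exp (- (1/t)) / t ^ n else 0)"

text \<open>From exp s \<ge> s with s = 1/(nt), raised to the n-th power. For n = 0 the bound reads
  0^0 = 1.\<close>

lemma flat_bound: "\<bar>flat n t\<bar> \<le> real n ^ n"
proof (cases "t > 0")
  case True
  have "(1/t) ^ n \<le> real n ^ n * exp (1/t)"
  proof (cases "n = 0")
    case True
    then show ?thesis using \<open>t > 0\<close> by simp
  next
    case False
    have "(1/t) / n \<le> exp ((1/t) / n)"
      using exp_ge_add_one_self[of "(1/t) / n"] by linarith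
    then have "((1/t) / n) ^ n \<le> exp ((1/t) / n) ^ n"
      using True by (intro power_mono) auto
    also have "\<dots> = exp (1/t)"
      using False by (simp flip: exp_of_nat_mult)
    finally have "(1/t) ^ n / real n ^ n \<le> exp (1/t)"
      by (simp add: power_divide power_mult_distrib)
    then show ?thesis
      using False by (simp add: pos_divide_le_eq mult.commute)
  qed
  then show ?thesis
    using True by (simp add: flat_def exp_minus field_simps)
qed (auto simp: flat_def)

lemma flat_Suc: "flat n t = t * flat (Suc n) t"
  by (auto simp: flat_def)

lemma flat_has_derivative: "(flat n has_real_derivative flat (n + 2) t - real n * flat (Suc n) t) (at t)"
proof -
  consider "t > 0" | "t < 0" | "t = 0" by linarith
  then show ?thesis
  proof cases
    case 1
    have "((\<lambda>t. exp (- inverse t) * inverse t ^ n) has_real_derivative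
        exp (- inverse t) * (inverse t * inverse t) * inverse t ^ n
        - real n * inverse t ^ (n - 1) * (inverse t * inverse t) * exp (- inverse t)) (at t)"
      using 1 by (auto intro!: derivative_eq_intros simp: algebra_simps)
    moreover have "exp (- inverse t) * (inverse t * inverse t) * inverse t ^ n
        - real n * inverse t ^ (n - 1) * (inverse t * inverse t) * exp (- inverse t)
        = flat (n + 2) t - real n * flat (Suc n) t"
      using 1 by (cases n) (auto simp: flat_def divide_inverse power_inverse)
    ultimately have "((\<lambda>t. exp (- inverse t) * inverse t ^ n) has_real_derivative flat (n + 2) t - real n * flat (Suc n) t) (at t)"
      by simp
    then show ?thesis
      using 1 by (rule has_field_derivative_transform_within[where d=t]) (auto simp: flat_def dist_real_def divide_inverse power_inverse)
  next
    case 2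
    have "((\<lambda>t. 0) has_real_derivative flat (n + 2) t - real n * flat (Suc n) t) (at t)"
      using 2 by (auto simp: flat_def)
    then show ?thesis
      by (rule has_field_derivative_transform_within[where d="-t"]) (use 2 in \<open>auto simp: flat_def dist_real_def\<close>)
  next
    case 3
    \<comment> \<open>At 0 the difference quotient of \<open>flat n\<close> is
      \<open>flat (Suc n)\<close>, which equals h times the bounded function
      \<open>flat (n + 2)\<close>.\<close>
    have "((\<lambda>h. flat (Suc n) h) \<longlongrightarrow> 0) (at 0)"
    proof (rule Lim_null_comparison)
      show "\<forall>\<^sub>F h in at 0. norm (flat (Suc n) h) \<le> \<bar>h\<bar> * real (n + 2) ^ (n + 2)"
        using flat_bound[of "n + 2"] flat_Suc[of "Suc n"]
        by (auto simp: abs_mult intro!: always_eventually mult_left_mono)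
      show "((\<lambda>h. \<bar>h\<bar> * real (n + 2) ^ (n + 2)) \<longlongrightarrow> 0) (at 0)"
        by (rule tendsto_eq_intros refl | simp)+
    qed
    then have "(\<lambda>h. (flat n (0 + h) - flat n 0) / h) \<midarrow>0\<rightarrow> 0"
      by (rule Lim_transform_eventually) (auto simp: eventually_at_filter flat_Suc[of n])
    then show ?thesis
      using 3 by (simp add: DERIV_def flat_def)
  qed
qed

lemma smooth_flat: "smooth (flat n)"
proof -
  have "Ck k (flat n)" for k
  proof (induction k arbitrary: n)
    case 0
    then show ?case
      using flat_has_derivative by (auto intro!: continuous_at_imp_continuous_on DERIV_isCont)
  next
    case (Suc k)
    show ?case
    proof (rule Ck_SucI[where D="\<lambda>t h. (flat (n + 2) t + (- real n) * flat (Suc n) t) * h"])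
      show "(flat n has_derivative (*) (flat (n + 2) x + - real n * flat (Suc n) x)) (at x)" for x
        using flat_has_derivative[of n x] by (simp add: has_field_derivative_def)
      show "Ck k (\<lambda>x. (flat (n + 2) x + - real n * flat (Suc n) x) * b)" for b
        by (intro Ck_mult Ck_add Ck_const Suc)
    qed
  qed
  then show ?thesis by (simp add: smooth_def)
qed

lemma supp_subset_closed: "closed K \<Longrightarrow> (\<And>x. x \<notin> K \<Longrightarrow> f x = 0) \<Longrightarrow> supp f \<subseteq> K"
  unfolding supp_def by (rule closure_minimal) auto

lemma not_in_supp: "x \<notin> supp f \<Longrightarrow> f x = 0"
  unfolding supp_def using closure_subset[of "{x. f x \<noteq> 0}"] by auto

lemma Cc_infI:
  assumes "smooth f" "compact K" "K \<subseteq> \<Omega>" "\<And>x. x \<notin> K \<Longrightarrow> f x = 0"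
  shows "f \<in> Cc_inf \<Omega>"
proof -
  have "supp f \<subseteq> K" using supp_subset_closed[of K f] assms compact_imp_closed by blast
  moreover have "closed (supp f)" by (simp add: supp_def)
  ultimately have "compact (supp f)"
    using compact_Int_closed[OF assms(2)] by (metis inf.absorb2)
  with \<open>supp f \<subseteq> K\<close> show ?thesis
    using assms unfolding Cc_inf_def smooth_def by auto
qed

lemma Cc_inf_smooth: "f \<in> Cc_inf \<Omega> \<Longrightarrow> smooth f"
  by (simp add: Cc_inf_def smooth_def)

lemma Cc_infE:
  assumes "f \<in> Cc_inf \<Omega>"
  obtains K where "compact K" "K \<subseteq> \<Omega>" "\<And>x. x \<notin> K \<Longrightarrow> f x = 0"
  using assms not_in_supp unfolding Cc_inf_def by blast

lemma smooth_bump: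
  fixes c :: "'a::euclidean_space"
  assumes "0 < r" "r < R"
  obtains \<beta> :: "'a \<Rightarrow> real" where "\<beta> \<in> Cc_inf (ball c R)" "\<And>x. 0 \<le> \<beta> x \<and> \<beta> x \<le> 1"
    "\<And>x. x \<in> cball c r \<Longrightarrow> \<beta> x = 1"
proof -
  \<comment> \<open>An intermediate radius: r < s keeps the denominator \<open>A + B\<close>
    positive everywhere, and s < R leaves a compact support inside the open ball.\<close>
  define s where "s = (r + R) / 2"
  have s: "r < s" "s < R" using assms by (auto simp: s_def)
  have rs: "r\<^sup>2 < s\<^sup>2" using s assms by (simp add: power_strict_mono)
  define q :: "'a \<Rightarrow> real" where "q = (\<lambda>x. (x - c) \<bullet> (x - c))"
  define A B where "A = (\<lambda>x. flat 0 (s\<^sup>2 - q x))" and "B = (\<lambda>x. flat 0 (q x - r\<^sup>2))"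
  have sq: "smooth q"
    unfolding q_def by (intro smooth_inner smooth_diff smooth_bounded_linear[OF bounded_linear_ident] smooth_const)
  have sA: "smooth A" "smooth B"
    unfolding A_def B_def by (auto intro!: smooth_compose_real[OF smooth_flat] smooth_diff sq)
  have nn: "A x \<ge> 0" "B x \<ge> 0" for x by (auto simp: A_def B_def flat_def)
  have pos: "A x + B x > 0" for x
  proof (cases "q x < s\<^sup>2")
    case True
    then have "A x > 0" by (simp add: A_def flat_def)
    with nn(2)[of x] show ?thesis by linarith
  next
    case False
    then have "B x > 0" using rs by (simp add: B_def flat_def)
    with nn(1)[of x] show ?thesis by linarith
  qed
  define \<beta> where "\<beta> = (\<lambda>x. A x * inverse (A x + B x))"
  have qd: "q x = (dist x c)\<^sup>2" for x by (simp add: q_def dist_norm power2_norm_eq_inner)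
  show thesis
  proof
    have "smooth \<beta>"
      unfolding \<beta>_def using pos by (intro smooth_mult smooth_inverse smooth_add sA) (metis less_irrefl)
    moreover have "\<beta> x = 0" if "x \<notin> cball c s" for x
    proof -
      have "s\<^sup>2 < q x" using that s assms by (simp add: qd power_strict_mono dist_commute)
      then show ?thesis by (simp add: \<beta>_def A_def flat_def)
    qed
    ultimately show "\<beta> \<in> Cc_inf (ball c R)"
      using s by (intro Cc_infI[where K="cball c s"]) auto
    show "0 \<le> \<beta> x \<and> \<beta> x \<le> 1" for x
      using nn[of x] pos[of x] by (auto simp: \<beta>_def divide_simps)
    show "\<beta> x = 1" if "x \<in> cball c r" for x
    proof -
      have "q x \<le> r\<^sup>2" using that assms by (simp add: qd power_mono dist_commute)
      then have "B x = 0" by (simp add: B_def flat_def)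
      then show ?thesis using pos[of x] by (simp add: \<beta>_def)
    qed
  qed
qed

lemma Cc_inf_mono: "\<Omega> \<subseteq> \<Omega>' \<Longrightarrow> f \<in> Cc_inf \<Omega> \<Longrightarrow> f \<in> Cc_inf \<Omega>'"
  by (auto simp: Cc_inf_def)

lemma Cc_inf_add:
  assumes "f \<in> Cc_inf \<Omega>" "g \<in> Cc_inf \<Omega>" shows "(\<lambda>x. f x + g x) \<in> Cc_inf \<Omega>"
proof -
  obtain K L where "compact K" "K \<subseteq> \<Omega>" "\<And>x. x \<notin> K \<Longrightarrow> f x = 0" "compact L" "L \<subseteq> \<Omega>" "\<And>x. x \<notin> L \<Longrightarrow> g x = 0"
    using assms by (meson Cc_infE)
  then show ?thesis
    using assms by (intro Cc_infI[where K="K \<union> L"] smooth_add) (auto simp: Cc_inf_smooth)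
qed

lemma Cc_inf_linear:
  assumes "f \<in> Cc_inf \<Omega>" "bounded_linear L" shows "(\<lambda>x. L (f x)) \<in> Cc_inf \<Omega>"
proof -
  obtain K where "compact K" "K \<subseteq> \<Omega>" "\<And>x. x \<notin> K \<Longrightarrow> f x = 0"
    using assms by (meson Cc_infE)
  then show ?thesis
    using linear_0[OF bounded_linear.linear[OF assms(2)]]
    by (intro Cc_infI[where K=K] smooth_bounded_linear_compose[OF assms(2) Cc_inf_smooth[OF assms(1)]]) auto
qed

lemma Cc_inf_scaleR: "f \<in> Cc_inf \<Omega> \<Longrightarrow> (\<lambda>x. c *\<^sub>R f x) \<in> Cc_inf \<Omega>"
  by (rule Cc_inf_linear[OF _ bounded_linear_scaleR_right])

lemma Cc_inf_zero: "(\<lambda>x. 0) \<in> Cc_inf \<Omega>"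
  by (rule Cc_infI[where K="{}"]) auto

lemma Cc_inf_sum: "(\<And>i. i \<in> I \<Longrightarrow> f i \<in> Cc_inf \<Omega>) \<Longrightarrow> (\<lambda>x. \<Sum>i\<in>I. f i x) \<in> Cc_inf \<Omega>"
  by (induction I rule: infinite_finite_induct) (auto intro: Cc_inf_zero Cc_inf_add)

lemma Cc_inf_smooth_scaleR_right:
  assumes "f \<in> Cc_inf \<Omega>" "smooth g" shows "(\<lambda>x. f x *\<^sub>R g x) \<in> Cc_inf \<Omega>"
proof -
  obtain K where "compact K" "K \<subseteq> \<Omega>" "\<And>x. x \<notin> K \<Longrightarrow> f x = 0"
    using assms by (meson Cc_infE)
  then show ?thesis
    using assms by (intro Cc_infI[where K=K] smooth_scaleR) (auto simp: Cc_inf_smooth)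
qed

lemma Cc_inf_smooth_scaleR_left:
  assumes "f \<in> Cc_inf \<Omega>" "smooth g" shows "(\<lambda>x. g x *\<^sub>R f x) \<in> Cc_inf \<Omega>"
proof -
  obtain K where "compact K" "K \<subseteq> \<Omega>" "\<And>x. x \<notin> K \<Longrightarrow> f x = 0"
    using assms by (meson Cc_infE)
  then show ?thesis
    using assms by (intro Cc_infI[where K=K] smooth_scaleR) (auto simp: Cc_inf_smooth)
qed

lemma dird_zero_open:
  assumes "open U" "x \<in> U" "\<And>y. y \<in> U \<Longrightarrow> f y = 0"
  shows "dird a f x = 0"
proof -
  have "(f has_derivative (\<lambda>h. 0)) (at x)"
    by (rule has_derivative_transform_within_open[OF has_derivative_const assms(1,2)]) (simp add: assms(3))
  then show ?thesis by (rule dird_eq)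
qed

lemma Cc_inf_dird:
  assumes "f \<in> Cc_inf \<Omega>" shows "dird a f \<in> Cc_inf \<Omega>"
proof -
  obtain K where K: "compact K" "K \<subseteq> \<Omega>" "\<And>x. x \<notin> K \<Longrightarrow> f x = 0"
    using assms by (meson Cc_infE)
  moreover have "dird a f x = 0" if "x \<notin> K" for x
    by (rule dird_zero_open[where U="- K"]) (use K that compact_imp_closed in auto)
  ultimately show ?thesis
    using assms by (intro Cc_infI[where K=K] smooth_dird) (auto simp: Cc_inf_smooth)
qed

lemma Cc_inf_shift:
  assumes "f \<in> Cc_inf \<Omega>" shows "(\<lambda>x. f (x + a)) \<in> Cc_inf ((\<lambda>x. x - a) ` \<Omega>)"
proof -
  obtain K where K: "compact K" "K \<subseteq> \<Omega>" "\<And>x. x \<notin> K \<Longrightarrow> f x = 0"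
    using assms by (meson Cc_infE)
  show ?thesis
  proof (rule Cc_infI[where K="(\<lambda>x. x - a) ` K"])
    show "compact ((\<lambda>x. x - a) ` K)" by (intro compact_continuous_image continuous_intros K)
    show "f (x + a) = 0" if "x \<notin> (\<lambda>x. x - a) ` K" for x
      by (rule K(3)) (use that in \<open>metis add_diff_cancel_right' imageI\<close>)
  qed (use K assms in \<open>auto intro: smooth_shift Cc_inf_smooth\<close>)
qed

text \<open>Equality to 1 holds on a whole neighbourhood \<open>V\<close> of \<open>K\<close>, so
  that derivatives of the cut-off vanish there.\<close>

lemma smooth_urysohn:
  fixes K :: "'a::euclidean_space set"
  assumes "compact K" "open U" "K \<subseteq> U"
  obtains \<theta> :: "'a \<Rightarrow> real" and V where "\<theta> \<in> Cc_inf U" "\<And>x. 0 \<le> \<theta> x \<and> \<theta> x \<le> 1" "open V" "K \<subseteq> V"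
    "\<And>x. x \<in> V \<Longrightarrow> \<theta> x = 1"
proof -
  have "\<forall>c\<in>K. \<exists>r>0. \<exists>\<beta>::'a \<Rightarrow> real. \<beta> \<in> Cc_inf U \<and> (\<forall>x. 0 \<le> \<beta> x \<and> \<beta> x \<le> 1) \<and> (\<forall>x\<in>ball c r. \<beta> x = 1)"
  proof
    fix c assume "c \<in> K"
    then obtain R where "R > 0" "ball c R \<subseteq> U" using assms openE by blast
    then show "\<exists>r>0. \<exists>\<beta>::'a \<Rightarrow> real. \<beta> \<in> Cc_inf U \<and> (\<forall>x. 0 \<le> \<beta> x \<and> \<beta> x \<le> 1) \<and> (\<forall>x\<in>ball c r. \<beta> x = 1)"
      using smooth_bump[of "R/2" R c] Cc_inf_mono[OF \<open>ball c R \<subseteq> U\<close>]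
      by (metis half_gt_zero_iff field_sum_of_halves less_add_same_cancel1 mem_ball_imp_mem_cball)
  qed
  then obtain r \<beta> where r: "\<And>c. c \<in> K \<Longrightarrow> r c > 0" and \<beta>: "\<And>c. c \<in> K \<Longrightarrow> (\<beta> c :: 'a \<Rightarrow> real) \<in> Cc_inf U"
    "\<And>c x. c \<in> K \<Longrightarrow> 0 \<le> \<beta> c x \<and> \<beta> c x \<le> 1" "\<And>c x. c \<in> K \<Longrightarrow> x \<in> ball c (r c) \<Longrightarrow> \<beta> c x = 1"
    by metis
  obtain D where D: "D \<subseteq> K" "finite D" "K \<subseteq> (\<Union>c\<in>D. ball c (r c))"
    by (rule compactE_image[OF assms(1), of K "\<lambda>c. ball c (r c)"]) (use r in force)+
  have "\<exists>\<theta>::'a \<Rightarrow> real. \<theta> \<in> Cc_inf U \<and> (\<forall>x. 0 \<le> \<theta> x \<and> \<theta> x \<le> 1) \<and> (\<forall>x\<in>(\<Union>c\<in>D. ball c (r c)). \<theta> x = 1)"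
    using D(2,1)
  proof (induction D rule: finite_induct)
    case empty
    then show ?case using Cc_inf_zero by (intro exI[of _ "\<lambda>x. 0"]) auto
  next
    case (insert c D)
    then obtain \<theta> where \<theta>: "(\<theta>::'a\<Rightarrow>real) \<in> Cc_inf U" "\<forall>x. 0 \<le> \<theta> x \<and> \<theta> x \<le> 1" "\<forall>x\<in>(\<Union>c\<in>D. ball c (r c)). \<theta> x = 1"
      by auto
    have c: "c \<in> K" using insert by auto
    \<comment> \<open>This is 1 - (1 - \<theta>)(1 - \<beta>): it stays in [0, 1] and equals 1
      wherever one of the two factors does.\<close>
    have "(\<lambda>x. \<theta> x + \<beta> c x *\<^sub>R (1 - \<theta> x)) \<in> Cc_inf U"
      by (intro Cc_inf_add \<theta> Cc_inf_smooth_scaleR_right \<beta> c smooth_diff smooth_const Cc_inf_smooth[OF \<theta>(1)])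
    moreover have "0 \<le> \<theta> x + \<beta> c x *\<^sub>R (1 - \<theta> x) \<and> \<theta> x + \<beta> c x *\<^sub>R (1 - \<theta> x) \<le> 1" for x
    proof -
      have "\<beta> c x * (1 - \<theta> x) \<le> 1 * (1 - \<theta> x)" "0 \<le> \<beta> c x * (1 - \<theta> x)"
        using \<beta>(2)[OF c, of x] \<theta>(2)[rule_format, of x] by (intro mult_right_mono mult_nonneg_nonneg; simp)+
      then show ?thesis using \<theta>(2) by (auto simp: add_nonneg_nonneg)
    qed
    ultimately show ?case
      using \<beta>(3)[OF c] \<theta>(3) by (intro exI[of _ "\<lambda>x. \<theta> x + \<beta> c x *\<^sub>R (1 - \<theta> x)"]) auto
  qed
  then show thesis
    using that[of _ "\<Union>c\<in>D. ball c (r c)"] D by blast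
qed

section \<open>The Hilbert space $L^2$\<close>

lemma sq_rep: "sq_integrable (rep_L2 u)"
  using Quotient_rep_reflp[OF Quotient_L2, of u] by (simp add: ae_rel_def)

lemma rep_abs: "sq_integrable f \<Longrightarrow> AE x in lebesgue. rep_L2 (abs_L2 f) x = f x"
  using Quotient_rep_abs[OF Quotient_L2, of f] by (simp add: ae_rel_def)

lemma L2_eqI:
  assumes "AE x in lebesgue. rep_L2 u x = rep_L2 v x" shows "u = v"
  using assms Quotient_rel_rep[OF Quotient_L2, of u v] by (simp add: ae_rel_def sq_rep)

lemma abs_L2_eq:
  assumes "sq_integrable f" "sq_integrable g" "AE x in lebesgue. f x = g x" shows "abs_L2 f = abs_L2 g"
  using assms Quotient_rel_abs[OF Quotient_L2, of f g] by (simp add: ae_rel_def)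

lemma abs_rep: "abs_L2 (rep_L2 u) = u"
  by (rule Quotient_abs_rep[OF Quotient_L2])

lemma abs_plus: "sq_integrable f \<Longrightarrow> sq_integrable g \<Longrightarrow> abs_L2 f + abs_L2 g = abs_L2 (\<lambda>x. f x + g x)"
  by (rule plus_L2.abs_eq) (auto simp: ae_rel_def)

lemma abs_minus: "sq_integrable f \<Longrightarrow> sq_integrable g \<Longrightarrow> abs_L2 f - abs_L2 g = abs_L2 (\<lambda>x. f x - g x)"
  by (rule minus_L2.abs_eq) (auto simp: ae_rel_def)

lemma abs_scale: "sq_integrable f \<Longrightarrow> c *\<^sub>R abs_L2 f = abs_L2 (\<lambda>x. c *\<^sub>R f x)"
  by (rule scaleR_L2.abs_eq) (auto simp: ae_rel_def)

lemma abs_zero: "abs_L2 (\<lambda>x. 0) = 0"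
  by (simp add: zero_L2_def)

lemma inner_abs: "sq_integrable f \<Longrightarrow> sq_integrable g \<Longrightarrow> abs_L2 f \<bullet> abs_L2 g = integral\<^sup>L lebesgue (\<lambda>x. f x \<bullet> g x)"
  by (rule inner_L2.abs_eq) (auto simp: ae_rel_def)

lemma rep_plus: "AE x in lebesgue. rep_L2 (u + v) x = rep_L2 u x + rep_L2 v x"
  using rep_abs[OF sq_integrable_add[OF sq_rep sq_rep], of u v] by (simp flip: abs_plus[OF sq_rep sq_rep] add: abs_rep)

lemma rep_minus: "AE x in lebesgue. rep_L2 (u - v) x = rep_L2 u x - rep_L2 v x"
  using rep_abs[OF sq_integrable_diff[OF sq_rep sq_rep], of u v] by (simp flip: abs_minus[OF sq_rep sq_rep] add: abs_rep)

lemma rep_scale: "AE x in lebesgue. rep_L2 (c *\<^sub>R u) x = c *\<^sub>R rep_L2 u x"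
  using rep_abs[OF sq_integrable_scaleR[OF sq_rep], of c u] by (simp flip: abs_scale[OF sq_rep] add: abs_rep)

lemma rep_zero: "AE x in lebesgue. rep_L2 0 x = 0"
  using rep_abs[OF sq_integrable_zero] by (simp add: abs_zero)

lemma inner_rep: "u \<bullet> v = integral\<^sup>L lebesgue (\<lambda>x. rep_L2 u x \<bullet> rep_L2 v x)"
  using inner_abs[OF sq_rep sq_rep, of u v] by (simp add: abs_rep)

lemma norm_sq_abs: "sq_integrable f \<Longrightarrow> (norm (abs_L2 f))\<^sup>2 = integral\<^sup>L lebesgue (\<lambda>x. (norm (f x))\<^sup>2)"
  by (simp add: power2_norm_eq_inner inner_abs)

lemma norm_sq_rep: "(norm u)\<^sup>2 = integral\<^sup>L lebesgue (\<lambda>x. (norm (rep_L2 u x))\<^sup>2)"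
  by (simp add: power2_norm_eq_inner inner_rep)

lemma nn_norm_rep: "(\<integral>\<^sup>+x. ennreal ((norm (rep_L2 u x))\<^sup>2) \<partial>lebesgue) = ennreal ((norm u)\<^sup>2)"
  unfolding norm_sq_rep using sq_rep[of u] by (intro nn_integral_eq_integral) (auto simp: sq_integrable_def)

lemma rep_measurable [measurable]: "rep_L2 u \<in> borel_measurable lebesgue"
  using sq_rep[of u] by (simp add: sq_integrable_def)

lemma sq_integrable_nn:
  assumes [measurable]: "f \<in> borel_measurable lebesgue"
    and "(\<integral>\<^sup>+x. ennreal ((norm (f x))\<^sup>2) \<partial>lebesgue) < \<infinity>"
  shows "sq_integrable f"
  using assms by (auto simp: sq_integrable_def intro!: integrableI_bounded)

lemma norm_abs_le_nn:
  assumes "sq_integrable f" "(\<integral>\<^sup>+x. ennreal ((norm (f x))\<^sup>2) \<partial>lebesgue) \<le> ennreal (e\<^sup>2)" "e \<ge> 0"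
  shows "norm (abs_L2 f) \<le> e"
proof -
  have "ennreal ((norm (abs_L2 f))\<^sup>2) = (\<integral>\<^sup>+x. ennreal ((norm (f x))\<^sup>2) \<partial>lebesgue)"
    unfolding norm_sq_abs[OF assms(1)] using assms(1)
    by (intro nn_integral_eq_integral[symmetric]) (auto simp: sq_integrable_def)
  with assms(2) have "(norm (abs_L2 f))\<^sup>2 \<le> e\<^sup>2" by (metis ennreal_le_iff zero_le_power2)
  then show ?thesis using assms(3) power2_le_imp_le by blast
qed

text \<open>Riesz-Fischer: a rapidly converging subsequence converges almost everywhere, Fatou's
  lemma bounds the distance of its pointwise limit to each member, and the Cauchy property transfers
  convergence to the whole sequence.\<close>

lemma L2_Cauchy_convergent:
  fixes X :: "nat \<Rightarrow> ('a::euclidean_space, 'b::euclidean_space) L2"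
  assumes X: "Cauchy X"
  shows "convergent X"
proof -
  have "\<forall>n. \<exists>M. \<forall>m\<ge>M. \<forall>k\<ge>M. norm (X m - X k) < (1/2) ^ n"
    using CauchyD[OF X, of "(1/2) ^ n" for n] by simp
  then obtain N where N: "\<And>n m k. m \<ge> N n \<Longrightarrow> k \<ge> N n \<Longrightarrow> norm (X m - X k) < (1/2) ^ n"
    by metis
  \<comment> \<open>Summing the successors makes \<open>r\<close> strictly increasing and still at
    least \<open>N n\<close>.\<close>
  define r where "r n = (\<Sum>i\<le>n. Suc (N i))" for n
  have r: "strict_mono r" by (auto simp: r_def strict_mono_Suc_iff)
  have rN: "N n \<le> r n" for n
  proof -
    have "r n = (\<Sum>i<n. Suc (N i)) + Suc (N n)"
      unfolding r_def by (metis lessThan_Suc_atMost sum.lessThan_Suc)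
    then show ?thesis by linarith
  qed
  define Y where "Y = X \<circ> r"
  have Y: "norm (Y m - Y n) \<le> (1/2) ^ n" if "m \<ge> n" for m n
    using N[of n "r m" "r n"] rN[of n] strict_mono_mono[OF r] that unfolding Y_def
    by (metis comp_apply less_imp_le monoD order_trans)
  define f where "f n = rep_L2 (Y n)" for n
  have [measurable]: "f n \<in> borel_measurable lebesgue" for n by (simp add: f_def)
  have diff: "(\<integral>\<^sup>+x. ennreal ((norm (f m x - f n x))\<^sup>2) \<partial>lebesgue) = ennreal ((norm (Y m - Y n))\<^sup>2)" for m n
    unfolding nn_norm_rep[symmetric] f_def
    by (rule nn_integral_cong_AE) (use rep_minus[of "Y m" "Y n"] in \<open>auto elim!: AE_mp\<close>)
  \<comment> \<open>The weight 2^n replaces Minkowski's inequality for series: the integrals are at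
    most 2^n 4^(-n), hence summable, while a finite sum of the \<open>g n x\<close> bounds each of
    them and so makes the increments decay like 2^(-n/2).\<close>
  define g where "g n x = 2 ^ n * (norm (f (Suc n) x - f n x))\<^sup>2" for n x
  have "(\<integral>\<^sup>+x. (\<Sum>n. ennreal (g n x)) \<partial>lebesgue) = (\<Sum>n. \<integral>\<^sup>+x. ennreal (g n x) \<partial>lebesgue)"
    by (rule nn_integral_suminf) (simp add: g_def)
  also have "\<dots> \<le> (\<Sum>n. ennreal ((1/2) ^ n))"
  proof (rule suminf_le)
    fix n
    have "(\<integral>\<^sup>+x. ennreal (g n x) \<partial>lebesgue) = (\<integral>\<^sup>+x. ennreal (2 ^ n) * ennreal ((norm (f (Suc n) x - f n x))\<^sup>2) \<partial>lebesgue)"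
      by (simp add: g_def ennreal_mult)
    also have "\<dots> = ennreal (2 ^ n) * ennreal ((norm (Y (Suc n) - Y n))\<^sup>2)"
      by (subst nn_integral_cmult) (simp_all add: diff)
    also have "\<dots> \<le> ennreal (2 ^ n) * ennreal (((1/2) ^ n)\<^sup>2)"
      using Y[of n "Suc n"] by (intro mult_left_mono ennreal_leI power_mono) auto
    also have "\<dots> = ennreal ((1/2) ^ n)"
      by (simp add: ennreal_mult[symmetric] power_mult_distrib[symmetric] power2_eq_square)
    finally show "(\<integral>\<^sup>+x. ennreal (g n x) \<partial>lebesgue) \<le> ennreal ((1/2) ^ n)" .
  qed auto
  also have "\<dots> < \<infinity>"
    by (subst suminf_ennreal2) (auto simp: summable_geometric)
  finally have "AE x in lebesgue. (\<Sum>n. ennreal (g n x)) \<noteq> \<infinity>"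
    by (intro nn_integral_noteq_infinite) (auto simp: g_def)
  then have conv: "AE x in lebesgue. (\<lambda>n. f n x) \<longlonglongrightarrow> lim (\<lambda>n. f n x)"
  proof (rule AE_mp, intro AE_I2 impI)
    fix x assume fin: "(\<Sum>n. ennreal (g n x)) \<noteq> \<infinity>"
    define T where "T = (\<Sum>n. ennreal (g n x))"
    define C where "C = enn2real T"
    have T: "T = ennreal C" using fin ennreal_enn2real[of T] unfolding C_def T_def[symmetric] by (simp add: less_top)
    have C0: "C \<ge> 0" by (simp add: C_def enn2real_nonneg)
    have C: "g n x \<le> C" for n
    proof -
      have "ennreal (g n x) \<le> T"
        unfolding T_def using sum_le_suminf[OF summableI, of "{n}" "\<lambda>n. ennreal (g n x)"] by simp
      then show ?thesis unfolding T by (simp only: ennreal_le_iff[OF C0])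
    qed
    have "norm (f (Suc n) x - f n x) \<le> sqrt C * (sqrt (1/2)) ^ n" for n
    proof -
      have "(norm (f (Suc n) x - f n x))\<^sup>2 \<le> C * (1/2) ^ n"
        using C[of n] by (simp add: g_def field_simps power_divide)
      then have "norm (f (Suc n) x - f n x) \<le> sqrt (C * (1/2) ^ n)"
        by (rule real_le_rsqrt)
      then show ?thesis by (simp add: real_sqrt_mult real_sqrt_power real_sqrt_divide power_divide)
    qed
    then have 1: "\<exists>N. \<forall>n\<ge>N. norm (f (Suc n) x - f n x) \<le> sqrt C * (sqrt (1/2)) ^ n"
      by blast
    have "sqrt (1/2) < 1" by (rule real_less_lsqrt) auto
    then have "summable (\<lambda>n. sqrt C * (sqrt (1/2)) ^ n)"
      by (intro summable_mult summable_geometric) simp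
    with 1 have "summable (\<lambda>n. f (Suc n) x - f n x)"
      by (rule summable_comparison_test)
    then obtain l where "(\<lambda>n. \<Sum>k<n. f (Suc k) x - f k x) \<longlonglongrightarrow> l"
      by (auto simp: summable_def sums_def)
    then have "(\<lambda>n. f n x - f 0 x) \<longlonglongrightarrow> l"
      by (simp add: sum_lessThan_telescope[of "\<lambda>n. f n x"])
    from tendsto_add[OF this tendsto_const[of "f 0 x"]] have "convergent (\<lambda>n. f n x)"
      by (auto simp: convergent_def)
    then show "(\<lambda>n. f n x) \<longlonglongrightarrow> lim (\<lambda>n. f n x)"
      by (simp add: convergent_LIMSEQ_iff)
  qed
  define F where "F x = lim (\<lambda>n. f n x)" for x
  have [measurable]: "F \<in> borel_measurable lebesgue"
    unfolding F_def by (rule borel_measurable_lim_metric) simp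
  have bound: "(\<integral>\<^sup>+x. ennreal ((norm (F x - f n x))\<^sup>2) \<partial>lebesgue) \<le> ennreal (((1/2) ^ n)\<^sup>2)" for n
  proof -
    have "(\<integral>\<^sup>+x. ennreal ((norm (F x - f n x))\<^sup>2) \<partial>lebesgue)
        = (\<integral>\<^sup>+x. liminf (\<lambda>m. ennreal ((norm (f m x - f n x))\<^sup>2)) \<partial>lebesgue)"
    proof (rule nn_integral_cong_AE, use conv in \<open>rule AE_mp\<close>, intro AE_I2 impI)
      fix x assume "(\<lambda>n. f n x) \<longlonglongrightarrow> lim (\<lambda>n. f n x)"
      then have "(\<lambda>m. ennreal ((norm (f m x - f n x))\<^sup>2)) \<longlonglongrightarrow> ennreal ((norm (F x - f n x))\<^sup>2)"
        unfolding F_def by (intro tendsto_intros)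
      then show "ennreal ((norm (F x - f n x))\<^sup>2) = liminf (\<lambda>m. ennreal ((norm (f m x - f n x))\<^sup>2))"
        by (rule lim_imp_Liminf[OF trivial_limit_sequentially, symmetric])
    qed
    also have "\<dots> \<le> liminf (\<lambda>m. \<integral>\<^sup>+x. ennreal ((norm (f m x - f n x))\<^sup>2) \<partial>lebesgue)"
      by (rule nn_integral_liminf) simp
    also have "\<dots> \<le> ennreal (((1/2) ^ n)\<^sup>2)"
      unfolding diff
    proof (rule Liminf_le, simp)
      show "\<forall>\<^sub>F m in sequentially. ennreal ((norm (Y m - Y n))\<^sup>2) \<le> ennreal (((1/2) ^ n)\<^sup>2)"
        using eventually_ge_at_top[of n] by eventually_elim (use Y in \<open>auto intro!: ennreal_leI power_mono\<close>)
    qed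
    finally show ?thesis .
  qed
  have sqd: "sq_integrable (\<lambda>x. F x - f n x)" for n
    by (rule sq_integrable_nn) (use bound[of n] in \<open>auto simp: le_less_trans\<close>)
  have "sq_integrable (\<lambda>x. (F x - f 0 x) + f 0 x)"
    by (intro sq_integrable_add sqd) (simp add: f_def sq_rep)
  then have sqF: "sq_integrable F" by simp
  have "norm (abs_L2 F - Y n) \<le> (1/2) ^ n" for n
  proof -
    have "abs_L2 F - Y n = abs_L2 (\<lambda>x. F x - f n x)"
      using abs_minus[OF sqF sq_rep[of "Y n"]] by (simp add: f_def abs_rep)
    then show ?thesis using norm_abs_le_nn[OF sqd bound] by simp
  qed
  then have "(\<lambda>n. norm (Y n - abs_L2 F)) \<longlonglongrightarrow> 0"
    by (intro tendsto_sandwich[of "\<lambda>n. 0", OF _ _ tendsto_const LIMSEQ_power_zero[of "1/2 :: real"]])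
       (auto simp: norm_minus_commute)
  then have "(X \<circ> r) \<longlonglongrightarrow> abs_L2 F"
    unfolding Y_def[symmetric] by (rule LIM_zero_cancel[OF tendsto_norm_zero_cancel])
  then show ?thesis
    using Cauchy_converges_subseq[OF X r] by (auto simp: convergent_def)
qed

instance L2 :: (euclidean_space, euclidean_space) complete_space
  by standard (rule L2_Cauchy_convergent)

text \<open>Uniformly bounded pointwise linear multipliers. The one notion covers constant linear
  maps such as the symmetric part, indicators, cut-offs, and the gradient term of the product rule;
  each then acts boundedly through \<open>opL2\<close>.\<close>

definition fibrewise :: "('a::euclidean_space \<Rightarrow> 'b::euclidean_space \<Rightarrow> 'c::euclidean_space) \<Rightarrow> bool" where
  "fibrewise A \<longleftrightarrow> (\<forall>x. linear (A x)) \<and> (\<exists>M. \<forall>x y. norm (A x y) \<le> M * norm y) \<and>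
     (\<forall>f\<in>borel_measurable lebesgue. (\<lambda>x. A x (f x)) \<in> borel_measurable lebesgue)"

definition opL2 :: "('a::euclidean_space \<Rightarrow> 'b::euclidean_space \<Rightarrow> 'c::euclidean_space) \<Rightarrow> ('a, 'b) L2 \<Rightarrow> ('a, 'c) L2" where
  "opL2 A u = abs_L2 (\<lambda>x. A x (rep_L2 u x))"

lemma sq_integrable_bound:
  assumes [measurable]: "f \<in> borel_measurable lebesgue" and "sq_integrable g" "\<And>x. norm (f x) \<le> M * norm (g x)"
  shows "sq_integrable f"
proof -
  have "integrable lebesgue (\<lambda>x. M\<^sup>2 * (norm (g x))\<^sup>2)"
    using assms by (auto simp: sq_integrable_def)
  moreover have "norm ((norm (f x))\<^sup>2) \<le> norm (M\<^sup>2 * (norm (g x))\<^sup>2)" for x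
    using power_mono[OF assms(3), of x 2] by (simp add: power_mult_distrib)
  ultimately have "integrable lebesgue (\<lambda>x. (norm (f x))\<^sup>2)"
    by (elim Bochner_Integration.integrable_bound) (auto intro!: AE_I2)
  then show ?thesis by (simp add: sq_integrable_def)
qed

lemma fibrewise_sq:
  assumes A: "fibrewise A" and f: "sq_integrable f" shows "sq_integrable (\<lambda>x. A x (f x))"
proof -
  obtain M where M: "\<And>x y. norm (A x y) \<le> M * norm y" using A by (auto simp: fibrewise_def)
  have "(\<lambda>x. A x (f x)) \<in> borel_measurable lebesgue"
    using A f by (simp add: fibrewise_def sq_integrable_def)
  then show ?thesis by (rule sq_integrable_bound[OF _ f M])
qed

lemma rep_opL2: "fibrewise A \<Longrightarrow> AE x in lebesgue. rep_L2 (opL2 A u) x = A x (rep_L2 u x)"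
  unfolding opL2_def by (rule rep_abs[OF fibrewise_sq[OF _ sq_rep]])

lemma opL2_abs:
  assumes "fibrewise A" "sq_integrable f" shows "opL2 A (abs_L2 f) = abs_L2 (\<lambda>x. A x (f x))"
  unfolding opL2_def
  by (rule abs_L2_eq[OF fibrewise_sq[OF assms(1) sq_rep] fibrewise_sq[OF assms]])
     (use rep_abs[OF assms(2)] in \<open>auto elim!: AE_mp\<close>)

lemma bounded_linear_opL2:
  assumes A: "fibrewise A" shows "bounded_linear (opL2 A)"
proof -
  have lin: "linear (A x)" for x using A by (simp add: fibrewise_def)
  obtain M where M: "\<And>x y. norm (A x y) \<le> M * norm y" using A by (auto simp: fibrewise_def)
  show ?thesis
  proof (rule bounded_linear_intro)
    show "opL2 A (u + v) = opL2 A u + opL2 A v" for u v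
      using rep_opL2[OF A, of "u + v"] rep_opL2[OF A, of u] rep_opL2[OF A, of v] rep_plus[of u v]
        rep_plus[of "opL2 A u" "opL2 A v"]
      by (intro L2_eqI, eventually_elim) (simp add: linear_add[OF lin])
    show "opL2 A (c *\<^sub>R u) = c *\<^sub>R opL2 A u" for c u
      using rep_opL2[OF A, of "c *\<^sub>R u"] rep_opL2[OF A, of u] rep_scale[of c u] rep_scale[of c "opL2 A u"]
      by (intro L2_eqI, eventually_elim) (simp add: linear_scale[OF lin])
    show "norm (opL2 A u) \<le> norm u * \<bar>M\<bar>" for u
    proof (subst opL2_def, rule norm_abs_le_nn)
      show "sq_integrable (\<lambda>x. A x (rep_L2 u x))" by (rule fibrewise_sq[OF A sq_rep])
      have "(\<integral>\<^sup>+x. ennreal ((norm (A x (rep_L2 u x)))\<^sup>2) \<partial>lebesgue)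
          \<le> (\<integral>\<^sup>+x. ennreal (M\<^sup>2) * ennreal ((norm (rep_L2 u x))\<^sup>2) \<partial>lebesgue)"
        using power_mono[OF M, of _ _ 2] by (intro nn_integral_mono) (auto simp: ennreal_mult[symmetric] power_mult_distrib)
      also have "\<dots> = ennreal (M\<^sup>2) * ennreal ((norm u)\<^sup>2)"
        by (subst nn_integral_cmult) (auto simp: nn_norm_rep)
      finally show "(\<integral>\<^sup>+x. ennreal ((norm (A x (rep_L2 u x)))\<^sup>2) \<partial>lebesgue) \<le> ennreal ((norm u * \<bar>M\<bar>)\<^sup>2)"
        by (simp add: ennreal_mult[symmetric] power_mult_distrib mult.commute)
    qed auto
  qed
qed

section \<open>Translations of the whole space\<close>

lemma lebesgue_shift:
  fixes a :: "'a::euclidean_space"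
  shows measurable_shift [measurable]: "(\<lambda>x. x + a) \<in> lebesgue \<rightarrow>\<^sub>M lebesgue"
    and distr_shift: "distr lebesgue lebesgue (\<lambda>x. x + a) = (lebesgue :: 'a measure)"
proof -
  have T: "(\<lambda>x. a + (\<Sum>j\<in>Basis. (1 * (x \<bullet> j)) *\<^sub>R j)) = (\<lambda>x::'a. x + a)"
    by (auto simp: euclidean_representation add.commute)
  show 1: "(\<lambda>x. x + a) \<in> lebesgue \<rightarrow>\<^sub>M lebesgue"
    using lebesgue_affine_measurable[of "\<lambda>_. 1" a] unfolding T by simp
  show "distr lebesgue lebesgue (\<lambda>x. x + a) = (lebesgue :: 'a measure)"
    using lebesgue_affine_euclidean[of "\<lambda>_. 1" a] unfolding T by (simp add: density_1)
qed

lemma AE_shift: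
  fixes a :: "'a::euclidean_space"
  assumes "AE x in lebesgue. P x" shows "AE x in lebesgue. P (x + a)"
proof -
  obtain N where N: "N \<in> null_sets lebesgue" "{x. \<not> P x} \<subseteq> N" using assms by (auto simp: eventually_ae_filter)
  have "AE x in distr lebesgue lebesgue (\<lambda>x. x + a). x \<notin> N"
    unfolding distr_shift by (rule AE_not_in[OF N(1)])
  then have "AE x in lebesgue. x + a \<notin> N"
    using null_setsD2[OF N(1)] sets.compl_sets[of N lebesgue]
    by (subst (asm) AE_distr_iff) (auto simp: Compl_eq_Diff_UNIV Collect_neg_eq)
  then show ?thesis using N(2) by (auto elim!: AE_mp)
qed

lemma nn_integral_shift:
  "f \<in> borel_measurable lebesgue \<Longrightarrow> (\<integral>\<^sup>+x. f (x + a) \<partial>lebesgue) = (\<integral>\<^sup>+x. f x \<partial>lebesgue)"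
  by (subst (2) distr_shift[of a, symmetric]) (simp add: nn_integral_distr)

lemma integral_shift:
  fixes f :: "'a::euclidean_space \<Rightarrow> 'b::{banach, second_countable_topology}"
  shows "f \<in> borel_measurable lebesgue \<Longrightarrow> integral\<^sup>L lebesgue (\<lambda>x. f (x + a)) = integral\<^sup>L lebesgue f"
  by (subst (2) distr_shift[of a, symmetric]) (simp add: integral_distr)

lemma sq_shift:
  assumes "sq_integrable f" shows "sq_integrable (\<lambda>x. f (x + a))"
proof (rule sq_integrable_nn)
  have [measurable]: "f \<in> borel_measurable lebesgue" using assms by (simp add: sq_integrable_def)
  show "(\<lambda>x. f (x + a)) \<in> borel_measurable lebesgue" by simp
  have "(\<integral>\<^sup>+x. ennreal ((norm (f (x + a)))\<^sup>2) \<partial>lebesgue) = (\<integral>\<^sup>+x. ennreal ((norm (f x))\<^sup>2) \<partial>lebesgue)"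
    by (rule nn_integral_shift[of "\<lambda>x. ennreal ((norm (f x))\<^sup>2)"]) simp
  also have "\<dots> < \<infinity>"
    using assms by (auto simp: sq_integrable_def integrable_iff_bounded)
  finally show "(\<integral>\<^sup>+x. ennreal ((norm (f (x + a)))\<^sup>2) \<partial>lebesgue) < \<infinity>" .
qed

definition trL2 :: "'a::euclidean_space \<Rightarrow> ('a, 'b::euclidean_space) L2 \<Rightarrow> ('a, 'b) L2" where
  "trL2 a u = abs_L2 (\<lambda>x. rep_L2 u (x + a))"

lemma rep_trL2: "AE x in lebesgue. rep_L2 (trL2 a u) x = rep_L2 u (x + a)"
  unfolding trL2_def by (intro rep_abs sq_shift sq_rep)

lemma trL2_abs: "sq_integrable f \<Longrightarrow> trL2 a (abs_L2 f) = abs_L2 (\<lambda>x. f (x + a))"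
  unfolding trL2_def by (rule abs_L2_eq) (auto intro!: sq_shift sq_rep AE_shift rep_abs)

lemma bounded_linear_trL2: "bounded_linear (trL2 a)"
  and norm_trL2_le: "norm (trL2 a u) \<le> norm u"
proof -
  show n: "norm (trL2 a u) \<le> norm u" for u
    unfolding trL2_def
  proof (rule norm_abs_le_nn)
    show "(\<integral>\<^sup>+x. ennreal ((norm (rep_L2 u (x + a)))\<^sup>2) \<partial>lebesgue) \<le> ennreal ((norm u)\<^sup>2)"
      using nn_integral_shift[of "\<lambda>x. ennreal ((norm (rep_L2 u x))\<^sup>2)" a] by (simp add: nn_norm_rep)
  qed (auto intro: sq_shift sq_rep)
  show "bounded_linear (trL2 a)"
  proof (rule bounded_linear_intro[where K=1])
    show "trL2 a (u + v) = trL2 a u + trL2 a v" for u v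
      using rep_trL2[of a "u + v"] rep_trL2[of a u] rep_trL2[of a v] AE_shift[OF rep_plus[of u v], of a]
        rep_plus[of "trL2 a u" "trL2 a v"]
      by (intro L2_eqI, eventually_elim) simp
    show "trL2 a (c *\<^sub>R u) = c *\<^sub>R trL2 a u" for c u
      using rep_trL2[of a "c *\<^sub>R u"] rep_trL2[of a u] AE_shift[OF rep_scale[of c u], of a] rep_scale[of c "trL2 a u"]
      by (intro L2_eqI, eventually_elim) simp
  qed (simp add: n)
qed

lemma sq_bounded_support:
  assumes [measurable]: "f \<in> borel_measurable lebesgue" and S: "S \<in> lmeasurable"
    and "\<And>x. x \<notin> S \<Longrightarrow> f x = 0" "\<And>x. norm (f x) \<le> B"
  shows "sq_integrable f" and "(norm (abs_L2 f))\<^sup>2 \<le> B\<^sup>2 * measure lebesgue S"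
proof -
  have i: "integrable lebesgue (\<lambda>x. B\<^sup>2 * indicator S x)"
    using S by (intro integrable_mult_right integrable_real_indicator) (auto simp: fmeasurable_def)
  have le: "(norm (f x))\<^sup>2 \<le> B\<^sup>2 * indicator S x" for x
    using assms(3,4)[of x] by (auto simp: indicator_def power_mono)
  have j: "integrable lebesgue (\<lambda>x. (norm (f x))\<^sup>2)"
    by (rule Bochner_Integration.integrable_bound[OF i]) (use le in \<open>auto intro!: AE_I2\<close>)
  then show s: "sq_integrable f" by (simp add: sq_integrable_def)
  have "(norm (abs_L2 f))\<^sup>2 \<le> integral\<^sup>L lebesgue (\<lambda>x. B\<^sup>2 * indicator S x)"
    unfolding norm_sq_abs[OF s] by (rule integral_mono[OF j i le])
  also have "\<dots> = B\<^sup>2 * measure lebesgue S"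
    using S by (simp add: fmeasurable_def)
  finally show "(norm (abs_L2 f))\<^sup>2 \<le> B\<^sup>2 * measure lebesgue S" .
qed

lemma continuous_measurable_lebesgue:
  fixes f :: "'a::euclidean_space \<Rightarrow> 'b::euclidean_space"
  shows "continuous_on UNIV f \<Longrightarrow> f \<in> borel_measurable lebesgue"
  by (rule measurable_completion) (simp add: borel_measurable_continuous_onI)

lemma smooth_measurable:
  fixes f :: "'a::euclidean_space \<Rightarrow> 'b::euclidean_space"
  shows "smooth f \<Longrightarrow> f \<in> borel_measurable lebesgue"
  by (intro continuous_measurable_lebesgue smooth_continuous)

lemma Cc_inf_bounded:
  fixes f :: "'a::euclidean_space \<Rightarrow> 'b::euclidean_space"
  assumes "f \<in> Cc_inf \<Omega>" obtains B where "B > 0" "\<And>x. norm (f x) \<le> B"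
proof -
  obtain K where K: "compact K" "\<And>x. x \<notin> K \<Longrightarrow> f x = 0" using Cc_infE[OF assms] by metis
  have "bounded (f ` K)"
    by (intro compact_imp_bounded compact_continuous_image K smooth_continuous Cc_inf_smooth[OF assms])
  then obtain B where "B > 0" "\<forall>y\<in>f ` K. norm y \<le> B" by (auto simp: bounded_pos)
  then have "norm (f x) \<le> B" for x using K(2)[of x] by (cases "x \<in> K") auto
  with \<open>B > 0\<close> that show ?thesis by blast
qed

lemma Cc_inf_sq:
  fixes f :: "'a::euclidean_space \<Rightarrow> 'b::euclidean_space"
  assumes "f \<in> Cc_inf \<Omega>" shows "sq_integrable f"
proof -
  obtain K where K: "compact K" "\<And>x. x \<notin> K \<Longrightarrow> f x = 0" using Cc_infE[OF assms] by metis
  obtain B where "\<And>x. norm (f x) \<le> B" using Cc_inf_bounded[OF assms] by metis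
  then show ?thesis
    by (intro sq_bounded_support(1)[where S=K] smooth_measurable Cc_inf_smooth[OF assms] K lmeasurable_compact)
qed

lemma Cc_inf_uniformly_continuous:
  fixes f :: "'a::euclidean_space \<Rightarrow> 'b::euclidean_space"
  assumes f: "f \<in> Cc_inf \<Omega>" and "e > 0"
  obtains d where "d > 0" "\<And>x y. dist x y < d \<Longrightarrow> dist (f x) (f y) < e"
proof -
  obtain K where K: "compact K" "\<And>x. x \<notin> K \<Longrightarrow> f x = 0" using Cc_infE[OF f] by metis
  obtain R where R: "R > 0" "K \<subseteq> ball 0 R" using bounded_subset_ballD[OF compact_imp_bounded[OF K(1)], of 0] by blast
  have "uniformly_continuous_on (cball 0 (R + 1)) f"
    by (intro compact_uniformly_continuous smooth_continuous Cc_inf_smooth[OF f] compact_cball)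
  then obtain d where d: "d > 0" "\<And>x y. x \<in> cball 0 (R + 1) \<Longrightarrow> y \<in> cball 0 (R + 1) \<Longrightarrow> dist x y < d \<Longrightarrow> dist (f x) (f y) < e"
    using \<open>e > 0\<close> by (metis uniformly_continuous_onE)
  show thesis
  proof
    show "min d 1 > 0" using d by simp
    fix x y :: 'a assume xy: "dist x y < min d 1"
    show "dist (f x) (f y) < e"
    proof (cases "x \<in> cball 0 (R + 1) \<and> y \<in> cball 0 (R + 1)")
      case True
      then show ?thesis using d xy by auto
    next
      case False
      then have "norm x > R \<and> norm y > R"
        using xy norm_triangle_ineq2[of x y] norm_triangle_ineq2[of y x] by (auto simp: dist_norm norm_minus_commute)
      then have "x \<notin> K" "y \<notin> K" using R by (auto simp: subset_iff)
      then show ?thesis using K \<open>e > 0\<close> by simp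
    qed
  qed
qed

text \<open>Continuity of translations, by uniform continuity of a nearby test function. It is
  stated for limits of test functions because every field of the graphs below is one by
  construction.\<close>

lemma trL2_continuous:
  fixes u :: "('a::euclidean_space, 'b::euclidean_space) L2"
  assumes u: "u \<in> closure (abs_L2 ` Cc_inf UNIV)" and "e > 0"
  obtains d where "d > 0" "\<And>a. norm a < d \<Longrightarrow> norm (trL2 a u - u) < e"
proof -
  obtain \<phi> where \<phi>: "\<phi> \<in> Cc_inf UNIV" "dist (abs_L2 \<phi>) u < e / 3"
    using u \<open>e > 0\<close> unfolding closure_approachable by (metis (no_types, lifting) imageE zero_less_divide_iff zero_less_numeral)
  obtain K where K: "compact K" "\<And>x. x \<notin> K \<Longrightarrow> \<phi> x = 0" using Cc_infE[OF \<phi>(1)] by metis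
  obtain R where R: "R > 0" "K \<subseteq> ball 0 R" using bounded_subset_ballD[OF compact_imp_bounded[OF K(1)], of 0] by blast
  \<comment> \<open>The radius R + 1 contains the supports of all translates by less than 1; the
    summand 1 makes \<open>V\<close> positive for the division that follows.\<close>
  define V where "V = measure lebesgue (cball 0 (R + 1) :: 'a set) + 1"
  have V: "V > 0" by (simp add: V_def add_nonneg_pos)
  \<comment> \<open>Chosen so that \<eta>^2 V = (e/4)^2; the three parts of the final estimate add
    up to e/3 + e/4 + e/3 < e.\<close>
  define \<eta> where "\<eta> = e / (4 * sqrt V)"
  have \<eta>: "\<eta> > 0" using V \<open>e > 0\<close> by (simp add: \<eta>_def)
  obtain d where d: "d > 0" "\<And>x y. dist x y < d \<Longrightarrow> dist (\<phi> x) (\<phi> y) < \<eta>"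
    using Cc_inf_uniformly_continuous[OF \<phi>(1) \<eta>] by metis
  show thesis
  proof
    show "min d 1 > 0" using d by simp
    fix a :: 'a assume a: "norm a < min d 1"
    have sq: "sq_integrable \<phi>" by (rule Cc_inf_sq[OF \<phi>(1)])
    have "(norm (abs_L2 (\<lambda>x. \<phi> (x + a) - \<phi> x)))\<^sup>2 \<le> \<eta>\<^sup>2 * measure lebesgue (cball 0 (R + 1) :: 'a set)"
    proof (rule sq_bounded_support(2))
      show "(\<lambda>x. \<phi> (x + a) - \<phi> x) \<in> borel_measurable lebesgue"
        by (intro smooth_measurable smooth_diff smooth_shift Cc_inf_smooth[OF \<phi>(1)])
      show "norm (\<phi> (x + a) - \<phi> x) \<le> \<eta>" for x
        using d(2)[of "x + a" x] a by (simp add: dist_norm)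
      show "\<phi> (x + a) - \<phi> x = 0" if "x \<notin> cball 0 (R + 1)" for x
      proof -
        have "R + 1 < norm x" using that by simp
        moreover have "norm x \<le> norm (x + a) + norm a" using norm_triangle_ineq4[of "x + a" a] by simp
        ultimately have "x + a \<notin> K" "x \<notin> K" using R a by auto
        then show ?thesis using K(2) by simp
      qed
    qed auto
    also have "\<dots> \<le> \<eta>\<^sup>2 * V" by (intro mult_left_mono) (simp_all add: V_def)
    also have "\<dots> = (e/4)\<^sup>2" using V by (simp add: \<eta>_def power_mult_distrib power_divide)
    finally have "norm (abs_L2 (\<lambda>x. \<phi> (x + a) - \<phi> x)) \<le> e/4"
      using \<open>e > 0\<close> power2_le_imp_le[of _ "e/4"] by simp
    then have 1: "norm (trL2 a (abs_L2 \<phi>) - abs_L2 \<phi>) \<le> e/4"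
      by (simp add: trL2_abs[OF sq] abs_minus sq sq_shift)
    have 2: "norm (trL2 a u - trL2 a (abs_L2 \<phi>)) < e/3"
      using norm_trL2_le[of a "u - abs_L2 \<phi>"] \<phi>(2) linear_diff[OF bounded_linear.linear[OF bounded_linear_trL2[of a]], of u "abs_L2 \<phi>"]
      by (simp add: dist_norm norm_minus_commute)
    have "trL2 a u - u = (trL2 a u - trL2 a (abs_L2 \<phi>)) + ((trL2 a (abs_L2 \<phi>) - abs_L2 \<phi>) + (abs_L2 \<phi> - u))" by simp
    also have "norm \<dots> \<le> norm (trL2 a u - trL2 a (abs_L2 \<phi>)) + (norm (trL2 a (abs_L2 \<phi>) - abs_L2 \<phi>) + norm (abs_L2 \<phi> - u))"
      by (intro norm_triangle_le add_mono norm_triangle_ineq order_refl)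
    also have "\<dots> < e" using 1 2 \<phi>(2) \<open>e > 0\<close> by (simp add: dist_norm)
    finally show "norm (trL2 a u - u) < e" .
  qed
qed

section \<open>Integration by parts, Poincare and Korn inequalities\<close>

lemma Cc_inf_integrable:
  fixes f :: "'a::euclidean_space \<Rightarrow> 'b::euclidean_space"
  assumes "f \<in> Cc_inf \<Omega>" shows "integrable lebesgue f"
proof -
  obtain K where K: "compact K" "\<And>x. x \<notin> K \<Longrightarrow> f x = 0" using Cc_infE[OF assms] by metis
  obtain B where B: "B > 0" "\<And>x. norm (f x) \<le> B" using Cc_inf_bounded[OF assms] by metis
  have "integrable lebesgue (\<lambda>x. B * indicator K x)"
    using lmeasurable_compact[OF K(1)] by (intro integrable_mult_right integrable_real_indicator) (auto simp: fmeasurable_def)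
  then show ?thesis
    by (rule Bochner_Integration.integrable_bound[OF _ smooth_measurable[OF Cc_inf_smooth[OF assms]]])
       (use B K in \<open>auto intro!: AE_I2 simp: indicator_def intro: order_trans\<close>)
qed

text \<open>Difference quotients have integral 0 by translation invariance of the measure. By the
  mean value theorem they are dominated by a constant on a fixed ball, so the integral of their
  limit is 0 as well.\<close>

lemma integral_dird_real:
  fixes f :: "'a::euclidean_space \<Rightarrow> real"
  assumes f: "f \<in> Cc_inf UNIV"
  shows "integral\<^sup>L lebesgue (dird a f) = 0"
proof -
  have sm: "smooth f" by (rule Cc_inf_smooth[OF f])
  obtain K where K: "compact K" "\<And>x. x \<notin> K \<Longrightarrow> f x = 0" using Cc_infE[OF f] by metis
  obtain R where R: "R > 0" "K \<subseteq> ball 0 R" using bounded_subset_ballD[OF compact_imp_bounded[OF K(1)], of 0] by blast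
  obtain B where B: "B > 0" "\<And>x. norm (dird a f x) \<le> B" using Cc_inf_bounded[OF Cc_inf_dird[OF f]] by metis
  define h where "h n = 1 / real (Suc n)" for n
  have h: "0 < h n" "h n \<le> 1" for n by (auto simp: h_def)
  have h0: "h \<longlonglongrightarrow> 0" unfolding h_def by (rule LIMSEQ_Suc[OF lim_1_over_n])
  define s where "s n x = (f (x + h n *\<^sub>R a) - f x) / h n" for n x
  have int0: "integral\<^sup>L lebesgue (s n) = 0" for n
  proof -
    have "integrable lebesgue (\<lambda>x. f (x + h n *\<^sub>R a))"
      using Cc_inf_integrable[OF Cc_inf_shift[OF f]] .
    then show ?thesis
      unfolding s_def using Cc_inf_integrable[OF f] integral_shift[OF smooth_measurable[OF sm], of "h n *\<^sub>R a"]
      by simp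
  qed
  have "(\<lambda>n. integral\<^sup>L lebesgue (s n)) \<longlonglongrightarrow> integral\<^sup>L lebesgue (dird a f)"
  proof (rule integral_dominated_convergence[where w="\<lambda>x. B * indicator (cball 0 (R + norm a)) x"])
    show "dird a f \<in> borel_measurable lebesgue"
      by (intro smooth_measurable smooth_dird sm)
    show "s n \<in> borel_measurable lebesgue" for n
      unfolding s_def divide_inverse using smooth_measurable[OF smooth_shift[OF sm]] smooth_measurable[OF sm] by measurable
    show "integrable lebesgue (\<lambda>x. B * indicator (cball 0 (R + norm a)) x)"
      using lmeasurable_cball[of 0 "R + norm a"] by (intro integrable_mult_right integrable_real_indicator) (auto simp: fmeasurable_def)
    show "AE x in lebesgue. (\<lambda>n. s n x) \<longlonglongrightarrow> dird a f x"
    proof (rule AE_I2)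
      fix x
      have "((\<lambda>s. f (x + s *\<^sub>R a)) has_real_derivative dird a f (x + 0 *\<^sub>R a)) (at 0)"
        by (rule smooth_line_deriv[OF sm])
      then have "(\<lambda>t. (f (x + t *\<^sub>R a) - f x) / t) \<midarrow>0\<rightarrow> dird a f x"
        by (simp add: DERIV_def)
      moreover have "filterlim h (at 0) sequentially"
        using h0 h(1) by (intro filterlim_atI) (auto intro!: always_eventually simp: less_imp_neq[symmetric])
      ultimately show "(\<lambda>n. s n x) \<longlonglongrightarrow> dird a f x"
        unfolding s_def by (rule filterlim_compose)
    qed
    show "AE x in lebesgue. norm (s n x) \<le> B * indicator (cball 0 (R + norm a)) x" for n
    proof (rule AE_I2)
      fix x
      show "norm (s n x) \<le> B * indicator (cball 0 (R + norm a)) x"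
      proof (cases "x \<in> cball 0 (R + norm a)")
        case True
        obtain z where "0 < z" "z < h n" "f (x + h n *\<^sub>R a) - f (x + 0 *\<^sub>R a) = (h n - 0) * dird a f (x + z *\<^sub>R a)"
          using MVT2[of 0 "h n" "\<lambda>s. f (x + s *\<^sub>R a)" "\<lambda>s. dird a f (x + s *\<^sub>R a)"] smooth_line_deriv[OF sm] h by metis
        then have "s n x = dird a f (x + z *\<^sub>R a)" using h[of n] by (simp add: s_def)
        then show ?thesis using True B by simp
      next
        case False
        then have "norm x > R + norm a" by simp
        moreover have "norm x \<le> norm (x + h n *\<^sub>R a) + norm (h n *\<^sub>R a)"
          using norm_triangle_ineq4[of "x + h n *\<^sub>R a" "h n *\<^sub>R a"] by simp
        moreover have "norm (h n *\<^sub>R a) \<le> norm a" using h[of n] by (simp add: mult_left_le_one_le)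
        ultimately have "norm (x + h n *\<^sub>R a) > R" "norm x > R" using norm_ge_zero[of a] by linarith+
        then have "x + h n *\<^sub>R a \<notin> K" "x \<notin> K" using R by (auto simp: subset_iff)
        then show ?thesis using K B by (simp add: s_def)
      qed
    qed
  qed
  then show ?thesis by (simp add: int0 LIMSEQ_const_iff)
qed

lemma integral_by_parts:
  fixes f g :: "'a::euclidean_space \<Rightarrow> real"
  assumes f: "f \<in> Cc_inf UNIV" and g: "smooth g"
  shows "integral\<^sup>L lebesgue (\<lambda>x. dird a f x * g x) = - integral\<^sup>L lebesgue (\<lambda>x. f x * dird a g x)"
proof -
  have sm: "smooth f" by (rule Cc_inf_smooth[OF f])
  have fg: "(\<lambda>x. f x * g x) \<in> Cc_inf UNIV" using Cc_inf_smooth_scaleR_right[OF f g] by simp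
  have 1: "dird a (\<lambda>x. f x * g x) x = f x * dird a g x + dird a f x * g x" for x
    by (rule dird_mult[OF sm g])
  have "integrable lebesgue (\<lambda>x. f x * dird a g x)"
    using Cc_inf_integrable[OF Cc_inf_smooth_scaleR_right[OF f smooth_dird[OF g]]] by simp
  moreover have "integrable lebesgue (\<lambda>x. dird a f x * g x)"
    using Cc_inf_integrable[OF Cc_inf_smooth_scaleR_right[OF Cc_inf_dird[OF f] g]] by simp
  moreover have "integral\<^sup>L lebesgue (\<lambda>x. f x * dird a g x + dird a f x * g x) = 0"
    using integral_dird_real[OF fg, of a] 1 by (metis (no_types, lifting) Bochner_Integration.integral_cong)
  ultimately show ?thesis by simp
qed

section \<open>Components of vector and matrix fields\<close>

lemma Cc_inf_nth:
  fixes f :: "'a::euclidean_space \<Rightarrow> ('b::euclidean_space) ^ 'n"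
  shows "f \<in> Cc_inf \<Omega> \<Longrightarrow> (\<lambda>x. f x $ i) \<in> Cc_inf \<Omega>"
  by (rule Cc_inf_linear[OF _ bounded_linear_vec_nth])

lemma smooth_nth:
  fixes f :: "'a::euclidean_space \<Rightarrow> ('b::euclidean_space) ^ 'n"
  shows "smooth f \<Longrightarrow> smooth (\<lambda>x. f x $ i)"
  by (rule smooth_bounded_linear_compose[OF bounded_linear_vec_nth])

lemma dird_nth:
  fixes f :: "'a::euclidean_space \<Rightarrow> ('b::euclidean_space) ^ 'n"
  shows "smooth f \<Longrightarrow> dird a (\<lambda>x. f x $ i) x = dird a f x $ i"
  by (rule dird_bounded_linear[OF bounded_linear_vec_nth])

lemma bounded_linear_axis: "bounded_linear (axis i :: 'b::euclidean_space \<Rightarrow> 'b ^ 'n)"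
  by (rule linear_conv_bounded_linear[THEN iffD1], rule linearI) (auto simp: vec_eq_iff axis_def)

lemma smooth_vecI:
  fixes f :: "'a::euclidean_space \<Rightarrow> ('b::euclidean_space) ^ 'n"
  assumes "\<And>i. smooth (\<lambda>x. f x $ i)" shows "smooth f"
proof -
  have "f x = (\<Sum>i\<in>UNIV. axis i (f x $ i))" for x
    by (simp add: vec_eq_iff axis_def if_distrib cong: if_cong)
  then have "f = (\<lambda>x. \<Sum>i\<in>UNIV. axis i (f x $ i))" by blast
  moreover have "smooth (\<lambda>x. \<Sum>i\<in>UNIV. axis i (f x $ i))"
    by (intro smooth_sum smooth_bounded_linear_compose[OF bounded_linear_axis] assms)
  ultimately show ?thesis by simp
qed

abbreviation pd :: "3 \<Rightarrow> (real^3 \<Rightarrow> 'b::real_normed_vector) \<Rightarrow> real^3 \<Rightarrow> 'b" where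
  "pd j \<equiv> dird (axis j 1)"

lemma grad_c_nth: "grad_c v x $ i $ j = pd j v x $ i"
  by (simp add: grad_c_def jacobian_def matrix_def dird_def)

lemma grad_c_mult: "smooth v \<Longrightarrow> grad_c v x *v h = dird h v x"
  using smooth_differentiable[of v x] smooth_has_derivative[of v x]
  by (metis frechet_derivative_at grad_c_def jacobian_works has_derivative_unique)

lemma smooth_grad_c: "smooth v \<Longrightarrow> smooth (grad_c v)"
  by (intro smooth_vecI) (simp add: grad_c_nth smooth_nth smooth_dird)

lemma grad_c_linear:
  assumes "smooth u" "smooth v"
  shows "grad_c (\<lambda>x. u x + v x) x = grad_c u x + grad_c v x"
    and "grad_c (\<lambda>x. c *\<^sub>R u x) x = c *\<^sub>R grad_c u x"
  using dird_bounded_linear[OF bounded_linear_scaleR_right assms(1), of _ c]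
  by (simp_all add: vec_eq_iff grad_c_nth dird_add assms)

lemma Cc_inf_grad_c:
  assumes "v \<in> Cc_inf \<Omega>" shows "grad_c v \<in> Cc_inf \<Omega>"
proof -
  obtain K where K: "compact K" "K \<subseteq> \<Omega>" "\<And>x. x \<notin> K \<Longrightarrow> v x = 0" using Cc_infE[OF assms] by metis
  show ?thesis
  proof (rule Cc_infI[OF smooth_grad_c[OF Cc_inf_smooth[OF assms]] K(1,2)])
    fix x assume x: "x \<notin> K"
    have "pd j v x = 0" for j
      by (rule dird_zero_open[where U="- K"]) (use K x compact_imp_closed in auto)
    then show "grad_c v x = 0" by (simp add: vec_eq_iff grad_c_nth)
  qed
qed

lemma bounded_linear_sym_part: "bounded_linear sym_part"
  by (rule linear_conv_bounded_linear[THEN iffD1], rule linearI)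
     (auto simp: sym_part_def vec_eq_iff transpose_def algebra_simps)

lemma sym_part_nth: "sym_part A $ i $ j = (A $ i $ j + A $ j $ i) / 2"
  by (simp add: sym_part_def transpose_def)

lemma symgrad_c_eq: "symgrad_c v = (\<lambda>x. sym_part (grad_c v x))"
  by (simp add: fun_eq_iff symgrad_c_def)

lemma Cc_inf_symgrad_c: "v \<in> Cc_inf \<Omega> \<Longrightarrow> symgrad_c v \<in> Cc_inf \<Omega>"
  unfolding symgrad_c_eq by (rule Cc_inf_linear[OF Cc_inf_grad_c bounded_linear_sym_part])

lemma smooth_symgrad_c: "smooth v \<Longrightarrow> smooth (symgrad_c v)"
  unfolding symgrad_c_eq by (rule smooth_bounded_linear_compose[OF bounded_linear_sym_part smooth_grad_c])

lemma inner_matrix: "(A :: real^3^3) \<bullet> B = (\<Sum>i\<in>UNIV. \<Sum>j\<in>UNIV. A $ i $ j * B $ i $ j)"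
  by (simp add: inner_vec_def)

text \<open>The weight is $|\varphi|^2 = |\varphi|^2 \partial_a (x \cdot a)$, integrated by parts.\<close>

lemma poincare:
  fixes \<phi> :: "'a::euclidean_space \<Rightarrow> 'b::euclidean_space"
  assumes \<phi>: "\<phi> \<in> Cc_inf (ball 0 R)" and a: "norm a = 1"
  shows "norm (abs_L2 \<phi>) \<le> 2 * R * norm (abs_L2 (dird a \<phi>))"
proof (cases "R > 0")
  case R: True
  have sm: "smooth \<phi>" by (rule Cc_inf_smooth[OF \<phi>])
  obtain K where K: "compact K" "K \<subseteq> ball 0 R" "\<And>x. x \<notin> K \<Longrightarrow> \<phi> x = 0" using Cc_infE[OF \<phi>] by metis
  define g where "g = (\<lambda>x. \<phi> x \<bullet> \<phi> x)"
  have gC: "g \<in> Cc_inf UNIV"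
    unfolding g_def by (rule Cc_infI[OF smooth_inner[OF sm sm] K(1)]) (use K in auto)
  have bl: "bounded_linear (\<lambda>x::'a. x \<bullet> a)" by (rule bounded_linear_inner_left)
  have da: "dird a (\<lambda>x::'a. x \<bullet> a) x = 1" for x
    using dird_eq[OF bounded_linear_imp_has_derivative[OF bl]] a by (simp add: norm_eq_1)
  have dg: "dird a g x = 2 * (\<phi> x \<bullet> dird a \<phi> x)" for x
    unfolding g_def by (subst dird_inner[OF sm sm]) (simp add: inner_commute)
  \<comment> \<open>The constant 2R has two sources: 2 from the derivative of |\<phi>|^2, and R from
    |x \<bullet> a| \<le> R on the support.\<close>
  define \<psi> where "\<psi> = (\<lambda>x. (x \<bullet> a) *\<^sub>R dird a \<phi> x)"
  have psi: "\<psi> \<in> Cc_inf UNIV"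
    unfolding \<psi>_def by (rule Cc_inf_smooth_scaleR_left[OF Cc_inf_mono[OF _ Cc_inf_dird[OF \<phi>]] smooth_bounded_linear[OF bl]]) auto
  have dz: "dird a \<phi> x = 0" if "x \<notin> ball 0 R" for x
    by (rule dird_zero_open[where U="- K"]) (use K that compact_imp_closed in auto)
  have psi_le: "norm (abs_L2 \<psi>) \<le> R * norm (abs_L2 (dird a \<phi>))"
  proof -
    have "(norm (abs_L2 \<psi>))\<^sup>2 \<le> integral\<^sup>L lebesgue (\<lambda>x. R\<^sup>2 * (norm (dird a \<phi> x))\<^sup>2)"
      unfolding norm_sq_abs[OF Cc_inf_sq[OF psi]]
    proof (rule integral_mono)
      show "integrable lebesgue (\<lambda>x. (norm (\<psi> x))\<^sup>2)" using Cc_inf_sq[OF psi] by (simp add: sq_integrable_def)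
      show "integrable lebesgue (\<lambda>x. R\<^sup>2 * (norm (dird a \<phi> x))\<^sup>2)"
        using Cc_inf_sq[OF Cc_inf_dird[OF \<phi>]] by (auto simp: sq_integrable_def)
      show "(norm (\<psi> x))\<^sup>2 \<le> R\<^sup>2 * (norm (dird a \<phi> x))\<^sup>2" for x
      proof (cases "x \<in> ball 0 R")
        case True
        then have "\<bar>x \<bullet> a\<bar> \<le> R" using Cauchy_Schwarz_ineq2[of x a] a by simp
        then have "(x \<bullet> a)\<^sup>2 \<le> R\<^sup>2" using R by (metis abs_le_square_iff abs_of_pos)
        then show ?thesis by (simp add: \<psi>_def power_mult_distrib mult_right_mono)
      qed (simp add: \<psi>_def dz)
    qed
    also have "\<dots> = (R * norm (abs_L2 (dird a \<phi>)))\<^sup>2"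
      by (simp add: power_mult_distrib norm_sq_abs[OF Cc_inf_sq[OF Cc_inf_dird[OF \<phi>]]])
    finally show ?thesis by (rule power2_le_imp_le) (use R in simp)
  qed
  have "(norm (abs_L2 \<phi>))\<^sup>2 = integral\<^sup>L lebesgue (\<lambda>x. g x * dird a (\<lambda>x. x \<bullet> a) x)"
    unfolding da norm_sq_abs[OF Cc_inf_sq[OF \<phi>]] g_def by (simp add: power2_norm_eq_inner)
  also have "\<dots> = - integral\<^sup>L lebesgue (\<lambda>x. dird a g x * (x \<bullet> a))"
    using integral_by_parts[OF gC smooth_bounded_linear[OF bl], of a] by simp
  also have "\<dots> = - integral\<^sup>L lebesgue (\<lambda>x. 2 * (\<phi> x \<bullet> \<psi> x))"
    by (simp add: dg \<psi>_def mult_ac)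
  also have "\<dots> = - 2 * integral\<^sup>L lebesgue (\<lambda>x. \<phi> x \<bullet> \<psi> x)"
    by simp
  also have "\<dots> = - 2 * (abs_L2 \<phi> \<bullet> abs_L2 \<psi>)"
    by (simp add: inner_abs[OF Cc_inf_sq[OF \<phi>] Cc_inf_sq[OF psi]])
  also have "\<dots> \<le> 2 * (norm (abs_L2 \<phi>) * norm (abs_L2 \<psi>))"
    using Cauchy_Schwarz_ineq2[of "abs_L2 \<phi>" "abs_L2 \<psi>"] by linarith
  also have "\<dots> \<le> 2 * (norm (abs_L2 \<phi>) * (R * norm (abs_L2 (dird a \<phi>))))"
    using psi_le by (intro mult_left_mono) auto
  finally have "norm (abs_L2 \<phi>) * norm (abs_L2 \<phi>) \<le> norm (abs_L2 \<phi>) * (2 * R * norm (abs_L2 (dird a \<phi>)))"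
    by (simp add: power2_eq_square mult_left_mono mult_ac)
  then show ?thesis
    using R by (cases "norm (abs_L2 \<phi>) = 0") (auto simp: mult_le_cancel_left_pos)
next
  case False
  then have "\<phi> x = 0" for x using Cc_infE[OF \<phi>] by (metis ball_eq_empty empty_iff not_less subset_empty)
  then have "\<phi> = (\<lambda>x. 0)" by blast
  moreover have "dird a (\<lambda>x. 0 :: 'b) = (\<lambda>x. 0)" by (auto simp: dird_def)
  ultimately show ?thesis by (simp add: abs_zero)
qed

text \<open>Both sides equal minus the integral of f times the mixed second derivative of g.\<close>

lemma integral_dird_commute:
  fixes f g :: "'a::euclidean_space \<Rightarrow> real"
  assumes f: "f \<in> Cc_inf UNIV" and g: "g \<in> Cc_inf UNIV"
  shows "integral\<^sup>L lebesgue (\<lambda>x. dird a f x * dird b g x) = integral\<^sup>L lebesgue (\<lambda>x. dird b f x * dird a g x)"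
  by (simp add: integral_by_parts[OF f smooth_dird[OF Cc_inf_smooth[OF g]]] dird_commute[OF Cc_inf_smooth[OF g], of a b])

text \<open>Pointwise, 2|sym M|^2 = |M|^2 + M \<bullet> M^T. By exchanging derivatives under the
  integral, the last term integrates to the integral of the squared divergence, which is
  nonnegative. The constant 2 does not depend on the support.\<close>

lemma korn:
  assumes \<phi>: "\<phi> \<in> Cc_inf \<Omega>"
  shows "(norm (abs_L2 (grad_c \<phi>)))\<^sup>2 \<le> 2 * (norm (abs_L2 (symgrad_c \<phi>)))\<^sup>2"
proof -
  have U: "\<phi> \<in> Cc_inf UNIV" using Cc_inf_mono[OF _ \<phi>] by blast
  have sm: "smooth \<phi>" by (rule Cc_inf_smooth[OF \<phi>])
  have comp: "(\<lambda>x. \<phi> x $ i) \<in> Cc_inf UNIV" for i by (rule Cc_inf_nth[OF U])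
  let ?A = "grad_c \<phi>"
  have AC: "?A \<in> Cc_inf UNIV" by (rule Cc_inf_grad_c[OF U])
  have A: "?A x $ i $ j = pd j (\<lambda>x. \<phi> x $ i) x" for x i j
    by (simp add: grad_c_nth dird_nth[OF sm])
  have int: "integrable lebesgue (\<lambda>x. pd i (\<lambda>x. \<phi> x $ j) x * pd k (\<lambda>x. \<phi> x $ l) x)" for i j k l
    using Cc_inf_integrable[OF Cc_inf_smooth_scaleR_right[OF Cc_inf_dird[OF comp] smooth_dird[OF Cc_inf_smooth[OF comp]]]]
    by simp
  have "integral\<^sup>L lebesgue (\<lambda>x. ?A x \<bullet> transpose (?A x))
      = (\<Sum>i\<in>UNIV. \<Sum>j\<in>UNIV. integral\<^sup>L lebesgue (\<lambda>x. pd j (\<lambda>x. \<phi> x $ i) x * pd i (\<lambda>x. \<phi> x $ j) x))"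
    by (simp add: inner_matrix transpose_def A int)
  also have "\<dots> = (\<Sum>i\<in>UNIV. \<Sum>j\<in>UNIV. integral\<^sup>L lebesgue (\<lambda>x. pd i (\<lambda>x. \<phi> x $ i) x * pd j (\<lambda>x. \<phi> x $ j) x))"
    by (intro sum.cong refl integral_dird_commute comp)
  also have "\<dots> = integral\<^sup>L lebesgue (\<lambda>x. (\<Sum>i\<in>UNIV. pd i (\<lambda>x. \<phi> x $ i) x)\<^sup>2)"
    by (simp add: int power2_eq_square sum_product)
  also have "\<dots> \<ge> 0" by simp
  finally have nn: "0 \<le> integral\<^sup>L lebesgue (\<lambda>x. ?A x \<bullet> transpose (?A x))" .
  have pw: "2 * (norm (sym_part M))\<^sup>2 = (norm M)\<^sup>2 + M \<bullet> transpose M" for M :: "real^3^3"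
    by (simp add: power2_norm_eq_inner inner_matrix sym_part_nth transpose_def sum_3 field_simps)
  have iA: "integrable lebesgue (\<lambda>x. (norm (?A x))\<^sup>2)"
    using Cc_inf_sq[OF AC] by (simp add: sq_integrable_def)
  have iAT: "integrable lebesgue (\<lambda>x. ?A x \<bullet> transpose (?A x))"
    by (simp add: inner_matrix transpose_def A int)
  have "2 * (norm (abs_L2 (symgrad_c \<phi>)))\<^sup>2 = integral\<^sup>L lebesgue (\<lambda>x. 2 * (norm (symgrad_c \<phi> x))\<^sup>2)"
    by (simp add: norm_sq_abs[OF Cc_inf_sq[OF Cc_inf_symgrad_c[OF \<phi>]]])
  also have "\<dots> = integral\<^sup>L lebesgue (\<lambda>x. (norm (?A x))\<^sup>2 + ?A x \<bullet> transpose (?A x))"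
    by (simp only: symgrad_c_def pw)
  also have "\<dots> = (norm (abs_L2 ?A))\<^sup>2 + integral\<^sup>L lebesgue (\<lambda>x. ?A x \<bullet> transpose (?A x))"
    using iA iAT by (simp add: norm_sq_abs[OF Cc_inf_sq[OF AC]])
  finally show ?thesis using nn by simp
qed

lemma poincare_grad:
  assumes \<phi>: "\<phi> \<in> Cc_inf (ball 0 R)" and "R \<ge> 0"
  shows "norm (abs_L2 \<phi>) \<le> 2 * R * norm (abs_L2 (grad_c \<phi>))"
proof -
  have "norm (pd 1 \<phi> x) \<le> norm (grad_c \<phi> x)" for x
  proof -
    have "(norm (pd 1 \<phi> x))\<^sup>2 \<le> (norm (grad_c \<phi> x))\<^sup>2"
      by (simp add: power2_norm_eq_inner inner_matrix grad_c_nth inner_vec_def sum_3)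
    then show ?thesis by (rule power2_le_imp_le) simp
  qed
  then have "(norm (abs_L2 (pd 1 \<phi>)))\<^sup>2 \<le> (norm (abs_L2 (grad_c \<phi>)))\<^sup>2"
    unfolding norm_sq_abs[OF Cc_inf_sq[OF Cc_inf_dird[OF \<phi>]]] norm_sq_abs[OF Cc_inf_sq[OF Cc_inf_grad_c[OF \<phi>]]]
    using Cc_inf_sq[OF Cc_inf_dird[OF \<phi>]] Cc_inf_sq[OF Cc_inf_grad_c[OF \<phi>]]
    by (intro integral_mono power_mono) (auto simp: sq_integrable_def)
  then have "norm (abs_L2 (pd 1 \<phi>)) \<le> norm (abs_L2 (grad_c \<phi>))" by (rule power2_le_imp_le) simp
  moreover have "norm (abs_L2 \<phi>) \<le> 2 * R * norm (abs_L2 (pd 1 \<phi>))" by (rule poincare[OF \<phi>]) simp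
  ultimately show ?thesis using assms(2) by (meson mult_left_mono mult_nonneg_nonneg order_trans zero_le_numeral)
qed

section \<open>The graph of the Jacobian on $H^1_0$\<close>

lemma subspace_closure:
  fixes S :: "'a::real_normed_vector set"
  assumes S: "subspace S" shows "subspace (closure S)"
proof (rule subspaceI)
  show "0 \<in> closure S" using subspace_0[OF S] closure_subset by blast
next
  fix x y assume "x \<in> closure S" "y \<in> closure S"
  then obtain f g where "\<And>n. f n \<in> S" "f \<longlonglongrightarrow> x" "\<And>n. g n \<in> S" "g \<longlonglongrightarrow> y"
    unfolding closure_sequential by blast
  then have "\<And>n. f n + g n \<in> S" "(\<lambda>n. f n + g n) \<longlonglongrightarrow> x + y"
    by (auto intro: subspace_add[OF S] tendsto_add)
  then show "x + y \<in> closure S" unfolding closure_sequential by (intro exI[of _ "\<lambda>n. f n + g n"]) auto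
next
  fix c x assume "x \<in> closure S"
  then obtain f where "\<And>n. f n \<in> S" "f \<longlonglongrightarrow> x"
    unfolding closure_sequential by blast
  then have "\<And>n. c *\<^sub>R f n \<in> S" "(\<lambda>n. c *\<^sub>R f n) \<longlonglongrightarrow> c *\<^sub>R x"
    by (auto intro: subspace_scale[OF S] tendsto_scaleR)
  then show "c *\<^sub>R x \<in> closure S" unfolding closure_sequential by (intro exI[of _ "\<lambda>n. c *\<^sub>R f n"]) auto
qed

section \<open>Multipliers, restriction to a set, symmetric parts\<close>

lemma fibrewise_const:
  fixes L :: "'b::euclidean_space \<Rightarrow> 'c::euclidean_space"
  assumes "bounded_linear L" shows "fibrewise (\<lambda>_::'a::euclidean_space. L)"
  unfolding fibrewise_def
proof (intro conjI ballI)
  show "\<forall>x::'a. linear L" using assms bounded_linear.linear by blast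
  show "\<exists>M. \<forall>(x::'a) y. norm (L y) \<le> M * norm y"
    using bounded_linear.bounded[OF assms] by (metis mult.commute)
  have "continuous_on UNIV L" using assms by (rule linear_continuous_on)
  then have [measurable]: "L \<in> borel_measurable borel" by (rule borel_measurable_continuous_onI)
  show "(\<lambda>x. L (f x)) \<in> borel_measurable lebesgue" if [measurable]: "f \<in> borel_measurable lebesgue" for f :: "'a \<Rightarrow> 'b"
    by measurable
qed

lemma fibrewise_scaleR:
  fixes \<eta> :: "'a::euclidean_space \<Rightarrow> real"
  assumes [measurable]: "\<eta> \<in> borel_measurable lebesgue" and "\<And>x. \<bar>\<eta> x\<bar> \<le> M"
  shows "fibrewise (\<lambda>x (y::'b::euclidean_space). \<eta> x *\<^sub>R y)"
  unfolding fibrewise_def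
proof (intro conjI ballI)
  show "\<forall>x. linear ((*\<^sub>R) (\<eta> x) :: 'b \<Rightarrow> 'b)" by (simp add: bounded_linear.linear bounded_linear_scaleR_right)
  show "\<exists>M. \<forall>x (y::'b). norm (\<eta> x *\<^sub>R y) \<le> M * norm y"
    using assms(2) by (intro exI[of _ M]) (auto intro: mult_right_mono)
  show "(\<lambda>x. \<eta> x *\<^sub>R f x) \<in> borel_measurable lebesgue" if [measurable]: "f \<in> borel_measurable lebesgue" for f :: "'a \<Rightarrow> 'b"
    by measurable
qed

text \<open>The projector of L^2 of the whole space onto the fields that vanish outside
  \<open>S\<close>, that is, restriction followed by extension by zero. Its fixed points are
  \<open>L2_on S\<close>, which gives closedness and the subspace property.\<close>

definition resL2 :: "'a::euclidean_space set \<Rightarrow> ('a, 'b::euclidean_space) L2 \<Rightarrow> ('a, 'b) L2" where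
  "resL2 S = opL2 (\<lambda>x y. indicator S x *\<^sub>R y)"

lemma fibrewise_indicator: "S \<in> sets lebesgue \<Longrightarrow> fibrewise (\<lambda>x (y::'b::euclidean_space). indicator S x *\<^sub>R y)"
  by (rule fibrewise_scaleR[where M=1]) (auto simp: indicator_def)

lemma bounded_linear_resL2: "S \<in> sets lebesgue \<Longrightarrow> bounded_linear (resL2 S)"
  unfolding resL2_def by (rule bounded_linear_opL2[OF fibrewise_indicator])

lemma rep_resL2: "S \<in> sets lebesgue \<Longrightarrow> AE x in lebesgue. rep_L2 (resL2 S u) x = indicator S x *\<^sub>R rep_L2 u x"
  unfolding resL2_def by (rule rep_opL2[OF fibrewise_indicator])

lemma sq_restrict:
  assumes "S \<in> sets lebesgue" "sq_integrable f"
  shows "sq_integrable (\<lambda>x. if x \<in> S then f x else 0)"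
proof -
  have "(\<lambda>x. indicator S x *\<^sub>R f x) = (\<lambda>x. if x \<in> S then f x else 0)" by auto
  then show ?thesis using fibrewise_sq[OF fibrewise_indicator[OF assms(1)] assms(2)] by simp
qed

lemma resL2_abs:
  assumes "S \<in> sets lebesgue" "sq_integrable f" shows "resL2 S (abs_L2 f) = to_L2 S f"
  unfolding resL2_def to_L2_def opL2_abs[OF fibrewise_indicator[OF assms(1)] assms(2)]
  by (rule arg_cong[where f=abs_L2]) (auto simp: indicator_def)

lemma L2_on_iff:
  assumes S: "S \<in> sets lebesgue" shows "u \<in> L2_on S \<longleftrightarrow> resL2 S u = u"
proof
  assume "u \<in> L2_on S"
  then show "resL2 S u = u"
    using rep_resL2[OF S, of u] unfolding L2_on_def
    by (intro L2_eqI) (auto elim!: AE_mp simp: indicator_def)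
next
  assume u: "resL2 S u = u"
  show "u \<in> L2_on S"
    using rep_resL2[OF S, of u] unfolding u L2_on_def by (auto elim!: AE_mp simp: indicator_def)
qed

lemma resL2_in: "S \<in> sets lebesgue \<Longrightarrow> resL2 S u \<in> L2_on S"
  using rep_resL2[of S u] unfolding L2_on_def by (auto elim!: AE_mp simp: indicator_def)

lemma closed_L2_on: "S \<in> sets lebesgue \<Longrightarrow> closed (L2_on S :: ('a::euclidean_space, 'b::euclidean_space) L2 set)"
proof -
  assume S: "S \<in> sets lebesgue"
  have eq: "(L2_on S :: ('a, 'b) L2 set) = {u. resL2 S u = u}" using L2_on_iff[OF S] by blast
  show ?thesis unfolding eq
    by (intro closed_Collect_eq continuous_on_id linear_continuous_on bounded_linear_resL2[OF S])
qed

lemma subspace_L2_on: "S \<in> sets lebesgue \<Longrightarrow> subspace (L2_on S :: ('a::euclidean_space, 'b::euclidean_space) L2 set)"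
proof -
  assume S: "S \<in> sets lebesgue"
  interpret linear "resL2 S :: ('a, 'b) L2 \<Rightarrow> _" by (rule bounded_linear.linear[OF bounded_linear_resL2[OF S]])
  show ?thesis by (auto simp: subspace_def L2_on_iff[OF S] add scale zero)
qed

lemma to_L2_eq: "(\<And>x. x \<notin> \<Omega> \<Longrightarrow> f x = 0) \<Longrightarrow> to_L2 \<Omega> f = abs_L2 f"
  unfolding to_L2_def by (rule arg_cong[where f=abs_L2]) auto

lemma Cc_inf_zero_off: "f \<in> Cc_inf \<Omega> \<Longrightarrow> x \<notin> \<Omega> \<Longrightarrow> f x = 0"
  by (meson Cc_infE subsetD)

lemma to_L2_Cc_inf: "f \<in> Cc_inf \<Omega> \<Longrightarrow> to_L2 \<Omega> f = abs_L2 f"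
  by (rule to_L2_eq) (rule Cc_inf_zero_off)

lemma abs_Cc_L2_on:
  fixes f :: "'a::euclidean_space \<Rightarrow> 'b::euclidean_space"
  shows "f \<in> Cc_inf \<Omega> \<Longrightarrow> abs_L2 f \<in> L2_on \<Omega>"
  using rep_abs[OF Cc_inf_sq] Cc_inf_zero_off unfolding L2_on_def by (force elim!: AE_mp)

definition symL2 :: "ten_L2 \<Rightarrow> ten_L2" where
  "symL2 = opL2 (\<lambda>_. sym_part)"

lemma bounded_linear_symL2: "bounded_linear symL2"
  unfolding symL2_def by (rule bounded_linear_opL2[OF fibrewise_const[OF bounded_linear_sym_part]])

lemma symL2_abs: "sq_integrable f \<Longrightarrow> symL2 (abs_L2 f) = abs_L2 (\<lambda>x. sym_part (f x))"
  unfolding symL2_def by (rule opL2_abs[OF fibrewise_const[OF bounded_linear_sym_part]])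

lemma rep_symL2: "AE x in lebesgue. rep_L2 (symL2 G) x = sym_part (rep_L2 G x)"
  unfolding symL2_def by (rule rep_opL2[OF fibrewise_const[OF bounded_linear_sym_part]])

lemma symL2_grad: "\<phi> \<in> Cc_inf \<Omega> \<Longrightarrow> symL2 (abs_L2 (grad_c \<phi>)) = abs_L2 (symgrad_c \<phi>)"
  by (simp add: symL2_abs Cc_inf_sq[OF Cc_inf_grad_c] symgrad_c_eq)

lemma transpose_sym_part: "transpose (sym_part A) = sym_part A"
  by (simp add: vec_eq_iff transpose_def sym_part_nth add.commute)

lemma symL2_in_sym:
  assumes "\<Omega> \<in> sets lebesgue" "G \<in> L2_on \<Omega>" shows "symL2 G \<in> L2_sym \<Omega>"
proof -
  have "AE x in lebesgue. x \<notin> \<Omega> \<longrightarrow> rep_L2 (symL2 G) x = 0"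
    using rep_symL2[of G] assms(2) linear_0[OF bounded_linear.linear[OF bounded_linear_sym_part]]
    unfolding L2_on_def by (auto elim!: AE_mp)
  moreover have "AE x in lebesgue. transpose (rep_L2 (symL2 G) x) = rep_L2 (symL2 G) x"
    using rep_symL2[of G] by eventually_elim (simp add: transpose_sym_part)
  ultimately show ?thesis by (simp add: L2_sym_def L2_on_def)
qed

lemma symL2_symm:
  assumes "S \<in> L2_sym \<Omega>" shows "symL2 S = S"
proof (rule L2_eqI)
  have "AE x in lebesgue. transpose (rep_L2 S x) = rep_L2 S x" using assms by (simp add: L2_sym_def)
  with rep_symL2[of S] show "AE x in lebesgue. rep_L2 (symL2 S) x = rep_L2 S x"
    by eventually_elim (simp add: sym_part_def flip: scaleR_2)
qed

section \<open>H^1_0 as a set of pairs\<close>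

definition grad_graph :: "(real^3) set \<Rightarrow> (vec_L2 \<times> ten_L2) set" where
  "grad_graph \<Omega> = (\<lambda>\<phi>. (abs_L2 \<phi>, abs_L2 (grad_c \<phi>))) ` Cc_inf \<Omega>"

text \<open>Keeping the Jacobian as a second component turns estimates between a field and its
  derivatives into closed conditions on pairs.\<close>

definition H10_graph :: "(real^3) set \<Rightarrow> (vec_L2 \<times> ten_L2) set" where
  "H10_graph \<Omega> = closure (grad_graph \<Omega>)"

lemma H10_eq: "H10 \<Omega> = Domain (H10_graph \<Omega>)"
  unfolding H10_def H10_graph_def grad_graph_def
  by (intro arg_cong[where f="\<lambda>X. Domain (closure X)"] image_cong refl)
     (simp add: to_L2_Cc_inf Cc_inf_grad_c)

lemma subspace_grad_graph: "subspace (grad_graph \<Omega>)"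
proof (rule subspaceI)
  have "grad_c (\<lambda>x. 0) x = 0" for x by (simp add: vec_eq_iff grad_c_nth dird_def)
  then have "grad_c (\<lambda>x. 0) = (\<lambda>x. 0)" by blast
  then have "(0, 0) = (abs_L2 (\<lambda>x. 0), abs_L2 (grad_c (\<lambda>x. 0)))" by (simp add: abs_zero)
  then show "0 \<in> grad_graph \<Omega>" unfolding grad_graph_def zero_prod_def using Cc_inf_zero by (rule image_eqI)
next
  fix p q assume "p \<in> grad_graph \<Omega>" "q \<in> grad_graph \<Omega>"
  then obtain f g where f: "f \<in> Cc_inf \<Omega>" "p = (abs_L2 f, abs_L2 (grad_c f))"
    and g: "g \<in> Cc_inf \<Omega>" "q = (abs_L2 g, abs_L2 (grad_c g))"
    by (auto simp: grad_graph_def)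
  have "grad_c (\<lambda>x. f x + g x) = (\<lambda>x. grad_c f x + grad_c g x)"
    using grad_c_linear(1)[of f g] f g by (auto simp: Cc_inf_smooth)
  then have "p + q = (abs_L2 (\<lambda>x. f x + g x), abs_L2 (grad_c (\<lambda>x. f x + g x)))"
    by (simp add: f(2) g(2) abs_plus Cc_inf_sq[OF f(1)] Cc_inf_sq[OF g(1)] Cc_inf_sq[OF Cc_inf_grad_c[OF f(1)]] Cc_inf_sq[OF Cc_inf_grad_c[OF g(1)]])
  then show "p + q \<in> grad_graph \<Omega>" unfolding grad_graph_def using Cc_inf_add[OF f(1) g(1)] by (rule image_eqI)
next
  fix c p assume "p \<in> grad_graph \<Omega>"
  then obtain f where f: "f \<in> Cc_inf \<Omega>" "p = (abs_L2 f, abs_L2 (grad_c f))"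
    by (auto simp: grad_graph_def)
  have "grad_c (\<lambda>x. c *\<^sub>R f x) = (\<lambda>x. c *\<^sub>R grad_c f x)"
    using grad_c_linear(2)[of f f] f by (auto simp: Cc_inf_smooth)
  then have "c *\<^sub>R p = (abs_L2 (\<lambda>x. c *\<^sub>R f x), abs_L2 (grad_c (\<lambda>x. c *\<^sub>R f x)))"
    by (simp add: f(2) abs_scale Cc_inf_sq[OF f(1)] Cc_inf_sq[OF Cc_inf_grad_c[OF f(1)]])
  then show "c *\<^sub>R p \<in> grad_graph \<Omega>" unfolding grad_graph_def using Cc_inf_scaleR[OF f(1)] by (rule image_eqI)
qed

lemma subspace_H10_graph: "subspace (H10_graph \<Omega>)"
  unfolding H10_graph_def by (rule subspace_closure[OF subspace_grad_graph])

lemma closed_H10_graph: "closed (H10_graph \<Omega>)"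
  by (simp add: H10_graph_def)

lemma H10_graph_test: "\<phi> \<in> Cc_inf \<Omega> \<Longrightarrow> (abs_L2 \<phi>, abs_L2 (grad_c \<phi>)) \<in> H10_graph \<Omega>"
  unfolding H10_graph_def grad_graph_def by (rule subsetD[OF closure_subset]) (rule imageI)

lemma H10_graph_subset:
  assumes "closed C" "\<And>\<phi>. \<phi> \<in> Cc_inf \<Omega> \<Longrightarrow> (abs_L2 \<phi>, abs_L2 (grad_c \<phi>)) \<in> C"
  shows "H10_graph \<Omega> \<subseteq> C"
  unfolding H10_graph_def
proof (rule closure_minimal)
  show "grad_graph \<Omega> \<subseteq> C"
    unfolding grad_graph_def by (rule image_subsetI) (rule assms(2))
qed (rule assms(1))

text \<open>Closure induction: Korn, Poincare, Leibniz rules, translations and weak derivatives all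
  pass from test fields to H^1_0 in this form.\<close>

lemma H10_graph_induct:
  assumes p: "p \<in> H10_graph \<Omega>" and C: "closed {p. P p}"
    and "\<And>\<phi>. \<phi> \<in> Cc_inf \<Omega> \<Longrightarrow> P (abs_L2 \<phi>, abs_L2 (grad_c \<phi>))"
  shows "P p"
proof -
  have "H10_graph \<Omega> \<subseteq> {p. P p}"
    by (rule H10_graph_subset[OF C], rule CollectI, rule assms(3))
  then show ?thesis by (rule CollectD[OF subsetD[OF _ p]])
qed

lemma H10_graph_mono: "\<Omega> \<subseteq> \<Omega>' \<Longrightarrow> H10_graph \<Omega> \<subseteq> H10_graph \<Omega>'"
  unfolding H10_graph_def grad_graph_def by (intro closure_mono image_mono) (auto intro: Cc_inf_mono)

lemmas symL2_continuous_on [continuous_intros] = bounded_linear.continuous_on[OF bounded_linear_symL2]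

lemma H10_graph_korn: "(u, G) \<in> H10_graph \<Omega> \<Longrightarrow> (norm G)\<^sup>2 \<le> 2 * (norm (symL2 G))\<^sup>2"
proof -
  assume *: "(u, G) \<in> H10_graph \<Omega>"
  have "(norm (snd p))\<^sup>2 \<le> 2 * (norm (symL2 (snd p)))\<^sup>2" if "p \<in> H10_graph \<Omega>" for p
    using that
  proof (rule H10_graph_induct)
    show "closed {p::vec_L2 \<times> ten_L2. (norm (snd p))\<^sup>2 \<le> 2 * (norm (symL2 (snd p)))\<^sup>2}"
      by (intro closed_Collect_le continuous_intros)
  qed (simp add: symL2_grad korn)
  from this[OF *] show ?thesis by simp
qed

lemma H10_graph_poincare: "(u, G) \<in> H10_graph (ball 0 R) \<Longrightarrow> R \<ge> 0 \<Longrightarrow> norm u \<le> 2 * R * norm G"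
proof -
  assume *: "(u, G) \<in> H10_graph (ball 0 R)" and R: "R \<ge> 0"
  have "norm (fst p) \<le> 2 * R * norm (snd p)" if "p \<in> H10_graph (ball 0 R)" for p
    using that
  proof (rule H10_graph_induct)
    show "closed {p::vec_L2 \<times> ten_L2. norm (fst p) \<le> 2 * R * norm (snd p)}"
      by (intro closed_Collect_le continuous_intros)
  qed (simp add: poincare_grad R)
  from this[OF *] show ?thesis by simp
qed

lemma H10_graph_L2_on:
  assumes "\<Omega> \<in> sets lebesgue" "(u, G) \<in> H10_graph \<Omega>" shows "u \<in> L2_on \<Omega>" "G \<in> L2_on \<Omega>"
proof -
  have "fst p \<in> L2_on \<Omega> \<and> snd p \<in> L2_on \<Omega>" if "p \<in> H10_graph \<Omega>" for p
    using that
  proof (rule H10_graph_induct)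
    have "{p. fst p \<in> L2_on \<Omega> \<and> snd p \<in> L2_on \<Omega>} = (L2_on \<Omega> \<times> L2_on \<Omega> :: (vec_L2 \<times> ten_L2) set)" by auto
    then show "closed {p::vec_L2 \<times> ten_L2. fst p \<in> L2_on \<Omega> \<and> snd p \<in> L2_on \<Omega>}"
      by (simp add: closed_Times closed_L2_on assms(1))
  qed (simp add: abs_Cc_L2_on Cc_inf_grad_c)
  from this[OF assms(2)] show "u \<in> L2_on \<Omega>" "G \<in> L2_on \<Omega>" by auto
qed

text \<open>With zero boundary values no rigid motion survives: Korn's inequality kills the Jacobian
  and Poincare's inequality the field. Uniqueness of \<psi> and linear independence of the basis
  both rest on this.\<close>

lemma H10_graph_zero:
  assumes "\<Omega> \<subseteq> ball 0 R" "R \<ge> 0" "(u, G) \<in> H10_graph \<Omega>" "symL2 G = 0" shows "u = 0" "G = 0"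
proof -
  show "G = 0" using H10_graph_korn[OF assms(3)] assms(4) by simp
  then show "u = 0" using H10_graph_poincare[of u G R] H10_graph_mono[OF assms(1)] assms(2,3) by auto
qed

text \<open>Convergence of symmetric gradients alone forces convergence of fields and Jacobians.
  This is the closedness of the range of the minimal symGrad, and it also lets mollified potentials
  converge.\<close>

lemma H10_graph_complete:
  assumes \<Omega>: "\<Omega> \<subseteq> ball 0 R" "R \<ge> 0" and \<phi>: "\<And>n. \<phi> n \<in> Cc_inf \<Omega>"
    and C: "Cauchy (\<lambda>n. abs_L2 (symgrad_c (\<phi> n)))"
  obtains u G where "(u, G) \<in> H10_graph \<Omega>" "(\<lambda>n. abs_L2 (\<phi> n)) \<longlonglongrightarrow> u" "(\<lambda>n. abs_L2 (grad_c (\<phi> n))) \<longlonglongrightarrow> G"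
    "(\<lambda>n. abs_L2 (symgrad_c (\<phi> n))) \<longlonglongrightarrow> symL2 G"
proof -
  define u' G' where "u' n = abs_L2 (\<phi> n)" and "G' n = abs_L2 (grad_c (\<phi> n))" for n
  have W: "(u' n, G' n) \<in> H10_graph \<Omega>" for n
    unfolding u'_def G'_def by (rule H10_graph_test[OF \<phi>])
  have d: "(u' m - u' n, G' m - G' n) \<in> H10_graph \<Omega>" for m n
    using subspace_diff[OF subspace_H10_graph W[of m] W[of n]] by simp
  have S: "symL2 (G' n) = abs_L2 (symgrad_c (\<phi> n))" for n
    unfolding G'_def by (rule symL2_grad[OF \<phi>])
  have k: "norm (G' m - G' n) \<le> 2 * norm (abs_L2 (symgrad_c (\<phi> m)) - abs_L2 (symgrad_c (\<phi> n)))" for m n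
  proof (rule power2_le_imp_le)
    have "(norm (G' m - G' n))\<^sup>2 \<le> 2 * (norm (symL2 (G' m - G' n)))\<^sup>2" by (rule H10_graph_korn[OF d])
    also have "\<dots> \<le> 4 * (norm (symL2 (G' m - G' n)))\<^sup>2" by simp
    also have "symL2 (G' m - G' n) = abs_L2 (symgrad_c (\<phi> m)) - abs_L2 (symgrad_c (\<phi> n))"
      using linear_diff[OF bounded_linear.linear[OF bounded_linear_symL2]] by (simp add: S)
    finally show "(norm (G' m - G' n))\<^sup>2 \<le> (2 * norm (abs_L2 (symgrad_c (\<phi> m)) - abs_L2 (symgrad_c (\<phi> n))))\<^sup>2"
      by (simp add: power_mult_distrib)
  qed simp
  have CG: "Cauchy G'"
  proof (rule CauchyI)
    fix e :: real assume "0 < e"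
    then obtain M where "\<And>m n. m \<ge> M \<Longrightarrow> n \<ge> M \<Longrightarrow> norm (abs_L2 (symgrad_c (\<phi> m)) - abs_L2 (symgrad_c (\<phi> n))) < e/2"
      using CauchyD[OF C, of "e/2"] by auto
    then show "\<exists>M. \<forall>m\<ge>M. \<forall>n\<ge>M. norm (G' m - G' n) < e"
      using k by (intro exI[of _ M]) (smt (verit, best) field_sum_of_halves)
  qed
  have p: "norm (u' m - u' n) \<le> 2 * R * norm (G' m - G' n)" for m n
    using H10_graph_poincare[of _ _ R] d H10_graph_mono[OF \<Omega>(1)] \<Omega>(2) by blast
  have Cu: "Cauchy u'"
  proof (rule CauchyI)
    fix e :: real assume e: "0 < e"
    \<comment> \<open>The summand 1 makes the division legitimate when R = 0.\<close>
    then have "e / (2 * R + 1) > 0" using \<Omega>(2) by (simp add: add_nonneg_pos)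
    then obtain M where M: "\<And>m n. m \<ge> M \<Longrightarrow> n \<ge> M \<Longrightarrow> norm (G' m - G' n) < e / (2 * R + 1)"
      using CauchyD[OF CG, of "e / (2 * R + 1)"] by auto
    have "norm (u' m - u' n) < e" if "m \<ge> M" "n \<ge> M" for m n
    proof -
      have "2 * R * norm (G' m - G' n) \<le> (2 * R + 1) * norm (G' m - G' n)" by (simp add: mult_right_mono)
      also have "\<dots> < (2 * R + 1) * (e / (2 * R + 1))"
        using M[OF that] \<Omega>(2) by (intro mult_strict_left_mono) auto
      also have "\<dots> = e" using \<Omega>(2) by simp
      finally show ?thesis using p[of m n] by linarith
    qed
    then show "\<exists>M. \<forall>m\<ge>M. \<forall>n\<ge>M. norm (u' m - u' n) < e" by blast
  qed
  obtain u G where lim: "u' \<longlonglongrightarrow> u" "G' \<longlonglongrightarrow> G"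
    using CG Cu by (meson Cauchy_convergent convergent_def)
  have "(\<lambda>n. (u' n, G' n)) \<longlonglongrightarrow> (u, G)" by (intro tendsto_Pair lim)
  then have "(u, G) \<in> H10_graph \<Omega>"
    by (rule closed_sequentially[OF closed_H10_graph W])
  moreover have "(\<lambda>n. symL2 (G' n)) \<longlonglongrightarrow> symL2 G"
    by (rule bounded_linear.tendsto[OF bounded_linear_symL2 lim(2)])
  ultimately show thesis using that lim unfolding S unfolding u'_def G'_def by blast
qed

section \<open>Weak gradients\<close>

lemma sq_indicator:
  assumes "S \<in> lmeasurable" shows "sq_integrable (\<lambda>x. indicator S x :: real)"
proof -
  have "(\<lambda>x. (norm (indicator S x :: real))\<^sup>2) = indicator S" by (auto simp: indicator_def)
  moreover have "integrable lebesgue (indicator S :: _ \<Rightarrow> real)"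
    by (rule integrable_real_indicator) (use assms in \<open>auto simp: fmeasurable_def\<close>)
  ultimately show ?thesis by (simp add: sq_integrable_def borel_measurable_integrable)
qed

text \<open>The fundamental lemma of the calculus of variations. Smooth cut-offs decreasing to a
  compact set show that every component has integral zero over it, and the set where a component is
  positive is a countable union of compact sets up to a null set.\<close>

lemma L2_test_zero:
  fixes G :: "('a::euclidean_space, 'b::euclidean_space) L2"
  assumes \<Omega>: "open \<Omega>" and G: "G \<in> L2_on \<Omega>" and zero: "\<And>\<Phi>. \<Phi> \<in> Cc_inf \<Omega> \<Longrightarrow> G \<bullet> abs_L2 \<Phi> = 0"
  shows "G = 0"
proof -
  define f where "f c = (\<lambda>x. rep_L2 G x \<bullet> c)" for c
  have [measurable]: "f c \<in> borel_measurable lebesgue" for c by (simp add: f_def)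
  have int_K: "integral\<^sup>L lebesgue (\<lambda>x. indicator K x * f c x) = 0"
    if K: "compact K" "K \<subseteq> \<Omega>" for K c
  proof -
    \<comment> \<open>Neighbourhoods shrinking to the compact set \<open>K\<close>, so that cut-offs
      supported in them converge pointwise to its indicator; all lie in the bounded set
      \<open>U 0\<close>, which supplies the dominating function.\<close>
    define U where "U n = \<Omega> \<inter> (\<Union>x\<in>K. ball x (1 / Suc n))" for n
    have "open (U n)" "K \<subseteq> U n" for n using \<Omega> K by (auto simp: U_def)
    then have "\<forall>n. \<exists>\<theta> :: 'a \<Rightarrow> real. \<theta> \<in> Cc_inf (U n) \<and> (\<forall>x. 0 \<le> \<theta> x \<and> \<theta> x \<le> 1) \<and> (\<forall>x\<in>K. \<theta> x = 1)"
      using smooth_urysohn[OF K(1)] by (metis subsetD)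
    then obtain \<theta> :: "nat \<Rightarrow> 'a \<Rightarrow> real" where \<theta>: "\<And>n. \<theta> n \<in> Cc_inf (U n)" "\<And>n x. 0 \<le> \<theta> n x \<and> \<theta> n x \<le> 1"
      "\<And>n x. x \<in> K \<Longrightarrow> \<theta> n x = 1" by metis
    have "integral\<^sup>L lebesgue (\<lambda>x. \<theta> n x * f c x) = 0" for n
    proof -
      have t: "(\<lambda>x. \<theta> n x *\<^sub>R c) \<in> Cc_inf \<Omega>"
        by (rule Cc_inf_smooth_scaleR_right[OF Cc_inf_mono[OF _ \<theta>(1)]]) (auto simp: U_def)
      have "G \<bullet> abs_L2 (\<lambda>x. \<theta> n x *\<^sub>R c) = integral\<^sup>L lebesgue (\<lambda>x. \<theta> n x * f c x)"
        using inner_abs[OF sq_rep Cc_inf_sq[OF t], of G] by (simp add: abs_rep f_def)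
      with zero[OF t] show ?thesis by simp
    qed
    moreover have "(\<lambda>n. integral\<^sup>L lebesgue (\<lambda>x. \<theta> n x * f c x)) \<longlonglongrightarrow> integral\<^sup>L lebesgue (\<lambda>x. indicator K x * f c x)"
    proof (rule integral_dominated_convergence)
      have U0: "U 0 \<in> lmeasurable"
      proof (rule bounded_set_imp_lmeasurable)
        obtain R where R: "K \<subseteq> ball 0 R" using bounded_subset_ballD[OF compact_imp_bounded[OF K(1)], of 0] by blast
        have "U 0 \<subseteq> ball 0 (R + 1)"
        proof
          fix y assume "y \<in> U 0"
          then obtain x where "x \<in> K" "dist x y < 1" by (auto simp: U_def)
          then show "y \<in> ball 0 (R + 1)" using R dist_triangle[of 0 y x] by fastforce
        qed
        then show "bounded (U 0)" using bounded_ball bounded_subset by blast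
        show "U 0 \<in> sets lebesgue" using \<open>open (U 0)\<close> by auto
      qed
      have "sq_integrable (\<lambda>x. indicator (U 0) x :: real)"
        by (rule sq_indicator[OF U0])
      moreover have "sq_integrable (\<lambda>x. norm (f c x))"
        by (rule sq_integrable_bound[OF _ sq_rep[of G], of _ "norm c"])
           (auto simp: f_def mult.commute intro: Cauchy_Schwarz_ineq2 order_trans[OF Cauchy_Schwarz_ineq2])
      ultimately show "integrable lebesgue (\<lambda>x. indicator (U 0) x * norm (f c x))"
        using integrable_inner_sq by fastforce
      have [measurable]: "\<theta> n \<in> borel_measurable lebesgue" for n by (rule smooth_measurable[OF Cc_inf_smooth[OF \<theta>(1)]])
      have [measurable]: "K \<in> sets lebesgue" using lmeasurable_compact[OF K(1)] by blast
      show "(\<lambda>x. indicator K x * f c x) \<in> borel_measurable lebesgue" by measurable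
      show "(\<lambda>x. \<theta> n x * f c x) \<in> borel_measurable lebesgue" for n by measurable
      show "AE x in lebesgue. norm (\<theta> n x * f c x) \<le> indicator (U 0) x * norm (f c x)" for n
      proof (rule AE_I2)
        fix x
        have "U n \<subseteq> U 0" unfolding U_def by (intro Int_mono order_refl UN_mono subset_ball) (auto simp: divide_simps)
        then have "x \<notin> U 0 \<Longrightarrow> \<theta> n x = 0" using Cc_inf_zero_off[OF \<theta>(1)] by blast
        then show "norm (\<theta> n x * f c x) \<le> indicator (U 0) x * norm (f c x)"
          using \<theta>(2)[of n x] by (auto simp: indicator_def abs_mult intro: mult_left_le_one_le)
      qed
      show "AE x in lebesgue. (\<lambda>n. \<theta> n x * f c x) \<longlonglongrightarrow> indicator K x * f c x"
      proof (rule AE_I2)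
        fix x
        have "(\<lambda>n. \<theta> n x) \<longlonglongrightarrow> indicator K x"
        proof (cases "x \<in> K")
          case False
          then obtain e where e: "e > 0" "ball x e \<subseteq> - K"
            using K(1) compact_imp_closed open_contains_ball[of "- K"] by blast
          obtain N where N: "1 / real (Suc N) < e" using e nat_approx_posE by blast
          have "\<theta> n x = 0" if "n \<ge> N" for n
          proof -
            have "1 / real (Suc n) \<le> 1 / real (Suc N)" using that by (simp add: divide_simps)
            then have "x \<notin> U n" using e N by (force simp: U_def dist_commute)
            then show ?thesis using Cc_inf_zero_off[OF \<theta>(1)] by blast
          qed
          then have "\<forall>\<^sub>F n in sequentially. \<theta> n x = indicator K x"
            using False by (auto simp: eventually_sequentially)
          then show ?thesis by (rule tendsto_eventually)
        qed (simp add: \<theta>(3))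
        then show "(\<lambda>n. \<theta> n x * f c x) \<longlonglongrightarrow> indicator K x * f c x" by (intro tendsto_intros)
      qed
    qed
    ultimately show ?thesis by (simp add: LIMSEQ_const_iff)
  qed
  have pos: "AE x in lebesgue. x \<in> \<Omega> \<longrightarrow> f c x \<le> 0" for c
  proof -
    define A where "A = {x\<in>\<Omega>. f c x > 0}"
    have \<Omega>m: "\<Omega> \<in> sets lebesgue" using \<Omega> by auto
    have "A = \<Omega> \<inter> {x\<in>space lebesgue. f c x > 0}" by (auto simp: A_def)
    also have "\<dots> \<in> sets lebesgue" using \<Omega>m by (intro sets.Int borel_measurable_less) simp_all
    finally have "A \<in> sets lebesgue" .
    \<comment> \<open>Inner regularity: on each compact piece of \<open>A\<close> a positive
      function has integral zero, which makes the piece null, and countably many pieces exhaust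
      \<open>A\<close> up to a null set.\<close>
    then obtain C T where CT: "fsigma C" "T \<in> null_sets lebesgue" "C \<union> T = A"
      by (metis lebesgue_set_almost_fsigma)
    obtain F :: "nat \<Rightarrow> 'a set" where F: "range F \<subseteq> Collect compact" "C = \<Union>(range F)"
      using fsigma_Union_compact CT(1) by metis
    have "F n \<in> null_sets lebesgue" for n
    proof -
      have K: "compact (F n)" "F n \<subseteq> A" using F CT by auto
      have [measurable]: "F n \<in> sets lebesgue" using lmeasurable_compact[OF K(1)] by blast
      have int: "integrable lebesgue (\<lambda>x. indicator (F n) x * f c x)"
      proof -
        have "sq_integrable (\<lambda>x. indicator (F n) x :: real)"
          by (rule sq_indicator[OF lmeasurable_compact[OF K(1)]])
        moreover have "sq_integrable (f c)"
          by (rule sq_integrable_bound[OF _ sq_rep[of G], of _ "norm c"])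
             (auto simp: f_def mult.commute intro: Cauchy_Schwarz_ineq2 order_trans[OF Cauchy_Schwarz_ineq2])
        ultimately show ?thesis using integrable_inner_sq by fastforce
      qed
      have "integral\<^sup>L lebesgue (\<lambda>x. indicator (F n) x * f c x) = 0"
        by (rule int_K) (use K in \<open>auto simp: A_def\<close>)
      then have "AE x in lebesgue. indicator (F n) x * f c x = 0"
        by (subst (asm) integral_nonneg_eq_0_iff_AE[OF int])
           (rule AE_I2, use K in \<open>auto simp: A_def indicator_def intro: less_imp_le\<close>)
      then have "AE x in lebesgue. x \<notin> F n"
        by (rule AE_mp, intro AE_I2) (use K(2) in \<open>auto simp: A_def indicator_def split: if_splits\<close>)
      then show ?thesis by (simp add: AE_iff_null_sets)
    qed
    then have "A \<in> null_sets lebesgue" using CT(2,3) F(2) by auto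
    then have "AE x in lebesgue. x \<notin> A" by (rule AE_not_in)
    then show ?thesis by eventually_elim (auto simp: A_def)
  qed
  \<comment> \<open>The one-sided bound, applied to \<open>c\<close> and \<open>- c\<close>, is an
    equality.\<close>
  have z: "AE x in lebesgue. x \<in> \<Omega> \<longrightarrow> f c x = 0" for c
    using pos[of c] pos[of "- c"] by eventually_elim (auto simp: f_def)
  have "AE x in lebesgue. \<forall>c\<in>Basis. x \<in> \<Omega> \<longrightarrow> f c x = 0"
    by (rule AE_finite_allI) (auto intro: z)
  moreover have "AE x in lebesgue. x \<notin> \<Omega> \<longrightarrow> rep_L2 G x = 0" using G by (simp add: L2_on_def)
  moreover note rep_zero
  ultimately have "AE x in lebesgue. rep_L2 G x = rep_L2 0 x"
    by eventually_elim (auto simp: f_def intro: euclidean_eqI)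
  then show ?thesis by (rule L2_eqI)
qed

lemma open_sets_lebesgue: "open \<Omega> \<Longrightarrow> \<Omega> \<in> sets lebesgue" for \<Omega> :: "'a::euclidean_space set"
  by auto

text \<open>The projection theorem: the parallelogram identity makes a minimising sequence Cauchy,
  and minimality forces the residual to be orthogonal to the subspace.\<close>

lemma orth_decomposition:
  fixes M :: "'a::{real_inner, complete_space} set"
  assumes M: "subspace M" "closed M"
  obtains y where "y \<in> M" "\<And>z. z \<in> M \<Longrightarrow> (x - y) \<bullet> z = 0"
proof -
  define d where "d = (INF y\<in>M. (norm (x - y))\<^sup>2)"
  have ne: "M \<noteq> {}" using subspace_0[OF M(1)] by blast
  have bdd: "bdd_below ((\<lambda>y. (norm (x - y))\<^sup>2) ` M)" by (rule bdd_belowI[of _ 0]) auto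
  have low: "d \<le> (norm (x - y))\<^sup>2" if "y \<in> M" for y
    unfolding d_def by (rule cINF_lower[OF bdd that])
  have "\<exists>y\<in>M. (norm (x - y))\<^sup>2 < d + 1 / real (Suc n)" for n
  proof -
    have "(INF y\<in>M. (norm (x - y))\<^sup>2) < d + 1 / real (Suc n)" by (simp add: d_def)
    then show ?thesis using cINF_less_iff[OF ne bdd] by blast
  qed
  then obtain y where y: "\<And>n. y n \<in> M" "\<And>n. (norm (x - y n))\<^sup>2 < d + 1 / real (Suc n)" by metis
  have par: "(norm (y m - y n))\<^sup>2 \<le> 4 / real (Suc N)" if "m \<ge> N" "n \<ge> N" for m n N
  proof -
    have "(1/2) *\<^sub>R (y m + y n) \<in> M" by (intro subspace_scale subspace_add M y)
    from low[OF this] have 1: "4 * d \<le> 4 * (norm (x - (1/2) *\<^sub>R (y m + y n)))\<^sup>2" by simp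
    have 2: "(norm (y m - y n))\<^sup>2 + 4 * (norm (x - (1/2) *\<^sub>R (y m + y n)))\<^sup>2 = 2 * (norm (x - y m))\<^sup>2 + 2 * (norm (x - y n))\<^sup>2"
      unfolding power2_norm_eq_inner
      by (simp add: inner_add_left inner_add_right inner_diff_left inner_diff_right algebra_simps inner_commute)
    have "1 / real (Suc m) \<le> 1 / real (Suc N)" "1 / real (Suc n) \<le> 1 / real (Suc N)"
      using that by (auto simp: divide_simps)
    then show ?thesis using 1 2 y(2)[of m] y(2)[of n] by linarith
  qed
  have "Cauchy y"
  proof (rule CauchyI)
    fix e :: real assume "0 < e"
    then obtain N where N: "4 / e\<^sup>2 < real (Suc N)" by (metis less_SucI of_nat_less_iff order_less_trans reals_Archimedean2 lessI)
    then have "4 / real (Suc N) < e\<^sup>2" using \<open>0 < e\<close> by (simp add: divide_simps mult.commute)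
    then have "norm (y m - y n) < e" if "m \<ge> N" "n \<ge> N" for m n
      using par[OF that] \<open>0 < e\<close> power_less_imp_less_base[of "norm (y m - y n)" 2 e] by linarith
    then show "\<exists>N. \<forall>m\<ge>N. \<forall>n\<ge>N. norm (y m - y n) < e" by blast
  qed
  then obtain l where l: "y \<longlonglongrightarrow> l" by (meson Cauchy_convergent convergent_def)
  have lM: "l \<in> M" by (rule closed_sequentially[OF M(2) y(1) l])
  have "(\<lambda>n. (norm (x - y n))\<^sup>2) \<longlonglongrightarrow> (norm (x - l))\<^sup>2" by (intro tendsto_intros l)
  moreover have "(\<lambda>n. d + 1 / real (Suc n)) \<longlonglongrightarrow> d + 0" by (intro tendsto_intros LIMSEQ_Suc[OF lim_1_over_n])
  ultimately have min: "(norm (x - l))\<^sup>2 \<le> d"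
    using y(2) by (intro tendsto_le[OF trivial_limit_sequentially, of "\<lambda>n. d + 1 / real (Suc n)" d]) (auto intro!: always_eventually less_imp_le)
  have "(x - l) \<bullet> z = 0" if z: "z \<in> M" for z
  proof (cases "z = 0")
    case False
    \<comment> \<open>The minimiser of the quadratic t \<mapsto> |x - l - t z|^2, for which the gain
      over t = 0 is the squared inner product divided by |z|^2.\<close>
    define t where "t = ((x - l) \<bullet> z) / (z \<bullet> z)"
    have "l + t *\<^sub>R z \<in> M" by (intro subspace_add subspace_scale M lM z)
    from low[OF this] have "d \<le> (norm (x - l - t *\<^sub>R z))\<^sup>2" by (simp add: diff_diff_add)
    with min have "(norm (x - l))\<^sup>2 \<le> (norm (x - l - t *\<^sub>R z))\<^sup>2" by linarith
    also have "\<dots> = (norm (x - l))\<^sup>2 - 2 * t * ((x - l) \<bullet> z) + t * t * (z \<bullet> z)"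
      unfolding power2_norm_eq_inner by (simp add: inner_diff_left inner_diff_right inner_commute algebra_simps)
    also have "t * t * (z \<bullet> z) = t * ((x - l) \<bullet> z)" using False by (simp add: t_def)
    finally have "t * ((x - l) \<bullet> z) \<le> 0" by simp
    then have "((x - l) \<bullet> z)\<^sup>2 / (z \<bullet> z) \<le> 0" by (simp add: t_def power2_eq_square)
    moreover have "z \<bullet> z > 0" using False by simp
    ultimately have "((x - l) \<bullet> z)\<^sup>2 \<le> 0" by (metis divide_nonneg_pos not_le order_antisym_conv zero_le_power2 zero_less_divide_iff)
    then show ?thesis by simp
  qed auto
  then show thesis using that lM by blast
qed

lemma Div_c_nth: "smooth \<Phi> \<Longrightarrow> Div_c \<Phi> x $ i = (\<Sum>j\<in>UNIV. pd j \<Phi> x $ i $ j)"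
  by (simp add: Div_c_def trace_def grad_c_nth dird_nth)

lemma Cc_inf_vecI:
  fixes f :: "'a::euclidean_space \<Rightarrow> ('b::euclidean_space) ^ 'n"
  assumes "\<And>i. (\<lambda>x. f x $ i) \<in> Cc_inf \<Omega>" shows "f \<in> Cc_inf \<Omega>"
proof -
  have "f = (\<lambda>x. \<Sum>i\<in>UNIV. axis i (f x $ i))"
    by (simp add: fun_eq_iff vec_eq_iff axis_def if_distrib cong: if_cong)
  moreover have "(\<lambda>x. \<Sum>i\<in>UNIV. axis i (f x $ i)) \<in> Cc_inf \<Omega>"
    by (intro Cc_inf_sum Cc_inf_linear[OF _ bounded_linear_axis] assms)
  ultimately show ?thesis by simp
qed

lemma Cc_inf_Div_c:
  assumes "\<Phi> \<in> Cc_inf \<Omega>" shows "Div_c \<Phi> \<in> Cc_inf \<Omega>"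
  by (rule Cc_inf_vecI) (simp add: Div_c_nth[OF Cc_inf_smooth[OF assms]] Cc_inf_sum Cc_inf_nth Cc_inf_dird assms)

lemma grad_Div_parts:
  assumes \<phi>: "\<phi> \<in> Cc_inf UNIV" and \<Phi>: "\<Phi> \<in> Cc_inf UNIV"
  shows "abs_L2 (grad_c \<phi>) \<bullet> abs_L2 \<Phi> = - (abs_L2 \<phi> \<bullet> abs_L2 (Div_c \<Phi>))"
proof -
  have s: "smooth \<phi>" "smooth \<Phi>" using \<phi> \<Phi> by (auto simp: Cc_inf_smooth)
  have c: "(\<lambda>x. \<phi> x $ i) \<in> Cc_inf UNIV" for i by (rule Cc_inf_nth[OF \<phi>])
  have C: "(\<lambda>x. \<Phi> x $ i $ j) \<in> Cc_inf UNIV" for i j by (intro Cc_inf_nth \<Phi>)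
  have dC: "pd k (\<lambda>x. \<Phi> x $ i $ j) x = pd k \<Phi> x $ i $ j" for i j k x
    by (simp add: dird_nth[OF smooth_nth[OF s(2)]] dird_nth[OF s(2)])
  have int1: "integrable lebesgue (\<lambda>x. pd j \<phi> x $ i * \<Phi> x $ i $ j)" for i j
    using Cc_inf_integrable[OF Cc_inf_smooth_scaleR_right[OF Cc_inf_dird[OF c] Cc_inf_smooth[OF C]]] by (simp add: dird_nth[OF s(1)])
  have int2: "integrable lebesgue (\<lambda>x. \<phi> x $ i * pd j \<Phi> x $ i $ j)" for i j
    using Cc_inf_integrable[OF Cc_inf_smooth_scaleR_right[OF c[of i]
          Cc_inf_smooth[OF Cc_inf_dird[OF C[of i j], of "axis j 1"]]]] by (simp add: dC)
  have "abs_L2 (grad_c \<phi>) \<bullet> abs_L2 \<Phi> = (\<Sum>i\<in>UNIV. \<Sum>j\<in>UNIV. integral\<^sup>L lebesgue (\<lambda>x. pd j \<phi> x $ i * \<Phi> x $ i $ j))"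
    by (simp add: inner_abs Cc_inf_sq[OF Cc_inf_grad_c[OF \<phi>]] Cc_inf_sq[OF \<Phi>] inner_matrix grad_c_nth int1)
  also have "\<dots> = (\<Sum>i\<in>UNIV. \<Sum>j\<in>UNIV. - integral\<^sup>L lebesgue (\<lambda>x. \<phi> x $ i * pd j \<Phi> x $ i $ j))"
    using integral_by_parts[OF c Cc_inf_smooth[OF C]] by (simp add: dC dird_nth[OF s(1)])
  also have "\<dots> = - (abs_L2 \<phi> \<bullet> abs_L2 (Div_c \<Phi>))"
    by (simp add: inner_abs Cc_inf_sq[OF Cc_inf_Div_c[OF \<Phi>]] Cc_inf_sq[OF \<phi>] inner_vec_def Div_c_nth[OF s(2)]
        sum_distrib_left int2 sum_negf)
  finally show ?thesis .
qed

lemma resL2_inner: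
  assumes S: "S \<in> sets lebesgue" shows "resL2 S u \<bullet> v = u \<bullet> resL2 S v"
  unfolding inner_rep
proof (rule integral_cong_AE)
  show "AE x in lebesgue. rep_L2 (resL2 S u) x \<bullet> rep_L2 v x = rep_L2 u x \<bullet> rep_L2 (resL2 S v) x"
    using rep_resL2[OF S, of u] rep_resL2[OF S, of v] by eventually_elim simp
qed auto

text \<open>Links the graph closure with the weak definition: integration by parts against a fixed
  test tensor is a closed condition on pairs, and a test tensor living in \<Omega> does not see the
  restriction.\<close>

lemma weak_Grad_restrict:
  assumes \<Omega>: "open \<Omega>" and p: "(u, G) \<in> H10_graph UNIV"
  shows "(resL2 \<Omega> u, resL2 \<Omega> G) \<in> weak_Grad \<Omega>"
proof -
  have \<Omega>m: "\<Omega> \<in> sets lebesgue" by (rule open_sets_lebesgue[OF \<Omega>])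
  have "resL2 \<Omega> G \<bullet> to_L2 \<Omega> \<Phi> = - (resL2 \<Omega> u \<bullet> to_L2 \<Omega> (Div_c \<Phi>))" if \<Phi>: "\<Phi> \<in> Cc_inf \<Omega>" for \<Phi>
  proof -
    have U: "\<Phi> \<in> Cc_inf UNIV" using Cc_inf_mono[OF _ \<Phi>] by blast
    have "snd q \<bullet> abs_L2 \<Phi> = - (fst q \<bullet> abs_L2 (Div_c \<Phi>))" if "q \<in> H10_graph UNIV" for q
      using that
    proof (rule H10_graph_induct)
      show "closed {q::vec_L2 \<times> ten_L2. snd q \<bullet> abs_L2 \<Phi> = - (fst q \<bullet> abs_L2 (Div_c \<Phi>))}"
        by (intro closed_Collect_eq continuous_intros)
    qed (simp add: grad_Div_parts U)
    from this[OF p] have "G \<bullet> abs_L2 \<Phi> = - (u \<bullet> abs_L2 (Div_c \<Phi>))" by simp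
    moreover have "resL2 \<Omega> (abs_L2 \<Phi>) = abs_L2 \<Phi>" "resL2 \<Omega> (abs_L2 (Div_c \<Phi>)) = abs_L2 (Div_c \<Phi>)"
      using abs_Cc_L2_on[OF \<Phi>] abs_Cc_L2_on[OF Cc_inf_Div_c[OF \<Phi>]] L2_on_iff[OF \<Omega>m] by blast+
    ultimately show ?thesis
      by (simp add: resL2_inner[OF \<Omega>m] to_L2_Cc_inf[OF \<Phi>] to_L2_Cc_inf[OF Cc_inf_Div_c[OF \<Phi>]])
  qed
  then show ?thesis by (simp add: weak_Grad_def resL2_in[OF \<Omega>m])
qed

lemma H10_graph_weak_Grad:
  assumes \<Omega>: "open \<Omega>" and p: "(u, G) \<in> H10_graph \<Omega>" shows "(u, G) \<in> weak_Grad \<Omega>"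
proof -
  have \<Omega>m: "\<Omega> \<in> sets lebesgue" by (rule open_sets_lebesgue[OF \<Omega>])
  have "(u, G) \<in> H10_graph UNIV" using p H10_graph_mono[of \<Omega> UNIV] by blast
  from weak_Grad_restrict[OF \<Omega> this] show ?thesis
    using H10_graph_L2_on[OF \<Omega>m p] L2_on_iff[OF \<Omega>m] by metis
qed

lemma weak_Grad_diff:
  assumes \<Omega>: "open \<Omega>" and "(u, G) \<in> weak_Grad \<Omega>" "(v, H) \<in> weak_Grad \<Omega>"
  shows "(u - v, G - H) \<in> weak_Grad \<Omega>"
  using assms(2,3)
  by (auto simp: weak_Grad_def inner_diff_left intro: subspace_diff[OF subspace_L2_on[OF open_sets_lebesgue[OF \<Omega>]]])

lemma weak_Grad_unique:
  assumes \<Omega>: "open \<Omega>" and "(u, G) \<in> weak_Grad \<Omega>" "(u, H) \<in> weak_Grad \<Omega>" shows "G = H"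
proof -
  have "(0, G - H) \<in> weak_Grad \<Omega>" using weak_Grad_diff[OF assms] by simp
  then have "G - H = 0"
    by (intro L2_test_zero[OF \<Omega>]) (auto simp: weak_Grad_def to_L2_Cc_inf)
  then show ?thesis by simp
qed

text \<open>Evaluates the definite description in \<open>Grad\<close>, which uniqueness of weak
  gradients makes meaningful.\<close>

lemma symGrad_eq:
  assumes "open \<Omega>" "(u, G) \<in> weak_Grad \<Omega>" shows "symGrad \<Omega> u = symL2 G"
proof -
  have "Grad \<Omega> u = G" unfolding Grad_def using assms weak_Grad_unique by blast
  then show ?thesis by (simp add: symGrad_def symL2_def opL2_def)
qed

text \<open>Identifies the domain of the minimal symGrad with H^1_0. Graph convergence controls only
  symmetric gradients; \<open>H10_graph_complete\<close> upgrades it to convergence of full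
  Jacobians, and continuity of \<open>symL2\<close> gives the other inclusion.\<close>

lemma symGrad_ring_eq:
  assumes \<Omega>: "\<Omega> \<subseteq> ball 0 R" "R \<ge> 0"
  shows "symGrad_ring \<Omega> = (\<lambda>(u, G). (u, symL2 G)) ` H10_graph \<Omega>"
proof -
  have eq: "symGrad_ring \<Omega> = closure ((\<lambda>\<phi>. (abs_L2 \<phi>, abs_L2 (symgrad_c \<phi>))) ` Cc_inf \<Omega>)"
    unfolding symGrad_ring_def
    by (intro arg_cong[where f=closure] image_cong refl) (simp add: to_L2_Cc_inf Cc_inf_symgrad_c)
  show ?thesis
  proof (intro set_eqI iffI)
    fix p assume "p \<in> symGrad_ring \<Omega>"
    then obtain s where s: "\<And>n. s n \<in> (\<lambda>\<phi>. (abs_L2 \<phi>, abs_L2 (symgrad_c \<phi>))) ` Cc_inf \<Omega>" "s \<longlonglongrightarrow> p"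
      unfolding eq closure_sequential by blast
    then have "\<forall>n. \<exists>\<phi>. \<phi> \<in> Cc_inf \<Omega> \<and> s n = (abs_L2 \<phi>, abs_L2 (symgrad_c \<phi>))" by blast
    then obtain \<phi> where \<phi>: "\<And>n. \<phi> n \<in> Cc_inf \<Omega>" "\<And>n. s n = (abs_L2 (\<phi> n), abs_L2 (symgrad_c (\<phi> n)))" by metis
    have l: "(\<lambda>n. abs_L2 (\<phi> n)) \<longlonglongrightarrow> fst p" "(\<lambda>n. abs_L2 (symgrad_c (\<phi> n))) \<longlonglongrightarrow> snd p"
      using tendsto_fst[OF s(2)] tendsto_snd[OF s(2)] by (simp_all add: \<phi>(2))
    obtain u G where "(u, G) \<in> H10_graph \<Omega>" "(\<lambda>n. abs_L2 (\<phi> n)) \<longlonglongrightarrow> u" "(\<lambda>n. abs_L2 (symgrad_c (\<phi> n))) \<longlonglongrightarrow> symL2 G"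
      using H10_graph_complete[OF \<Omega> \<phi>(1) LIMSEQ_imp_Cauchy[OF l(2)]] by metis
    then show "p \<in> (\<lambda>(u, G). (u, symL2 G)) ` H10_graph \<Omega>"
      using LIMSEQ_unique[OF l(1)] LIMSEQ_unique[OF l(2)] by (intro image_eqI[of _ _ "(u, G)"]) (auto simp: prod_eq_iff)
  next
    fix p assume "p \<in> (\<lambda>(u, G). (u, symL2 G)) ` H10_graph \<Omega>"
    then obtain q where q: "q \<in> H10_graph \<Omega>" "p = (fst q, symL2 (snd q))" by (auto simp: case_prod_beta)
    have "(fst q, symL2 (snd q)) \<in> symGrad_ring \<Omega>"
      using q(1)
    proof (rule H10_graph_induct)
      show "closed {q. (fst q, symL2 (snd q)) \<in> symGrad_ring \<Omega>}"
      proof -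
        have "closed ((\<lambda>q. (fst q, symL2 (snd q))) -` symGrad_ring \<Omega>)"
          by (rule closed_vimage) (simp add: eq, intro continuous_intros)
        then show ?thesis by (simp add: vimage_def)
      qed
      show "(fst (abs_L2 \<phi>, abs_L2 (grad_c \<phi>)), symL2 (snd (abs_L2 \<phi>, abs_L2 (grad_c \<phi>)))) \<in> symGrad_ring \<Omega>"
        if "\<phi> \<in> Cc_inf \<Omega>" for \<phi>
        unfolding eq using that by (intro subsetD[OF closure_subset]) (auto simp: symL2_grad)
    qed
    then show "p \<in> symGrad_ring \<Omega>" by (simp add: q(2))
  qed
qed

section \<open>The adjoint of the minimal symGrad and the orthogonal projection\<close>

lemma subspace_L2_sym:
  assumes "\<Omega> \<in> sets lebesgue" shows "subspace (L2_sym \<Omega>)"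
proof -
  have "S \<in> L2_sym \<Omega> \<longleftrightarrow> S \<in> L2_on \<Omega> \<and> symL2 S = S" for S
    using symL2_symm[of S \<Omega>] symL2_in_sym[OF assms, of S] by (auto simp: L2_sym_def)
  then show ?thesis
    using subspace_L2_on[OF assms, where 'b="real^3^3"] bounded_linear.linear[OF bounded_linear_symL2]
    by (auto simp: subspace_def linear_add linear_scale linear_0)
qed

text \<open>The kernel of an adjoint is the orthogonal complement of the range; the sign in
  \<open>Div_S\<close> does not affect the kernel.\<close>

lemma ker_Div_S:
  assumes \<Omega>: "open \<Omega>" "\<Omega> \<subseteq> ball 0 R" "R \<ge> 0"
  shows "ker_graph (Div_S \<Omega>) = {S \<in> L2_sym \<Omega>. \<forall>p\<in>H10_graph \<Omega>. symL2 (snd p) \<bullet> S = 0}"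
  unfolding ker_graph_def Div_S_def adjoint_graph_def symGrad_ring_eq[OF \<Omega>(2,3)]
  using subspace_0[OF subspace_L2_on[OF open_sets_lebesgue[OF \<Omega>(1)]]] by (auto simp: case_prod_beta)

lemma subspace_ker_Div_S:
  assumes \<Omega>: "open \<Omega>" "\<Omega> \<subseteq> ball 0 R" "R \<ge> 0"
  shows "subspace (ker_graph (Div_S \<Omega>))"
  unfolding ker_Div_S[OF \<Omega>]
  using subspace_L2_sym[OF open_sets_lebesgue[OF \<Omega>(1)]] by (auto simp: subspace_def inner_add_right)

text \<open>The projection is found on the range side: project \<open>x\<close> onto the closure of
  the symmetric gradients of test fields and subtract. The residual is orthogonal to the range,
  hence lies in the kernel of the divergence.\<close>

lemma symGrad_projection:
  assumes \<Omega>: "open \<Omega>" "\<Omega> \<subseteq> ball 0 R" "R \<ge> 0" and x: "x \<in> L2_sym \<Omega>"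
  obtains \<psi> G where "(\<psi>, G) \<in> H10_graph \<Omega>" "x - symL2 G \<in> ker_graph (Div_S \<Omega>)"
    "orth_proj (ker_graph (Div_S \<Omega>)) x = x - symL2 G"
proof -
  have \<Omega>m: "\<Omega> \<in> sets lebesgue" by (rule open_sets_lebesgue[OF \<Omega>(1)])
  interpret symL2: bounded_linear symL2 by (rule bounded_linear_symL2)
  have eq: "(\<lambda>\<phi>. abs_L2 (symgrad_c \<phi>)) ` Cc_inf \<Omega> = (\<lambda>p. symL2 (snd p)) ` grad_graph \<Omega>"
    unfolding grad_graph_def image_image by (intro image_cong refl) (simp add: symL2_grad)
  have "linear (\<lambda>p::vec_L2 \<times> ten_L2. symL2 (snd p))"
    by (rule linearI) (auto simp: symL2.add symL2.scale)
  then have sub: "subspace (closure ((\<lambda>\<phi>. abs_L2 (symgrad_c \<phi>)) ` Cc_inf \<Omega>))"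
    unfolding eq by (intro subspace_closure linear_subspace_image subspace_grad_graph)
  obtain y where y: "y \<in> closure ((\<lambda>\<phi>. abs_L2 (symgrad_c \<phi>)) ` Cc_inf \<Omega>)"
    and orth: "\<And>z. z \<in> closure ((\<lambda>\<phi>. abs_L2 (symgrad_c \<phi>)) ` Cc_inf \<Omega>) \<Longrightarrow> (x - y) \<bullet> z = 0"
    using orth_decomposition[OF sub closed_closure] by metis
  obtain s where s: "\<And>n. s n \<in> (\<lambda>\<phi>. abs_L2 (symgrad_c \<phi>)) ` Cc_inf \<Omega>" "s \<longlonglongrightarrow> y"
    using y unfolding closure_sequential by blast
  then have "\<forall>n. \<exists>\<phi>. \<phi> \<in> Cc_inf \<Omega> \<and> s n = abs_L2 (symgrad_c \<phi>)" by blast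
  then obtain \<phi> where \<phi>: "\<And>n. \<phi> n \<in> Cc_inf \<Omega>" "\<And>n. s n = abs_L2 (symgrad_c (\<phi> n))" by metis
  have l: "(\<lambda>n. abs_L2 (symgrad_c (\<phi> n))) \<longlonglongrightarrow> y" using s(2) by (simp flip: \<phi>(2))
  obtain \<psi> G where W: "(\<psi>, G) \<in> H10_graph \<Omega>" "(\<lambda>n. abs_L2 (symgrad_c (\<phi> n))) \<longlonglongrightarrow> symL2 G"
    using H10_graph_complete[OF \<Omega>(2,3) \<phi>(1) LIMSEQ_imp_Cauchy[OF l]] by metis
  \<comment> \<open>Closedness of the range in action: the limit of symmetric gradients of test
    fields is the symmetric gradient of an element of H^1_0.\<close>
  have yG: "y = symL2 G" using LIMSEQ_unique[OF l W(2)] .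
  have orth': "symL2 (snd q) \<bullet> (x - symL2 G) = 0" if "q \<in> H10_graph \<Omega>" for q
    using that
  proof (rule H10_graph_induct)
    show "closed {q::vec_L2 \<times> ten_L2. symL2 (snd q) \<bullet> (x - symL2 G) = 0}" by (intro closed_Collect_eq continuous_intros)
    fix \<phi> :: vec_field assume "\<phi> \<in> Cc_inf \<Omega>"
    then show "symL2 (snd (abs_L2 \<phi>, abs_L2 (grad_c \<phi>))) \<bullet> (x - symL2 G) = 0"
      using orth[of "abs_L2 (symgrad_c \<phi>)"] closure_subset[of "(\<lambda>\<phi>. abs_L2 (symgrad_c \<phi>)) ` Cc_inf \<Omega>"]
      by (auto simp: symL2_grad yG inner_commute)
  qed
  have "x - symL2 G \<in> L2_sym \<Omega>"
    by (intro subspace_diff[OF subspace_L2_sym[OF \<Omega>m]] x symL2_in_sym[OF \<Omega>m] H10_graph_L2_on[OF \<Omega>m W(1)])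
  with orth' have K: "x - symL2 G \<in> ker_graph (Div_S \<Omega>)" unfolding ker_Div_S[OF \<Omega>] by simp
  have perp: "symL2 G \<bullet> z = 0" if "z \<in> ker_graph (Div_S \<Omega>)" for z
    using that W(1) unfolding ker_Div_S[OF \<Omega>] by force
  have "orth_proj (ker_graph (Div_S \<Omega>)) x = x - symL2 G"
    unfolding orth_proj_def
  proof (rule the_equality)
    show "x - symL2 G \<in> ker_graph (Div_S \<Omega>) \<and> (\<forall>z\<in>ker_graph (Div_S \<Omega>). (x - (x - symL2 G)) \<bullet> z = 0)"
      using K perp by simp
    fix w assume w: "w \<in> ker_graph (Div_S \<Omega>) \<and> (\<forall>z\<in>ker_graph (Div_S \<Omega>). (x - w) \<bullet> z = 0)"
    \<comment> \<open>Uniqueness for the definite description in \<open>orth_proj\<close>: the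
      difference of two candidates lies in the subspace and is orthogonal to it.\<close>
    define d where "d = (x - symL2 G) - w"
    have d: "d \<in> ker_graph (Div_S \<Omega>)"
      unfolding d_def by (intro subspace_diff[OF subspace_ker_Div_S[OF \<Omega>]] K) (use w in blast)
    have "d \<bullet> d = (x - w) \<bullet> d - symL2 G \<bullet> d" by (simp add: d_def inner_diff_left)
    also have "\<dots> = 0" using w d perp by simp
    finally show "w = x - symL2 G" by (simp add: d_def)
  qed
  then show thesis using that W(1) K by blast
qed

section \<open>Evaluation of the constructed fields\<close>

lemma smooth_rigid_field: "smooth (rigid_field j)"
proof (cases "j \<le> 3")
  case True
  have "bounded_linear (\<lambda>x. cross3 (axis (of_nat j) 1) x)"
    by (rule linear_conv_bounded_linear[THEN iffD1], rule linearI)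
       (simp_all add: cross_add_right cross_mult_right)
  then have "smooth (\<lambda>x. cross3 (axis (of_nat j) 1) x)" by (rule smooth_bounded_linear)
  moreover have "rigid_field j = (\<lambda>x. cross3 (axis (of_nat j) 1) x)" using True by (auto simp: rigid_field_def)
  ultimately show ?thesis by simp
next
  case False
  then have "rigid_field j = (\<lambda>x. axis (of_nat (j - 3)) 1)" by (auto simp: rigid_field_def)
  then show ?thesis by simp
qed

text \<open>Resolves the definite descriptions behind \<open>v_field\<close>. Afterwards its
  symmetric gradient is used only as that of the cut-off rigid motion minus that of an element of
  H^1_0.\<close>

lemma v_field_properties:
  fixes j :: nat
  assumes \<Omega>: "open \<Omega>" "\<Omega> \<subseteq> ball 0 R" "R \<ge> 0" and \<eta>: "\<eta> \<in> Cc_inf UNIV"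
  defines "f \<equiv> \<lambda>x. \<eta> x *\<^sub>R rigid_field j x"
  obtains \<psi> G where "(\<psi>, G) \<in> H10_graph \<Omega>" "v_field \<Omega> \<eta> j \<in> H1 \<Omega>"
    "symGrad \<Omega> (v_field \<Omega> \<eta> j) = to_L2 \<Omega> (symgrad_c f) - symL2 G"
    "symGrad \<Omega> (v_field \<Omega> \<eta> j) \<in> ker_graph (Div_S \<Omega>)"
proof -
  have \<Omega>m: "\<Omega> \<in> sets lebesgue" by (rule open_sets_lebesgue[OF \<Omega>(1)])
  interpret symL2: bounded_linear symL2 by (rule bounded_linear_symL2)
  have f: "f \<in> Cc_inf UNIV" unfolding f_def by (rule Cc_inf_smooth_scaleR_right[OF \<eta> smooth_rigid_field])
  have xi: "xi_field \<Omega> \<eta> j = resL2 \<Omega> (abs_L2 f)"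
    unfolding xi_field_def f_def[symmetric] by (rule resL2_abs[OF \<Omega>m Cc_inf_sq[OF f], symmetric])
  define F where "F = resL2 \<Omega> (abs_L2 (grad_c f))"
  have wg: "(xi_field \<Omega> \<eta> j, F) \<in> weak_Grad \<Omega>"
    unfolding xi F_def by (rule weak_Grad_restrict[OF \<Omega>(1) H10_graph_test[OF f]])
  have F: "F \<in> L2_on \<Omega>" unfolding F_def by (rule resL2_in[OF \<Omega>m])
  have symF: "symL2 F = to_L2 \<Omega> (symgrad_c f)"
  proof -
    have "F = to_L2 \<Omega> (grad_c f)" unfolding F_def by (rule resL2_abs[OF \<Omega>m Cc_inf_sq[OF Cc_inf_grad_c[OF f]]])
    also have "symL2 \<dots> = abs_L2 (\<lambda>x. sym_part (if x \<in> \<Omega> then grad_c f x else 0))"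
      unfolding to_L2_def by (rule symL2_abs[OF sq_restrict[OF \<Omega>m Cc_inf_sq[OF Cc_inf_grad_c[OF f]]]])
    also have "\<dots> = to_L2 \<Omega> (symgrad_c f)"
      unfolding to_L2_def symgrad_c_def
      using linear_0[OF bounded_linear.linear[OF bounded_linear_sym_part]] by (simp add: if_distrib cong: if_cong)
    finally show ?thesis .
  qed
  obtain \<psi> G where W: "(\<psi>, G) \<in> H10_graph \<Omega>" "symL2 F - symL2 G \<in> ker_graph (Div_S \<Omega>)"
    "orth_proj (ker_graph (Div_S \<Omega>)) (symL2 F) = symL2 F - symL2 G"
    using symGrad_projection[OF \<Omega> symL2_in_sym[OF \<Omega>m F]] by metis
  have vg: "(xi_field \<Omega> \<eta> j - u, F - H) \<in> weak_Grad \<Omega>" if "(u, H) \<in> H10_graph \<Omega>" for u H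
    by (rule weak_Grad_diff[OF \<Omega>(1) wg H10_graph_weak_Grad[OF \<Omega>(1) that]])
  have sg: "symGrad \<Omega> (xi_field \<Omega> \<eta> j - u) = symL2 F - symL2 H" if "(u, H) \<in> H10_graph \<Omega>" for u H
    using symGrad_eq[OF \<Omega>(1) vg[OF that]] by (simp add: symL2.diff)
  \<comment> \<open>Existence comes from the projection. Two candidates have the same symmetric
    gradient, so their difference vanishes by \<open>H10_graph_zero\<close>.\<close>
  have "psi_field \<Omega> \<eta> j = \<psi>"
    unfolding psi_field_def symGrad_eq[OF \<Omega>(1) wg]
  proof (rule the_equality)
    show "\<psi> \<in> H10 \<Omega> \<and> orth_proj (ker_graph (Div_S \<Omega>)) (symL2 F) = symGrad \<Omega> (xi_field \<Omega> \<eta> j - \<psi>)"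
      using W sg[OF W(1)] by (auto simp: H10_eq)
    fix u assume u: "u \<in> H10 \<Omega> \<and> orth_proj (ker_graph (Div_S \<Omega>)) (symL2 F) = symGrad \<Omega> (xi_field \<Omega> \<eta> j - u)"
    then obtain H where H: "(u, H) \<in> H10_graph \<Omega>" by (auto simp: H10_eq)
    then have "symL2 G = symL2 H" using u sg[OF H] W(3) by simp
    then have "symL2 (H - G) = 0" by (simp add: symL2.diff)
    moreover have "(u - \<psi>, H - G) \<in> H10_graph \<Omega>" using subspace_diff[OF subspace_H10_graph H W(1)] by simp
    ultimately show "u = \<psi>" using H10_graph_zero(1)[OF \<Omega>(2,3)] by fastforce
  qed
  then have v: "v_field \<Omega> \<eta> j = xi_field \<Omega> \<eta> j - \<psi>" by (simp add: v_field_def)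
  show thesis
  proof
    show "(\<psi>, G) \<in> H10_graph \<Omega>" by (rule W(1))
    show "v_field \<Omega> \<eta> j \<in> H1 \<Omega>" unfolding v H1_def using vg[OF W(1)] by blast
    show "symGrad \<Omega> (v_field \<Omega> \<eta> j) = to_L2 \<Omega> (symgrad_c f) - symL2 G" unfolding v sg[OF W(1)] symF ..
    show "symGrad \<Omega> (v_field \<Omega> \<eta> j) \<in> ker_graph (Div_S \<Omega>)" unfolding v sg[OF W(1)] by (rule W(2))
  qed
qed

section \<open>Domains with continuous boundary\<close>

text \<open>A boundary chart in coordinate-free form: \<open>u\<close> is the vertical direction and \<open>F\<close> the height
  above the graph.\<close>

lemma continuous_boundary_chart:
  assumes "continuous_boundary \<Omega>" "p \<in> frontier \<Omega>"
  shows "\<exists>U (u :: real^3) (F :: real^3 \<Rightarrow> real). open U \<and> p \<in> U \<and> norm u = 1 \<and> continuous_on UNIV F \<and>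
    (\<forall>x t. F (x + t *\<^sub>R u) = F x + t) \<and> \<Omega> \<inter> U = {x \<in> U. F x < 0}"
proof -
  obtain U and Q :: "real^3 \<Rightarrow> real^3" and g :: "real \<times> real \<Rightarrow> real" where
    U: "open U" "p \<in> U" and Q: "orthogonal_transformation Q" and g: "continuous_on UNIV g" and
    eq: "\<Omega> \<inter> U = {x \<in> U. Q x $ 3 < g (Q x $ 1, Q x $ 2)}"
    using assms unfolding continuous_boundary_def by blast
  obtain u where u: "Q u = axis 3 1" using orthogonal_transformation_surj[OF Q] by (metis surjD)
  have lin: "linear Q" using Q by (rule orthogonal_transformation_linear)
  have cQ: "continuous_on UNIV Q" using lin by (simp add: linear_continuous_on linear_conv_bounded_linear)
  define F where "F x = Q x $ 3 - g (Q x $ 1, Q x $ 2)" for x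
  show ?thesis
  proof (intro exI conjI allI)
    show "norm u = 1" using orthogonal_transformation_norm[OF Q, of u] u by simp
    show "continuous_on UNIV F"
      unfolding F_def by (intro continuous_intros continuous_on_compose2[OF g] continuous_on_compose2[OF _ cQ]) auto
    show "F (x + t *\<^sub>R u) = F x + t" for x t
    proof -
      have "Q (x + t *\<^sub>R u) = Q x + t *\<^sub>R axis 3 1" by (simp add: linear_add[OF lin] linear_scale[OF lin] u)
      then show ?thesis by (simp add: F_def axis_def)
    qed
    show "\<Omega> \<inter> U = {x \<in> U. F x < 0}" using eq by (auto simp: F_def)
  qed (use U in auto)
qed

text \<open>Strictly above the graph lies an open set that misses \<Omega>, and a point on or below
  the graph is a limit of points moved down along \<open>u\<close>. The closure thus adds exactly
  the graph.\<close>

lemma chart_closure: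
  fixes \<Omega> U :: "'a::real_normed_vector set"
  assumes U: "open U" and F: "continuous_on UNIV F" "\<And>x t. F (x + t *\<^sub>R u) = F x + t"
    and \<Omega>: "\<Omega> \<inter> U = {x \<in> U. F x < (0::real)}" and x: "x \<in> U"
  shows "x \<in> closure \<Omega> \<longleftrightarrow> F x \<le> 0"
proof
  assume xc: "x \<in> closure \<Omega>"
  show "F x \<le> 0"
  proof (rule ccontr)
    assume "\<not> F x \<le> 0"
    have o: "open (U \<inter> {y. F y > 0})" by (intro open_Int U open_Collect_less F continuous_intros)
    have "x \<in> U \<inter> {y. F y > 0}" using x \<open>\<not> F x \<le> 0\<close> by simp
    then have "\<Omega> \<inter> (U \<inter> {y. F y > 0}) \<noteq> {}"
      using xc o by (metis open_Int_closure_eq_empty disjoint_iff inf_commute)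
    then obtain y where "y \<in> \<Omega>" "y \<in> U" "F y > 0" by blast
    then have "F y < 0" using \<Omega> by blast
    with \<open>F y > 0\<close> show False by simp
  qed
next
  assume le: "F x \<le> 0"
  have lim: "((\<lambda>t. x + t *\<^sub>R u) \<longlongrightarrow> x + 0 *\<^sub>R u) (at_left 0)" by (intro tendsto_intros)
  then have "\<forall>\<^sub>F t in at_left 0. x + t *\<^sub>R u \<in> U" using U x by (intro topological_tendstoD) auto
  moreover have "\<forall>\<^sub>F t in at_left (0::real). t < 0" by (simp add: eventually_at_filter)
  ultimately have "\<forall>\<^sub>F t in at_left 0. x + t *\<^sub>R u \<in> closure \<Omega>"
  proof eventually_elim
    case (elim t)
    then have "F (x + t *\<^sub>R u) < 0" using le F(2)[of x t] by linarith
    then have "x + t *\<^sub>R u \<in> \<Omega>" using \<Omega> elim(1) by blast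
    then show ?case by (rule subsetD[OF closure_subset])
  qed
  moreover have "at_left (0::real) \<noteq> bot" by (rule trivial_limit_at_left_real)
  ultimately show "x \<in> closure \<Omega>"
    using Lim_in_closed_set[OF closed_closure _ _ lim, of \<Omega>] by simp
qed

lemma chart_frontier:
  fixes \<Omega> U :: "'a::real_normed_vector set"
  assumes "open \<Omega>" "open U" "continuous_on UNIV F" "\<And>x t. F (x + t *\<^sub>R u) = F x + t"
    "\<Omega> \<inter> U = {x \<in> U. F x < (0::real)}" "p \<in> U" "p \<in> frontier \<Omega>"
  shows "F p = 0"
proof -
  have "p \<in> closure \<Omega>" "p \<notin> \<Omega>" using assms(1,7) by (auto simp: frontier_def interior_open)
  then show ?thesis using chart_closure[OF assms(2,3,4,5,6)] assms(5,6) by fastforce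
qed

text \<open>Moving up by a fixed height \<open>t\<close> joins all exterior points near \<open>p\<close> to a ball above the graph.\<close>

lemma exterior_locally_connected:
  assumes \<Omega>: "open \<Omega>" "continuous_boundary \<Omega>" and p: "p \<in> frontier \<Omega>"
  obtains V c where "open V" "p \<in> V" "\<And>x. x \<in> V - closure \<Omega> \<Longrightarrow> connected_component (- closure \<Omega>) x c"
proof -
  obtain U u F where ch: "open U" "p \<in> U" "norm u = 1" "continuous_on UNIV F"
    "\<And>x t. F (x + t *\<^sub>R u) = F x + t" "\<Omega> \<inter> U = {x \<in> U. F x < 0}"
    using continuous_boundary_chart[OF \<Omega>(2) p] by blast
  have ext: "x \<notin> closure \<Omega>" if "x \<in> U" "F x > 0" for x
    using chart_closure[OF ch(1,4,5,6) that(1)] that(2) by simp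
  have Fp: "F p = 0" using chart_frontier[OF \<Omega>(1) ch(1,4,5,6,2) p] .
  obtain e where e: "e > 0" "ball p e \<subseteq> U" using ch(1,2) openE by blast
  define t where "t = e / 3"
  have t: "t > 0" using e by (simp add: t_def)
  have "\<exists>d>0. \<forall>y. dist y p < d \<longrightarrow> dist (F y) (F p) < t"
    using ch(4) t unfolding continuous_on_iff by (metis UNIV_I)
  then obtain d where d: "d > 0" "\<And>y. dist y p < d \<Longrightarrow> \<bar>F y\<bar> < t" by (auto simp: Fp dist_real_def)
  \<comment> \<open>Within distance d of \<open>p\<close> the height is less than t in absolute
    value, so lifting the whole ball by t puts it above the graph.\<close>
  define r where "r = min d t"
  have r: "r > 0" using d t by (simp add: r_def)
  have inU: "y + s *\<^sub>R u \<in> U" if "y \<in> ball p r" "0 \<le> s" "s \<le> t" for y s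
  proof -
    have "dist p (y + s *\<^sub>R u) \<le> dist p y + s"
      using dist_triangle[of p "y + s *\<^sub>R u" y] that ch(3) by (simp add: dist_norm)
    also have "\<dots> < e" using that t by (simp add: r_def t_def)
    finally show ?thesis using e by auto
  qed
  show thesis
  proof
    show "open (ball p r)" "p \<in> ball p r" using r by auto
    fix x assume x: "x \<in> ball p r - closure \<Omega>"
    have xU: "x \<in> U" using inU[of x 0] x t by simp
    have Fx: "F x > 0" using chart_closure[OF ch(1,4,5,6) xU] x by simp
    have "connected_component (- closure \<Omega>) x (x + t *\<^sub>R u)"
      unfolding connected_component_def
    proof (intro exI conjI)
      show "connected (closed_segment x (x + t *\<^sub>R u))" by simp
      show "closed_segment x (x + t *\<^sub>R u) \<subseteq> - closure \<Omega>"
      proof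
        fix z assume "z \<in> closed_segment x (x + t *\<^sub>R u)"
        then obtain s where s: "0 \<le> s" "s \<le> 1" "z = (1 - s) *\<^sub>R x + s *\<^sub>R (x + t *\<^sub>R u)" by (auto simp: in_segment)
        then have z: "z = x + (s * t) *\<^sub>R u" by (simp add: algebra_simps)
        have st: "0 \<le> s * t" "s * t \<le> t" using s t by (auto simp: mult_left_le_one_le)
        have "F z > 0" using Fx st by (simp add: z ch(5))
        moreover have "z \<in> U" unfolding z by (rule inU) (use x st in auto)
        ultimately show "z \<in> - closure \<Omega>" using ext by simp
      qed
    qed auto
    moreover have "connected_component (- closure \<Omega>) (x + t *\<^sub>R u) (p + t *\<^sub>R u)"
      unfolding connected_component_def
    proof (intro exI conjI)
      show "connected (ball (p + t *\<^sub>R u) r)" by simp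
      show "ball (p + t *\<^sub>R u) r \<subseteq> - closure \<Omega>"
      proof
        fix z assume z: "z \<in> ball (p + t *\<^sub>R u) r"
        define y where "y = z - t *\<^sub>R u"
        have y: "y \<in> ball p r" using z by (simp add: y_def dist_norm algebra_simps)
        have zy: "z = y + t *\<^sub>R u" by (simp add: y_def)
        have "\<bar>F y\<bar> < t" using d(2)[of y] y by (simp add: r_def dist_commute)
        then have "F z > 0" by (simp add: zy ch(5))
        moreover have "z \<in> U" unfolding zy by (rule inU) (use y t in auto)
        ultimately show "z \<in> - closure \<Omega>" using ext by simp
      qed
      show "x + t *\<^sub>R u \<in> ball (p + t *\<^sub>R u) r" using x by (simp add: dist_norm)
    qed (use r in auto)
    ultimately show "connected_component (- closure \<Omega>) x (p + t *\<^sub>R u)" by (rule connected_component_trans)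
  qed
qed

text \<open>\<Omega> lies on one side of its boundary: moving a boundary point up along
  \<open>u\<close> leads out of the closure of \<Omega>.\<close>

lemma frontier_subset_closure_exterior:
  assumes \<Omega>: "open \<Omega>" "continuous_boundary \<Omega>"
  shows "frontier \<Omega> \<subseteq> closure (- closure \<Omega>)"
proof
  fix p assume p: "p \<in> frontier \<Omega>"
  obtain U u F where ch: "open U" "p \<in> U" "norm u = 1" "continuous_on UNIV F"
    "\<And>x t. F (x + t *\<^sub>R u) = F x + t" "\<Omega> \<inter> U = {x \<in> U. F x < 0}"
    using continuous_boundary_chart[OF \<Omega>(2) p] by blast
  have Fp: "F p = 0" using chart_frontier[OF \<Omega>(1) ch(1,4,5,6,2) p] .
  have lim: "((\<lambda>t. p + t *\<^sub>R u) \<longlongrightarrow> p + 0 *\<^sub>R u) (at_right 0)" by (intro tendsto_intros)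
  then have "\<forall>\<^sub>F t in at_right 0. p + t *\<^sub>R u \<in> U" using ch(1,2) by (intro topological_tendstoD) auto
  moreover have "\<forall>\<^sub>F t in at_right (0::real). t > 0" by (simp add: eventually_at_filter)
  ultimately have "\<forall>\<^sub>F t in at_right 0. p + t *\<^sub>R u \<in> closure (- closure \<Omega>)"
  proof eventually_elim
    case (elim t)
    then have "p + t *\<^sub>R u \<in> - closure \<Omega>" using chart_closure[OF ch(1,4,5,6)] Fp ch(5)[of p t] by simp
    then show ?case by (rule subsetD[OF closure_subset])
  qed
  moreover have "at_right (0::real) \<noteq> bot" by (rule trivial_limit_at_right_real)
  ultimately show "p \<in> closure (- closure \<Omega>)"
    using Lim_in_closed_set[OF closed_closure _ _ lim, of "- closure \<Omega>"] by simp
qed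

text \<open>Lets a continuous field that vanishes on the exterior be seen to vanish everywhere off
  \<Omega>, boundary included.\<close>

lemma compl_eq_closure_exterior:
  assumes \<Omega>: "open \<Omega>" "continuous_boundary \<Omega>"
  shows "- \<Omega> = closure (- closure \<Omega>)"
proof
  show "- \<Omega> \<subseteq> closure (- closure \<Omega>)"
    using frontier_subset_closure_exterior[OF \<Omega>] closure_subset[of "- closure \<Omega>"] interior_open[OF \<Omega>(1)] by (auto simp: frontier_def)
  show "closure (- closure \<Omega>) \<subseteq> - \<Omega>"
    by (rule closure_minimal) (use \<Omega> closure_subset in auto)
qed

text \<open>Every component other than the whole space has a frontier point on the frontier of
  \<Omega>, and near such a point the exterior lies in a single component; compactness of the
  frontier leaves finitely many.\<close>

lemma finite_exterior_components:
  assumes \<Omega>: "open \<Omega>" "bounded \<Omega>" "continuous_boundary \<Omega>"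
  shows "finite (components (- closure \<Omega>))"
proof -
  define E where "E = - closure \<Omega>"
  have "\<forall>p\<in>frontier \<Omega>. \<exists>V c. open V \<and> p \<in> V \<and> (\<forall>x\<in>V \<inter> E. connected_component E x c)"
    using exterior_locally_connected[OF \<Omega>(1,3)] unfolding E_def by (metis ComplD DiffI IntD1 IntD2)
  then obtain V c where V: "\<And>p. p \<in> frontier \<Omega> \<Longrightarrow> open (V p)" "\<And>p. p \<in> frontier \<Omega> \<Longrightarrow> p \<in> V p"
    "\<And>p x. p \<in> frontier \<Omega> \<Longrightarrow> x \<in> V p \<Longrightarrow> x \<in> E \<Longrightarrow> connected_component E x (c p)" by (metis IntI)
  have "compact (frontier \<Omega>)" using \<Omega>(2) by (rule compact_frontier_bounded)
  then obtain D where D: "D \<subseteq> frontier \<Omega>" "finite D" "frontier \<Omega> \<subseteq> (\<Union>p\<in>D. V p)"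
    by (rule compactE_image[of _ "frontier \<Omega>" V]) (use V in blast)+
  \<comment> \<open>The extra member \<open>UNIV\<close> accounts for empty \<Omega>, where the only
    component has empty frontier.\<close>
  have "components E \<subseteq> insert UNIV ((\<lambda>p. connected_component_set E (c p)) ` D)"
  proof
    fix C assume C: "C \<in> components E"
    show "C \<in> insert UNIV ((\<lambda>p. connected_component_set E (c p)) ` D)"
    proof (cases "C = UNIV")
      case False
      have "frontier C \<noteq> {}" using in_components_nonempty[OF C] False by (simp add: frontier_eq_empty)
      moreover have "frontier C \<subseteq> frontier (closure \<Omega>)"
        using frontier_of_components_subset[OF C] by (simp add: E_def frontier_complement)
      moreover have "frontier (closure \<Omega>) \<subseteq> frontier \<Omega>"
        using interior_mono[OF closure_subset[of \<Omega>]] by (auto simp: frontier_def)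
      ultimately obtain q where q: "q \<in> frontier C" "q \<in> frontier \<Omega>" by blast
      then obtain p where p: "p \<in> D" "q \<in> V p" using D by blast
      have "q \<in> closure C" using q by (simp add: frontier_def)
      then obtain x where x: "x \<in> C" "x \<in> V p"
        using p D open_Int_closure_eq_empty[of "V p" C] V(1)[of p] by blast
      have "x \<in> E" using x(1) in_components_subset[OF C] by blast
      then have "connected_component E x (c p)" using V(3)[of p x] p x D by blast
      moreover have "C = connected_component_set E x" using C x(1) by (metis componentsE connected_component_eq)
      ultimately have "C = connected_component_set E (c p)" using connected_component_eq by (metis mem_Collect_eq)
      then show ?thesis using p by blast
    qed simp
  qed
  then show ?thesis using D(2) finite_subset unfolding E_def by blast
qed

text \<open>A common closure point would be an exterior or a boundary point, and near either the
  exterior belongs to one component only. This is the room in which cut-offs constant near the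
  closures exist.\<close>

lemma closure_components_disjoint:
  assumes \<Omega>: "open \<Omega>" "continuous_boundary \<Omega>"
    and C: "C \<in> components (- closure \<Omega>)" "C' \<in> components (- closure \<Omega>)" "C \<noteq> C'"
  shows "closure C \<inter> closure C' = {}"
proof (rule ccontr)
  define E where "E = - closure \<Omega>"
  have E: "open E" by (simp add: E_def open_Compl)
  assume "closure C \<inter> closure C' \<noteq> {}"
  then obtain p where p: "p \<in> closure C" "p \<in> closure C'" by blast
  have C': "C \<in> components E" "C' \<in> components E" using C by (auto simp: E_def)
  have meets: "W \<inter> C \<noteq> {}" "W \<inter> C' \<noteq> {}" if "open W" "p \<in> W" for W
    using p that open_Int_closure_eq_empty[OF that(1)] by blast+
  have "p \<notin> \<Omega>"
    using meets(1)[OF \<Omega>(1)] in_components_subset[OF C(1)] closure_subset[of \<Omega>] by blast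
  consider "p \<in> E" | "p \<in> frontier \<Omega>" using \<open>p \<notin> \<Omega>\<close> interior_open[OF \<Omega>(1)] by (auto simp: E_def frontier_def)
  then show False
  proof cases
    case 1
    define C0 where "C0 = connected_component_set E p"
    have C0: "C0 \<in> components E" using 1 by (auto simp: C0_def components_def)
    have "open C0" using open_components[OF E C0] .
    moreover have "p \<in> C0" using 1 by (simp add: C0_def)
    ultimately have "C0 \<inter> C \<noteq> {}" "C0 \<inter> C' \<noteq> {}" using meets by blast+
    then show False using components_eq C0 C' C(3) by metis
  next
    case 2
    obtain V c where V: "open V" "p \<in> V" "\<And>x. x \<in> V - closure \<Omega> \<Longrightarrow> connected_component (- closure \<Omega>) x c"
      using exterior_locally_connected[OF \<Omega> 2] by metis
    obtain x x' where x: "x \<in> V" "x \<in> C" "x' \<in> V" "x' \<in> C'" using meets[OF V(1,2)] by blast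
    then have "connected_component E x c" "connected_component E x' c"
      using V(3) in_components_subset[OF C'(1)] in_components_subset[OF C'(2)] by (auto simp: E_def)
    moreover have "C = connected_component_set E x" "C' = connected_component_set E x'"
      using C' x by (metis componentsE connected_component_eq)+
    ultimately show False using C(3) connected_component_eq by (metis mem_Collect_eq)
  qed
qed

text \<open>Inner points and boundary points are treated alike (\<open>u = 0\<close> for inner points).\<close>

lemma inward_translation:
  assumes \<Omega>: "open \<Omega>" "continuous_boundary \<Omega>" and x: "x \<in> closure \<Omega>"
  obtains N u where "open N" "x \<in> N"
    "\<And>C. compact C \<Longrightarrow> C \<subseteq> N \<inter> closure \<Omega> \<Longrightarrow> \<exists>\<tau>0>0. \<forall>\<tau>. 0 < \<tau> \<and> \<tau> < \<tau>0 \<longrightarrow> (\<lambda>y. y - \<tau> *\<^sub>R u) ` C \<subseteq> \<Omega>"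
proof (cases "x \<in> \<Omega>")
  case True
  show thesis
    by (rule that[of \<Omega> 0]) (use True \<Omega> in \<open>auto intro: exI[of _ 1]\<close>)
next
  case False
  then have p: "x \<in> frontier \<Omega>" using x interior_open[OF \<Omega>(1)] by (simp add: frontier_def)
  obtain U u F where ch: "open U" "x \<in> U" "norm u = 1" "continuous_on UNIV F"
    "\<And>x t. F (x + t *\<^sub>R u) = F x + t" "\<Omega> \<inter> U = {x \<in> U. F x < 0}"
    using continuous_boundary_chart[OF \<Omega>(2) p] by blast
  show thesis
  proof (rule that[OF ch(1,2), of u])
    fix C assume C: "compact C" "C \<subseteq> U \<inter> closure \<Omega>"
    then obtain e where e: "e > 0" "(\<Union>y\<in>C. ball y e) \<subseteq> U"
      using compact_subset_open_imp_ball_epsilon_subset[OF C(1) ch(1)] by (metis le_inf_iff)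
    have "y - \<tau> *\<^sub>R u \<in> \<Omega>" if "0 < \<tau>" "\<tau> < e" "y \<in> C" for y \<tau>
    proof -
      have "y - \<tau> *\<^sub>R u \<in> ball y e" using that ch(3) by (simp add: dist_norm)
      then have "y - \<tau> *\<^sub>R u \<in> U" using e that by blast
      moreover have "F y \<le> 0" using chart_closure[OF ch(1,4,5,6)] C that by blast
      then have "F (y - \<tau> *\<^sub>R u) < 0" using ch(5)[of y "- \<tau>"] that by simp
      ultimately show ?thesis using ch(6) by blast
    qed
    then show "\<exists>\<tau>0>0. \<forall>\<tau>. 0 < \<tau> \<and> \<tau> < \<tau>0 \<longrightarrow> (\<lambda>y. y - \<tau> *\<^sub>R u) ` C \<subseteq> \<Omega>" using e(1) by blast
  qed
qed

section \<open>Enumeration of the exterior components and cut-off families\<close>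

lemma exterior_enumeration_exists:
  fixes \<Omega> :: "(real^3) set"
  assumes \<Omega>: "open \<Omega>" "bounded \<Omega>" "continuous_boundary \<Omega>" and m: "m = card (components (- closure \<Omega>))"
  obtains \<Xi> where "exterior_enumeration \<Omega> m \<Xi>"
proof -
  let ?C = "components (- closure \<Omega>)"
  have fin: "finite ?C" by (rule finite_exterior_components[OF \<Omega>])
  obtain c where c: "c \<in> ?C" "\<not> bounded c"
    using cobounded_unbounded_components[of "- closure \<Omega>"] \<Omega>(2) by auto
  obtain h where h: "bij_betw h {0..<m} ?C" using ex_bij_betw_nat_finite[OF fin] m by metis
  \<comment> \<open>With truncated subtraction, positivity of \<open>m\<close> is what identifies
    {0..<m} with {0..m - 1}.\<close>
  have "m > 0" using c fin m by (metis card_gt_0_iff empty_iff)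
  then have I: "{0..<m} = {0..m - 1}" by auto
  obtain k where k: "k \<in> {0..m - 1}" "h k = c" using h c(1) I by (metis bij_betw_iff_bijections)
  \<comment> \<open>A swap brings an unbounded component to index 0.\<close>
  have "bij_betw (Transposition.transpose 0 k) {0..m - 1} {0..m - 1}"
    using k(1) by (intro bij_betw_transpose_iff) auto
  then have "bij_betw (h \<circ> Transposition.transpose 0 k) {0..m - 1} ?C"
    using h unfolding I by (rule bij_betw_trans)
  moreover have "(h \<circ> Transposition.transpose 0 k) 0 = c" using k by simp
  ultimately have "exterior_enumeration \<Omega> m (h \<circ> Transposition.transpose 0 k)"
    using c(2) unfolding exterior_enumeration_def by metis
  then show thesis by (rule that)
qed

lemma exterior_enumeration_props:
  fixes \<Omega> :: "(real^3) set"
  assumes "exterior_enumeration \<Omega> m \<Xi>"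
  shows "\<And>k. k \<le> m - 1 \<Longrightarrow> \<Xi> k \<in> components (- closure \<Omega>)"
    and "\<And>k l. k \<le> m - 1 \<Longrightarrow> l \<le> m - 1 \<Longrightarrow> \<Xi> k = \<Xi> l \<Longrightarrow> k = l"
    and "- closure \<Omega> = (\<Union>k\<le>m - 1. \<Xi> k)"
    and "\<not> bounded (\<Xi> 0)"
    and "\<And>k. k \<le> m - 1 \<Longrightarrow> open (\<Xi> k)"
    and "\<And>k. bounded \<Omega> \<Longrightarrow> k \<le> m - 1 \<Longrightarrow> k \<noteq> 0 \<Longrightarrow> bounded (\<Xi> k)"
proof -
  have b: "bij_betw \<Xi> {0..m - 1} (components (- closure \<Omega>))" and u: "\<not> bounded (\<Xi> 0)"
    using assms by (auto simp: exterior_enumeration_def)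
  show 1: "\<Xi> k \<in> components (- closure \<Omega>)" if "k \<le> m - 1" for k using b that by (auto simp: bij_betw_def)
  show 2: "k = l" if "k \<le> m - 1" "l \<le> m - 1" "\<Xi> k = \<Xi> l" for k l
    using b that by (auto simp: bij_betw_def inj_on_def)
  have "\<Xi> ` {0..m - 1} = components (- closure \<Omega>)" using b by (simp add: bij_betw_def)
  then show "- closure \<Omega> = (\<Union>k\<le>m - 1. \<Xi> k)" using Union_components[of "- closure \<Omega>"] by (simp add: atLeast0AtMost)
  show "\<not> bounded (\<Xi> 0)" by (rule u)
  show "open (\<Xi> k)" if "k \<le> m - 1" for k by (rule open_components[OF _ 1[OF that]]) (simp add: open_Compl)
  \<comment> \<open>In dimension at least two a set with bounded complement has only one unbounded
    component, and index 0 holds it.\<close>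
  show "bounded (\<Xi> k)" if "bounded \<Omega>" "k \<le> m - 1" "k \<noteq> 0" for k
    using cobounded_unique_unbounded_components[of "- closure \<Omega>" "\<Xi> 0" "\<Xi> k"] 1[of 0] 1[OF that(2)] u 2[of 0 k] that by auto
qed

text \<open>The second conclusion is stronger than the definition of a cut-off family: these
  functions are constant near the closures of the components. That is what gives their rigid motions
  symmetric gradients with compact support in \<Omega>.\<close>

lemma cutoff_family_exists:
  fixes \<Omega> :: "(real^3) set"
  assumes \<Omega>: "open \<Omega>" "bounded \<Omega>" "continuous_boundary \<Omega>" and en: "exterior_enumeration \<Omega> m \<Xi>"
  obtains \<xi> where "is_cutoff_family m \<Xi> \<xi>"
    "\<And>l k. l \<in> {1..m - 1} \<Longrightarrow> k \<le> m - 1 \<Longrightarrow> \<exists>W. open W \<and> closure (\<Xi> k) \<subseteq> W \<and> (\<forall>x\<in>W. \<xi> l x = (if k = l then 1 else 0))"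
proof -
  note P = exterior_enumeration_props[OF en]
  define A where "A l = (\<Union>k\<in>{0..m - 1} - {l}. closure (\<Xi> k))" for l
  \<comment> \<open>Voronoi cells: the points closer to the l-th closure than to all the others.
    They are open and pairwise disjoint, which yields the disjoint supports.\<close>
  define O' where "O' l = {x. infdist x (closure (\<Xi> l)) < infdist x (A l)}" for l
  have clA: "closed (A l)" for l unfolding A_def by (intro closed_UN) auto
  have ne: "closure (\<Xi> k) \<noteq> {}" if "k \<le> m - 1" for k
    using in_components_nonempty[OF P(1)[OF that]] by simp
  have neA: "A l \<noteq> {}" if "l \<in> {1..m - 1}" for l
    using ne[of 0] that unfolding A_def by fastforce
  have disj: "closure (\<Xi> k) \<inter> closure (\<Xi> l) = {}" if "k \<le> m - 1" "l \<le> m - 1" "k \<noteq> l" for k l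
    using closure_components_disjoint[OF \<Omega>(1,3) P(1)[OF that(1)] P(1)[OF that(2)]] P(2) that by blast
  have openO: "open (O' l)" for l
    unfolding O'_def by (intro open_Collect_less continuous_intros)
  have sub: "closure (\<Xi> l) \<subseteq> O' l" if l: "l \<in> {1..m - 1}" for l
  proof
    fix x assume x: "x \<in> closure (\<Xi> l)"
    have "x \<notin> A l"
    proof
      assume "x \<in> A l"
      then obtain k where "k \<in> {0..m - 1} - {l}" "x \<in> closure (\<Xi> k)" unfolding A_def by blast
      then have "k \<le> m - 1" "k \<noteq> l" "x \<in> closure (\<Xi> k)" by auto
      then show False using disj[of k l] x l by auto
    qed
    then have "infdist x (A l) > 0" using infdist_pos_not_in_closed[OF clA neA[OF l]] by simp
    then show "x \<in> O' l" using x by (simp add: O'_def)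
  qed
  have disjO: "O' l \<inter> O' k = {}" if lk: "l \<in> {1..m - 1}" "k \<in> {1..m - 1}" "l \<noteq> k" for l k
  proof (rule ccontr)
    assume "O' l \<inter> O' k \<noteq> {}"
    then obtain x where x: "infdist x (closure (\<Xi> l)) < infdist x (A l)" "infdist x (closure (\<Xi> k)) < infdist x (A k)"
      by (auto simp: O'_def)
    have "infdist x (A l) \<le> infdist x (closure (\<Xi> k))"
      by (rule infdist_mono) (use lk ne[of k] in \<open>auto simp: A_def\<close>)
    moreover have "infdist x (A k) \<le> infdist x (closure (\<Xi> l))"
      by (rule infdist_mono) (use lk ne[of l] in \<open>auto simp: A_def\<close>)
    ultimately show False using x by linarith
  qed
  have AO: "O' l \<inter> A l = {}" for l
  proof -
    have False if "x \<in> O' l" "x \<in> A l" for x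
      using that infdist_nonneg[of x "closure (\<Xi> l)"] by (simp add: O'_def)
    then show ?thesis by blast
  qed
  have "\<forall>l\<in>{1..m - 1}. \<exists>\<theta>::real^3 \<Rightarrow> real. \<theta> \<in> Cc_inf (O' l) \<and> (\<exists>W. open W \<and> closure (\<Xi> l) \<subseteq> W \<and> (\<forall>x\<in>W. \<theta> x = 1))"
  proof
    fix l assume l: "l \<in> {1..m - 1}"
    have "compact (closure (\<Xi> l))" using P(6)[OF \<Omega>(2), of l] l by (auto simp: compact_closure)
    from smooth_urysohn[OF this openO sub[OF l]]
    show "\<exists>\<theta>::real^3 \<Rightarrow> real. \<theta> \<in> Cc_inf (O' l) \<and> (\<exists>W. open W \<and> closure (\<Xi> l) \<subseteq> W \<and> (\<forall>x\<in>W. \<theta> x = 1))" by metis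
  qed
  then obtain \<xi> :: "nat \<Rightarrow> real^3 \<Rightarrow> real" where \<xi>: "\<And>l. l \<in> {1..m - 1} \<Longrightarrow> \<xi> l \<in> Cc_inf (O' l)"
    "\<And>l. l \<in> {1..m - 1} \<Longrightarrow> \<exists>W. open W \<and> closure (\<Xi> l) \<subseteq> W \<and> (\<forall>x\<in>W. \<xi> l x = 1)"
    by metis
  have supp: "supp (\<xi> l) \<subseteq> O' l" if "l \<in> {1..m - 1}" for l using \<xi>(1)[OF that] by (simp add: Cc_inf_def)
  have strong: "\<exists>W. open W \<and> closure (\<Xi> k) \<subseteq> W \<and> (\<forall>x\<in>W. \<xi> l x = (if k = l then 1 else 0))"
    if l: "l \<in> {1..m - 1}" and k: "k \<le> m - 1" for l k
  proof (cases "k = l")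
    case True then show ?thesis using \<xi>(2)[OF l] by simp
  next
    case False
    have "open (- supp (\<xi> l))" unfolding supp_def by (rule open_Compl[OF closed_closure])
    moreover have "closure (\<Xi> k) \<subseteq> A l" using False k by (auto simp: A_def)
    then have "closure (\<Xi> k) \<subseteq> - supp (\<xi> l)" using AO[of l] supp[OF l] by blast
    ultimately show ?thesis using False not_in_supp[of _ "\<xi> l"] by (intro exI[of _ "- supp (\<xi> l)"]) auto
  qed
  have "is_cutoff_family m \<Xi> \<xi>"
    unfolding is_cutoff_family_def
  proof (intro conjI ballI impI)
    fix l assume l: "l \<in> {1..m - 1}"
    show "\<xi> l \<in> Cc_inf UNIV" using Cc_inf_mono[OF _ \<xi>(1)[OF l]] by blast
    show "\<exists>U. open U \<and> \<Xi> l \<subseteq> U \<and> (\<forall>x\<in>U. \<xi> l x = 1)"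
      using strong[OF l, of l] l closure_subset[of "\<Xi> l"] by (auto dest: subset_trans)
    fix k
    show "supp (\<xi> l) \<inter> supp (\<xi> k) = {}" if "k \<in> {1..m - 1}" "l \<noteq> k"
      using disjO[OF l that] supp[OF l] supp[OF that(1)] by blast
    show "\<exists>U. open U \<and> \<Xi> k \<subseteq> U \<and> (\<forall>x\<in>U. \<xi> l x = 0)" if "k \<in> {0..m - 1} - {l}"
      using strong[OF l, of k] that closure_subset[of "\<Xi> k"] by (auto dest: subset_trans)
  qed
  then show thesis using that strong by blast
qed

section \<open>Extension by zero and $H^1_0$\<close>

text \<open>The rank one matrix y (grad \<beta>)^T, the second term in the product rule for the
  Jacobian.\<close>

definition tens :: "(real^3 \<Rightarrow> real) \<Rightarrow> real^3 \<Rightarrow> real^3 \<Rightarrow> real^3^3" where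
  "tens \<beta> x y = (\<chi> i j. y $ i * pd j \<beta> x)"

text \<open>Multiplication by a cut-off on pairs: the Leibniz rule taken as a definition, hence
  bounded linear in both components.\<close>

definition gmul :: "(real^3 \<Rightarrow> real) \<Rightarrow> vec_L2 \<times> ten_L2 \<Rightarrow> vec_L2 \<times> ten_L2" where
  "gmul \<beta> p = (opL2 (\<lambda>x y. \<beta> x *\<^sub>R y) (fst p), opL2 (\<lambda>x A. \<beta> x *\<^sub>R A) (snd p) + opL2 (tens \<beta>) (fst p))"

lemma fibrewise_Cc_inf:
  fixes \<beta> :: "'a::euclidean_space \<Rightarrow> real"
  assumes "\<beta> \<in> Cc_inf \<Omega>" shows "fibrewise (\<lambda>x (y::'b::euclidean_space). \<beta> x *\<^sub>R y)"
proof -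
  obtain B where "\<And>x. norm (\<beta> x) \<le> B" using Cc_inf_bounded[OF assms] by metis
  then show ?thesis
    by (intro fibrewise_scaleR[where M=B] smooth_measurable Cc_inf_smooth[OF assms]) auto
qed

lemma fibrewise_tens:
  assumes \<beta>: "\<beta> \<in> Cc_inf \<Omega>" shows "fibrewise (tens \<beta>)"
  unfolding fibrewise_def
proof (intro conjI ballI)
  define g where "g = (\<lambda>x. (\<chi> j. pd j \<beta> x) :: real^3)"
  have g: "g \<in> Cc_inf \<Omega>"
    by (rule Cc_inf_vecI) (simp add: g_def Cc_inf_dird \<beta>)
  obtain B where B: "\<And>x. norm (g x) \<le> B" using Cc_inf_bounded[OF g] by metis
  show "\<forall>x. linear (tens \<beta> x)"
    by (auto intro!: linearI simp: tens_def vec_eq_iff algebra_simps)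
  have "norm (tens \<beta> x y) \<le> B * norm y" for x y
  proof -
    have "(norm (tens \<beta> x y))\<^sup>2 = (norm (g x) * norm y)\<^sup>2"
      by (simp add: power_mult_distrib power2_norm_eq_inner inner_matrix inner_vec_def tens_def g_def sum_product mult_ac)
    then have "norm (tens \<beta> x y) = norm (g x) * norm y" by (simp add: power2_eq_iff_nonneg)
    then show ?thesis using B by (simp add: mult_right_mono)
  qed
  then show "\<exists>M. \<forall>x y. norm (tens \<beta> x y) \<le> M * norm y" by blast
  fix f :: "real^3 \<Rightarrow> real^3" assume f: "f \<in> borel_measurable lebesgue"
  have "continuous_on UNIV (\<lambda>x::(real^3) \<times> (real^3). \<chi> i j. fst x $ i * snd x $ j)"
    by (intro continuous_on_vec_lambda continuous_intros)
  from borel_measurable_continuous_Pair[OF f smooth_measurable[OF Cc_inf_smooth[OF g]] this]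
  show "(\<lambda>x. tens \<beta> x (f x)) \<in> borel_measurable lebesgue" by (simp add: tens_def g_def)
qed

lemma bounded_linear_gmul:
  assumes \<beta>: "\<beta> \<in> Cc_inf \<Omega>" shows "bounded_linear (gmul \<beta>)"
  unfolding gmul_def
  by (intro bounded_linear_Pair bounded_linear_add bounded_linear_compose[OF bounded_linear_opL2[OF fibrewise_Cc_inf[OF \<beta>]]]
      bounded_linear_compose[OF bounded_linear_opL2[OF fibrewise_tens[OF \<beta>]]] bounded_linear_fst bounded_linear_snd)

lemma grad_c_scale:
  assumes "smooth \<beta>" "smooth \<phi>"
  shows "grad_c (\<lambda>x. \<beta> x *\<^sub>R \<phi> x) x = \<beta> x *\<^sub>R grad_c \<phi> x + tens \<beta> x (\<phi> x)"
  by (simp add: vec_eq_iff grad_c_nth dird_scaleR[OF assms] tens_def)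

lemma gmul_test:
  assumes \<beta>: "\<beta> \<in> Cc_inf \<Omega>" and \<phi>: "\<phi> \<in> Cc_inf UNIV"
  shows "gmul \<beta> (abs_L2 \<phi>, abs_L2 (grad_c \<phi>)) = (abs_L2 (\<lambda>x. \<beta> x *\<^sub>R \<phi> x), abs_L2 (grad_c (\<lambda>x. \<beta> x *\<^sub>R \<phi> x)))"
proof -
  note sq = Cc_inf_sq[OF \<phi>] Cc_inf_sq[OF Cc_inf_grad_c[OF \<phi>]]
  have "grad_c (\<lambda>x. \<beta> x *\<^sub>R \<phi> x) = (\<lambda>x. \<beta> x *\<^sub>R grad_c \<phi> x + tens \<beta> x (\<phi> x))"
    using grad_c_scale[OF Cc_inf_smooth[OF \<beta>] Cc_inf_smooth[OF \<phi>]] by blast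
  then show ?thesis
    unfolding gmul_def fst_conv snd_conv opL2_abs[OF fibrewise_Cc_inf[OF \<beta>] sq(1)] opL2_abs[OF fibrewise_Cc_inf[OF \<beta>] sq(2)]
      opL2_abs[OF fibrewise_tens[OF \<beta>] sq(1)]
    by (simp add: abs_plus[OF fibrewise_sq[OF fibrewise_Cc_inf[OF \<beta>] sq(2)] fibrewise_sq[OF fibrewise_tens[OF \<beta>] sq(1)]])
qed

text \<open>The product rule is continuous in the graph norm, so test fields suffice; a cut-off
  supported in \<Omega> carries whole-space pairs into the graph over \<Omega>.\<close>

lemma gmul_H10:
  assumes \<beta>: "\<beta> \<in> Cc_inf \<Omega>" and p: "p \<in> H10_graph UNIV"
  shows "gmul \<beta> p \<in> H10_graph \<Omega>"
  using p
proof (rule H10_graph_induct)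
  have "closed (gmul \<beta> -` H10_graph \<Omega>)"
    by (rule closed_vimage[OF closed_H10_graph linear_continuous_on[OF bounded_linear_gmul[OF \<beta>]]])
  then show "closed {p. gmul \<beta> p \<in> H10_graph \<Omega>}" by (simp add: vimage_def)
  fix \<phi> :: vec_field assume \<phi>: "\<phi> \<in> Cc_inf UNIV"
  show "gmul \<beta> (abs_L2 \<phi>, abs_L2 (grad_c \<phi>)) \<in> H10_graph \<Omega>"
    unfolding gmul_test[OF \<beta> \<phi>]
    by (rule H10_graph_test[OF Cc_inf_smooth_scaleR_right[OF \<beta> Cc_inf_smooth[OF \<phi>]]])
qed

text \<open>Field and Jacobian are tracked together, so unions, differences and products with
  cut-offs can be handled set by set on representatives.\<close>

definition vanishes_on :: "vec_L2 \<times> ten_L2 \<Rightarrow> (real^3) set \<Rightarrow> bool" where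
  "vanishes_on p S \<longleftrightarrow> (AE x in lebesgue. x \<in> S \<longrightarrow> rep_L2 (fst p) x = 0 \<and> rep_L2 (snd p) x = 0)"

lemma vanishes_on_Un:
  assumes "vanishes_on p S" "vanishes_on p T" shows "vanishes_on p (S \<union> T)"
  using assms unfolding vanishes_on_def by eventually_elim auto

lemma vanishes_on_subset: "vanishes_on p S \<Longrightarrow> T \<subseteq> S \<Longrightarrow> vanishes_on p T"
  unfolding vanishes_on_def by (auto elim!: AE_mp)

lemma vanishes_on_UNIV: "vanishes_on p UNIV \<Longrightarrow> p = 0"
proof -
  assume p: "vanishes_on p UNIV"
  have "fst p = 0"
    by (rule L2_eqI) (use p rep_zero[where 'a="real^3" and 'b="real^3"] in \<open>auto simp: vanishes_on_def elim!: AE_mp\<close>)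
  moreover have "snd p = 0"
    by (rule L2_eqI) (use p rep_zero[where 'a="real^3" and 'b="real^3^3"] in \<open>auto simp: vanishes_on_def elim!: AE_mp\<close>)
  ultimately show ?thesis by (simp add: prod_eq_iff)
qed

lemma vanishes_on_diff:
  assumes "vanishes_on p S" "vanishes_on q S" shows "vanishes_on (p - q) S"
  using assms unfolding vanishes_on_def fst_diff snd_diff
  using rep_minus[of "fst p" "fst q"] rep_minus[of "snd p" "snd q"] by eventually_elim auto

lemma rep_gmul:
  assumes \<beta>: "\<beta> \<in> Cc_inf \<Omega>"
  shows "AE x in lebesgue. rep_L2 (fst (gmul \<beta> p)) x = \<beta> x *\<^sub>R rep_L2 (fst p) x \<and>
    rep_L2 (snd (gmul \<beta> p)) x = \<beta> x *\<^sub>R rep_L2 (snd p) x + tens \<beta> x (rep_L2 (fst p) x)"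
  unfolding gmul_def fst_conv snd_conv
  using rep_opL2[OF fibrewise_Cc_inf[OF \<beta>], of "fst p"] rep_opL2[OF fibrewise_Cc_inf[OF \<beta>], of "snd p"]
    rep_opL2[OF fibrewise_tens[OF \<beta>], of "fst p"]
    rep_plus[of "opL2 (\<lambda>x A. \<beta> x *\<^sub>R A) (snd p)" "opL2 (tens \<beta>) (fst p)"]
  by eventually_elim simp

lemma tens_0: "tens \<beta> x 0 = 0"
  by (simp add: tens_def vec_eq_iff)

lemma gmul_vanishes:
  assumes "\<beta> \<in> Cc_inf \<Omega>" "vanishes_on p S" shows "vanishes_on (gmul \<beta> p) S"
  using rep_gmul[OF assms(1), of p] assms(2) unfolding vanishes_on_def by eventually_elim (simp add: tens_0)

lemma tens_const:
  assumes "open V" "x \<in> V" "\<And>y. y \<in> V \<Longrightarrow> \<beta> y = c" shows "tens \<beta> x y = 0"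
proof -
  have "(\<beta> has_derivative (\<lambda>h. 0)) (at x)"
    by (rule has_derivative_transform_within_open[OF has_derivative_const[of c] assms(1,2)]) (simp add: assms(3))
  then show ?thesis by (simp add: tens_def vec_eq_iff dird_eq)
qed

lemma gmul_vanishes_zero:
  assumes "\<beta> \<in> Cc_inf \<Omega>" "open V" "\<And>y. y \<in> V \<Longrightarrow> \<beta> y = 0" shows "vanishes_on (gmul \<beta> p) V"
  unfolding vanishes_on_def using rep_gmul[OF assms(1), of p]
  by (rule AE_mp, intro AE_I2) (use tens_const[OF assms(2) _ assms(3)] assms(3) in auto)

lemma gmul_vanishes_one:
  assumes "\<beta> \<in> Cc_inf \<Omega>" "open V" "\<And>y. y \<in> V \<Longrightarrow> \<beta> y = 1" shows "vanishes_on (p - gmul \<beta> p) V"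
proof -
  have t: "tens \<beta> x y = 0" if "x \<in> V" for x y by (rule tens_const[OF assms(2) that assms(3)])
  have "AE x in lebesgue. rep_L2 (fst (p - gmul \<beta> p)) x = rep_L2 (fst p) x - \<beta> x *\<^sub>R rep_L2 (fst p) x \<and>
    rep_L2 (snd (p - gmul \<beta> p)) x = rep_L2 (snd p) x - (\<beta> x *\<^sub>R rep_L2 (snd p) x + tens \<beta> x (rep_L2 (fst p) x))"
    unfolding fst_diff snd_diff
    using rep_gmul[OF assms(1), of p] rep_minus[of "fst p" "fst (gmul \<beta> p)"] rep_minus[of "snd p" "snd (gmul \<beta> p)"]
    by eventually_elim simp
  then show ?thesis
    unfolding vanishes_on_def by (rule AE_mp, intro AE_I2) (use t assms(3) in auto)
qed

section \<open>Translation of pairs\<close>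

definition gtr :: "real^3 \<Rightarrow> vec_L2 \<times> ten_L2 \<Rightarrow> vec_L2 \<times> ten_L2" where
  "gtr a p = (trL2 a (fst p), trL2 a (snd p))"

lemma bounded_linear_gtr: "bounded_linear (gtr a)"
  unfolding gtr_def
  by (intro bounded_linear_Pair bounded_linear_compose[OF bounded_linear_trL2] bounded_linear_fst bounded_linear_snd)

lemma gtr_H10:
  assumes "p \<in> H10_graph UNIV" shows "gtr a p \<in> H10_graph UNIV"
  using assms
proof (rule H10_graph_induct)
  have "closed (gtr a -` H10_graph UNIV)"
    by (rule closed_vimage[OF closed_H10_graph linear_continuous_on[OF bounded_linear_gtr]])
  then show "closed {p. gtr a p \<in> H10_graph UNIV}" by (simp add: vimage_def)
  fix \<phi> :: vec_field assume \<phi>: "\<phi> \<in> Cc_inf UNIV"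
  have g: "grad_c (\<lambda>x. \<phi> (x + a)) = (\<lambda>x. grad_c \<phi> (x + a))"
    by (simp add: fun_eq_iff vec_eq_iff grad_c_nth dird_shift[OF Cc_inf_smooth[OF \<phi>]])
  have "(\<lambda>x. \<phi> (x + a)) \<in> Cc_inf UNIV" using Cc_inf_mono[OF _ Cc_inf_shift[OF \<phi>, of a]] by blast
  from H10_graph_test[OF this]
  show "gtr a (abs_L2 \<phi>, abs_L2 (grad_c \<phi>)) \<in> H10_graph UNIV"
    by (simp add: gtr_def trL2_abs Cc_inf_sq[OF \<phi>] Cc_inf_sq[OF Cc_inf_grad_c[OF \<phi>]] g)
qed

lemma gtr_vanishes:
  assumes "vanishes_on p (- C)" shows "vanishes_on (gtr a p) (- ((\<lambda>y. y - a) ` C))"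
proof -
  have "AE x in lebesgue. x + a \<in> - C \<longrightarrow> rep_L2 (fst p) (x + a) = 0 \<and> rep_L2 (snd p) (x + a) = 0"
    using AE_shift[OF assms[unfolded vanishes_on_def], of a] .
  moreover note rep_trL2[of a "fst p"] rep_trL2[of a "snd p"]
  ultimately show ?thesis
    unfolding vanishes_on_def gtr_def fst_conv snd_conv
  proof eventually_elim
    case (elim x)
    then show ?case by (auto simp: image_iff)
  qed
qed

lemma H10_graph_closure_test:
  assumes "p \<in> H10_graph UNIV"
  shows "fst p \<in> closure (abs_L2 ` Cc_inf UNIV)" "snd p \<in> closure (abs_L2 ` Cc_inf UNIV)"
proof -
  have "fst p \<in> closure (abs_L2 ` Cc_inf UNIV) \<and> snd p \<in> closure (abs_L2 ` Cc_inf UNIV)"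
    using assms
  proof (rule H10_graph_induct)
    have "{p::vec_L2 \<times> ten_L2. fst p \<in> closure (abs_L2 ` Cc_inf UNIV) \<and> snd p \<in> closure (abs_L2 ` Cc_inf UNIV)}
        = closure (abs_L2 ` Cc_inf UNIV) \<times> closure (abs_L2 ` Cc_inf UNIV)" by auto
    then show "closed {p::vec_L2 \<times> ten_L2. fst p \<in> closure (abs_L2 ` Cc_inf UNIV) \<and> snd p \<in> closure (abs_L2 ` Cc_inf UNIV)}"
      by (simp add: closed_Times)
    fix \<phi> :: vec_field assume "\<phi> \<in> Cc_inf UNIV"
    then show "fst (abs_L2 \<phi>, abs_L2 (grad_c \<phi>)) \<in> closure (abs_L2 ` Cc_inf UNIV) \<and>
        snd (abs_L2 \<phi>, abs_L2 (grad_c \<phi>)) \<in> closure (abs_L2 ` Cc_inf UNIV)"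
      using Cc_inf_grad_c[of \<phi> UNIV] by (auto intro!: subsetD[OF closure_subset])
  qed
  then show "fst p \<in> closure (abs_L2 ` Cc_inf UNIV)" "snd p \<in> closure (abs_L2 ` Cc_inf UNIV)" by auto
qed

text \<open>Once its support is pushed compactly into \<Omega>, the pair equals its own product with
  a cut-off supported in \<Omega> and so lies in the graph over \<Omega>. Letting the translation
  tend to zero, closedness of the graph brings back the original pair.\<close>

lemma H10_graph_translate:
  assumes \<Omega>: "open \<Omega>" and p: "p \<in> H10_graph UNIV" and C: "compact C" "vanishes_on p (- C)"
    and \<tau>0: "\<tau>0 > 0" "\<And>\<tau>. 0 < \<tau> \<Longrightarrow> \<tau> < \<tau>0 \<Longrightarrow> (\<lambda>y. y - \<tau> *\<^sub>R u) ` C \<subseteq> \<Omega>"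
  shows "p \<in> H10_graph \<Omega>"
proof -
  have shifted: "gtr (\<tau> *\<^sub>R u) p \<in> H10_graph \<Omega>" if \<tau>: "0 < \<tau>" "\<tau> < \<tau>0" for \<tau>
  proof -
    let ?K = "(\<lambda>y. y - \<tau> *\<^sub>R u) ` C"
    have K: "compact ?K" by (intro compact_continuous_image continuous_intros C)
    obtain \<theta> :: "real^3 \<Rightarrow> real" and V where \<theta>: "\<theta> \<in> Cc_inf \<Omega>" "open V" "?K \<subseteq> V" "\<And>x. x \<in> V \<Longrightarrow> \<theta> x = 1"
      using smooth_urysohn[OF K \<Omega> \<tau>0(2)[OF \<tau>]] by metis
    let ?q = "gtr (\<tau> *\<^sub>R u) p"
    have v1: "vanishes_on (?q - gmul \<theta> ?q) V" by (rule gmul_vanishes_one[OF \<theta>(1,2,4)])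
    have v2: "vanishes_on (?q - gmul \<theta> ?q) (- ?K)"
      by (intro vanishes_on_diff gmul_vanishes[OF \<theta>(1)] gtr_vanishes C)
    have "vanishes_on (?q - gmul \<theta> ?q) UNIV"
      by (rule vanishes_on_subset[OF vanishes_on_Un[OF v1 v2]]) (use \<theta>(3) in blast)
    then have "?q = gmul \<theta> ?q" using vanishes_on_UNIV by fastforce
    then show ?thesis using gmul_H10[OF \<theta>(1) gtr_H10[OF p]] by metis
  qed
  have "\<exists>y\<in>H10_graph \<Omega>. dist y p < e" if e: "e > 0" for e
  proof -
    obtain d1 where d1: "d1 > 0" "\<And>a. norm a < d1 \<Longrightarrow> norm (trL2 a (fst p) - fst p) < e / 2"
      using trL2_continuous[OF H10_graph_closure_test(1)[OF p], of "e / 2"] e by auto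
    obtain d2 where d2: "d2 > 0" "\<And>a. norm a < d2 \<Longrightarrow> norm (trL2 a (snd p) - snd p) < e / 2"
      using trL2_continuous[OF H10_graph_closure_test(2)[OF p], of "e / 2"] e by auto
    \<comment> \<open>Below \<tau>0, so that the translate is admissible, and short enough for both
      components to move by less than e/2. The summand 1 covers u = 0, the case of inner
      points.\<close>
    define \<tau> where "\<tau> = min (\<tau>0 / 2) (min d1 d2 / (2 * (norm u + 1)))"
    have n: "norm u + 1 > 0" by (simp add: add_nonneg_pos)
    have "min d1 d2 / (2 * (norm u + 1)) > 0" using d1 d2 n by simp
    then have "\<tau> > 0" using \<tau>0(1) unfolding \<tau>_def min_less_iff_conj by simp
    moreover have "\<tau> \<le> \<tau>0 / 2" unfolding \<tau>_def by (rule min.cobounded1)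
    ultimately have \<tau>: "0 < \<tau>" "\<tau> < \<tau>0" using \<tau>0(1) by linarith+
    have "\<tau> * norm u \<le> min d1 d2 / (2 * (norm u + 1)) * (norm u + 1)"
      using \<tau>(1) by (intro mult_mono) (auto simp: \<tau>_def)
    also have "\<dots> = min d1 d2 / 2" using n by (simp add: field_simps)
    also have "\<dots> < min d1 d2" using d1(1) d2(1) by linarith
    finally have a: "norm (\<tau> *\<^sub>R u) < min d1 d2" using \<tau> by simp
    have "dist (gtr (\<tau> *\<^sub>R u) p) p \<le> dist (trL2 (\<tau> *\<^sub>R u) (fst p)) (fst p) + dist (trL2 (\<tau> *\<^sub>R u) (snd p)) (snd p)"
      unfolding gtr_def dist_prod_def fst_conv snd_conv by (rule sqrt_sum_squares_le_sum) auto
    also have "\<dots> < e" using d1(2)[of "\<tau> *\<^sub>R u"] d2(2)[of "\<tau> *\<^sub>R u"] a by (simp add: dist_norm)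
    finally show ?thesis using shifted[OF \<tau>] by blast
  qed
  then have "p \<in> closure (H10_graph \<Omega>)" by (simp add: closure_approachable)
  then show ?thesis using closed_H10_graph by simp
qed

text \<open>The pair is peeled off by cut-offs living in boundary charts; each piece can be pushed into
  the domain.\<close>

lemma H10_graph_vanishing:
  assumes \<Omega>: "open \<Omega>" "bounded \<Omega>" "continuous_boundary \<Omega>"
    and p: "p \<in> H10_graph UNIV" "vanishes_on p (- closure \<Omega>)"
  shows "p \<in> H10_graph \<Omega>"
proof -
  \<comment> \<open>Quantified over all pairs \<open>q\<close> rather than for \<open>p\<close>,
    since the peeling below applies each cut-off to what the earlier ones have left over.\<close>
  have "\<forall>x\<in>closure \<Omega>. \<exists>r>0. \<exists>\<beta>::real^3 \<Rightarrow> real. \<beta> \<in> Cc_inf UNIV \<and> (\<forall>y\<in>ball x r. \<beta> y = 1) \<and>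
    (\<forall>q. q \<in> H10_graph UNIV \<longrightarrow> vanishes_on q (- closure \<Omega>) \<longrightarrow> gmul \<beta> q \<in> H10_graph \<Omega>)"
  proof
    fix x assume x: "x \<in> closure \<Omega>"
    obtain N u where N: "open N" "x \<in> N"
      "\<And>C. compact C \<Longrightarrow> C \<subseteq> N \<inter> closure \<Omega> \<Longrightarrow> \<exists>\<tau>0>0. \<forall>\<tau>. 0 < \<tau> \<and> \<tau> < \<tau>0 \<longrightarrow> (\<lambda>y. y - \<tau> *\<^sub>R u) ` C \<subseteq> \<Omega>"
      using inward_translation[OF \<Omega>(1,3) x] by metis
    obtain R where R: "R > 0" "ball x R \<subseteq> N" using openE[OF N(1,2)] by blast
    obtain \<beta> :: "real^3 \<Rightarrow> real" where \<beta>: "\<beta> \<in> Cc_inf (ball x R)" "\<And>y. y \<in> cball x (R/2) \<Longrightarrow> \<beta> y = 1"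
      using smooth_bump[of "R/2" R x] R by (metis half_gt_zero_iff field_sum_of_halves less_add_same_cancel1)
    have "gmul \<beta> q \<in> H10_graph \<Omega>" if q: "q \<in> H10_graph UNIV" "vanishes_on q (- closure \<Omega>)" for q
    proof -
      obtain K where K: "compact K" "K \<subseteq> ball x R" "\<And>y. y \<notin> K \<Longrightarrow> \<beta> y = 0" using Cc_infE[OF \<beta>(1)] by metis
      define C where "C = K \<inter> closure \<Omega>"
      have C: "compact C" "C \<subseteq> N \<inter> closure \<Omega>" using K R by (auto simp: C_def)
      have "vanishes_on (gmul \<beta> q) (- K)"
        by (rule gmul_vanishes_zero[OF \<beta>(1)]) (use K compact_imp_closed open_Compl in auto)
      moreover have "vanishes_on (gmul \<beta> q) (- closure \<Omega>)" by (rule gmul_vanishes[OF \<beta>(1) q(2)])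
      ultimately have v: "vanishes_on (gmul \<beta> q) (- C)" using vanishes_on_Un by (simp add: C_def Compl_Int)
      obtain \<tau>0 where "\<tau>0 > 0" "\<forall>\<tau>. 0 < \<tau> \<and> \<tau> < \<tau>0 \<longrightarrow> (\<lambda>y. y - \<tau> *\<^sub>R u) ` C \<subseteq> \<Omega>"
        using N(3)[OF C] by blast
      then show ?thesis
        using H10_graph_translate[OF \<Omega>(1) subsetD[OF H10_graph_mono[OF subset_UNIV] gmul_H10[OF \<beta>(1) q(1)]] C(1) v] by blast
    qed
    moreover have "\<beta> \<in> Cc_inf UNIV" using Cc_inf_mono[OF _ \<beta>(1)] by blast
    moreover have "\<forall>y\<in>ball x (R/2). \<beta> y = 1" using \<beta>(2) by auto
    ultimately show "\<exists>r>0. \<exists>\<beta>::real^3 \<Rightarrow> real. \<beta> \<in> Cc_inf UNIV \<and> (\<forall>y\<in>ball x r. \<beta> y = 1) \<and>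
      (\<forall>q. q \<in> H10_graph UNIV \<longrightarrow> vanishes_on q (- closure \<Omega>) \<longrightarrow> gmul \<beta> q \<in> H10_graph \<Omega>)"
      using R(1) half_gt_zero by blast
  qed
  then obtain r \<beta> where r: "\<And>x. x \<in> closure \<Omega> \<Longrightarrow> r x > 0"
    and \<beta>: "\<And>x. x \<in> closure \<Omega> \<Longrightarrow> (\<beta> x :: real^3 \<Rightarrow> real) \<in> Cc_inf UNIV"
      "\<And>x y. x \<in> closure \<Omega> \<Longrightarrow> y \<in> ball x (r x) \<Longrightarrow> \<beta> x y = 1"
      "\<And>x q. x \<in> closure \<Omega> \<Longrightarrow> q \<in> H10_graph UNIV \<Longrightarrow> vanishes_on q (- closure \<Omega>) \<Longrightarrow> gmul (\<beta> x) q \<in> H10_graph \<Omega>"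
    by metis
  have "compact (closure \<Omega>)" using \<Omega>(2) by (simp add: compact_closure)
  then obtain D where D: "D \<subseteq> closure \<Omega>" "finite D" "closure \<Omega> \<subseteq> (\<Union>x\<in>D. ball x (r x))"
    by (rule compactE_image[of _ "closure \<Omega>" "\<lambda>x. ball x (r x)"]) (use r in force)+
  \<comment> \<open>Invariant of the peeling: \<open>q\<close> is the remainder, zero outside and on
    the balls already treated, and the part removed so far lies over \<Omega>. Passing from q to (1
    - \<beta>) q clears one more ball and keeps the rest cleared.\<close>
  have "\<exists>q. q \<in> H10_graph UNIV \<and> vanishes_on q (- closure \<Omega>) \<and> vanishes_on q (\<Union>x\<in>D. ball x (r x)) \<and> p - q \<in> H10_graph \<Omega>"
    using D(2,1)
  proof (induction D rule: finite_induct)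
    case empty
    show ?case using p subspace_0[OF subspace_H10_graph] by (intro exI[of _ p]) (auto simp: vanishes_on_def)
  next
    case (insert x D)
    then obtain q where q: "q \<in> H10_graph UNIV" "vanishes_on q (- closure \<Omega>)" "vanishes_on q (\<Union>x\<in>D. ball x (r x))" "p - q \<in> H10_graph \<Omega>"
      by auto
    have x: "x \<in> closure \<Omega>" using insert by auto
    let ?q = "q - gmul (\<beta> x) q"
    have g: "gmul (\<beta> x) q \<in> H10_graph \<Omega>" by (rule \<beta>(3)[OF x q(1,2)])
    have "?q \<in> H10_graph UNIV"
      by (rule subspace_diff[OF subspace_H10_graph q(1) subsetD[OF H10_graph_mono[OF subset_UNIV] g]])
    moreover have "vanishes_on ?q (- closure \<Omega>)" by (rule vanishes_on_diff[OF q(2) gmul_vanishes[OF \<beta>(1)[OF x] q(2)]])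
    moreover have "vanishes_on ?q (\<Union>x\<in>insert x D. ball x (r x))"
    proof -
      have "vanishes_on ?q (ball x (r x))" by (rule gmul_vanishes_one[OF \<beta>(1)[OF x] open_ball \<beta>(2)[OF x]])
      moreover have "vanishes_on ?q (\<Union>x\<in>D. ball x (r x))" by (rule vanishes_on_diff[OF q(3) gmul_vanishes[OF \<beta>(1)[OF x] q(3)]])
      ultimately show ?thesis using vanishes_on_Un by simp
    qed
    moreover have "p - ?q \<in> H10_graph \<Omega>"
    proof -
      have "p - ?q = (p - q) + gmul (\<beta> x) q" by simp
      then show ?thesis using subspace_add[OF subspace_H10_graph q(4) g] by metis
    qed
    ultimately show ?case by blast
  qed
  then obtain q where q: "vanishes_on q (- closure \<Omega>)" "vanishes_on q (\<Union>x\<in>D. ball x (r x))" "p - q \<in> H10_graph \<Omega>" by blast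
  have "vanishes_on q UNIV"
    by (rule vanishes_on_subset[OF vanishes_on_Un[OF q(1,2)]]) (use D(3) in blast)
  then have "q = 0" by (rule vanishes_on_UNIV)
  then show ?thesis using q(3) by simp
qed

section \<open>Mollification\<close>

text \<open>Correlation instead of convolution: only translations of the kernel occur, at the price of a
  sign in the derivative.\<close>

definition cor :: "('a::euclidean_space \<Rightarrow> real) \<Rightarrow> ('a, 'b::euclidean_space) L2 \<Rightarrow> 'a \<Rightarrow> 'b" where
  "cor \<rho> u x = integral\<^sup>L lebesgue (\<lambda>y. \<rho> (y - x) *\<^sub>R rep_L2 u y)"

lemma Cc_inf_translate: "\<rho> \<in> Cc_inf UNIV \<Longrightarrow> (\<lambda>y. \<rho> (y - x)) \<in> Cc_inf UNIV"
  using Cc_inf_mono[OF _ Cc_inf_shift[of \<rho> UNIV "- x"]] by simp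

lemma sq_norm_rep: "sq_integrable (\<lambda>x. norm (rep_L2 u x))"
  by (rule sq_integrable_bound[OF _ sq_rep[of u], of _ 1]) auto

lemma integrable_scaleR_sq:
  fixes f :: "'a::euclidean_space \<Rightarrow> real" and g :: "'a \<Rightarrow> 'b::euclidean_space"
  assumes f: "sq_integrable f" and g: "sq_integrable g"
  shows "integrable lebesgue (\<lambda>y. f y *\<^sub>R g y)"
proof -
  have m [measurable]: "f \<in> borel_measurable lebesgue" "g \<in> borel_measurable lebesgue" using f g by (auto simp: sq_integrable_def)
  have "sq_integrable (\<lambda>x. norm (g x))" by (rule sq_integrable_bound[OF _ g, of _ 1]) auto
  then have "integrable lebesgue (\<lambda>y. f y * norm (g y))" using integrable_inner_sq[OF f] by fastforce
  then show ?thesis by (rule Bochner_Integration.integrable_bound) (auto simp: abs_mult)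
qed

lemma cor_integrable: "\<rho> \<in> Cc_inf UNIV \<Longrightarrow> integrable lebesgue (\<lambda>y. \<rho> (y - x) *\<^sub>R rep_L2 u y)"
  by (intro integrable_scaleR_sq sq_rep Cc_inf_sq[OF Cc_inf_translate])

text \<open>A point value of the mollified field is an L^2 pairing with a fixed test field, so L^2
  convergence of \<open>u\<close> gives pointwise convergence of the mollifications; with
  derivatives on the kernel it gives that of their derivatives too.\<close>

lemma cor_inner:
  assumes \<rho>: "\<rho> \<in> Cc_inf UNIV"
  shows "cor \<rho> u x \<bullet> b = u \<bullet> abs_L2 (\<lambda>y. \<rho> (y - x) *\<^sub>R b)"
proof -
  have t: "(\<lambda>y. \<rho> (y - x) *\<^sub>R b) \<in> Cc_inf UNIV"
    by (rule Cc_inf_smooth_scaleR_right[OF Cc_inf_translate[OF \<rho>] smooth_const])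
  have "cor \<rho> u x \<bullet> b = integral\<^sup>L lebesgue (\<lambda>y. (\<rho> (y - x) *\<^sub>R rep_L2 u y) \<bullet> b)"
    unfolding cor_def by (rule integral_inner_left[symmetric]) (rule cor_integrable[OF \<rho>])
  also have "\<dots> = u \<bullet> abs_L2 (\<lambda>y. \<rho> (y - x) *\<^sub>R b)"
    using inner_abs[OF sq_rep Cc_inf_sq[OF t], of u] by (simp add: abs_rep)
  finally show ?thesis .
qed

lemma cor_tendsto:
  assumes \<rho>: "\<rho> \<in> Cc_inf UNIV" and u: "U \<longlonglongrightarrow> u"
  shows "(\<lambda>n. cor \<rho> (U n) x) \<longlonglongrightarrow> cor \<rho> u x"
  by (subst tendsto_componentwise_iff) (auto simp: cor_inner[OF \<rho>] intro!: tendsto_intros u)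

lemma cor_dird_sum:
  fixes \<rho> :: "'a::euclidean_space \<Rightarrow> real"
  assumes \<rho>: "\<rho> \<in> Cc_inf UNIV"
  shows "cor (dird h \<rho>) u x = (\<Sum>b\<in>Basis. (h \<bullet> b) *\<^sub>R cor (dird b \<rho>) u x)"
proof -
  have "cor (dird h \<rho>) u x = integral\<^sup>L lebesgue (\<lambda>y. \<Sum>b\<in>Basis. (h \<bullet> b) *\<^sub>R (dird b \<rho> (y - x) *\<^sub>R rep_L2 u y))"
    unfolding cor_def dird_sum_Basis[OF Cc_inf_smooth[OF \<rho>], of h] by (simp add: scaleR_sum_left)
  also have "\<dots> = (\<Sum>b\<in>Basis. integral\<^sup>L lebesgue (\<lambda>y. (h \<bullet> b) *\<^sub>R (dird b \<rho> (y - x) *\<^sub>R rep_L2 u y)))"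
    by (rule Bochner_Integration.integral_sum) (intro integrable_scaleR_right cor_integrable Cc_inf_dird \<rho>)
  also have "\<dots> = (\<Sum>b\<in>Basis. (h \<bullet> b) *\<^sub>R cor (dird b \<rho>) u x)"
    unfolding cor_def by (intro sum.cong refl integral_scaleR_right)
  finally show ?thesis .
qed

text \<open>The first-order Taylor remainder is small uniformly in the base point, by the mean value
  theorem and uniform continuity of the partial derivatives. This permits differentiation under the
  integral.\<close>

lemma Cc_inf_uniform_derivative:
  fixes \<rho> :: "'a::euclidean_space \<Rightarrow> real"
  assumes \<rho>: "\<rho> \<in> Cc_inf \<Omega>" and e: "e > 0"
  obtains d where "d > 0" "\<And>z h. norm h < d \<Longrightarrow> \<bar>\<rho> (z + h) - \<rho> z - dird h \<rho> z\<bar> \<le> e * norm h"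
proof -
  have sm: "smooth \<rho>" by (rule Cc_inf_smooth[OF \<rho>])
  define e' where "e' = e / real DIM('a)"
  have e': "e' > 0" using e by (simp add: e'_def)
  have "\<forall>b. \<exists>d>0. \<forall>x y. dist x y < d \<longrightarrow> dist (dird b \<rho> x) (dird b \<rho> y) < e'"
    using Cc_inf_uniformly_continuous[OF Cc_inf_dird[OF \<rho>] e'] by metis
  then obtain D where D: "\<And>b. D b > 0" "\<And>b x y. dist x y < D b \<Longrightarrow> dist (dird b \<rho> x) (dird b \<rho> y) < e'" by metis
  define d where "d = Min (D ` (Basis :: 'a set))"
  have d: "d > 0" "\<And>b. b \<in> Basis \<Longrightarrow> d \<le> D b" using D(1) by (auto simp: d_def)
  show thesis
  proof
    show "d > 0" by (rule d(1))
    fix z h :: 'a assume h: "norm h < d"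
    have "\<exists>s. 0 < s \<and> s < 1 \<and> \<rho> (z + 1 *\<^sub>R h) - \<rho> (z + 0 *\<^sub>R h) = (1 - 0) * dird h \<rho> (z + s *\<^sub>R h)"
      by (rule MVT2[of 0 1 "\<lambda>s. \<rho> (z + s *\<^sub>R h)"]) (auto intro: smooth_line_deriv[OF sm])
    then obtain s where s: "0 < s" "s < 1" "\<rho> (z + 1 *\<^sub>R h) - \<rho> (z + 0 *\<^sub>R h) = (1 - 0) * dird h \<rho> (z + s *\<^sub>R h)"
      by blast
    have "\<rho> (z + h) - \<rho> z - dird h \<rho> z = dird h \<rho> (z + s *\<^sub>R h) - dird h \<rho> z" using s by simp
    also have "\<dots> = (\<Sum>b\<in>Basis. (h \<bullet> b) * (dird b \<rho> (z + s *\<^sub>R h) - dird b \<rho> z))"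
      unfolding dird_sum_Basis[OF sm, of h] by (simp add: sum_subtractf right_diff_distrib)
    also have "\<bar>\<dots>\<bar> \<le> (\<Sum>b\<in>(Basis::'a set). norm h * e')"
    proof (rule order_trans[OF sum_abs], rule sum_mono)
      fix b :: 'a assume b: "b \<in> Basis"
      have "dist (z + s *\<^sub>R h) z = s * norm h" using s by (simp add: dist_norm)
      also have "\<dots> \<le> 1 * norm h" using s by (intro mult_right_mono) auto
      also have "\<dots> < D b" using h d(2)[OF b] by linarith
      finally have "dist (dird b \<rho> (z + s *\<^sub>R h)) (dird b \<rho> z) < e'" by (rule D(2))
      then have "\<bar>dird b \<rho> (z + s *\<^sub>R h) - dird b \<rho> z\<bar> \<le> e'" by (simp add: dist_real_def)
      then show "\<bar>(h \<bullet> b) * (dird b \<rho> (z + s *\<^sub>R h) - dird b \<rho> z)\<bar> \<le> norm h * e'"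
        unfolding abs_mult using Basis_le_norm[OF b, of h] by (intro mult_mono) auto
    qed
    also have "\<dots> = e * norm h" by (simp add: e'_def)
    finally show "\<bar>\<rho> (z + h) - \<rho> z - dird h \<rho> z\<bar> \<le> e * norm h" .
  qed
qed

lemma cor_has_derivative:
  fixes \<rho> :: "'a::euclidean_space \<Rightarrow> real" and u :: "('a, 'b::euclidean_space) L2"
  assumes \<rho>: "\<rho> \<in> Cc_inf UNIV"
  shows "(cor \<rho> u has_derivative (\<lambda>h. - cor (dird h \<rho>) u x)) (at x)"
proof -
  have e: "(\<lambda>h. - cor (dird h \<rho>) u x) = (\<lambda>h. - (\<Sum>b\<in>Basis. (h \<bullet> b) *\<^sub>R cor (dird b \<rho>) u x))"
    by (rule ext, subst cor_dird_sum[OF \<rho>], rule refl)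
  have bl: "bounded_linear (\<lambda>h. - cor (dird h \<rho>) u x)"
    unfolding e
    by (rule linear_conv_bounded_linear[THEN iffD1], rule linearI)
       (simp_all add: inner_add_left scaleR_add_left sum.distrib scaleR_sum_right)
  have est: "\<exists>d>0. \<forall>h. norm h < d \<longrightarrow> norm (cor \<rho> u (x + h) - cor \<rho> u x + cor (dird h \<rho>) u x) \<le> e * norm h" if e: "e > 0" for e
  proof -
    obtain K where K: "compact K" "\<And>x. x \<notin> K \<Longrightarrow> \<rho> x = 0" using Cc_infE[OF \<rho>] by metis
    obtain R where R: "R > 0" "K \<subseteq> ball 0 R" using bounded_subset_ballD[OF compact_imp_bounded[OF K(1)], of 0] by blast
    have rho0: "\<rho> z = 0" "dird h \<rho> z = 0" if "norm z \<ge> R" for z h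
    proof -
      have z: "z \<notin> K" using R that by auto
      then show "\<rho> z = 0" using K by blast
      show "dird h \<rho> z = 0" by (rule dird_zero_open[where U="- K"]) (use K z compact_imp_closed in auto)
    qed
    \<comment> \<open>For |h| < 1 all three kernels in the remainder vanish outside this ball, so
      only the integral of |u| over it matters.\<close>
    let ?B = "cball x (R + 1)"
    have iB: "integrable lebesgue (\<lambda>y. indicator ?B y * norm (rep_L2 u y))"
      using integrable_inner_sq[OF sq_indicator[OF lmeasurable_cball[of x "R + 1"]] sq_norm_rep[of u]] by simp
    define M where "M = integral\<^sup>L lebesgue (\<lambda>y. indicator ?B y * norm (rep_L2 u y))"
    have M: "M \<ge> 0" unfolding M_def by (rule integral_nonneg_AE) auto
    \<comment> \<open>The denominator M + 1 absorbs the factor M from the integral of |u| over the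
      ball and cannot vanish.\<close>
    obtain d where d: "d > 0" "\<And>z h. norm h < d \<Longrightarrow> \<bar>\<rho> (z + h) - \<rho> z - dird h \<rho> z\<bar> \<le> e / (M + 1) * norm h"
      using Cc_inf_uniform_derivative[OF \<rho>, of "e / (M + 1)"] e M by (metis add_nonneg_pos divide_pos_pos zero_less_one)
    have "norm (cor \<rho> u (x + h) - cor \<rho> u x + cor (dird h \<rho>) u x) \<le> e * norm h" if h: "norm h < min d 1" for h
    proof -
      let ?f = "\<lambda>y. (\<rho> (y - (x + h)) - \<rho> (y - x) + dird h \<rho> (y - x)) *\<^sub>R rep_L2 u y"
      have i: "integrable lebesgue (\<lambda>y. \<rho> (y - (x + h)) *\<^sub>R rep_L2 u y)" "integrable lebesgue (\<lambda>y. \<rho> (y - x) *\<^sub>R rep_L2 u y)"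
        "integrable lebesgue (\<lambda>y. dird h \<rho> (y - x) *\<^sub>R rep_L2 u y)"
        by (intro cor_integrable \<rho> Cc_inf_dird)+
      have "cor \<rho> u (x + h) - cor \<rho> u x + cor (dird h \<rho>) u x = integral\<^sup>L lebesgue ?f"
        unfolding cor_def by (simp add: scaleR_add_left scaleR_diff_left i)
      also have "norm \<dots> \<le> integral\<^sup>L lebesgue (\<lambda>y. (e / (M + 1) * norm h) * (indicator ?B y * norm (rep_L2 u y)))"
      proof (rule order_trans[OF integral_norm_bound integral_mono])
        show "integrable lebesgue (\<lambda>y. norm (?f y))" unfolding scaleR_add_left scaleR_diff_left
          by (intro integrable_norm Bochner_Integration.integrable_add Bochner_Integration.integrable_diff i)
        show "integrable lebesgue (\<lambda>y. (e / (M + 1) * norm h) * (indicator ?B y * norm (rep_L2 u y)))"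
          by (rule integrable_mult_right[OF iB])
        fix y
        show "norm (?f y) \<le> (e / (M + 1) * norm h) * (indicator ?B y * norm (rep_L2 u y))"
        proof (cases "y \<in> ?B")
          case True
          have lin: "dird (- h) \<rho> z = - dird h \<rho> z" for z
            using linear_neg[OF linear_dird[OF Cc_inf_smooth[OF \<rho>]]] .
          have "\<bar>\<rho> ((y - x) + (- h)) - \<rho> (y - x) - dird (- h) \<rho> (y - x)\<bar> \<le> e / (M + 1) * norm (- h)"
            by (rule d(2)) (use h in simp)
          then have "\<bar>\<rho> (y - (x + h)) - \<rho> (y - x) + dird h \<rho> (y - x)\<bar> \<le> e / (M + 1) * norm h"
            by (simp add: lin diff_diff_eq)
          from mult_right_mono[OF this norm_ge_zero[of "rep_L2 u y"]] show ?thesis using True by simp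
        next
          case False
          then have "norm (y - x) > R + 1" by (simp add: dist_norm norm_minus_commute)
          moreover have "norm (y - x) \<le> norm (y - (x + h)) + norm h"
            using norm_triangle_ineq[of "y - (x + h)" h] by simp
          ultimately have "norm (y - (x + h)) \<ge> R" "norm (y - x) \<ge> R" using h by auto
          then show ?thesis using False by (simp add: rho0)
        qed
      qed
      also have "\<dots> = e / (M + 1) * norm h * M" by (simp add: M_def)
      also have "\<dots> = (M / (M + 1)) * (e * norm h)" by simp
      also have "\<dots> \<le> 1 * (e * norm h)" using M e by (intro mult_right_mono) auto
      finally show ?thesis by simp
    qed
    then show ?thesis using d(1) by (intro exI[of _ "min d 1"]) auto
  qed
  show ?thesis
    unfolding has_derivative_at_alt
  proof (intro conjI allI impI bl)
    fix e :: real assume "0 < e"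
    then obtain d where d: "d > 0" "\<And>h. norm h < d \<Longrightarrow> norm (cor \<rho> u (x + h) - cor \<rho> u x + cor (dird h \<rho>) u x) \<le> e * norm h"
      using est by blast
    have "norm (cor \<rho> u y - cor \<rho> u x - - cor (dird (y - x) \<rho>) u x) \<le> e * norm (y - x)" if "norm (y - x) < d" for y
      using d(2)[OF that] by simp
    with d(1) show "\<exists>d>0. \<forall>y. norm (y - x) < d \<longrightarrow> norm (cor \<rho> u y - cor \<rho> u x - - cor (dird (y - x) \<rho>) u x) \<le> e * norm (y - x)"
      by blast
  qed
qed

lemma smooth_cor:
  fixes \<rho> :: "'a::euclidean_space \<Rightarrow> real" and u :: "('a, 'b::euclidean_space) L2"
  assumes \<rho>: "\<rho> \<in> Cc_inf UNIV" shows "smooth (cor \<rho> u)"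
proof -
  have "Ck k (cor \<rho> u)" for k
    using \<rho>
  proof (induction k arbitrary: \<rho>)
    case 0
    then show ?case
      using cor_has_derivative by (auto intro!: continuous_at_imp_continuous_on has_derivative_continuous)
  next
    case (Suc k)
    show ?case
    proof (rule Ck_SucI[OF cor_has_derivative[OF Suc.prems]])
      fix b :: 'a
      show "Ck k (\<lambda>x. - cor (dird b \<rho>) u x)"
        by (rule Ck_bounded_linear_compose[OF bounded_linear_minus[OF bounded_linear_ident] Suc.IH[OF Cc_inf_dird[OF Suc.prems]]])
    qed
  qed
  then show ?thesis by (simp add: smooth_def)
qed

lemma dird_cor: "\<rho> \<in> Cc_inf UNIV \<Longrightarrow> dird a (cor \<rho> u) x = - cor (dird a \<rho>) u x"
  by (rule dird_eq[OF cor_has_derivative])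

text \<open>The sign from integration by parts cancels the sign of \<open>dird_cor\<close>, so
  mollification commutes with derivatives on test fields.\<close>

lemma cor_parts:
  fixes \<rho> :: "'a::euclidean_space \<Rightarrow> real" and \<Phi> :: "'a \<Rightarrow> 'b::euclidean_space"
  assumes \<rho>: "\<rho> \<in> Cc_inf UNIV" and \<Phi>: "\<Phi> \<in> Cc_inf UNIV"
  shows "cor (dird a \<rho>) (abs_L2 \<Phi>) x = - cor \<rho> (abs_L2 (dird a \<Phi>)) x"
proof (rule euclidean_eqI)
  fix b :: 'b
  have 1: "cor \<sigma> (abs_L2 \<Psi>) x \<bullet> b = integral\<^sup>L lebesgue (\<lambda>y. \<sigma> (y - x) * (\<Psi> y \<bullet> b))"
    if \<sigma>: "\<sigma> \<in> Cc_inf UNIV" and \<Psi>: "\<Psi> \<in> Cc_inf UNIV" for \<sigma> and \<Psi> :: "'a \<Rightarrow> 'b"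
  proof -
    have t: "(\<lambda>y. \<sigma> (y - x) *\<^sub>R b) \<in> Cc_inf UNIV"
      by (rule Cc_inf_smooth_scaleR_right[OF Cc_inf_translate[OF \<sigma>] smooth_const])
    show ?thesis unfolding cor_inner[OF \<sigma>] inner_abs[OF Cc_inf_sq[OF \<Psi>] Cc_inf_sq[OF t]] by simp
  qed
  have d: "dird a (\<lambda>y. \<rho> (y - x)) y = dird a \<rho> (y - x)" for y
    using dird_shift[OF Cc_inf_smooth[OF \<rho>], of a "- x" y] by simp
  have e: "dird a (\<lambda>y. \<Phi> y \<bullet> b) y = dird a \<Phi> y \<bullet> b" for y
    by (rule dird_bounded_linear[OF bounded_linear_inner_left Cc_inf_smooth[OF \<Phi>]])
  have "integral\<^sup>L lebesgue (\<lambda>y. dird a (\<lambda>y. \<rho> (y - x)) y * (\<Phi> y \<bullet> b))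
      = - integral\<^sup>L lebesgue (\<lambda>y. \<rho> (y - x) * dird a (\<lambda>y. \<Phi> y \<bullet> b) y)"
    by (rule integral_by_parts[OF Cc_inf_translate[OF \<rho>] smooth_bounded_linear_compose[OF bounded_linear_inner_left Cc_inf_smooth[OF \<Phi>]]])
  then show "cor (dird a \<rho>) (abs_L2 \<Phi>) x \<bullet> b = - cor \<rho> (abs_L2 (dird a \<Phi>)) x \<bullet> b"
    by (simp add: 1 \<rho> \<Phi> Cc_inf_dird d e)
qed

lemma dird_cor_test:
  fixes \<Phi> :: "'a::euclidean_space \<Rightarrow> 'b::euclidean_space"
  assumes "\<rho> \<in> Cc_inf UNIV" "\<Phi> \<in> Cc_inf UNIV"
  shows "dird a (cor \<rho> (abs_L2 \<Phi>)) = cor \<rho> (abs_L2 (dird a \<Phi>))"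
  by (simp add: fun_eq_iff dird_cor assms cor_parts)

lemma cor_zero:
  assumes u: "u \<in> L2_on S" and \<rho>: "\<And>z. z \<notin> ball 0 \<epsilon> \<Longrightarrow> \<rho> z = 0" and x: "ball x \<epsilon> \<inter> S = {}"
  shows "cor \<rho> u x = 0"
proof -
  have "AE y in lebesgue. \<rho> (y - x) *\<^sub>R rep_L2 u y = 0"
    using u unfolding L2_on_def mem_Collect_eq
  proof eventually_elim
    case (elim y)
    show ?case
    proof (cases "y \<in> S")
      case True
      then have "y - x \<notin> ball 0 \<epsilon>" using x by (auto simp: dist_norm norm_minus_commute)
      then show ?thesis using \<rho> by simp
    qed (use elim in simp)
  qed
  then show ?thesis unfolding cor_def by (rule integral_eq_zero_AE)
qed

lemma cor_Cc_inf:
  fixes u :: "('a::euclidean_space, 'b::euclidean_space) L2"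
  assumes \<rho>: "\<rho> \<in> Cc_inf (ball 0 \<epsilon>)" and u: "u \<in> L2_on (ball 0 R)" and "R + \<epsilon> < R'"
  shows "cor \<rho> u \<in> Cc_inf (ball 0 R')"
proof (rule Cc_infI[where K="cball 0 (R + \<epsilon>)"])
  show "smooth (cor \<rho> u)" using Cc_inf_mono[OF _ \<rho>] by (intro smooth_cor) blast
  fix x :: 'a assume x: "x \<notin> cball 0 (R + \<epsilon>)"
  have False if "y \<in> ball x \<epsilon>" "y \<in> ball 0 R" for y
    using that x dist_triangle[of 0 x y] by (simp add: dist_commute)
  then show "cor \<rho> u x = 0"
    by (intro cor_zero[OF u Cc_inf_zero_off[OF \<rho>]]) auto
qed (use assms in auto)

text \<open>Nonnegativity of the variance: expand the integral of \<rho> (|h| - c)^2 with c the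
  \<rho>-mean of |h|. If the right-hand side is infinite there is nothing to show.\<close>

lemma jensen_sq:
  fixes h :: "'a::euclidean_space \<Rightarrow> 'b::euclidean_space"
  assumes \<rho>: "\<And>z. 0 \<le> \<rho> z" "integrable lebesgue \<rho>" "integral\<^sup>L lebesgue \<rho> = 1"
    and [measurable]: "h \<in> borel_measurable lebesgue" and i: "integrable lebesgue (\<lambda>z. \<rho> z *\<^sub>R h z)"
  shows "ennreal ((norm (integral\<^sup>L lebesgue (\<lambda>z. \<rho> z *\<^sub>R h z)))\<^sup>2) \<le> (\<integral>\<^sup>+z. ennreal (\<rho> z * (norm (h z))\<^sup>2) \<partial>lebesgue)"
proof (cases "(\<integral>\<^sup>+z. ennreal (\<rho> z * (norm (h z))\<^sup>2) \<partial>lebesgue) < \<infinity>")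
  case True
  have [measurable]: "\<rho> \<in> borel_measurable lebesgue" using \<rho>(2) by simp
  have i2: "integrable lebesgue (\<lambda>z. \<rho> z * (norm (h z))\<^sup>2)"
    using True \<rho>(1) by (intro integrableI_bounded) auto
  have i1: "integrable lebesgue (\<lambda>z. \<rho> z * norm (h z))"
    using integrable_norm[OF i] \<rho>(1) by simp
  define c where "c = integral\<^sup>L lebesgue (\<lambda>z. \<rho> z * norm (h z))"
  have "norm (integral\<^sup>L lebesgue (\<lambda>z. \<rho> z *\<^sub>R h z)) \<le> c"
    unfolding c_def using integral_norm_bound[of lebesgue "\<lambda>z. \<rho> z *\<^sub>R h z"] \<rho>(1) by simp
  then have "(norm (integral\<^sup>L lebesgue (\<lambda>z. \<rho> z *\<^sub>R h z)))\<^sup>2 \<le> c\<^sup>2" by (intro power_mono) auto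
  also have "c\<^sup>2 \<le> integral\<^sup>L lebesgue (\<lambda>z. \<rho> z * (norm (h z))\<^sup>2)"
  proof -
    have "0 \<le> integral\<^sup>L lebesgue (\<lambda>z. \<rho> z * (norm (h z) - c)\<^sup>2)"
      using \<rho>(1) by (intro integral_nonneg_AE) auto
    also have "(\<lambda>z. \<rho> z * (norm (h z) - c)\<^sup>2) = (\<lambda>z. \<rho> z * (norm (h z))\<^sup>2 - 2 * c * (\<rho> z * norm (h z)) + c\<^sup>2 * \<rho> z)"
      by (auto simp: power2_eq_square algebra_simps)
    also have "integral\<^sup>L lebesgue \<dots> = integral\<^sup>L lebesgue (\<lambda>z. \<rho> z * (norm (h z))\<^sup>2) - 2 * c * c + c\<^sup>2"
      using i1 i2 \<rho>(2,3) by (simp add: c_def)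
    finally show ?thesis by (simp add: power2_eq_square)
  qed
  also have "ennreal (integral\<^sup>L lebesgue (\<lambda>z. \<rho> z * (norm (h z))\<^sup>2)) = (\<integral>\<^sup>+z. ennreal (\<rho> z * (norm (h z))\<^sup>2) \<partial>lebesgue)"
    using \<rho>(1) by (intro nn_integral_eq_integral[symmetric] i2) auto
  finally show ?thesis by (simp add: ennreal_leI)
qed (simp add: less_top[symmetric])

text \<open>Fubini's theorem below is applied to \<open>lborel\<close>, and the map (x, z) \<mapsto>
  g (z + x) is measurable on the product for a Borel representative.\<close>

lemma rep_borel:
  fixes u :: "('a::euclidean_space, 'b::euclidean_space) L2"
  obtains g :: "'a \<Rightarrow> 'b" where "g \<in> borel_measurable borel" "AE x in lebesgue. rep_L2 u x = g x"
proof -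
  have "\<exists>g\<in>borel_measurable lborel. AE x in lborel. rep_L2 u x \<bullet> b = g x" for b
    by (rule completion_ex_borel_measurable_real) simp
  then obtain g :: "'b \<Rightarrow> 'a \<Rightarrow> real" where g: "\<And>b. g b \<in> borel_measurable lborel" "\<And>b. AE x in lborel. rep_L2 u x \<bullet> b = g b x" by metis
  show thesis
  proof
    show "(\<lambda>x. \<Sum>b\<in>Basis. g b x *\<^sub>R b) \<in> borel_measurable borel" using g(1) by simp
    have "AE x in lebesgue. \<forall>b\<in>Basis. rep_L2 u x \<bullet> b = g b x"
      by (rule AE_finite_allI) (use g(2) in \<open>auto intro: AE_completion\<close>)
    then show "AE x in lebesgue. rep_L2 u x = (\<Sum>b\<in>Basis. g b x *\<^sub>R b)"
    proof eventually_elim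
      case (elim x)
      then show ?case using euclidean_representation[of "rep_L2 u x"] by simp
    qed
  qed
qed

text \<open>Jensen's inequality bounds the pointwise error squared by the \<rho>-average of |u(x +
  z) - u(x)|^2. Fubini turns its integral into an average of squared translation errors, each at
  most \<eta>^2.\<close>

lemma cor_approx:
  fixes u :: "('a::euclidean_space, 'b::euclidean_space) L2"
  assumes \<rho>: "\<rho> \<in> Cc_inf (ball 0 \<epsilon>)" "\<And>z. 0 \<le> \<rho> z" "integral\<^sup>L lebesgue \<rho> = 1"
    and \<eta>: "\<And>a. norm a < \<epsilon> \<Longrightarrow> norm (trL2 a u - u) \<le> \<eta>" "\<eta> \<ge> 0" and sq: "sq_integrable (cor \<rho> u)"
  shows "norm (abs_L2 (cor \<rho> u) - u) \<le> \<eta>"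
proof -
  obtain g where g [measurable]: "g \<in> borel_measurable borel" and gu: "AE x in lebesgue. rep_L2 u x = g x"
    using rep_borel[of u] by metis
  have gm [measurable]: "g \<in> borel_measurable lebesgue" by (rule measurable_completion) simp
  have sqg: "sq_integrable g"
  proof -
    have "integrable lebesgue (\<lambda>x. (norm (rep_L2 u x))\<^sup>2) \<longleftrightarrow> integrable lebesgue (\<lambda>x. (norm (g x))\<^sup>2)"
      by (rule integrable_cong_AE) (use gu in \<open>auto elim!: AE_mp\<close>)
    then show ?thesis using sq_rep[of u] by (simp add: sq_integrable_def)
  qed
  have ug: "u = abs_L2 g" using abs_L2_eq[OF sq_rep sqg gu] by (simp add: abs_rep)
  have \<rho>U: "\<rho> \<in> Cc_inf UNIV" using Cc_inf_mono[OF _ \<rho>(1)] by blast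
  have rc: "continuous_on UNIV \<rho>" by (rule smooth_continuous[OF Cc_inf_smooth[OF \<rho>(1)]])
  have [measurable]: "\<rho> \<in> borel_measurable borel" by (rule borel_measurable_continuous_onI[OF rc])
  have i\<rho>: "integrable lebesgue \<rho>" by (rule Cc_inf_integrable[OF \<rho>(1)])
  have i1: "integrable lebesgue (\<lambda>z. \<rho> z *\<^sub>R g (z + x))" for x
    by (rule integrable_scaleR_sq[OF Cc_inf_sq[OF \<rho>(1)] sq_shift[OF sqg]])
  have corg: "cor \<rho> u x = integral\<^sup>L lebesgue (\<lambda>z. \<rho> z *\<^sub>R g (z + x))" for x
  proof -
    have [measurable]: "(\<lambda>y. \<rho> (y - x)) \<in> borel_measurable lebesgue"
      by (rule smooth_measurable[OF Cc_inf_smooth[OF Cc_inf_translate[OF \<rho>U]]])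
    have "cor \<rho> u x = integral\<^sup>L lebesgue (\<lambda>y. \<rho> (y - x) *\<^sub>R g y)"
      unfolding cor_def by (rule integral_cong_AE) (use gu in \<open>auto elim!: AE_mp\<close>)
    also have "\<dots> = integral\<^sup>L lebesgue (\<lambda>z. \<rho> ((z + x) - x) *\<^sub>R g (z + x))"
      by (rule integral_shift[symmetric]) simp
    finally show ?thesis by simp
  qed
  have diff: "cor \<rho> u x - g x = integral\<^sup>L lebesgue (\<lambda>z. \<rho> z *\<^sub>R (g (z + x) - g x))" for x
  proof -
    have "integral\<^sup>L lebesgue (\<lambda>z. \<rho> z *\<^sub>R g x) = g x" using i\<rho> \<rho>(3) by simp
    then show ?thesis unfolding corg scaleR_diff_right using i1 i\<rho> by simp
  qed
  have pt: "ennreal ((norm (cor \<rho> u x - g x))\<^sup>2) \<le> (\<integral>\<^sup>+z. ennreal (\<rho> z * (norm (g (z + x) - g x))\<^sup>2) \<partial>lebesgue)" for x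
    unfolding diff
  proof (rule jensen_sq[OF \<rho>(2) i\<rho> \<rho>(3)])
    show "(\<lambda>z. g (z + x) - g x) \<in> borel_measurable lebesgue" by simp
    show "integrable lebesgue (\<lambda>z. \<rho> z *\<^sub>R (g (z + x) - g x))"
      unfolding scaleR_diff_right using i1 i\<rho> by simp
  qed
  have tr: "(\<integral>\<^sup>+x. ennreal ((norm (g (z + x) - g x))\<^sup>2) \<partial>lebesgue) \<le> ennreal (\<eta>\<^sup>2)" if z: "norm z < \<epsilon>" for z
  proof -
    have "AE x in lebesgue. g (z + x) - g x = rep_L2 (trL2 z u - u) x"
      using rep_trL2[of z u] rep_minus[of "trL2 z u" u] gu AE_shift[OF gu, of z]
      by eventually_elim (simp add: add.commute)
    then have "(\<integral>\<^sup>+x. ennreal ((norm (g (z + x) - g x))\<^sup>2) \<partial>lebesgue) = (\<integral>\<^sup>+x. ennreal ((norm (rep_L2 (trL2 z u - u) x))\<^sup>2) \<partial>lebesgue)"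
      by (intro nn_integral_cong_AE) (auto elim!: AE_mp)
    also have "\<dots> = ennreal ((norm (trL2 z u - u))\<^sup>2)" by (rule nn_norm_rep)
    also have "\<dots> \<le> ennreal (\<eta>\<^sup>2)" using \<eta>(1)[OF z] by (intro ennreal_leI power_mono) auto
    finally show ?thesis .
  qed
  have "(\<integral>\<^sup>+x. ennreal ((norm (cor \<rho> u x - g x))\<^sup>2) \<partial>lebesgue)
      \<le> (\<integral>\<^sup>+x. \<integral>\<^sup>+z. ennreal (\<rho> z * (norm (g (z + x) - g x))\<^sup>2) \<partial>lborel \<partial>lborel)"
    unfolding nn_integral_completion by (rule nn_integral_mono) (rule pt[unfolded nn_integral_completion])
  also have "\<dots> = (\<integral>\<^sup>+z. \<integral>\<^sup>+x. ennreal (\<rho> z * (norm (g (z + x) - g x))\<^sup>2) \<partial>lborel \<partial>lborel)"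
    by (rule lborel_pair.Fubini') simp
  also have "\<dots> \<le> (\<integral>\<^sup>+z. ennreal (\<rho> z) * ennreal (\<eta>\<^sup>2) \<partial>lborel)"
  proof (rule nn_integral_mono)
    fix z :: 'a
    have "(\<integral>\<^sup>+x. ennreal (\<rho> z * (norm (g (z + x) - g x))\<^sup>2) \<partial>lborel) = ennreal (\<rho> z) * (\<integral>\<^sup>+x. ennreal ((norm (g (z + x) - g x))\<^sup>2) \<partial>lborel)"
      by (simp add: ennreal_mult \<rho>(2) nn_integral_cmult)
    also have "\<dots> \<le> ennreal (\<rho> z) * ennreal (\<eta>\<^sup>2)"
    proof (cases "norm z < \<epsilon>")
      case True
      then show ?thesis using tr[OF True] by (intro mult_left_mono) (simp_all add: nn_integral_completion)
    next
      case False
      then have "\<rho> z = 0" using Cc_inf_zero_off[OF \<rho>(1)] by simp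
      then show ?thesis by simp
    qed
    finally show "(\<integral>\<^sup>+x. ennreal (\<rho> z * (norm (g (z + x) - g x))\<^sup>2) \<partial>lborel) \<le> ennreal (\<rho> z) * ennreal (\<eta>\<^sup>2)" .
  qed
  also have "\<dots> = (\<integral>\<^sup>+z. ennreal (\<rho> z) \<partial>lebesgue) * ennreal (\<eta>\<^sup>2)"
    by (simp add: nn_integral_multc nn_integral_completion)
  also have "(\<integral>\<^sup>+z. ennreal (\<rho> z) \<partial>lebesgue) = 1"
    using nn_integral_eq_integral[OF i\<rho>] \<rho>(2,3) by simp
  finally have le: "(\<integral>\<^sup>+x. ennreal ((norm (cor \<rho> u x - g x))\<^sup>2) \<partial>lebesgue) \<le> ennreal (\<eta>\<^sup>2)" by simp
  have "abs_L2 (cor \<rho> u) - u = abs_L2 (\<lambda>x. cor \<rho> u x - g x)"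
    unfolding ug[symmetric] using abs_minus[OF sq sqg] by (simp add: ug[symmetric])
  then show ?thesis using norm_abs_le_nn[OF sq_integrable_diff[OF sq sqg] le \<eta>(2)] by simp
qed

lemma mollifier_exists:
  assumes "\<epsilon> > 0"
  obtains \<rho> :: "'a::euclidean_space \<Rightarrow> real" where "\<rho> \<in> Cc_inf (ball 0 \<epsilon>)" "\<And>z. 0 \<le> \<rho> z" "integral\<^sup>L lebesgue \<rho> = 1"
proof -
  obtain \<beta> :: "'a \<Rightarrow> real" where \<beta>: "\<beta> \<in> Cc_inf (ball 0 \<epsilon>)" "\<And>x. 0 \<le> \<beta> x \<and> \<beta> x \<le> 1" "\<And>x. x \<in> cball 0 (\<epsilon>/2) \<Longrightarrow> \<beta> x = 1"
    using smooth_bump[of "\<epsilon>/2" \<epsilon> 0] assms by (metis half_gt_zero_iff field_sum_of_halves less_add_same_cancel1)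
  define c where "c = integral\<^sup>L lebesgue \<beta>"
  have "0 < measure lebesgue (cball 0 (\<epsilon>/2) :: 'a set)" using assms content_cball_pos[of "\<epsilon>/2" 0] by (simp add: content_cball_pos)
  also have "measure lebesgue (cball 0 (\<epsilon>/2) :: 'a set) = integral\<^sup>L lebesgue (indicator (cball 0 (\<epsilon>/2) :: 'a set))"
    by simp
  also have "\<dots> \<le> c"
    unfolding c_def
  proof (rule integral_mono[OF integrable_real_indicator Cc_inf_integrable[OF \<beta>(1)]])
    show "indicator (cball 0 (\<epsilon>/2)) x \<le> \<beta> x" for x using \<beta>(2,3)[of x] by (auto simp: indicator_def)
    show "cball 0 (\<epsilon>/2) \<in> sets lebesgue" "emeasure lebesgue (cball 0 (\<epsilon>/2) :: 'a set) < \<infinity>"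
      using lmeasurable_cball[of 0 "\<epsilon>/2"] by (auto simp: fmeasurable_def)
  qed
  finally have c: "c > 0" .
  show thesis
  proof
    show "(\<lambda>x. (1 / c) *\<^sub>R \<beta> x) \<in> Cc_inf (ball 0 \<epsilon>)" by (rule Cc_inf_scaleR[OF \<beta>(1)])
    show "0 \<le> (1 / c) *\<^sub>R \<beta> z" for z using c \<beta>(2) by simp
    show "integral\<^sup>L lebesgue (\<lambda>x. (1 / c) *\<^sub>R \<beta> x) = 1" using c by (simp add: c_def)
  qed
qed

section \<open>Potentials with compact support\<close>

text \<open>The Poincare lemma with compact support. The potential integrates F along a ray that
  comes from infinity in a fixed direction; outside the ball its gradient vanishes, and since that
  set is connected in dimension at least two, it is constant there with a value read off at one
  point.\<close>

lemma compact_potential: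
  fixes F :: "'a::euclidean_space \<Rightarrow> 'a"
  assumes dim: "2 \<le> DIM('a)" and F: "smooth F" "R > 0" "\<And>x. R \<le> norm x \<Longrightarrow> F x = 0"
    and sym: "\<And>x h k. dird h F x \<bullet> k = dird k F x \<bullet> h"
  obtains u where "smooth u" "\<And>x h. dird h u x = F x \<bullet> h" "\<And>x. R \<le> norm x \<Longrightarrow> u x = (0::real)"
proof -
  obtain e :: 'a where e: "norm e = 1" by (metis norm_Basis nonempty_Basis ex_in_conv)
  define u where "u x = integral {0..} (\<lambda>s. F (x - s *\<^sub>R e) \<bullet> e)" for x
  have far: "F (x - s *\<^sub>R e) = 0" if "s \<ge> norm x + R" for x s
  proof (rule F(3))
    have "\<bar>s\<bar> = norm (s *\<^sub>R e)" using e by simp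
    also have "\<dots> \<le> norm (x - s *\<^sub>R e) + norm x" using norm_triangle_ineq4[of x "x - s *\<^sub>R e"] by simp
    finally show "R \<le> norm (x - s *\<^sub>R e)" using that by linarith
  qed
  have cF: "continuous_on S (\<lambda>s. F (x - s *\<^sub>R e) \<bullet> k)" for S x k
    by (intro continuous_intros continuous_on_compose2[OF smooth_continuous[OF F(1), of UNIV]]) auto
  have uL: "u x = integral (cbox 0 L) (\<lambda>s. F (x - s *\<^sub>R e) \<bullet> e)" if "L \<ge> norm x + R" for x L
  proof -
    have i: "((\<lambda>s. F (x - s *\<^sub>R e) \<bullet> e) has_integral integral (cbox 0 L) (\<lambda>s. F (x - s *\<^sub>R e) \<bullet> e)) (cbox 0 L)"
      by (rule integrable_integral[OF integrable_continuous[OF cF]])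
    have eq: "(\<lambda>s. if s \<in> cbox 0 L then F (x - s *\<^sub>R e) \<bullet> e else 0) = (\<lambda>s. if s \<in> {0..} then F (x - s *\<^sub>R e) \<bullet> e else 0)"
      using far[of x] that by auto
    from has_integral_restrict_UNIV[THEN iffD2, OF i]
    have "((\<lambda>s. F (x - s *\<^sub>R e) \<bullet> e) has_integral integral (cbox 0 L) (\<lambda>s. F (x - s *\<^sub>R e) \<bullet> e)) {0..}"
      unfolding eq by (rule has_integral_restrict_UNIV[THEN iffD1])
    then show ?thesis unfolding u_def by (rule integral_unique)
  qed
  have deriv: "(u has_derivative (\<lambda>h. F x0 \<bullet> h)) (at x0)" for x0
  proof -
    \<comment> \<open>One length of integration that serves all points in the unit ball around
      \<open>x0\<close>, so that the Leibniz rule applies on a fixed interval.\<close>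
    define L where "L = norm x0 + 1 + R"
    define fx where "fx x s = (\<Sum>b\<in>Basis. (dird b F (x - s *\<^sub>R e) \<bullet> e) *\<^sub>R blinfun_inner_left b)" for x s
    have fx: "blinfun_apply (fx x s) h = dird h F (x - s *\<^sub>R e) \<bullet> e" for x s h
      unfolding fx_def by (subst dird_sum_Basis[OF F(1), of h]) (auto simp: blinfun.sum_left blinfun.scaleR_left inner_sum_left inner_commute[of h] intro!: sum.cong)
    have d1: "((\<lambda>x. F (x - s *\<^sub>R e) \<bullet> e) has_derivative blinfun_apply (fx x s)) (at x within UNIV)" for x s
    proof -
      have "((\<lambda>x. F (x - s *\<^sub>R e)) has_derivative (\<lambda>h. dird h F (x - s *\<^sub>R e))) (at x)"
        by (rule has_derivative_compose[where f="\<lambda>x. x - s *\<^sub>R e" and f'="\<lambda>h. h"])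
           (auto intro!: derivative_eq_intros smooth_has_derivative F)
      from has_derivative_inner_left[OF this, of e] show ?thesis by (simp add: fx[abs_def])
    qed
    have cfx: "continuous_on (UNIV \<times> cbox 0 L) (\<lambda>(x, s). fx x s)"
      unfolding fx_def case_prod_beta
      by (intro continuous_intros continuous_on_compose2[OF smooth_continuous[OF smooth_dird[OF F(1)], of UNIV]]) auto
    have "((\<lambda>x. integral (cbox 0 L) (\<lambda>s. F (x - s *\<^sub>R e) \<bullet> e)) has_derivative blinfun_apply (integral (cbox 0 L) (fx x0))) (at x0 within UNIV)"
      by (rule leibniz_rule[OF d1 integrable_continuous[OF cF] cfx]) auto
    moreover have "blinfun_apply (integral (cbox 0 L) (fx x0)) h = F x0 \<bullet> h" for h
    proof -
      have "continuous_on (cbox 0 L) (\<lambda>s. case (x0, s) of (x, s) \<Rightarrow> fx x s)"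
        by (rule continuous_on_compose2[OF cfx]) (auto intro!: continuous_intros)
      then have "continuous_on (cbox 0 L) (fx x0)" by simp
      then have i: "fx x0 integrable_on cbox 0 L" by (rule integrable_continuous)
      have "blinfun_apply (integral (cbox 0 L) (fx x0)) h = integral (cbox 0 L) (\<lambda>s. blinfun_apply (fx x0 s) h)"
        by (rule blinfun_apply_integral[OF i])
      \<comment> \<open>Symmetry of the derivative trades the h-derivative of F \<bullet> e for the
        e-derivative of F \<bullet> h, which is a total derivative along the ray.\<close>
      also have "\<dots> = integral {0..L} (\<lambda>s. dird e F (x0 - s *\<^sub>R e) \<bullet> h)"
        by (simp add: fx sym[of h _ e])
      also have "\<dots> = - (F (x0 - L *\<^sub>R e) \<bullet> h) - - (F (x0 - 0 *\<^sub>R e) \<bullet> h)"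
      proof (rule integral_unique, rule fundamental_theorem_of_calculus)
        show "0 \<le> L" using F(2) by (simp add: L_def)
        fix s
        have "dird (- e) F y = - dird e F y" for y using linear_neg[OF linear_dird[OF F(1)]] .
        then have "((\<lambda>s. F (x0 - s *\<^sub>R e)) has_vector_derivative - dird e F (x0 - s *\<^sub>R e)) (at s)"
          using smooth_line_vector_derivative[OF F(1), of x0 "- e" s] by simp
        then have "((\<lambda>s. F (x0 - s *\<^sub>R e) \<bullet> h) has_vector_derivative (- dird e F (x0 - s *\<^sub>R e)) \<bullet> h) (at s)"
          by (rule bounded_linear.has_vector_derivative[OF bounded_linear_inner_left])
        from has_vector_derivative_minus[OF this]
        have "((\<lambda>s. - (F (x0 - s *\<^sub>R e) \<bullet> h)) has_vector_derivative dird e F (x0 - s *\<^sub>R e) \<bullet> h) (at s)" by simp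
        then show "((\<lambda>s. - (F (x0 - s *\<^sub>R e) \<bullet> h)) has_vector_derivative dird e F (x0 - s *\<^sub>R e) \<bullet> h) (at s within {0..L})"
          by (rule has_vector_derivative_at_within)
      qed
      also have "\<dots> = F x0 \<bullet> h" using far[of x0 L] by (simp add: L_def)
      finally show ?thesis .
    qed
    then have "blinfun_apply (integral (cbox 0 L) (fx x0)) = (\<lambda>h. F x0 \<bullet> h)" by blast
    ultimately have "((\<lambda>x. integral (cbox 0 L) (\<lambda>s. F (x - s *\<^sub>R e) \<bullet> e)) has_derivative (\<lambda>h. F x0 \<bullet> h)) (at x0)"
      by simp
    then show ?thesis
    proof (rule has_derivative_transform_within_open[of _ _ _ _ "ball x0 1"])
      fix x assume "x \<in> ball x0 1"
      then have "norm x \<le> norm x0 + 1" using norm_triangle_ineq2[of x x0] by (simp add: dist_norm norm_minus_commute)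
      then show "integral (cbox 0 L) (\<lambda>s. F (x - s *\<^sub>R e) \<bullet> e) = u x" by (intro uL[symmetric]) (simp add: L_def)
    qed auto
  qed
  have sm: "smooth u"
    by (rule smooth_coinduct_derivative[OF deriv]) (intro smooth_inner F smooth_const)
  have "u x = 0" if x: "R < norm x" for x
  proof -
    let ?U = "- cball 0 R :: 'a set"
    have conn: "connected ?U" by (rule connected_complement_bounded_convex[OF bounded_cball convex_cball dim])
    have op: "open ?U" by (simp add: open_Compl)
    have "(u has_derivative (\<lambda>h. 0)) (at y)" if "y \<in> ?U" for y
      using deriv[of y] F(3)[of y] that by simp
    then have "\<forall>y\<in>?U - {}. (u has_derivative (\<lambda>h. 0)) (at y within ?U)"
      by (simp add: has_derivative_at_withinI)
    from has_derivative_zero_connected_constant_on[OF conn op finite.emptyI smooth_continuous[OF sm] this]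
    obtain c where c: "\<And>y. y \<in> ?U \<Longrightarrow> u y = c" unfolding constant_on_def by blast
    \<comment> \<open>From this point the ray in direction -e moves away from the ball and never
      meets the support of F.\<close>
    define z where "z = - (R + 1) *\<^sub>R e"
    have "u z = 0"
    proof -
      have "F (z - s *\<^sub>R e) = 0" if "s \<ge> 0" for s
      proof (rule F(3))
        have "z - s *\<^sub>R e = - (R + 1 + s) *\<^sub>R e" by (simp add: z_def algebra_simps)
        then show "R \<le> norm (z - s *\<^sub>R e)" using e F(2) that by simp
      qed
      then have "((\<lambda>s. F (z - s *\<^sub>R e) \<bullet> e) has_integral 0) {0..}" by (intro has_integral_is_0) auto
      then show ?thesis unfolding u_def by (rule integral_unique)
    qed
    moreover have "z \<in> ?U" using e F(2) by (simp add: z_def)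
    ultimately show ?thesis using c x by auto
  qed
  moreover have "continuous_on UNIV u" by (rule smooth_continuous[OF sm])
  \<comment> \<open>The sphere itself is reached by continuity, from points slightly farther
    out.\<close>
  ultimately have "u x = 0" if "R \<le> norm x" for x
  proof -
    assume outside: "\<And>x. R < norm x \<Longrightarrow> u x = 0" and cont: "continuous_on UNIV u"
    have cl: "closed {y. u y = 0}" by (intro closed_Collect_eq cont continuous_on_const)
    have "x \<noteq> 0" using that F(2) by auto
    have lim: "(\<lambda>n. (1 + 1 / real (Suc n)) *\<^sub>R x) \<longlonglongrightarrow> (1 + 0) *\<^sub>R x"
      by (intro tendsto_intros LIMSEQ_Suc[OF lim_1_over_n])
    have mem: "(1 + 1 / real (Suc n)) *\<^sub>R x \<in> {y. u y = 0}" for n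
    proof -
      have "1 * norm x < (1 + 1 / real (Suc n)) * norm x" using \<open>x \<noteq> 0\<close> by (intro mult_strict_right_mono) auto
      then show ?thesis using outside that by (simp add: add_pos_pos)
    qed
    have "(1 + 0) *\<^sub>R x \<in> {y. u y = 0}" by (rule closed_sequentially[OF cl mem lim])
    then show ?thesis by simp
  qed
  moreover have "dird h u x = F x \<bullet> h" for x h by (rule dird_eq[OF deriv])
  ultimately show thesis using that sm by blast
qed

lemma Curl_c_nth:
  assumes "smooth S"
  shows "Curl_c S x $ i $ 1 = pd 2 S x $ i $ 3 - pd 3 S x $ i $ 2"
    "Curl_c S x $ i $ 2 = pd 3 S x $ i $ 1 - pd 1 S x $ i $ 3"
    "Curl_c S x $ i $ 3 = pd 1 S x $ i $ 2 - pd 2 S x $ i $ 1"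
  by (simp_all add: Curl_c_def curl_c_def Let_def grad_c_nth vector_3 dird_nth[OF assms])

text \<open>Each row is a curl-free vector field and has a scalar potential. The radius of the
  support is preserved, so the lemma can be applied twice in succession with the same R.\<close>

lemma curl_free_potential:
  assumes T: "smooth T" "R > 0" "\<And>x. R \<le> norm x \<Longrightarrow> T x = 0" and curl: "\<And>x. Curl_c T x = 0"
  obtains w where "smooth w" "\<And>x. grad_c w x = T x" "\<And>x. R \<le> norm x \<Longrightarrow> w x = 0"
proof -
  have "\<exists>u. smooth u \<and> (\<forall>x h. dird h u x = T x $ i \<bullet> h) \<and> (\<forall>x. R \<le> norm x \<longrightarrow> u x = (0::real))" for i
  proof -
    have J: "pd j T x $ i $ k = pd k T x $ i $ j" for j k x
    proof -
      have "\<forall>j k. pd j T x $ i $ k = pd k T x $ i $ j"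
        using Curl_c_nth[OF T(1), of x i] by (simp add: curl forall_3)
      then show ?thesis by blast
    qed
    have sym: "dird h (\<lambda>x. T x $ i) x \<bullet> k = dird k (\<lambda>x. T x $ i) x \<bullet> h" for x h k
    proof -
      have *: "dird h (\<lambda>x. T x $ i) x \<bullet> k = (\<Sum>a\<in>UNIV. \<Sum>b\<in>UNIV. h $ b * k $ a * pd b T x $ i $ a)" for h k
      proof -
        have "dird h (\<lambda>x. T x $ i) x $ a = (\<Sum>b\<in>UNIV. pd b T x $ i $ a * h $ b)" for a
          unfolding grad_c_mult[OF smooth_nth[OF T(1)], symmetric]
          by (simp add: matrix_vector_mult_def grad_c_nth dird_nth[OF T(1)])
        then show ?thesis by (simp add: inner_vec_def sum_distrib_left sum_distrib_right mult_ac)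
      qed
      show ?thesis unfolding * by (subst sum.swap) (simp add: J mult_ac)
    qed
    obtain u where "smooth u" "\<And>x h. dird h u x = T x $ i \<bullet> h" "\<And>x. R \<le> norm x \<Longrightarrow> u x = (0::real)"
      using compact_potential[OF _ smooth_nth[OF T(1)] T(2) _ sym] T(3) by auto
    then show ?thesis by blast
  qed
  then obtain u where u: "\<And>i. smooth (u i)" "\<And>i x h. dird h (u i) x = T x $ i \<bullet> h" "\<And>i x. R \<le> norm x \<Longrightarrow> u i x = (0::real)"
    by metis
  define w :: vec_field where "w x = (\<chi> i. u i x)" for x
  have w: "smooth w" by (rule smooth_vecI) (simp add: w_def u)
  show thesis
  proof
    show "grad_c w x = T x" for x
    proof -
      have "pd j w x $ i = T x $ i $ j" for i j
      proof -
        have "pd j w x $ i = pd j (\<lambda>x. w x $ i) x" by (rule dird_nth[OF w, symmetric])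
        also have "(\<lambda>x. w x $ i) = u i" by (simp add: w_def)
        finally show ?thesis by (simp add: u(2) inner_axis)
      qed
      then show ?thesis by (simp add: vec_eq_iff grad_c_nth)
    qed
  qed (use w u(3) in \<open>auto simp: w_def vec_eq_iff\<close>)
qed

text \<open>The matrix of the cross product x \<mapsto> w \<times> x; every skew matrix has this
  form.\<close>

definition spn :: "real^3 \<Rightarrow> real^3^3" where
  "spn w = vector [vector [0, - w $ 3, w $ 2], vector [w $ 3, 0, - w $ 1], vector [- w $ 2, w $ 1, 0]]"

lemma spn_nth:
  "spn w $ 1 $ 1 = 0" "spn w $ 1 $ 2 = - w $ 3" "spn w $ 1 $ 3 = w $ 2"
  "spn w $ 2 $ 1 = w $ 3" "spn w $ 2 $ 2 = 0" "spn w $ 2 $ 3 = - w $ 1"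
  "spn w $ 3 $ 1 = - w $ 2" "spn w $ 3 $ 2 = w $ 1" "spn w $ 3 $ 3 = 0"
  by (simp_all add: spn_def vector_3)

lemma bounded_linear_spn: "bounded_linear spn"
  by (rule linear_conv_bounded_linear[THEN iffD1], rule linearI) (simp_all add: vec_eq_iff forall_3 spn_nth)

lemma sym_part_spn: "sym_part (spn w) = 0"
  by (simp add: vec_eq_iff forall_3 sym_part_nth spn_nth)

text \<open>With $\operatorname{Grad}\omega = (\operatorname{Curl}S)^\top$ the field $S + \operatorname{spn}\omega$ is
  curl free, since $\operatorname{Curl}\operatorname{spn}\omega = (\operatorname{div}\omega) I -
  (\operatorname{Grad}\omega)^\top$ and $\operatorname{Curl}S$ is trace free for symmetric $S$.\<close>

lemma saint_venant:
  assumes S: "smooth S" "R > 0" "\<And>x. R \<le> norm x \<Longrightarrow> S x = 0"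
    and sym: "\<And>x. transpose (S x) = S x" and cc: "\<And>x. CurlCurlT_c S x = 0"
  obtains v \<omega> where "smooth v" "smooth \<omega>" "\<And>x. R \<le> norm x \<Longrightarrow> v x = 0" "\<And>x. grad_c v x = S x + spn (\<omega> x)"
    "\<And>x. grad_c \<omega> x = transpose (Curl_c S x)"
proof -
  define C where "C x = transpose (Curl_c S x)" for x
  have pdS: "smooth (\<lambda>x. pd k S x $ i $ j)" for i j k by (intro smooth_nth smooth_dird S)
  have C: "smooth C"
  proof (intro smooth_vecI)
    fix i j :: 3
    have "\<forall>j i. smooth (\<lambda>x. Curl_c S x $ j $ i)"
      unfolding forall_3 Curl_c_nth[OF S(1)] by (intro conjI smooth_diff pdS)
    then show "smooth (\<lambda>x. C x $ i $ j)" by (simp add: C_def transpose_def)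
  qed
  have out: "pd k S x $ i $ j = 0" if "R \<le> norm x" for x i j k
  proof (cases "R < norm x")
    case True
    have "pd k S x = 0"
      by (rule dird_zero_open[where U="- cball 0 R"]) (use True S(3) in \<open>auto simp: open_Compl\<close>)
    then show ?thesis by simp
  next
    case False
    then have xR: "norm x = R" using that by simp
    have "x \<noteq> 0" using xR S(2) by auto
    \<comment> \<open>On the sphere the derivatives vanish as limits from outside, where S is
      locally zero.\<close>
    have z: "pd k S ((1 + 1 / real (Suc n)) *\<^sub>R x) = 0" for n
    proof (rule dird_zero_open[where U="- cball 0 R"])
      have "1 * norm x < (1 + 1 / real (Suc n)) * norm x" using \<open>x \<noteq> 0\<close> by (intro mult_strict_right_mono) auto
      then show "(1 + 1 / real (Suc n)) *\<^sub>R x \<in> - cball 0 R" using xR by (simp add: add_pos_pos)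
    qed (use S(3) in \<open>auto simp: open_Compl\<close>)
    have "(\<lambda>n. (1 + 1 / real (Suc n)) *\<^sub>R x) \<longlonglongrightarrow> (1 + 0) *\<^sub>R x"
      by (intro tendsto_intros LIMSEQ_Suc[OF lim_1_over_n])
    then have "(\<lambda>n. pd k S ((1 + 1 / real (Suc n)) *\<^sub>R x)) \<longlonglongrightarrow> pd k S ((1 + 0) *\<^sub>R x)"
      using continuous_on_tendsto_compose[OF smooth_continuous[OF smooth_dird[OF S(1)], of UNIV]] by auto
    then have "pd k S x = 0" unfolding z by (simp add: LIMSEQ_const_iff)
    then show ?thesis by simp
  qed
  have CR: "C x = 0" if "R \<le> norm x" for x
    using out[OF that] by (simp add: C_def vec_eq_iff transpose_def forall_3 Curl_c_nth[OF S(1)])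
  have "C = (\<lambda>x. transpose (Curl_c S x))" by (auto simp: C_def)
  then have curlC: "Curl_c C x = 0" for x using cc[of x] by (simp add: CurlCurlT_c_def)
  obtain \<omega> where \<omega>: "smooth \<omega>" "\<And>x. grad_c \<omega> x = C x" "\<And>x. R \<le> norm x \<Longrightarrow> \<omega> x = 0"
    using curl_free_potential[OF C S(2) CR curlC] by metis
  define T where "T x = S x + spn (\<omega> x)" for x
  have so: "smooth (\<lambda>x. spn (\<omega> x))" by (rule smooth_bounded_linear_compose[OF bounded_linear_spn \<omega>(1)])
  have T: "smooth T" unfolding T_def by (rule smooth_add[OF S(1) so])
  have TR: "T x = 0" if "R \<le> norm x" for x
    using S(3)[OF that] \<omega>(3)[OF that] linear_0[OF bounded_linear.linear[OF bounded_linear_spn]] by (simp add: T_def)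
  have pdo: "pd k \<omega> x $ i = Curl_c S x $ k $ i" for k i x
    using \<omega>(2)[of x] by (simp add: vec_eq_iff grad_c_nth C_def transpose_def)
  have pdT: "pd k T x = pd k S x + spn (pd k \<omega> x)" for k x
    unfolding T_def dird_add[OF S(1) so] dird_bounded_linear[OF bounded_linear_spn \<omega>(1)] ..
  have symd: "pd k S x $ i $ j = pd k S x $ j $ i" for k x i j
  proof -
    have "(\<lambda>x. S x $ i $ j) = (\<lambda>x. S x $ j $ i)" using sym by (auto simp: vec_eq_iff transpose_def)
    then have "pd k (\<lambda>x. S x $ i $ j) x = pd k (\<lambda>x. S x $ j $ i) x" by simp
    then show ?thesis by (simp add: dird_nth[OF smooth_nth[OF S(1)]] dird_nth[OF S(1)])
  qed
  have symd': "pd k S x $ 2 $ 1 = pd k S x $ 1 $ 2" "pd k S x $ 3 $ 1 = pd k S x $ 1 $ 3" "pd k S x $ 3 $ 2 = pd k S x $ 2 $ 3" for k x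
    by (rule symd)+
  have curlT: "Curl_c T x = 0" for x
    by (simp add: vec_eq_iff forall_3 Curl_c_nth[OF T] pdT spn_nth pdo Curl_c_nth[OF S(1)] symd')
  obtain v where v: "smooth v" "\<And>x. grad_c v x = T x" "\<And>x. R \<le> norm x \<Longrightarrow> v x = 0"
    using curl_free_potential[OF T S(2) TR curlT] by metis
  show thesis using that[OF v(1) \<omega>(1) v(3)] v(2) \<omega>(2) by (simp add: T_def C_def)
qed

text \<open>The k-th coefficient of the row-wise Curl, which is the sum over k of
  \<open>curl_map k\<close> applied to the k-th partial derivative. With it Curl Curl^T becomes a
  second-order operator with constant coefficients, which commutes with mollification and with
  limits.\<close>

definition curl_map :: "3 \<Rightarrow> real^3^3 \<Rightarrow> real^3^3" where
  "curl_map k A = (\<chi> i. if k = 1 then vector [0, - A $ i $ 3, A $ i $ 2]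
     else if k = 2 then vector [A $ i $ 3, 0, - A $ i $ 1] else vector [- A $ i $ 2, A $ i $ 1, 0])"

lemma bounded_linear_curl_map: "bounded_linear (curl_map k)"
  by (rule linear_conv_bounded_linear[THEN iffD1], rule linearI)
     (simp_all add: vec_eq_iff forall_3 curl_map_def vector_3)

lemma bounded_linear_transpose: "bounded_linear (transpose :: real^3^3 \<Rightarrow> real^3^3)"
  by (rule linear_conv_bounded_linear[THEN iffD1], rule linearI) (simp_all add: vec_eq_iff transpose_def)

lemma Curl_c_eq: "smooth S \<Longrightarrow> Curl_c S x = (\<Sum>k\<in>UNIV. curl_map k (pd k S x))"
  by (simp add: vec_eq_iff forall_3 Curl_c_nth sum_3 curl_map_def vector_3)

lemma smooth_curl_map: "smooth f \<Longrightarrow> smooth (\<lambda>x. curl_map k (f x))"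
  by (rule smooth_bounded_linear_compose[OF bounded_linear_curl_map])

lemma smooth_transpose: "smooth f \<Longrightarrow> smooth (\<lambda>x. transpose (f x :: real^3^3))"
  by (rule smooth_bounded_linear_compose[OF bounded_linear_transpose])

lemma CurlCurlT_c_eq:
  assumes S: "smooth S"
  shows "CurlCurlT_c S x = (\<Sum>k\<in>UNIV. \<Sum>m\<in>UNIV. curl_map k (transpose (curl_map m (pd k (pd m S) x))))"
proof -
  have s: "smooth (\<lambda>x. transpose (curl_map m (pd m S x)))" for m
    by (intro smooth_transpose smooth_curl_map smooth_dird S)
  have tr_sum: "transpose (\<Sum>m\<in>UNIV. f m) = (\<Sum>m\<in>UNIV. transpose (f m))" for f :: "3 \<Rightarrow> real^3^3"
    by (rule linear_sum[OF bounded_linear.linear[OF bounded_linear_transpose]])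
  have eq: "(\<lambda>x. transpose (Curl_c S x)) = (\<lambda>x. \<Sum>m\<in>UNIV. transpose (curl_map m (pd m S x)))"
    by (simp add: Curl_c_eq[OF S] tr_sum)
  have d: "pd k (\<lambda>x. \<Sum>m\<in>UNIV. transpose (curl_map m (pd m S x))) x = (\<Sum>m\<in>UNIV. transpose (curl_map m (pd k (pd m S) x)))" for k
  proof -
    have d1: "pd k (\<lambda>x. transpose (curl_map m (pd m S x))) x = transpose (curl_map m (pd k (pd m S) x))" for m
      by (rule dird_bounded_linear[OF bounded_linear_compose[OF bounded_linear_transpose bounded_linear_curl_map] smooth_dird[OF S]])
    show ?thesis unfolding sum_3
      by (simp add: dird_add smooth_add s d1)
  qed
  have "CurlCurlT_c S x = (\<Sum>k\<in>UNIV. curl_map k (pd k (\<lambda>x. \<Sum>m\<in>UNIV. transpose (curl_map m (pd m S x))) x))"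
    unfolding CurlCurlT_c_def eq by (rule Curl_c_eq) (intro smooth_sum s)
  also have "\<dots> = (\<Sum>k\<in>UNIV. \<Sum>m\<in>UNIV. curl_map k (transpose (curl_map m (pd k (pd m S) x))))"
    unfolding d by (intro sum.cong refl linear_sum[OF bounded_linear.linear[OF bounded_linear_curl_map]])
  finally show ?thesis .
qed

text \<open>A purely algebraic cancellation: after expansion only third derivatives remain, and
  these are symmetric in all three indices.\<close>

lemma CurlCurlT_symgrad:
  assumes \<phi>: "smooth \<phi>" shows "CurlCurlT_c (symgrad_c \<phi>) x = 0"
proof -
  define D where "D k m j = pd k (pd m (pd j \<phi>)) x" for k m j
  have c1: "D k m j = D m k j" for k m j unfolding D_def by (intro dird_commute smooth_dird \<phi>)
  have c2: "D k m j = D k j m" for k m j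
  proof -
    have "pd m (pd j \<phi>) = pd j (pd m \<phi>)" using dird_commute[OF \<phi>] by blast
    then show ?thesis by (simp add: D_def)
  qed
  have S: "smooth (symgrad_c \<phi>)" by (rule smooth_symgrad_c[OF \<phi>])
  have e: "pd k (pd m (symgrad_c \<phi>)) x $ i $ j = (D k m j $ i + D k m i $ j) / 2" for k m i j
  proof -
    have eq: "(\<lambda>x. symgrad_c \<phi> x $ i $ j) = (\<lambda>x. (1/2) *\<^sub>R (pd j \<phi> x $ i + pd i \<phi> x $ j))"
      by (simp add: fun_eq_iff symgrad_c_def sym_part_nth grad_c_nth)
    have sp: "smooth (\<lambda>x. pd a (pd b \<phi>) x $ c)" "smooth (\<lambda>x. pd b \<phi> x $ c)" for a b c by (intro smooth_nth smooth_dird \<phi>)+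
    have 1: "pd m (\<lambda>x. symgrad_c \<phi> x $ i $ j) = (\<lambda>x. (1/2) *\<^sub>R (pd m (pd j \<phi>) x $ i + pd m (pd i \<phi>) x $ j))"
      unfolding eq by (rule ext, subst dird_bounded_linear[OF bounded_linear_scaleR_right smooth_add[OF sp(2) sp(2)]])
        (simp add: dird_add[OF sp(2) sp(2)] dird_nth[OF smooth_dird[OF \<phi>]])
    have 2: "pd k (pd m (\<lambda>x. symgrad_c \<phi> x $ i $ j)) x = (1/2) *\<^sub>R (D k m j $ i + D k m i $ j)"
      unfolding 1 by (subst dird_bounded_linear[OF bounded_linear_scaleR_right smooth_add[OF sp(1) sp(1)]])
        (simp add: dird_add[OF sp(1) sp(1)] dird_nth[OF smooth_dird[OF smooth_dird[OF \<phi>]]] D_def)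
    have 3: "pd m (\<lambda>x. symgrad_c \<phi> x $ i $ j) = (\<lambda>x. pd m (symgrad_c \<phi>) x $ i $ j)"
      by (simp add: fun_eq_iff dird_nth[OF smooth_nth[OF S]] dird_nth[OF S])
    show ?thesis using 2 unfolding 3
      by (simp add: dird_nth[OF smooth_nth[OF smooth_dird[OF S]]] dird_nth[OF smooth_dird[OF S]])
  qed
  \<comment> \<open>Rewriting rules that sort the indices of third derivatives, so that equal terms
    become syntactically equal.\<close>
  have r1: "D 2 1 j = D 1 2 j" "D 3 1 j = D 1 3 j" "D 3 2 j = D 2 3 j" for j by (rule c1)+
  have r2: "D k 2 1 = D k 1 2" "D k 3 1 = D k 1 3" "D k 3 2 = D k 2 3" for k by (rule c2)+
  show ?thesis
    unfolding CurlCurlT_c_eq[OF S]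
    by (simp add: vec_eq_iff forall_3 sum_3 curl_map_def vector_3 transpose_def e)
       (simp add: r1 r2 r1[of 1] r1[of 2] c2[of 2 1 1] c2[of 2 2 1] field_simps)
qed

section \<open>Rigid motions\<close>

lemma grad_c_eqI: "(v has_derivative (\<lambda>h. A *v h)) (at x) \<Longrightarrow> grad_c v x = A"
  unfolding grad_c_def jacobian_def by (metis frechet_derivative_at matrix_of_matrix_vector_mul)

lemma grad_c_affine: "grad_c (\<lambda>x. A *v x + b) x = A"
  by (rule grad_c_eqI) (auto intro!: derivative_eq_intros bounded_linear_imp_has_derivative)

lemma grad_c_transform_open:
  assumes "smooth g" "open U" "x \<in> U" "\<And>y. y \<in> U \<Longrightarrow> f y = g y"
  shows "grad_c f x = grad_c g x"
  using dird_transform_open[OF assms(1-3), of f] assms(4) by (simp add: vec_eq_iff grad_c_nth)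

lemma smooth_affine: "smooth (\<lambda>x. (A :: real^3^3) *v x + b)"
  by (intro smooth_add smooth_bounded_linear smooth_const) simp

text \<open>The six coefficients are coordinates of a rigid motion: the first three form the
  rotation vector, the last three the translation.\<close>

lemma rigid_sum:
  fixes c :: "nat \<Rightarrow> real"
  shows "(\<Sum>j\<in>{1..6}. c j *\<^sub>R rigid_field j x) = spn (vector [c 1, c 2, c 3]) *v x + vector [c 4, c 5, c 6]"
proof -
  have I: "{1..6} = {1, 2, 3, 4, 5, 6::nat}" by auto
  show ?thesis
    unfolding I
    by (simp add: rigid_field_def vec_eq_iff forall_3 cross3_def matrix_vector_mult_def sum_3 vector_3 spn_nth axis_def)
qed

lemma rigid_sum_eq_0:
  fixes c :: "nat \<Rightarrow> real"
  assumes "spn (vector [c 1, c 2, c 3]) = 0" "spn (vector [c 1, c 2, c 3]) *v x + vector [c 4, c 5, c 6] = 0" "j \<in> {1..6}"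
  shows "c j = 0"
proof -
  have "c 1 = 0" "c 2 = 0" "c 3 = 0" using assms(1) by (simp_all add: vec_eq_iff forall_3 spn_nth vector_3)
  moreover have "vector [c 4, c 5, c 6] = (0 :: real^3)" using assms(1,2) by simp
  then have "c 4 = 0" "c 5 = 0" "c 6 = 0" by (simp_all add: vec_eq_iff forall_3 vector_3)
  moreover have "j = 1 \<or> j = 2 \<or> j = 3 \<or> j = 4 \<or> j = 5 \<or> j = 6" using assms(3) by auto
  ultimately show ?thesis by auto
qed

lemma skew_eq_spn:
  assumes "sym_part A = 0" shows "A = spn (vector [A $ 3 $ 2, A $ 1 $ 3, A $ 2 $ 1])"
  using assms by (simp add: vec_eq_iff forall_3 sym_part_nth spn_nth vector_3)

text \<open>Nonempty open sets are not negligible. Used to extract exact equations between constants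
  from statements known almost everywhere.\<close>

lemma not_AE_open:
  fixes U :: "'a::euclidean_space set"
  assumes "open U" "U \<noteq> {}" and AE: "AE x in lebesgue. x \<in> U \<longrightarrow> P x"
  obtains x where "x \<in> U" "P x"
proof -
  have "\<exists>x\<in>U. P x"
  proof (rule ccontr)
    assume "\<not> (\<exists>x\<in>U. P x)"
    then have "AE x in lebesgue. x \<notin> U" using AE by (auto elim!: AE_mp)
    then have "U \<in> null_sets lebesgue" using AE_iff_null_sets[of U lebesgue] assms(1) by auto
    then have "negligible U" by (simp add: negligible_iff_null_sets)
    then show False using open_not_negligible[OF assms(1,2)] by simp
  qed
  then show thesis using that by blast
qed

section \<open>Fields with vanishing $\operatorname{Curl}\operatorname{Curl}^\top$\<close>

lemma cor_bounded_linear: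
  fixes \<rho> :: "'a::euclidean_space \<Rightarrow> real" and L :: "'b::euclidean_space \<Rightarrow> 'c::euclidean_space"
  assumes L: "bounded_linear L" and \<rho>: "\<rho> \<in> Cc_inf UNIV"
  shows "L (cor \<rho> u x) = cor \<rho> (opL2 (\<lambda>_. L) u) x"
proof -
  interpret L: bounded_linear L by (rule L)
  have "L (cor \<rho> u x) = integral\<^sup>L lebesgue (\<lambda>y. L (\<rho> (y - x) *\<^sub>R rep_L2 u y))"
    unfolding cor_def by (rule integral_bounded_linear[symmetric, OF L cor_integrable[OF \<rho>]])
  also have "\<dots> = cor \<rho> (opL2 (\<lambda>_. L) u) x"
    unfolding cor_def
  proof (rule integral_cong_AE)
    have [measurable]: "(\<lambda>y. \<rho> (y - x)) \<in> borel_measurable lebesgue"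
      by (rule smooth_measurable[OF Cc_inf_smooth[OF Cc_inf_translate[OF \<rho>]]])
    show "(\<lambda>y. L (\<rho> (y - x) *\<^sub>R rep_L2 u y)) \<in> borel_measurable lebesgue"
    proof -
      have [measurable]: "(\<lambda>y. L (rep_L2 u y)) \<in> borel_measurable lebesgue"
        using fibrewise_const[OF L, where 'a='a] rep_measurable[of u] unfolding fibrewise_def by blast
      show ?thesis unfolding L.scaleR by measurable
    qed
    show "(\<lambda>y. \<rho> (y - x) *\<^sub>R rep_L2 (opL2 (\<lambda>_. L) u) y) \<in> borel_measurable lebesgue" by measurable
    show "AE y in lebesgue. L (\<rho> (y - x) *\<^sub>R rep_L2 u y) = \<rho> (y - x) *\<^sub>R rep_L2 (opL2 (\<lambda>_. L) u) y"
      using rep_opL2[OF fibrewise_const[OF L], of u] by eventually_elim (simp add: L.scaleR)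
  qed
  finally show ?thesis .
qed

abbreviation ccm :: "3 \<Rightarrow> 3 \<Rightarrow> real^3^3 \<Rightarrow> real^3^3" where
  "ccm k m A \<equiv> curl_map k (transpose (curl_map m A))"

lemma bounded_linear_ccm: "bounded_linear (ccm k m)"
  by (rule bounded_linear_compose[OF bounded_linear_curl_map bounded_linear_compose[OF bounded_linear_transpose bounded_linear_curl_map]])

lemma Cc_inf_CurlCurlT:
  assumes "\<Phi> \<in> Cc_inf \<Omega>" shows "CurlCurlT_c \<Phi> \<in> Cc_inf \<Omega>"
proof -
  have "CurlCurlT_c \<Phi> = (\<lambda>x. \<Sum>k\<in>UNIV. \<Sum>m\<in>UNIV. ccm k m (pd k (pd m \<Phi>) x))"
    using CurlCurlT_c_eq[OF Cc_inf_smooth[OF assms]] by blast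
  moreover have "(\<lambda>x. \<Sum>k\<in>UNIV. \<Sum>m\<in>UNIV. ccm k m (pd k (pd m \<Phi>) x)) \<in> Cc_inf \<Omega>"
    by (intro Cc_inf_sum Cc_inf_linear[OF _ bounded_linear_ccm] Cc_inf_dird assms)
  ultimately show ?thesis by simp
qed

lemma CurlCurlT_cor_test:
  assumes \<rho>: "\<rho> \<in> Cc_inf UNIV" and \<Phi>: "\<Phi> \<in> Cc_inf UNIV"
  shows "CurlCurlT_c (cor \<rho> (abs_L2 \<Phi>)) x = cor \<rho> (abs_L2 (CurlCurlT_c \<Phi>)) x"
proof -
  have P: "pd k (pd m \<Phi>) \<in> Cc_inf UNIV" for k m by (intro Cc_inf_dird \<Phi>)
  have c: "ccm k m (cor \<rho> (abs_L2 (pd k (pd m \<Phi>))) x) = cor \<rho> (abs_L2 (\<lambda>y. ccm k m (pd k (pd m \<Phi>) y))) x" for k m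
    unfolding cor_bounded_linear[OF bounded_linear_ccm \<rho>] opL2_abs[OF fibrewise_const[OF bounded_linear_ccm] Cc_inf_sq[OF P]] ..
  have LP: "(\<lambda>y. ccm k m (pd k (pd m \<Phi>) y)) \<in> Cc_inf UNIV" for k m by (rule Cc_inf_linear[OF P bounded_linear_ccm])
  have add: "cor \<rho> (abs_L2 f) x + cor \<rho> (abs_L2 g) x = cor \<rho> (abs_L2 (\<lambda>y. f y + g y)) x"
    if "f \<in> Cc_inf UNIV" "g \<in> Cc_inf UNIV" for f g :: ten_field
  proof (rule euclidean_eqI)
    fix b :: "real^3^3"
    show "(cor \<rho> (abs_L2 f) x + cor \<rho> (abs_L2 g) x) \<bullet> b = cor \<rho> (abs_L2 (\<lambda>y. f y + g y)) x \<bullet> b"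
      by (simp add: inner_add_left cor_inner[OF \<rho>] abs_plus[OF Cc_inf_sq[OF that(1)] Cc_inf_sq[OF that(2)], symmetric])
  qed
  have "CurlCurlT_c (cor \<rho> (abs_L2 \<Phi>)) x = (\<Sum>k\<in>UNIV. \<Sum>m\<in>UNIV. ccm k m (pd k (pd m (cor \<rho> (abs_L2 \<Phi>))) x))"
    by (rule CurlCurlT_c_eq[OF smooth_cor[OF \<rho>]])
  also have "\<dots> = (\<Sum>k\<in>UNIV. \<Sum>m\<in>UNIV. cor \<rho> (abs_L2 (\<lambda>y. ccm k m (pd k (pd m \<Phi>) y))) x)"
    by (simp add: dird_cor_test \<rho> \<Phi> Cc_inf_dird c)
  also have "\<dots> = cor \<rho> (abs_L2 (\<lambda>y. \<Sum>k\<in>UNIV. \<Sum>m\<in>UNIV. ccm k m (pd k (pd m \<Phi>) y))) x"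
    unfolding sum_3 by (simp add: add LP Cc_inf_add)
  also have "(\<lambda>y. \<Sum>k\<in>UNIV. \<Sum>m\<in>UNIV. ccm k m (pd k (pd m \<Phi>) y)) = CurlCurlT_c \<Phi>"
    using CurlCurlT_c_eq[OF Cc_inf_smooth[OF \<Phi>]] by (metis (no_types, lifting) ext)
  finally show ?thesis .
qed

lemma CurlCurlT_ring_eq:
  "CurlCurlT_ring \<Omega> = closure ((\<lambda>\<Phi>. (abs_L2 \<Phi>, abs_L2 (CurlCurlT_c \<Phi>))) ` Cc_inf_sym \<Omega>)"
  unfolding CurlCurlT_ring_def
  by (intro arg_cong[where f=closure] image_cong refl) (simp add: Cc_inf_sym_def to_L2_Cc_inf Cc_inf_CurlCurlT)

lemma subspace_CurlCurlT_ring: "subspace (CurlCurlT_ring \<Omega>)"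
  unfolding CurlCurlT_ring_eq
proof (rule subspace_closure, rule subspaceI)
  let ?g = "\<lambda>\<Phi>. (abs_L2 \<Phi>, abs_L2 (CurlCurlT_c \<Phi>))"
  have bl: "bounded_linear (ccm k m)" for k m by (rule bounded_linear_ccm)
  have lin: "CurlCurlT_c (\<lambda>y. c *\<^sub>R f y + d *\<^sub>R g y) = (\<lambda>y. c *\<^sub>R CurlCurlT_c f y + d *\<^sub>R CurlCurlT_c g y)"
    if f: "smooth f" and g: "smooth g" for f g :: ten_field and c d
  proof
    fix x
    have s: "smooth (\<lambda>y. c *\<^sub>R f y)" "smooth (\<lambda>y. d *\<^sub>R g y)" if "smooth f" "smooth g" for f g :: ten_field
      by (intro smooth_bounded_linear_compose[OF bounded_linear_scaleR_right] that)+
    have D: "dird a (\<lambda>y. c *\<^sub>R f y + d *\<^sub>R g y) = (\<lambda>y. c *\<^sub>R dird a f y + d *\<^sub>R dird a g y)" if "smooth f" "smooth g" for a and f g :: ten_field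
      by (simp add: fun_eq_iff dird_add[OF s[OF that]] dird_bounded_linear[OF bounded_linear_scaleR_right] that)
    have "CurlCurlT_c (\<lambda>y. c *\<^sub>R f y + d *\<^sub>R g y) x
       = (\<Sum>k\<in>UNIV. \<Sum>m\<in>UNIV. c *\<^sub>R ccm k m (pd k (pd m f) x) + d *\<^sub>R ccm k m (pd k (pd m g) x))"
      unfolding CurlCurlT_c_eq[OF smooth_add[OF s[OF f g]]] D[OF f g] D[OF smooth_dird[OF f] smooth_dird[OF g]]
      by (simp add: linear_add[OF bounded_linear.linear[OF bl]] linear_scale[OF bounded_linear.linear[OF bl]])
    also have "\<dots> = c *\<^sub>R CurlCurlT_c f x + d *\<^sub>R CurlCurlT_c g x"
      by (simp add: CurlCurlT_c_eq f g sum.distrib scaleR_sum_right)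
    finally show "CurlCurlT_c (\<lambda>y. c *\<^sub>R f y + d *\<^sub>R g y) x = c *\<^sub>R CurlCurlT_c f x + d *\<^sub>R CurlCurlT_c g x" .
  qed
  have comb: "c *\<^sub>R p + d *\<^sub>R q \<in> ?g ` Cc_inf_sym \<Omega>" if p: "p \<in> ?g ` Cc_inf_sym \<Omega>" and q: "q \<in> ?g ` Cc_inf_sym \<Omega>" for p q c d
  proof -
    obtain f g where fg: "f \<in> Cc_inf_sym \<Omega>" "p = ?g f" "g \<in> Cc_inf_sym \<Omega>" "q = ?g g" using p q by blast
    then have C: "f \<in> Cc_inf \<Omega>" "g \<in> Cc_inf \<Omega>" by (auto simp: Cc_inf_sym_def)
    have h: "(\<lambda>y. c *\<^sub>R f y + d *\<^sub>R g y) \<in> Cc_inf \<Omega>" by (intro Cc_inf_add Cc_inf_scaleR C)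
    have tr: "transpose (c *\<^sub>R A + d *\<^sub>R B) = c *\<^sub>R transpose A + d *\<^sub>R transpose B" for A B :: "real^3^3"
      by (simp add: vec_eq_iff transpose_def)
    have "(\<lambda>y. c *\<^sub>R f y + d *\<^sub>R g y) \<in> Cc_inf_sym \<Omega>" using h fg(1,3) by (simp add: Cc_inf_sym_def tr)
    moreover have "c *\<^sub>R p + d *\<^sub>R q = ?g (\<lambda>y. c *\<^sub>R f y + d *\<^sub>R g y)"
      unfolding lin[OF Cc_inf_smooth[OF C(1)] Cc_inf_smooth[OF C(2)]] fg(2,4)
      by (simp add: abs_scale abs_plus sq_integrable_scaleR Cc_inf_sq[OF C(1)] Cc_inf_sq[OF C(2)]
          Cc_inf_sq[OF Cc_inf_CurlCurlT[OF C(1)]] Cc_inf_sq[OF Cc_inf_CurlCurlT[OF C(2)]])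
    ultimately show ?thesis by blast
  qed
  have z: "(\<lambda>x. 0) \<in> Cc_inf_sym \<Omega>" by (simp add: Cc_inf_sym_def Cc_inf_zero vec_eq_iff transpose_def)
  then have "0 *\<^sub>R ?g (\<lambda>x. 0) + 0 *\<^sub>R ?g (\<lambda>x. 0) \<in> ?g ` Cc_inf_sym \<Omega>" by (intro comb) auto
  then show "0 \<in> ?g ` Cc_inf_sym \<Omega>" by (simp add: zero_prod_def)
  show "p + q \<in> ?g ` Cc_inf_sym \<Omega>" if "p \<in> ?g ` Cc_inf_sym \<Omega>" "q \<in> ?g ` Cc_inf_sym \<Omega>" for p q
    using comb[OF that, of 1 1] by simp
  show "c *\<^sub>R p \<in> ?g ` Cc_inf_sym \<Omega>" if "p \<in> ?g ` Cc_inf_sym \<Omega>" for c p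
    using comb[OF that that, of c 0] by simp
qed

lemma subspace_ker_CurlCurlT: "subspace (ker_graph (CurlCurlT_ring \<Omega>))"
proof (rule subspaceI)
  show "0 \<in> ker_graph (CurlCurlT_ring \<Omega>)"
    using subspace_0[OF subspace_CurlCurlT_ring[of \<Omega>]] by (simp add: ker_graph_def zero_prod_def)
  show "x + y \<in> ker_graph (CurlCurlT_ring \<Omega>)"
    if "x \<in> ker_graph (CurlCurlT_ring \<Omega>)" "y \<in> ker_graph (CurlCurlT_ring \<Omega>)" for x y
    using subspace_add[OF subspace_CurlCurlT_ring, of "(x, 0)" \<Omega> "(y, 0)"] that by (simp add: ker_graph_def)
  show "c *\<^sub>R x \<in> ker_graph (CurlCurlT_ring \<Omega>)" if "x \<in> ker_graph (CurlCurlT_ring \<Omega>)" for c x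
    using subspace_scale[OF subspace_CurlCurlT_ring, of "(x, 0)" \<Omega> c] that by (simp add: ker_graph_def)
qed

lemma CurlCurlT_ker_test:
  assumes "\<Phi> \<in> Cc_inf_sym \<Omega>" "\<And>x. CurlCurlT_c \<Phi> x = 0" shows "abs_L2 \<Phi> \<in> ker_graph (CurlCurlT_ring \<Omega>)"
proof -
  have "CurlCurlT_c \<Phi> = (\<lambda>x. 0)" using assms(2) by blast
  then have "(abs_L2 \<Phi>, 0) = (abs_L2 \<Phi>, abs_L2 (CurlCurlT_c \<Phi>))" by (simp add: abs_zero)
  then show ?thesis
    unfolding ker_graph_def CurlCurlT_ring_eq using assms(1) by (auto intro!: subsetD[OF closure_subset])
qed

text \<open>The support condition is put on the symmetric gradient: the field itself may be a
  nonzero rigid motion outside \<Omega>, as the cut-off rigid motions are.\<close>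

lemma symgrad_Cc_inf_sym:
  assumes "symgrad_c \<phi> \<in> Cc_inf \<Omega>" "smooth \<phi>"
  shows "abs_L2 (symgrad_c \<phi>) \<in> ker_graph (CurlCurlT_ring \<Omega>)"
  using assms by (intro CurlCurlT_ker_test CurlCurlT_symgrad) (auto simp: Cc_inf_sym_def symgrad_c_def transpose_sym_part)

lemma H10_graph_ker_CurlCurlT:
  assumes "p \<in> H10_graph \<Omega>" shows "symL2 (snd p) \<in> ker_graph (CurlCurlT_ring \<Omega>)"
  using assms
proof (rule H10_graph_induct)
  have "closed ((\<lambda>p::vec_L2 \<times> ten_L2. (symL2 (snd p), 0)) -` CurlCurlT_ring \<Omega>)"
    by (rule closed_vimage) (simp add: CurlCurlT_ring_def, intro continuous_intros)
  then show "closed {p::vec_L2 \<times> ten_L2. symL2 (snd p) \<in> ker_graph (CurlCurlT_ring \<Omega>)}" by (simp add: vimage_def ker_graph_def)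
  fix \<phi> :: vec_field assume \<phi>: "\<phi> \<in> Cc_inf \<Omega>"
  then show "symL2 (snd (abs_L2 \<phi>, abs_L2 (grad_c \<phi>))) \<in> ker_graph (CurlCurlT_ring \<Omega>)"
    by (simp add: symL2_grad symgrad_Cc_inf_sym Cc_inf_symgrad_c Cc_inf_smooth)
qed

text \<open>S is approximated by test fields whose Curl Curl^T merely tends to zero. For a fixed
  kernel the mollified identity passes to the limit pointwise, so the mollification of S satisfies
  Curl Curl^T = 0 exactly.\<close>

lemma CurlCurlT_ker_mollify:
  assumes \<Omega>: "\<Omega> \<subseteq> ball 0 R" "open \<Omega>" and S: "S \<in> ker_graph (CurlCurlT_ring \<Omega>)" and \<epsilon>: "\<epsilon> > 0" "\<epsilon> \<le> 1"
  obtains S' where "S' \<in> Cc_inf (ball 0 (R + 2))" "\<And>x. transpose (S' x) = S' x" "\<And>x. CurlCurlT_c S' x = 0"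
    "norm (abs_L2 S' - S) \<le> \<epsilon>" "\<And>x. ball x \<epsilon> \<inter> \<Omega> = {} \<Longrightarrow> S' x = 0"
proof -
  have \<Omega>m: "\<Omega> \<in> sets lebesgue" by (rule open_sets_lebesgue[OF \<Omega>(2)])
  have "(S, 0) \<in> closure ((\<lambda>\<Phi>. (abs_L2 \<Phi>, abs_L2 (CurlCurlT_c \<Phi>))) ` Cc_inf_sym \<Omega>)"
    using S by (simp add: ker_graph_def CurlCurlT_ring_eq)
  then obtain s where s: "\<And>n. s n \<in> (\<lambda>\<Phi>. (abs_L2 \<Phi>, abs_L2 (CurlCurlT_c \<Phi>))) ` Cc_inf_sym \<Omega>" "s \<longlonglongrightarrow> (S, 0)"
    unfolding closure_sequential by blast
  then have "\<forall>n. \<exists>\<Phi>. \<Phi> \<in> Cc_inf_sym \<Omega> \<and> s n = (abs_L2 \<Phi>, abs_L2 (CurlCurlT_c \<Phi>))" by blast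
  then obtain \<Phi> where \<Phi>s: "\<And>n. \<Phi> n \<in> Cc_inf_sym \<Omega>" and sn: "\<And>n. s n = (abs_L2 (\<Phi> n), abs_L2 (CurlCurlT_c (\<Phi> n)))" by metis
  have \<Phi>: "\<Phi> n \<in> Cc_inf \<Omega>" "transpose (\<Phi> n x) = \<Phi> n x" for n x using \<Phi>s by (auto simp: Cc_inf_sym_def)
  have \<Phi>U: "\<Phi> n \<in> Cc_inf UNIV" for n using Cc_inf_mono[OF _ \<Phi>(1)] by blast
  have l: "(\<lambda>n. abs_L2 (\<Phi> n)) \<longlonglongrightarrow> S" "(\<lambda>n. abs_L2 (CurlCurlT_c (\<Phi> n))) \<longlonglongrightarrow> 0"
    using tendsto_fst[OF s(2)] tendsto_snd[OF s(2)] by (simp_all add: sn)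
  have Son: "S \<in> L2_on \<Omega>" by (rule closed_sequentially[OF closed_L2_on[OF \<Omega>m] abs_Cc_L2_on[OF \<Phi>(1)] l(1)])
  have Sball: "S \<in> L2_on (ball 0 R)"
    using Son unfolding L2_on_def mem_Collect_eq by (rule AE_mp, intro AE_I2) (use \<Omega>(1) in blast)
  have Scl: "S \<in> closure (abs_L2 ` Cc_inf UNIV)"
    unfolding closure_sequential using l(1) \<Phi>U by (intro exI[of _ "\<lambda>n. abs_L2 (\<Phi> n)"]) auto
  obtain d where d: "d > 0" "\<And>a. norm a < d \<Longrightarrow> norm (trL2 a S - S) < \<epsilon>"
    using trL2_continuous[OF Scl \<epsilon>(1)] by metis
  \<comment> \<open>Two requirements on the kernel radius: at most \<open>d\<close> for the L^2
    error, and at most \<epsilon> for the spreading of the support.\<close>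
  define e where "e = min d \<epsilon>"
  have e: "e > 0" "e \<le> \<epsilon>" "e \<le> d" using d \<epsilon> by (auto simp: e_def)
  obtain \<rho> :: "real^3 \<Rightarrow> real" where \<rho>: "\<rho> \<in> Cc_inf (ball 0 e)" "\<And>z. 0 \<le> \<rho> z" "integral\<^sup>L lebesgue \<rho> = 1"
    using mollifier_exists[OF e(1)] by metis
  have \<rho>U: "\<rho> \<in> Cc_inf UNIV" using Cc_inf_mono[OF _ \<rho>(1)] by blast
  have C: "cor \<rho> S \<in> Cc_inf (ball 0 (R + 2))"
    by (rule cor_Cc_inf[OF \<rho>(1) Sball]) (use e \<epsilon> in simp)
  show thesis
  proof
    show "cor \<rho> S \<in> Cc_inf (ball 0 (R + 2))" by (rule C)
    show "norm (abs_L2 (cor \<rho> S) - S) \<le> \<epsilon>"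
      by (rule cor_approx[OF \<rho>]) (use d(2) e \<epsilon> Cc_inf_sq[OF C] in \<open>auto intro: less_imp_le\<close>)
    show "cor \<rho> S x = 0" if "ball x \<epsilon> \<inter> \<Omega> = {}" for x
      by (rule cor_zero[OF Son Cc_inf_zero_off[OF \<rho>(1)]]) (use that e subset_ball[OF e(2), of x] in auto)
    show "transpose (cor \<rho> S x) = cor \<rho> S x" for x
    proof -
      have "transpose (cor \<rho> (abs_L2 (\<Phi> n)) x) = cor \<rho> (abs_L2 (\<Phi> n)) x" for n
        unfolding cor_bounded_linear[OF bounded_linear_transpose \<rho>U] opL2_abs[OF fibrewise_const[OF bounded_linear_transpose] Cc_inf_sq[OF \<Phi>U]]
        by (simp add: \<Phi>(2))
      then have "(\<lambda>n. cor \<rho> (abs_L2 (\<Phi> n)) x) \<longlonglongrightarrow> transpose (cor \<rho> S x)"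
        using bounded_linear.tendsto[OF bounded_linear_transpose cor_tendsto[OF \<rho>U l(1), of x]] by simp
      then show ?thesis using LIMSEQ_unique cor_tendsto[OF \<rho>U l(1), of x] by blast
    qed
    show "CurlCurlT_c (cor \<rho> S) x = 0" for x
    proof -
      \<comment> \<open>Both derivatives fall on the kernel, so the second derivatives of the
        mollifications depend continuously on \<open>u\<close> in L^2.\<close>
      have D: "pd k (pd m (cor \<rho> u)) x = cor (pd k (pd m \<rho>)) u x" for k m and u :: ten_L2
      proof -
        have "pd m (cor \<rho> u) = (\<lambda>x. - cor (pd m \<rho>) u x)" by (simp add: fun_eq_iff dird_cor[OF \<rho>U])
        then have "pd k (pd m (cor \<rho> u)) x = - pd k (cor (pd m \<rho>) u) x"
          using dird_bounded_linear[OF bounded_linear_minus[OF bounded_linear_ident] smooth_cor[OF Cc_inf_dird[OF \<rho>U]]] by simp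
        then show ?thesis by (simp add: dird_cor[OF Cc_inf_dird[OF \<rho>U]])
      qed
      have "(\<lambda>n. CurlCurlT_c (cor \<rho> (abs_L2 (\<Phi> n))) x) \<longlonglongrightarrow> CurlCurlT_c (cor \<rho> S) x"
        unfolding CurlCurlT_c_eq[OF smooth_cor[OF \<rho>U]] D
        by (intro tendsto_sum bounded_linear.tendsto[OF bounded_linear_ccm] cor_tendsto Cc_inf_dird \<rho>U l(1))
      moreover have "(\<lambda>n. CurlCurlT_c (cor \<rho> (abs_L2 (\<Phi> n))) x) \<longlonglongrightarrow> cor \<rho> 0 x"
        unfolding CurlCurlT_cor_test[OF \<rho>U \<Phi>U] by (rule cor_tendsto[OF \<rho>U l(2)])
      moreover have "cor \<rho> 0 x = (0 :: real^3^3)"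
        by (rule euclidean_eqI) (simp add: cor_inner[OF \<rho>U])
      ultimately show ?thesis using LIMSEQ_unique by metis
    qed
  qed
qed

section \<open>Limits of affine fields on balls\<close>

lemma sq_ball:
  fixes f :: "'a::euclidean_space \<Rightarrow> 'b::euclidean_space"
  assumes f: "continuous_on UNIV f" shows "sq_integrable (\<lambda>x. if x \<in> ball c r then f x else 0)"
proof -
  have "bounded (f ` cball c r)"
    by (intro compact_imp_bounded compact_continuous_image continuous_on_subset[OF f]) auto
  then obtain M where M: "M > 0" "\<forall>y\<in>f ` cball c r. norm y \<le> M" by (auto simp: bounded_pos)
  have [measurable]: "f \<in> borel_measurable lebesgue" by (rule continuous_measurable_lebesgue[OF f])
  have e: "(\<lambda>x. if x \<in> ball c r then f x else 0) = (\<lambda>x. indicator (ball c r) x *\<^sub>R f x)" by (auto simp: indicator_def)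
  show ?thesis
  proof (rule sq_bounded_support(1)[where S="ball c r" and B=M])
    show "(\<lambda>x. if x \<in> ball c r then f x else 0) \<in> borel_measurable lebesgue" unfolding e by (intro borel_measurable_scaleR borel_measurable_indicator) auto
    show "norm (if x \<in> ball c r then f x else 0) \<le> M" for x using M by auto
  qed auto
qed

lemma bounded_linear_to_L2_ball:
  fixes L :: "'e::euclidean_space \<Rightarrow> 'a::euclidean_space \<Rightarrow> 'b::euclidean_space"
  assumes L: "\<And>x. linear (\<lambda>e. L e x)" "\<And>e. continuous_on UNIV (L e)"
  shows "bounded_linear (\<lambda>e. to_L2 (ball c r) (L e))"
proof (rule linear_conv_bounded_linear[THEN iffD1], rule linearI)
  fix e e' :: 'e and k :: real
  show "to_L2 (ball c r) (L (e + e')) = to_L2 (ball c r) (L e) + to_L2 (ball c r) (L e')"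
    unfolding to_L2_def abs_plus[OF sq_ball[OF L(2)] sq_ball[OF L(2)]]
    by (rule arg_cong[where f=abs_L2]) (auto simp: linear_add[OF L(1)])
  show "to_L2 (ball c r) (L (k *\<^sub>R e)) = k *\<^sub>R to_L2 (ball c r) (L e)"
    unfolding to_L2_def abs_scale[OF sq_ball[OF L(2)]]
    by (rule arg_cong[where f=abs_L2]) (auto simp: linear_scale[OF L(1)])
qed

text \<open>A constant field on the ball has L^2 norm |e| times the root of the volume, so
  convergence can be read back to the constants.\<close>

lemma convergent_const_ball:
  fixes a :: "nat \<Rightarrow> 'b::euclidean_space" and c :: "'a::euclidean_space"
  assumes r: "r > 0" and conv: "convergent (\<lambda>n. to_L2 (ball c r) (\<lambda>x. a n))"
  shows "convergent a"
proof -
  interpret T: bounded_linear "\<lambda>e::'b. to_L2 (ball c r) (\<lambda>x. e)"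
    by (rule bounded_linear_to_L2_ball) (auto intro: linearI)
  define V where "V = measure lebesgue (ball c r)"
  have V: "V > 0" using content_ball_pos[OF r, of c] by (simp add: V_def)
  have n: "(norm (to_L2 (ball c r) (\<lambda>x. e)))\<^sup>2 = (norm e)\<^sup>2 * V" for e :: 'b
  proof -
    have "(\<lambda>x. (norm (if x \<in> ball c r then e else 0))\<^sup>2) = (\<lambda>x. (norm e)\<^sup>2 * indicator (ball c r) x)"
      by (auto simp: indicator_def)
    then show ?thesis
      unfolding to_L2_def norm_sq_abs[OF sq_ball[OF continuous_on_const]] by (simp add: V_def)
  qed
  have "Cauchy a"
  proof (rule CauchyI)
    fix e :: real assume e: "0 < e"
    have "Cauchy (\<lambda>n. to_L2 (ball c r) (\<lambda>x. a n))" using conv by (rule convergent_Cauchy)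
    moreover have "e * sqrt V > 0" using e V by simp
    ultimately obtain M where M: "\<And>m n. m \<ge> M \<Longrightarrow> n \<ge> M \<Longrightarrow> norm (to_L2 (ball c r) (\<lambda>x. a m) - to_L2 (ball c r) (\<lambda>x. a n)) < e * sqrt V"
      using CauchyD by blast
    have "norm (a m - a n) < e" if "m \<ge> M" "n \<ge> M" for m n
    proof -
      have "(norm (a m - a n))\<^sup>2 * V = (norm (to_L2 (ball c r) (\<lambda>x. a m) - to_L2 (ball c r) (\<lambda>x. a n)))\<^sup>2"
        unfolding T.diff[symmetric] n ..
      also have "\<dots> < (e * sqrt V)\<^sup>2" by (rule power_strict_mono[OF M[OF that]]) auto
      also have "\<dots> = e\<^sup>2 * V" using V by (simp add: power_mult_distrib)
      finally have "(norm (a m - a n))\<^sup>2 < e\<^sup>2" using V by simp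
      then show ?thesis using e by (intro power_less_imp_less_base[of _ 2 e]) auto
    qed
    then show "\<exists>M. \<forall>m\<ge>M. \<forall>n\<ge>M. norm (a m - a n) < e" by blast
  qed
  then show ?thesis by (rule Cauchy_convergent)
qed

text \<open>The Jacobians are constant fields, so the matrices converge first. Subtracting the
  linear parts leaves constant fields again, and the translations converge too.\<close>

lemma affine_limit:
  fixes A :: "nat \<Rightarrow> real^3^3"
  assumes r: "r > 0" and V: "(\<lambda>n. to_L2 (ball c r) (\<lambda>x. A n *v x + b n)) \<longlonglongrightarrow> v"
    and G: "(\<lambda>n. to_L2 (ball c r) (\<lambda>x. A n)) \<longlonglongrightarrow> G"
  obtains A' b' where "v = to_L2 (ball c r) (\<lambda>x. A' *v x + b')" "G = to_L2 (ball c r) (\<lambda>x. A')"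
proof -
  let ?B = "ball c r"
  have bA: "bounded_linear (\<lambda>A::real^3^3. to_L2 ?B (\<lambda>x. A *v x))"
    by (rule bounded_linear_to_L2_ball) (auto intro!: linearI linear_continuous_on simp: matrix_vector_mult_add_rdistrib scaleR_matrix_vector_assoc)
  have bC: "bounded_linear (\<lambda>A::real^3^3. to_L2 ?B (\<lambda>x. A))" "bounded_linear (\<lambda>b::real^3. to_L2 ?B (\<lambda>x. b))"
    by (rule bounded_linear_to_L2_ball; auto intro: linearI)+
  have cA: "continuous_on UNIV (\<lambda>x. (A::real^3^3) *v x)" for A by (intro linear_continuous_on) simp
  have split: "to_L2 ?B (\<lambda>x. A *v x + b) = to_L2 ?B (\<lambda>x. A *v x) + to_L2 ?B (\<lambda>x. b)" for A :: "real^3^3" and b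
    unfolding to_L2_def abs_plus[OF sq_ball[OF cA] sq_ball[OF continuous_on_const]]
    by (rule arg_cong[where f=abs_L2]) auto
  obtain A' where A': "A \<longlonglongrightarrow> A'"
    using convergent_const_ball[OF r convergentI[OF G]] by (auto simp: convergent_def)
  have lA: "(\<lambda>n. to_L2 ?B (\<lambda>x. A n *v x)) \<longlonglongrightarrow> to_L2 ?B (\<lambda>x. A' *v x)" by (rule bounded_linear.tendsto[OF bA A'])
  have "(\<lambda>n. to_L2 ?B (\<lambda>x. b n)) \<longlonglongrightarrow> v - to_L2 ?B (\<lambda>x. A' *v x)"
    using tendsto_diff[OF V lA] by (simp add: split)
  from convergent_const_ball[OF r convergentI[OF this]] obtain b' where b': "b \<longlonglongrightarrow> b'"
    by (auto simp: convergent_def)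
  have lb: "(\<lambda>n. to_L2 ?B (\<lambda>x. b n)) \<longlonglongrightarrow> to_L2 ?B (\<lambda>x. b')" by (rule bounded_linear.tendsto[OF bC(2) b'])
  show thesis
  proof
    show "v = to_L2 ?B (\<lambda>x. A' *v x + b')"
      using LIMSEQ_unique[OF V] tendsto_add[OF lA lb] by (simp add: split)
    show "G = to_L2 ?B (\<lambda>x. A')"
      using LIMSEQ_unique[OF G bounded_linear.tendsto[OF bC(1) A']] .
  qed
qed

text \<open>The rigid motions of the approximating potentials near a given exterior point depend on
  the approximation. Their convergence is extracted from the L^2 convergence of fields and Jacobians
  by \<open>affine_limit\<close>.\<close>

lemma CurlCurlT_ker_potential:
  assumes \<Omega>: "\<Omega> \<subseteq> ball 0 R" "open \<Omega>" "R > 0" and S: "S \<in> ker_graph (CurlCurlT_ring \<Omega>)"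
  obtains v G where "(v, G) \<in> H10_graph (ball 0 (R + 3))" "symL2 G = S"
    "\<And>x0. x0 \<notin> closure \<Omega> \<Longrightarrow> \<exists>r>0. \<exists>A b. AE x in lebesgue. x \<in> ball x0 r \<longrightarrow> rep_L2 v x = A *v x + b \<and> rep_L2 G x = A"
proof -
  define \<epsilon> where "\<epsilon> n = 1 / real (Suc n)" for n
  have \<epsilon>: "\<epsilon> n > 0" "\<epsilon> n \<le> 1" for n by (auto simp: \<epsilon>_def)
  have "\<exists>S'. S' \<in> Cc_inf (ball 0 (R + 2)) \<and> (\<forall>x. transpose (S' x) = S' x) \<and> (\<forall>x. CurlCurlT_c S' x = 0) \<and>
    norm (abs_L2 S' - S) \<le> \<epsilon> n \<and> (\<forall>x. ball x (\<epsilon> n) \<inter> \<Omega> = {} \<longrightarrow> S' x = 0)" for n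
    using CurlCurlT_ker_mollify[OF \<Omega>(1,2) S \<epsilon>(1)[of n] \<epsilon>(2)[of n]] by metis
  then obtain T where T: "\<And>n. T n \<in> Cc_inf (ball 0 (R + 2))" "\<And>n x. transpose (T n x) = T n x" "\<And>n x. CurlCurlT_c (T n) x = 0"
    "\<And>n. norm (abs_L2 (T n) - S) \<le> \<epsilon> n" "\<And>n x. ball x (\<epsilon> n) \<inter> \<Omega> = {} \<Longrightarrow> T n x = 0" by metis
  have sT: "smooth (T n)" for n by (rule Cc_inf_smooth[OF T(1)])
  have "\<exists>v \<omega>. smooth v \<and> smooth \<omega> \<and> (\<forall>x. R + 2 \<le> norm x \<longrightarrow> v x = 0) \<and> (\<forall>x. grad_c v x = T n x + spn (\<omega> x)) \<and>
    (\<forall>x. grad_c \<omega> x = transpose (Curl_c (T n) x))" for n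
  proof -
    have "T n x = 0" if "R + 2 \<le> norm x" for x using Cc_inf_zero_off[OF T(1)] that by simp
    from saint_venant[OF sT _ this T(2,3)] \<Omega>(3) show ?thesis by (metis add_pos_pos zero_less_numeral)
  qed
  then obtain V \<omega> where V: "\<And>n. smooth (V n)" "\<And>n. smooth (\<omega> n)" "\<And>n x. R + 2 \<le> norm x \<Longrightarrow> V n x = 0"
    "\<And>n x. grad_c (V n) x = T n x + spn (\<omega> n x)" "\<And>n x. grad_c (\<omega> n) x = transpose (Curl_c (T n) x)" by metis
  have VC: "V n \<in> Cc_inf (ball 0 (R + 3))" for n
    by (rule Cc_infI[where K="cball 0 (R + 2)"]) (use V in auto)
  have sym: "symgrad_c (V n) = T n" for n
  proof
    fix x
    have "sym_part (T n x) = T n x" using T(2)[of n x] by (simp add: sym_part_def flip: scaleR_2)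
    then show "symgrad_c (V n) x = T n x"
      by (simp add: symgrad_c_def V(4) linear_add[OF bounded_linear.linear[OF bounded_linear_sym_part]] sym_part_spn)
  qed
  have lS: "(\<lambda>n. abs_L2 (T n)) \<longlonglongrightarrow> S"
  proof (rule LIM_zero_cancel, rule Lim_null_comparison)
    show "\<forall>\<^sub>F n in sequentially. norm (abs_L2 (T n) - S) \<le> \<epsilon> n" using T(4) by simp
    show "\<epsilon> \<longlonglongrightarrow> 0" unfolding \<epsilon>_def by (rule LIMSEQ_Suc[OF lim_1_over_n])
  qed
  have "Cauchy (\<lambda>n. abs_L2 (symgrad_c (V n)))" unfolding sym by (rule LIMSEQ_imp_Cauchy[OF lS])
  from H10_graph_complete[OF order_refl _ VC this] \<Omega>(3)
  obtain v G where W: "(v, G) \<in> H10_graph (ball 0 (R + 3))" "(\<lambda>n. abs_L2 (V n)) \<longlonglongrightarrow> v" "(\<lambda>n. abs_L2 (grad_c (V n))) \<longlonglongrightarrow> G"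
    "(\<lambda>n. abs_L2 (symgrad_c (V n))) \<longlonglongrightarrow> symL2 G"
    by (metis add_nonneg_nonneg less_imp_le zero_le_numeral)
  have symG: "symL2 G = S" using LIMSEQ_unique[OF W(4)] lS by (simp add: sym)
  have loc: "\<exists>r>0. \<exists>A b. AE x in lebesgue. x \<in> ball x0 r \<longrightarrow> rep_L2 v x = A *v x + b \<and> rep_L2 G x = A" if x0: "x0 \<notin> closure \<Omega>" for x0
  proof -
    have "open (- closure \<Omega>)" "x0 \<in> - closure \<Omega>" using x0 by (auto simp: open_Compl)
    then obtain e where e: "e > 0" "ball x0 e \<subseteq> - closure \<Omega>" using openE by blast
    define r where "r = e / 2"
    have r: "r > 0" using e by (simp add: r_def)
    let ?B = "ball x0 r"
    have Bm: "?B \<in> sets lebesgue" by simp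
    obtain N where N: "1 / real (Suc N) < r" using r nat_approx_posE by blast
    \<comment> \<open>Half of the free radius around \<open>x0\<close> is kept for the spreading:
      from N on, the mollification radius is below the other half.\<close>
    have zero: "T n x = 0" if "n \<ge> N" "x \<in> ?B" for n x
    proof (rule T(5))
      have "\<epsilon> n \<le> 1 / real (Suc N)" using that(1) by (simp add: \<epsilon>_def divide_simps)
      then have "\<epsilon> n < r" using N by simp
      have "ball x (\<epsilon> n) \<subseteq> ball x0 e"
      proof
        fix y assume "y \<in> ball x (\<epsilon> n)"
        then show "y \<in> ball x0 e" using that(2) \<open>\<epsilon> n < r\<close> dist_triangle[of x0 y x] by (simp add: r_def)
      qed
      then show "ball x (\<epsilon> n) \<inter> \<Omega> = {}" using e(2) closure_subset[of \<Omega>] by blast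
    qed
    \<comment> \<open>Where \<open>T n\<close> vanishes the gradient of the rotation field
      \<open>\<omega> n\<close> vanishes too, so \<open>\<omega> n\<close> is constant on the convex
      ball and \<open>V n\<close> has a constant skew Jacobian.\<close>
    have aff: "\<exists>A b. \<forall>x\<in>?B. V n x = A *v x + b \<and> grad_c (V n) x = A" if n: "n \<ge> N" for n
    proof -
      have "grad_c (\<omega> n) x = 0" if x: "x \<in> ?B" for x
      proof -
        have "pd k (T n) x = 0" for k by (rule dird_zero_open[OF open_ball x]) (rule zero[OF n])
        then show ?thesis unfolding V(5) by (simp add: vec_eq_iff forall_3 transpose_def Curl_c_nth[OF sT])
      qed
      then have d\<omega>: "(\<omega> n has_derivative (\<lambda>h. 0)) (at x within ?B)" if "x \<in> ?B" for x
        using smooth_has_derivative[OF V(2)[of n], of x] that grad_c_mult[OF V(2)[of n], of x]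
        by (simp add: has_derivative_at_withinI)
      from has_derivative_zero_constant[OF convex_ball d\<omega>] obtain w where w: "\<And>x. x \<in> ?B \<Longrightarrow> \<omega> n x = w" by blast
      define A where "A = spn w"
      have gA: "grad_c (V n) x = A" if "x \<in> ?B" for x using V(4)[of n x] zero[OF n that] w[OF that] by (simp add: A_def)
      have dV: "((\<lambda>x. V n x - A *v x) has_derivative (\<lambda>h. 0)) (at x within ?B)" if "x \<in> ?B" for x
      proof -
        have "((\<lambda>x. V n x - A *v x) has_derivative (\<lambda>h. dird h (V n) x - A *v h)) (at x)"
          by (intro derivative_intros smooth_has_derivative V bounded_linear_imp_has_derivative) simp
        moreover have "dird h (V n) x = A *v h" for h using grad_c_mult[OF V(1)[of n], of x h] gA[OF that] by simp
        ultimately show ?thesis by (simp add: has_derivative_at_withinI)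
      qed
      from has_derivative_zero_constant[OF convex_ball dV] obtain b where b: "\<And>x. x \<in> ?B \<Longrightarrow> V n x - A *v x = b" by blast
      have "\<forall>x\<in>?B. V n x = A *v x + b \<and> grad_c (V n) x = A" using gA b by (metis add.commute diff_add_cancel)
      then show ?thesis by blast
    qed
    then obtain A b where Ab: "\<And>n x. n \<ge> N \<Longrightarrow> x \<in> ?B \<Longrightarrow> V n x = A n *v x + b n \<and> grad_c (V n) x = A n" by metis
    \<comment> \<open>The affine form holds from N on, so limits are taken along the tail.\<close>
    have eq: "resL2 ?B (abs_L2 (V (n + N))) = to_L2 ?B (\<lambda>x. A (n + N) *v x + b (n + N))"
      "resL2 ?B (abs_L2 (grad_c (V (n + N)))) = to_L2 ?B (\<lambda>x. A (n + N))" for n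
      unfolding resL2_abs[OF Bm Cc_inf_sq[OF VC]] resL2_abs[OF Bm Cc_inf_sq[OF Cc_inf_grad_c[OF VC]]] to_L2_def
      by (intro arg_cong[where f=abs_L2] ext; use Ab[of "n + N"] in simp)+
    have "(\<lambda>n. to_L2 ?B (\<lambda>x. A (n + N) *v x + b (n + N))) \<longlonglongrightarrow> resL2 ?B v"
      unfolding eq[symmetric] by (intro bounded_linear.tendsto[OF bounded_linear_resL2[OF Bm]] LIMSEQ_ignore_initial_segment W)
    moreover have "(\<lambda>n. to_L2 ?B (\<lambda>x. A (n + N))) \<longlonglongrightarrow> resL2 ?B G"
      unfolding eq[symmetric] by (intro bounded_linear.tendsto[OF bounded_linear_resL2[OF Bm]] LIMSEQ_ignore_initial_segment W)
    ultimately obtain A' b' where L: "resL2 ?B v = to_L2 ?B (\<lambda>x. A' *v x + b')" "resL2 ?B G = to_L2 ?B (\<lambda>x. A')"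
      by (rule affine_limit[OF r])
    have c: "continuous_on UNIV (\<lambda>x. A' *v x + b')" by (rule smooth_continuous[OF smooth_affine])
    have "AE x in lebesgue. x \<in> ?B \<longrightarrow> rep_L2 v x = A' *v x + b' \<and> rep_L2 G x = A'"
      using rep_resL2[OF Bm, of v] rep_resL2[OF Bm, of G] rep_abs[OF sq_ball[OF c, of x0 r]]
        rep_abs[OF sq_ball[OF continuous_on_const[of UNIV A'], of x0 r]]
      unfolding L to_L2_def by eventually_elim auto
    then show ?thesis using r by blast
  qed
  show thesis by (rule that[OF W(1) symG loc])
qed

text \<open>The coefficients seen near a point are unique and locally constant, hence constant on a
  connected set. The local almost-everywhere statements are then glued.\<close>

lemma affine_on_component:
  fixes v :: vec_L2 and G :: ten_L2
  assumes C: "open C" "connected C"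
    and loc: "\<And>x0. x0 \<in> C \<Longrightarrow> \<exists>r>0. \<exists>A b. AE x in lebesgue. x \<in> ball x0 r \<longrightarrow> rep_L2 v x = A *v x + b \<and> rep_L2 G x = A"
  obtains A b where "AE x in lebesgue. x \<in> C \<longrightarrow> rep_L2 v x = A *v x + b \<and> rep_L2 G x = A"
proof (cases "C = {}")
  case True
  then show thesis using that by simp
next
  case False
  define Q where "Q p x \<longleftrightarrow> rep_L2 v x = fst p *v x + snd p \<and> rep_L2 G x = fst p" for p x
  define P where "P x0 r p \<longleftrightarrow> r > 0 \<and> (AE x in lebesgue. x \<in> ball x0 r \<longrightarrow> Q p x)" for x0 r p
  have ex: "\<exists>r p. P x0 r p" if x0: "x0 \<in> C" for x0
  proof -
    obtain r A b where "r > 0" "AE x in lebesgue. x \<in> ball x0 r \<longrightarrow> rep_L2 v x = A *v x + b \<and> rep_L2 G x = A"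
      using loc[OF x0] by blast
    then have "P x0 r (A, b)" by (simp add: P_def Q_def)
    then show ?thesis by blast
  qed
  \<comment> \<open>Since the Jacobian is recorded along with the field, a single common point
    determines both coefficients.\<close>
  have uniq: "p = q" if "P x0 r p" "P x0 s q" for x0 r s p q
  proof -
    have AE: "AE x in lebesgue. x \<in> ball x0 (min r s) \<longrightarrow> Q p x \<and> Q q x"
      using that unfolding P_def by (auto elim!: AE_mp)
    have "0 < min r s" using that unfolding P_def by simp
    then have "x0 \<in> ball x0 (min r s)" by (simp only: centre_in_ball)
    then have "ball x0 (min r s) \<noteq> {}" by blast
    from not_AE_open[OF open_ball this AE] obtain x where "Q p x" "Q q x" by blast
    then have "fst p = fst q" "fst p *v x + snd p = fst q *v x + snd q" unfolding Q_def by auto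
    then show ?thesis by (simp add: prod_eq_iff)
  qed
  define f where "f x0 = (SOME p. \<exists>r. P x0 r p)" for x0
  have f: "\<exists>r. P x0 r (f x0)" if "x0 \<in> C" for x0
    using someI_ex[of "\<lambda>p. \<exists>r. P x0 r p"] ex[OF that] unfolding f_def by blast
  have "f a = f b" if "a \<in> C" "b \<in> C" for a b
  proof (rule connected_local_const[OF C(2) that], rule ballI)
    fix x0 assume x0: "x0 \<in> C"
    obtain r where r: "P x0 r (f x0)" using f[OF x0] by blast
    have "f x0 = f y" if y: "y \<in> C" "dist y x0 < r" for y
    proof -
      obtain s where s: "P y s (f y)" using f[OF y(1)] by blast
      have "P y (r - dist y x0) (f x0)"
      proof -
        have sub: "ball y (r - dist y x0) \<subseteq> ball x0 r"
        proof
          fix z assume "z \<in> ball y (r - dist y x0)"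
          then show "z \<in> ball x0 r" using dist_triangle[of x0 z y] by (simp add: dist_commute)
        qed
        have a: "AE x in lebesgue. x \<in> ball x0 r \<longrightarrow> Q (f x0) x" using r unfolding P_def by blast
        have "AE x in lebesgue. x \<in> ball y (r - dist y x0) \<longrightarrow> Q (f x0) x"
          using a by (rule AE_mp, intro AE_I2) (use sub in blast)
        then show ?thesis using y(2) unfolding P_def by simp
      qed
      from uniq[OF this s] show ?thesis .
    qed
    then show "\<forall>\<^sub>F y in at x0 within C. f x0 = f y"
      using r unfolding eventually_at P_def by blast
  qed
  then obtain p where p: "\<And>x. x \<in> C \<Longrightarrow> f x = p" using False by blast
  \<comment> \<open>Uncountably many balls are involved. The exceptional set is null because
    negligibility is a local property.\<close>
  define N where "N = {x\<in>C. \<not> Q p x}"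
  have "negligible N"
    unfolding locally_negligible_alt[of N]
  proof
    fix x0 assume "x0 \<in> N"
    then have x0: "x0 \<in> C" by (simp add: N_def)
    then obtain r where r: "P x0 r p" using f p by metis
    have "AE x in lebesgue. x \<notin> N \<inter> ball x0 r" using r unfolding P_def N_def by (auto elim!: AE_mp)
    then obtain N' where "N' \<in> null_sets lebesgue" "N \<inter> ball x0 r \<subseteq> N'"
      unfolding eventually_ae_filter by (auto simp del: mem_ball)
    then have "negligible (N \<inter> ball x0 r)"
      using negligible_subset[of N'] by (simp add: negligible_iff_null_sets)
    then show "\<exists>U. openin (top_of_set N) U \<and> x0 \<in> U \<and> negligible U"
      using \<open>x0 \<in> N\<close> r unfolding P_def by (intro exI[of _ "N \<inter> ball x0 r"]) (auto simp: openin_open_Int)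
  qed
  then have "AE x in lebesgue. x \<notin> N" by (intro AE_not_in) (simp add: negligible_iff_null_sets)
  then have "AE x in lebesgue. x \<in> C \<longrightarrow> rep_L2 v x = fst p *v x + snd p \<and> rep_L2 G x = fst p"
    by eventually_elim (auto simp: N_def Q_def)
  then show thesis by (rule that)
qed

section \<open>The basis of harmonic fields\<close>

text \<open>Injectivity is obtained as well, so that the number of basis elements equals the number
  of indices.\<close>

lemma independent_family:
  fixes y :: "'i \<Rightarrow> 'v::real_vector"
  assumes I: "finite I" and ind: "\<And>c i. (\<Sum>i\<in>I. c i *\<^sub>R y i) = 0 \<Longrightarrow> i \<in> I \<Longrightarrow> c i = 0"
  shows "inj_on y I" "independent (y ` I)"
proof -
  show inj: "inj_on y I"
  proof (rule inj_onI, rule ccontr)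
    fix i k assume ik: "i \<in> I" "k \<in> I" "y i = y k" "i \<noteq> k"
    define c where "c n = (if n = i then 1 else if n = k then - 1 else (0::real))" for n
    have "(\<Sum>n\<in>I. c n *\<^sub>R y n) = (\<Sum>n\<in>I. (if n = i then y n else 0) - (if n = k then y n else 0))"
      using ik(4) by (intro sum.cong) (auto simp: c_def)
    also have "\<dots> = 0" using I ik by (simp add: sum_subtractf)
    finally have "c i = 0" using ind ik(1) by blast
    then show False by (simp add: c_def)
  qed
  show "independent (y ` I)"
    unfolding dependent_finite[OF finite_imageI[OF I]]
  proof (rule notI, elim exE conjE bexE)
    fix u w assume w: "w \<in> y ` I" "u w \<noteq> 0" and s: "(\<Sum>v\<in>y ` I. u v *\<^sub>R v) = 0"
    have "(\<Sum>i\<in>I. u (y i) *\<^sub>R y i) = 0" using s by (simp add: sum.reindex[OF inj])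
    then have "u (y i) = 0" if "i \<in> I" for i using ind[of "\<lambda>i. u (y i)"] that by blast
    then show False using w by auto
  qed
qed

definition gp :: "vec_field \<Rightarrow> vec_L2 \<times> ten_L2" where
  "gp \<phi> = (abs_L2 \<phi>, abs_L2 (grad_c \<phi>))"

lemma gp_add:
  assumes "f \<in> Cc_inf UNIV" "g \<in> Cc_inf UNIV" shows "gp (\<lambda>x. f x + g x) = gp f + gp g"
proof -
  have "grad_c (\<lambda>x. f x + g x) = (\<lambda>x. grad_c f x + grad_c g x)"
    using grad_c_linear(1)[OF Cc_inf_smooth[OF assms(1)] Cc_inf_smooth[OF assms(2)]] by blast
  then show ?thesis
    by (simp add: gp_def abs_plus Cc_inf_sq[OF assms(1)] Cc_inf_sq[OF assms(2)] Cc_inf_sq[OF Cc_inf_grad_c[OF assms(1)]] Cc_inf_sq[OF Cc_inf_grad_c[OF assms(2)]])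
qed

lemma gp_scale:
  assumes "f \<in> Cc_inf UNIV" shows "gp (\<lambda>x. c *\<^sub>R f x) = c *\<^sub>R gp f"
proof -
  have "grad_c (\<lambda>x. c *\<^sub>R f x) = (\<lambda>x. c *\<^sub>R grad_c f x)"
    using grad_c_linear(2)[OF Cc_inf_smooth[OF assms] Cc_inf_smooth[OF assms]] by blast
  then show ?thesis
    by (simp add: gp_def abs_scale Cc_inf_sq[OF assms(1)] Cc_inf_sq[OF Cc_inf_grad_c[OF assms(1)]])
qed

lemma gp_sum:
  assumes "finite I" "\<And>i. i \<in> I \<Longrightarrow> f i \<in> Cc_inf UNIV" shows "gp (\<lambda>x. \<Sum>i\<in>I. c i *\<^sub>R f i x) = (\<Sum>i\<in>I. c i *\<^sub>R gp (f i))"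
  using assms
proof (induction I rule: finite_induct)
  case empty
  have "grad_c (\<lambda>x. 0) x = 0" for x by (simp add: vec_eq_iff grad_c_nth dird_def)
  then have "grad_c (\<lambda>x. 0) = (\<lambda>x. 0)" by blast
  then show ?case by (simp add: gp_def abs_zero zero_prod_def)
next
  case (insert i I)
  have "(\<lambda>x. c i *\<^sub>R f i x) \<in> Cc_inf UNIV" "(\<lambda>x. \<Sum>i\<in>I. c i *\<^sub>R f i x) \<in> Cc_inf UNIV"
    using insert.prems by (auto intro!: Cc_inf_scaleR Cc_inf_sum)
  then show ?case using insert by (simp add: gp_add gp_scale)
qed

lemma gp_H10: "\<phi> \<in> Cc_inf \<Omega> \<Longrightarrow> gp \<phi> \<in> H10_graph \<Omega>"
  unfolding gp_def by (rule H10_graph_test)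

lemma rep_gp:
  assumes "\<phi> \<in> Cc_inf UNIV"
  shows "AE x in lebesgue. rep_L2 (fst (gp \<phi>)) x = \<phi> x \<and> rep_L2 (snd (gp \<phi>)) x = grad_c \<phi> x"
  unfolding gp_def fst_conv snd_conv
  using rep_abs[OF Cc_inf_sq[OF assms]] rep_abs[OF Cc_inf_sq[OF Cc_inf_grad_c[OF assms]]] by eventually_elim simp

lemma vanishes_on_UN:
  assumes "finite I" "\<And>i. i \<in> I \<Longrightarrow> vanishes_on p (S i)" shows "vanishes_on p (\<Union>i\<in>I. S i)"
  using assms by (induction I rule: finite_induct) (auto intro: vanishes_on_Un simp: vanishes_on_def)

lemma rigid_field_affine:
  assumes "j \<in> {1..6}" obtains w b where "\<And>x. rigid_field j x = spn w *v x + b"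
proof -
  define c where "c k = (if k = j then 1 else (0::real))" for k
  have "rigid_field j x = (\<Sum>k\<in>{1..6}. c k *\<^sub>R rigid_field k x)" for x
  proof -
    have "(\<Sum>k\<in>{1..6}. c k *\<^sub>R rigid_field k x) = (\<Sum>k\<in>{1..6}. if k = j then rigid_field k x else 0)"
      by (intro sum.cong) (auto simp: c_def)
    then show ?thesis using assms by simp
  qed
  then show thesis using that unfolding rigid_sum by blast
qed

lemma symgrad_cutoff:
  assumes "open U" "x \<in> U" "\<And>y. y \<in> U \<Longrightarrow> \<eta> y = a" "j \<in> {1..6}"
  shows "symgrad_c (\<lambda>x. \<eta> x *\<^sub>R rigid_field j x) x = 0"
proof -
  obtain w b where wb: "\<And>x. rigid_field j x = spn w *v x + b" using rigid_field_affine[OF assms(4)] by metis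
  have "grad_c (\<lambda>x. \<eta> x *\<^sub>R rigid_field j x) x = grad_c (\<lambda>x. (a *\<^sub>R spn w) *v x + a *\<^sub>R b) x"
    by (rule grad_c_transform_open[OF smooth_affine assms(1,2)]) (simp add: assms(3) wb scaleR_add_right scaleR_matrix_vector_assoc)
  then have "grad_c (\<lambda>x. \<eta> x *\<^sub>R rigid_field j x) x = a *\<^sub>R spn w" by (simp add: grad_c_affine)
  then show ?thesis
    by (simp add: symgrad_c_def linear_scale[OF bounded_linear.linear[OF bounded_linear_sym_part]] sym_part_spn)
qed

lemma cutoff_values:
  assumes "is_cutoff_family m \<Xi> \<xi>" "l \<in> {1..m - 1}" "k \<le> m - 1" "x \<in> \<Xi> k"
  shows "\<xi> l x = (if k = l then 1 else 0)"
proof -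
  note d = assms(1)[unfolded is_cutoff_family_def]
  note c1 = d[THEN conjunct2, THEN conjunct2, THEN conjunct1] and c0 = d[THEN conjunct2, THEN conjunct2, THEN conjunct2]
  show ?thesis
  proof (cases "k = l")
    case True
    obtain U where "\<Xi> l \<subseteq> U" "\<forall>x\<in>U. \<xi> l x = 1" using bspec[OF c1 assms(2)] by blast
    then show ?thesis using True assms(4) by auto
  next
    case False
    then have "k \<in> {0..m - 1} - {l}" using assms(3) by simp
    then obtain U where "\<Xi> k \<subseteq> U" "\<forall>x\<in>U. \<xi> l x = 0" using bspec[OF bspec[OF c0 assms(2)]] by blast
    then show ?thesis using False assms(4) by auto
  qed
qed

lemma exterior_component_outside:
  fixes \<Omega> :: "(real^3) set"
  assumes en: "exterior_enumeration \<Omega> m \<Xi>" and "k \<le> m - 1" "x \<in> \<Xi> k" shows "x \<notin> closure \<Omega>" "x \<notin> \<Omega>"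
proof -
  have "x \<in> - closure \<Omega>" unfolding exterior_enumeration_props(3)[OF en] using assms(2,3) by auto
  then show "x \<notin> closure \<Omega>" "x \<notin> \<Omega>" using closure_subset[of \<Omega>] by blast+
qed

lemma cutoff_Cc_inf: "is_cutoff_family m \<Xi> \<xi> \<Longrightarrow> l \<in> {1..m - 1} \<Longrightarrow> (\<lambda>x. \<xi> l x *\<^sub>R rigid_field j x) \<in> Cc_inf UNIV"
  by (rule Cc_inf_smooth_scaleR_right[OF _ smooth_rigid_field]) (simp add: is_cutoff_family_def)

text \<open>On each component the cut-off is locally constant and the field locally rigid. The
  boundary follows by continuity, because the complement of \<Omega> is the closure of the exterior.
  Restricting the symmetric gradient to \<Omega> therefore changes nothing.\<close>

lemma cutoff_symgrad_outside:
  fixes \<Omega> :: "(real^3) set"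
  assumes \<Omega>: "open \<Omega>" "continuous_boundary \<Omega>" and en: "exterior_enumeration \<Omega> m \<Xi>" and cf: "is_cutoff_family m \<Xi> \<xi>"
    and lj: "l \<in> {1..m - 1}" "j \<in> {1..6}" and x: "x \<notin> \<Omega>"
  shows "symgrad_c (\<lambda>x. \<xi> l x *\<^sub>R rigid_field j x) x = 0"
proof -
  let ?f = "\<lambda>x. \<xi> l x *\<^sub>R rigid_field j x"
  have "continuous_on UNIV (symgrad_c ?f)"
    by (rule smooth_continuous[OF smooth_symgrad_c[OF Cc_inf_smooth[OF cutoff_Cc_inf[OF cf lj(1)]]]])
  then have cl: "closed {x. symgrad_c ?f x = 0}" by (intro closed_Collect_eq continuous_on_const)
  have "symgrad_c ?f y = 0" if y: "y \<in> - closure \<Omega>" for y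
  proof -
    obtain k where k: "k \<le> m - 1" "y \<in> \<Xi> k" using y[unfolded exterior_enumeration_props(3)[OF en]] by auto
    show ?thesis
      by (rule symgrad_cutoff[OF exterior_enumeration_props(5)[OF en k(1)] k(2) cutoff_values[OF cf lj(1) k(1)] lj(2)])
  qed
  then have "closure (- closure \<Omega>) \<subseteq> {x. symgrad_c ?f x = 0}" by (intro closure_minimal cl) auto
  moreover have "x \<in> closure (- closure \<Omega>)" unfolding compl_eq_closure_exterior[OF \<Omega>, symmetric] using x by simp
  ultimately show ?thesis by blast
qed

text \<open>The given cut-offs need not be locally constant near the closures of the components; they are
  compared with cut-offs that are.\<close>

lemma cutoff_ker_CurlCurlT:
  fixes \<Omega> :: "(real^3) set"
  assumes \<Omega>: "open \<Omega>" "bounded \<Omega>" "continuous_boundary \<Omega>"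
    and en: "exterior_enumeration \<Omega> m \<Xi>" and cf: "is_cutoff_family m \<Xi> \<xi>"
    and lj: "l \<in> {1..m - 1}" "j \<in> {1..6}"
  shows "abs_L2 (symgrad_c (\<lambda>x. \<xi> l x *\<^sub>R rigid_field j x)) \<in> ker_graph (CurlCurlT_ring \<Omega>)"
proof -
  interpret symL2: bounded_linear symL2 by (rule bounded_linear_symL2)
  note P = exterior_enumeration_props[OF en]
  obtain \<xi>' where cf': "is_cutoff_family m \<Xi> \<xi>'" and
    strong: "\<And>l k. l \<in> {1..m - 1} \<Longrightarrow> k \<le> m - 1 \<Longrightarrow> \<exists>W. open W \<and> closure (\<Xi> k) \<subseteq> W \<and> (\<forall>x\<in>W. \<xi>' l x = (if k = l then 1 else 0))"
    using cutoff_family_exists[OF \<Omega> en] by metis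
  obtain W where W: "\<And>k. k \<le> m - 1 \<Longrightarrow> open (W k)" "\<And>k. k \<le> m - 1 \<Longrightarrow> closure (\<Xi> k) \<subseteq> W k"
    "\<And>k x. k \<le> m - 1 \<Longrightarrow> x \<in> W k \<Longrightarrow> \<xi>' l x = (if k = l then 1 else 0)"
    using strong[OF lj(1)] by metis
  let ?f = "\<lambda>x. \<xi> l x *\<^sub>R rigid_field j x" and ?g = "\<lambda>x. \<xi>' l x *\<^sub>R rigid_field j x"
  have f: "?f \<in> Cc_inf UNIV" and g: "?g \<in> Cc_inf UNIV" by (intro cutoff_Cc_inf[OF cf lj(1)] cutoff_Cc_inf[OF cf' lj(1)])+
  \<comment> \<open>What the neighbourhoods of constancy leave over: a compact subset of \<Omega>
    that carries the symmetric gradient of \<open>?g\<close>.\<close>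
  define K where "K = - (\<Union>k\<le>m - 1. W k)"
  have clK: "closed K" unfolding K_def by (intro closed_Compl open_UN) (use W in auto)
  have "- \<Omega> \<subseteq> (\<Union>k\<le>m - 1. W k)"
  proof -
    have "closure (\<Union>k\<le>m - 1. \<Xi> k) \<subseteq> (\<Union>k\<le>m - 1. closure (\<Xi> k))"
      by (rule closure_minimal) (auto intro!: closed_UN closure_subset[THEN subsetD])
    also have "\<dots> \<subseteq> (\<Union>k\<le>m - 1. W k)" using W(2) by blast
    finally show ?thesis unfolding compl_eq_closure_exterior[OF \<Omega>(1,3)] P(3) .
  qed
  then have K: "K \<subseteq> \<Omega>" by (auto simp: K_def)
  have "compact K" using clK \<Omega>(2) K bounded_subset compact_eq_bounded_closed by blast
  then have "symgrad_c ?g \<in> Cc_inf \<Omega>"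
  proof (rule Cc_infI[OF smooth_symgrad_c[OF Cc_inf_smooth[OF g]] _ K])
    fix x assume "x \<notin> K"
    then obtain k where k: "k \<le> m - 1" "x \<in> W k" by (auto simp: K_def)
    show "symgrad_c ?g x = 0" by (rule symgrad_cutoff[OF W(1)[OF k(1)] k(2) W(3)[OF k(1)] lj(2)])
  qed
  then have gK: "abs_L2 (symgrad_c ?g) \<in> ker_graph (CurlCurlT_ring \<Omega>)"
    by (rule symgrad_Cc_inf_sym[OF _ Cc_inf_smooth[OF g]])
  \<comment> \<open>Both cut-offs take the same values on the exterior, so the difference of the
    fields vanishes there and belongs to H^1_0 of \<Omega>.\<close>
  have p: "gp ?f - gp ?g \<in> H10_graph \<Omega>"
  proof (rule H10_graph_vanishing[OF \<Omega>])
    show "gp ?f - gp ?g \<in> H10_graph UNIV" by (intro subspace_diff[OF subspace_H10_graph] gp_H10 f g)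
    have "vanishes_on (gp ?f - gp ?g) (\<Xi> k)" if k: "k \<le> m - 1" for k
    proof -
      have eq: "?f y = ?g y" if "y \<in> \<Xi> k" for y
        using cutoff_values[OF cf lj(1) k that] cutoff_values[OF cf' lj(1) k that] by simp
      have "grad_c ?f y = grad_c ?g y" if "y \<in> \<Xi> k" for y
        by (rule grad_c_transform_open[OF Cc_inf_smooth[OF g] P(5)[OF k] that eq])
      then show ?thesis
        unfolding vanishes_on_def fst_diff snd_diff
        using rep_gp[OF f] rep_gp[OF g] rep_minus[of "fst (gp ?f)" "fst (gp ?g)"] rep_minus[of "snd (gp ?f)" "snd (gp ?g)"] eq
        by - (rule AE_mp, assumption, rule AE_mp, assumption, rule AE_mp, assumption, rule AE_mp, assumption, intro AE_I2, auto)
    qed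
    then show "vanishes_on (gp ?f - gp ?g) (- closure \<Omega>)"
      unfolding P(3) by (intro vanishes_on_UN) auto
  qed
  have "abs_L2 (symgrad_c ?f) = symL2 (snd (gp ?f - gp ?g)) + abs_L2 (symgrad_c ?g)"
    by (simp add: symL2.diff) (simp add: gp_def symL2_grad[OF f] symL2_grad[OF g])
  then show ?thesis
    using subspace_add[OF subspace_ker_CurlCurlT H10_graph_ker_CurlCurlT[OF p] gK] by simp
qed

text \<open>On a component only its own cut-off contributes. The unbounded component has none, hence
  the separate value for k = 0.\<close>

lemma cutoff_combination:
  fixes \<Omega> :: "(real^3) set" and c :: "nat \<times> nat \<Rightarrow> real"
  assumes en: "exterior_enumeration \<Omega> m \<Xi>" and cf: "is_cutoff_family m \<Xi> \<xi>"
    and k: "k \<le> m - 1" and x: "x \<in> \<Xi> k"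
  defines "F \<equiv> \<lambda>x. \<Sum>i\<in>{1..m - 1} \<times> {1..6}. c i *\<^sub>R (\<xi> (fst i) x *\<^sub>R rigid_field (snd i) x)"
    and "A \<equiv> if k = 0 then 0 else spn (vector [c (k, 1), c (k, 2), c (k, 3)])"
    and "b \<equiv> if k = 0 then 0 else vector [c (k, 4), c (k, 5), c (k, 6)]"
  shows "F x = A *v x + b" "grad_c F x = A"
proof -
  have F: "F y = A *v y + b" if y: "y \<in> \<Xi> k" for y
  proof -
    have "F y = (\<Sum>l\<in>{1..m - 1}. \<Sum>j\<in>{1..6}. c (l, j) *\<^sub>R (\<xi> l y *\<^sub>R rigid_field j y))"
      unfolding F_def by (subst sum.cartesian_product) (simp add: case_prod_beta)
    also have "\<dots> = (\<Sum>l\<in>{1..m - 1}. if l = k then \<Sum>j\<in>{1..6}. c (l, j) *\<^sub>R rigid_field j y else 0)"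
      by (intro sum.cong refl) (simp add: cutoff_values[OF cf _ k y])
    also have "\<dots> = A *v y + b"
      using k rigid_sum[of "\<lambda>j. c (k, j)" y] by (auto simp: A_def b_def)
    finally show ?thesis .
  qed
  show "F x = A *v x + b" by (rule F[OF x])
  have "grad_c F x = grad_c (\<lambda>x. A *v x + b) x"
    by (rule grad_c_transform_open[OF smooth_affine exterior_enumeration_props(5)[OF en k] x F])
  then show "grad_c F x = A" by (simp add: grad_c_affine)
qed

text \<open>By \<open>sy\<close> below, a linear combination of the \<open>y i\<close> is the
  symmetric gradient of a single pair, the combined cut-off field \<open>F c\<close> minus an
  element of H^1_0. Independence and spanning thereby become statements about that pair.\<close>

lemma harmonic_fields_basis:
  fixes \<Omega> :: "(real^3) set"
  assumes \<Omega>: "open \<Omega>" "bounded \<Omega>" "continuous_boundary \<Omega>"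
    and en: "exterior_enumeration \<Omega> m \<Xi>" and cf: "is_cutoff_family m \<Xi> \<xi>"
  defines "I \<equiv> {1..m - 1} \<times> {1..6}" and "y \<equiv> \<lambda>i. symGrad \<Omega> (v_field \<Omega> (\<xi> (fst i)) (snd i))"
  shows "\<And>l j. l \<in> {1..m - 1} \<Longrightarrow> v_field \<Omega> (\<xi> l) j \<in> H1 \<Omega>" "inj_on y I" "independent (y ` I)" "span (y ` I) = harmonic_fields \<Omega>"
proof -
  interpret symL2: bounded_linear symL2 by (rule bounded_linear_symL2)
  note P = exterior_enumeration_props[OF en]
  obtain R0 where R0: "R0 > 0" "\<Omega> \<subseteq> ball 0 R0" using bounded_subset_ballD[OF \<Omega>(2), of 0] by blast
  have \<Omega>m: "\<Omega> \<in> sets lebesgue" by (rule open_sets_lebesgue[OF \<Omega>(1)])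
  have finI: "finite I" by (simp add: I_def)
  define f where "f i = (\<lambda>x. \<xi> (fst i) x *\<^sub>R rigid_field (snd i) x)" for i
  have f: "f i \<in> Cc_inf UNIV" if "i \<in> I" for i
    unfolding f_def by (rule cutoff_Cc_inf[OF cf]) (use that in \<open>auto simp: I_def\<close>)
  have vf: "\<exists>\<psi> G. (\<psi>, G) \<in> H10_graph \<Omega> \<and> v_field \<Omega> (\<xi> l) j \<in> H1 \<Omega> \<and>
      symGrad \<Omega> (v_field \<Omega> (\<xi> l) j) = to_L2 \<Omega> (symgrad_c (\<lambda>x. \<xi> l x *\<^sub>R rigid_field j x)) - symL2 G \<and>
      symGrad \<Omega> (v_field \<Omega> (\<xi> l) j) \<in> ker_graph (Div_S \<Omega>)" if "l \<in> {1..m - 1}" for l j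
  proof -
    have "\<xi> l \<in> Cc_inf UNIV" using cf that by (simp add: is_cutoff_family_def)
    then show ?thesis by (rule v_field_properties[OF \<Omega>(1) R0(2) less_imp_le[OF R0(1)], of "\<xi> l" j]) blast
  qed
  then show "v_field \<Omega> (\<xi> l) j \<in> H1 \<Omega>" if "l \<in> {1..m - 1}" for l j using that by blast
  have "\<exists>q. q \<in> H10_graph \<Omega> \<and> y i = symL2 (snd (gp (f i))) - symL2 (snd q) \<and> y i \<in> ker_graph (Div_S \<Omega>)" if i: "i \<in> I" for i
  proof -
    have i': "fst i \<in> {1..m - 1}" "snd i \<in> {1..6}" using i by (auto simp: I_def)
    have "to_L2 \<Omega> (symgrad_c (f i)) = abs_L2 (symgrad_c (f i))"
      by (rule to_L2_eq) (unfold f_def, rule cutoff_symgrad_outside[OF \<Omega>(1,3) en cf i'])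
    also have "\<dots> = symL2 (snd (gp (f i)))" by (simp add: gp_def symL2_grad[OF f[OF i]])
    finally show ?thesis using vf[OF i'(1), of "snd i"] unfolding y_def f_def by fastforce
  qed
  then obtain q where q: "\<And>i. i \<in> I \<Longrightarrow> q i \<in> H10_graph \<Omega>" "\<And>i. i \<in> I \<Longrightarrow> y i = symL2 (snd (gp (f i))) - symL2 (snd (q i))"
    "\<And>i. i \<in> I \<Longrightarrow> y i \<in> ker_graph (Div_S \<Omega>)" by metis
  have subD: "subspace (ker_graph (Div_S \<Omega>))" by (rule subspace_ker_Div_S[OF \<Omega>(1) R0(2) less_imp_le[OF R0(1)]])
  have perp: "symL2 (snd z) \<bullet> S = 0" if "z \<in> H10_graph \<Omega>" "S \<in> ker_graph (Div_S \<Omega>)" for z S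
    using that unfolding ker_Div_S[OF \<Omega>(1) R0(2) less_imp_le[OF R0(1)]] by blast
  define F where "F c = (\<lambda>x. \<Sum>i\<in>I. c i *\<^sub>R f i x)" for c
  have F: "F c \<in> Cc_inf UNIV" for c unfolding F_def by (intro Cc_inf_sum Cc_inf_scaleR f)
  have gF: "gp (F c) = (\<Sum>i\<in>I. c i *\<^sub>R gp (f i))" for c unfolding F_def by (rule gp_sum[OF finI f])
  have Q: "(\<Sum>i\<in>I. c i *\<^sub>R q i) \<in> H10_graph \<Omega>" for c
    by (intro subspace_sum[OF subspace_H10_graph] subspace_scale[OF subspace_H10_graph] q)
  have sy: "(\<Sum>i\<in>I. c i *\<^sub>R y i) = symL2 (snd (gp (F c) - (\<Sum>i\<in>I. c i *\<^sub>R q i)))" for c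
  proof -
    have "symL2 (snd (gp (F c) - (\<Sum>i\<in>I. c i *\<^sub>R q i))) = (\<Sum>i\<in>I. c i *\<^sub>R symL2 (snd (gp (f i)))) - (\<Sum>i\<in>I. c i *\<^sub>R symL2 (snd (q i)))"
      unfolding gF by (simp add: snd_sum symL2.diff symL2.sum symL2.scale)
    also have "\<dots> = (\<Sum>i\<in>I. c i *\<^sub>R y i)"
      by (simp add: q(2) scaleR_diff_right sum_subtractf)
    finally show ?thesis ..
  qed
  have Fval: "F c x = (if k = 0 then 0 else spn (vector [c (k, 1), c (k, 2), c (k, 3)])) *v x + (if k = 0 then 0 else vector [c (k, 4), c (k, 5), c (k, 6)])"
      "grad_c (F c) x = (if k = 0 then 0 else spn (vector [c (k, 1), c (k, 2), c (k, 3)]))"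
    if "k \<le> m - 1" "x \<in> \<Xi> k" for c k x
    using cutoff_combination[OF en cf that, of c] unfolding F_def f_def I_def by blast+
  have ind: "c i = 0" if c: "(\<Sum>i\<in>I. c i *\<^sub>R y i) = 0" and i: "i \<in> I" for c i
  proof -
    obtain K where K: "compact K" "\<And>x. x \<notin> K \<Longrightarrow> F c x = 0" using Cc_infE[OF F] by metis
    obtain R1 where R1: "R1 > 0" "K \<subseteq> ball 0 R1" using bounded_subset_ballD[OF compact_imp_bounded[OF K(1)], of 0] by blast
    define R where "R = max R0 R1"
    have R: "\<Omega> \<subseteq> ball 0 R" "K \<subseteq> ball 0 R" "R \<ge> 0" using R0 R1 by (auto simp: R_def)
    have FR: "F c \<in> Cc_inf (ball 0 R)" by (rule Cc_infI[OF Cc_inf_smooth[OF F] K(1) R(2) K(2)])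
    \<comment> \<open>This pair has zero boundary values on a ball containing the supports, and its
      symmetric gradient is the given combination. If the latter vanishes, so does the pair.\<close>
    define D where "D = gp (F c) - (\<Sum>i\<in>I. c i *\<^sub>R q i)"
    have "D \<in> H10_graph (ball 0 R)"
      unfolding D_def using FR
      by (intro subspace_diff[OF subspace_H10_graph] gp_H10 subsetD[OF H10_graph_mono[OF R(1)] Q])
    then have "(fst D, snd D) \<in> H10_graph (ball 0 R)" by simp
    from H10_graph_zero[OF order_refl R(3) this] have "D = 0"
      using c[unfolded sy, folded D_def] by (simp add: prod_eq_iff)
    \<comment> \<open>The cut-off combination coincides with an element of H^1_0 of \<Omega>, so it
      is zero on the exterior, where its values show the coefficients.\<close>
    then have "gp (F c) \<in> H10_graph \<Omega>" using Q[of c] by (simp add: D_def)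
    then have on: "fst (gp (F c)) \<in> L2_on \<Omega>" "snd (gp (F c)) \<in> L2_on \<Omega>" using H10_graph_L2_on[OF \<Omega>m] by (metis prod.collapse)+
    have i': "fst i \<in> {1..m - 1}" "fst i \<le> m - 1" "snd i \<in> {1..6}" using i by (auto simp: I_def)
    have "AE x in lebesgue. x \<in> \<Xi> (fst i) \<longrightarrow> F c x = 0 \<and> grad_c (F c) x = 0"
      using rep_gp[OF F[of c]] on[unfolded L2_on_def mem_Collect_eq]
    proof eventually_elim
      case (elim x)
      then show ?case using exterior_component_outside(2)[OF en i'(2), of x] by auto
    qed
    from not_AE_open[OF P(5)[OF i'(2)] in_components_nonempty[OF P(1)[OF i'(2)]] this]
    obtain x where x: "x \<in> \<Xi> (fst i)" "F c x = 0" "grad_c (F c) x = 0" by blast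
    have "c (fst i, snd i) = 0"
    proof (rule rigid_sum_eq_0[where c="\<lambda>j. c (fst i, j)", OF _ _ i'(3)])
      show "spn (vector [c (fst i, 1), c (fst i, 2), c (fst i, 3)]) = 0"
        using Fval(2)[OF i'(2) x(1), of c] x(3) i'(1) by simp
      show "spn (vector [c (fst i, 1), c (fst i, 2), c (fst i, 3)]) *v x + vector [c (fst i, 4), c (fst i, 5), c (fst i, 6)] = 0"
        using Fval(1)[OF i'(2) x(1), of c] x(2) i'(1) by simp
    qed
    then show ?thesis by simp
  qed
  show "inj_on y I" by (rule independent_family(1)[of I y, OF finI]) (rule ind)
  show "independent (y ` I)" by (rule independent_family(2)[of I y, OF finI]) (rule ind)
  have yK: "y i \<in> ker_graph (CurlCurlT_ring \<Omega>)" if i: "i \<in> I" for i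
  proof -
    have "symL2 (snd (gp (f i))) = abs_L2 (symgrad_c (f i))" by (simp add: gp_def symL2_grad[OF f[OF i]])
    also have "\<dots> \<in> ker_graph (CurlCurlT_ring \<Omega>)"
      unfolding f_def by (rule cutoff_ker_CurlCurlT[OF \<Omega> en cf]) (use i in \<open>auto simp: I_def\<close>)
    finally show ?thesis
      unfolding q(2)[OF i] by (rule subspace_diff[OF subspace_ker_CurlCurlT _ H10_graph_ker_CurlCurlT[OF q(1)[OF i]]])
  qed
  show "span (y ` I) = harmonic_fields \<Omega>"
  proof
    have "subspace (harmonic_fields \<Omega>)"
      unfolding harmonic_fields_def by (intro subspace_inter subspace_ker_CurlCurlT subD)
    then show "span (y ` I) \<subseteq> harmonic_fields \<Omega>"
      by (intro span_minimal) (auto simp: harmonic_fields_def yK q(3))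
    show "harmonic_fields \<Omega> \<subseteq> span (y ` I)"
    proof
      fix S assume "S \<in> harmonic_fields \<Omega>"
      then have S: "S \<in> ker_graph (CurlCurlT_ring \<Omega>)" "S \<in> ker_graph (Div_S \<Omega>)" by (auto simp: harmonic_fields_def)
      have Son: "S \<in> L2_on \<Omega>" using S(2) unfolding ker_Div_S[OF \<Omega>(1) R0(2) less_imp_le[OF R0(1)]] by (simp add: L2_sym_def)
      obtain v G where vG: "(v, G) \<in> H10_graph (ball 0 (R0 + 3))" "symL2 G = S"
        "\<And>x0. x0 \<notin> closure \<Omega> \<Longrightarrow> \<exists>r>0. \<exists>A b. AE x in lebesgue. x \<in> ball x0 r \<longrightarrow> rep_L2 v x = A *v x + b \<and> rep_L2 G x = A"
        by (rule CurlCurlT_ker_potential[OF R0(2) \<Omega>(1) R0(1) S(1)]) blast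
      have aff: "\<exists>A b. AE x in lebesgue. x \<in> \<Xi> k \<longrightarrow> rep_L2 v x = A *v x + b \<and> rep_L2 G x = A" if k: "k \<le> m - 1" for k
        by (rule affine_on_component[OF P(5)[OF k] in_components_connected[OF P(1)[OF k]]
              vG(3)[OF exterior_component_outside(1)[OF en k]]]) (assumption, blast)
      have "\<exists>p. k \<le> m - 1 \<longrightarrow> (AE x in lebesgue. x \<in> \<Xi> k \<longrightarrow> rep_L2 v x = fst p *v x + snd p \<and> rep_L2 G x = fst p)" for k
      proof (cases "k \<le> m - 1")
        case True
        from aff[OF this] obtain A b where "AE x in lebesgue. x \<in> \<Xi> k \<longrightarrow> rep_L2 v x = A *v x + b \<and> rep_L2 G x = A" by blast
        then show ?thesis by (intro exI[of _ "(A, b)"]) simp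
      qed simp
      then have "\<exists>p. \<forall>k. k \<le> m - 1 \<longrightarrow> (AE x in lebesgue. x \<in> \<Xi> k \<longrightarrow> rep_L2 v x = fst (p k) *v x + snd (p k) \<and> rep_L2 G x = fst (p k))"
        by (intro choice allI)
      then obtain p where p: "\<And>k. k \<le> m - 1 \<Longrightarrow> AE x in lebesgue. x \<in> \<Xi> k \<longrightarrow> rep_L2 v x = fst (p k) *v x + snd (p k) \<and> rep_L2 G x = fst (p k)"
        by blast
      define A b where "A k = fst (p k)" and "b k = snd (p k)" for k
      have Ab: "AE x in lebesgue. x \<in> \<Xi> k \<longrightarrow> rep_L2 v x = A k *v x + b k \<and> rep_L2 G x = A k" if "k \<le> m - 1" for k
        using p[OF that] by (simp add: A_def b_def)
      \<comment> \<open>The unbounded component reaches beyond the ball that carries the potential,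
        and the rigid motion on it vanishes there.\<close>
      have A0: "A 0 = 0 \<and> b 0 = 0"
      proof -
        let ?U = "\<Xi> 0 \<inter> - cball 0 (R0 + 3)"
        have U: "open ?U" using P(5)[of 0] by (intro open_Int) (auto simp: open_Compl)
        have ne: "?U \<noteq> {}" using P(4) bounded_subset[OF bounded_cball[of 0 "R0 + 3"], of "\<Xi> 0"] by blast
        have h: "v \<in> L2_on (ball 0 (R0 + 3))" "G \<in> L2_on (ball 0 (R0 + 3))"
          using H10_graph_L2_on[OF _ vG(1)] by auto
        have "AE x in lebesgue. x \<in> ?U \<longrightarrow> A 0 *v x + b 0 = 0 \<and> A 0 = 0"
          using Ab[of 0, OF le0] h[unfolded L2_on_def mem_Collect_eq]
        proof eventually_elim
          case (elim x)
          show ?case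
          proof
            assume x: "x \<in> ?U"
            then have "x \<notin> ball 0 (R0 + 3)" using ball_subset_cball by blast
            with elim x show "A 0 *v x + b 0 = 0 \<and> A 0 = 0" by auto
          qed
        qed
        from not_AE_open[OF U ne this] obtain x where "A 0 *v x + b 0 = 0" "A 0 = 0" by blast
        then show ?thesis by (simp only: matrix_vector_mult_0 add_0)
      qed
      \<comment> \<open>On an exterior component S is zero, so the constant Jacobian has vanishing
        symmetric part.\<close>
      have skew: "A k = spn (vector [A k $ 3 $ 2, A k $ 1 $ 3, A k $ 2 $ 1])" if k: "k \<le> m - 1" for k
      proof (rule skew_eq_spn)
        have "AE x in lebesgue. x \<in> \<Xi> k \<longrightarrow> sym_part (A k) = 0"
          using Ab[OF k] rep_symL2[of G, unfolded vG(2)] Son[unfolded L2_on_def mem_Collect_eq]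
        proof eventually_elim
          case (elim x)
          then show ?case using exterior_component_outside(2)[OF en k, of x] by auto
        qed
        from not_AE_open[OF P(5)[OF k] in_components_nonempty[OF P(1)[OF k]] this]
        show "sym_part (A k) = 0" by blast
      qed
      \<comment> \<open>The inverse of \<open>rigid_sum\<close>: the rotation vector is read off
        from the entries 32, 13 and 21 of the skew matrix, the translation from the components of
        \<open>b k\<close>; for j = 6 the index is 3 in the cyclic index type.\<close>
      define c where "c i = (let k = fst i; j = snd i in if j = 1 then A k $ 3 $ 2 else if j = 2 then A k $ 1 $ 3
        else if j = 3 then A k $ 2 $ 1 else b k $ of_nat (j - 3))" for i :: "nat \<times> nat"
      have cA: "spn (vector [c (k, 1), c (k, 2), c (k, 3)]) = A k" if "k \<le> m - 1" for k
        using skew[OF that] by (simp add: c_def)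
      have cb: "vector [c (k, 4), c (k, 5), c (k, 6)] = b k" for k
        by (simp add: c_def vec_eq_iff forall_3 vector_3)
      have FA: "F c x = A k *v x + b k" "grad_c (F c) x = A k" if k: "k \<le> m - 1" "x \<in> \<Xi> k" for k x
        using Fval[OF k, of c] cA[OF k(1)] cb[of k] A0 by (auto split: if_splits)
      have van: "vanishes_on ((v, G) - gp (F c)) (\<Xi> k)" if k: "k \<le> m - 1" for k
        unfolding vanishes_on_def fst_diff snd_diff fst_conv snd_conv
        using Ab[OF k] rep_gp[OF F[of c]] rep_minus[of v "fst (gp (F c))"] rep_minus[of G "snd (gp (F c))"]
      proof eventually_elim
        case (elim x)
        then show ?case using FA[OF k, of x] by auto
      qed
      have z: "(v, G) - gp (F c) \<in> H10_graph \<Omega>"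
      proof (rule H10_graph_vanishing[OF \<Omega>])
        show "(v, G) - gp (F c) \<in> H10_graph UNIV"
          using vG(1) H10_graph_mono[of "ball 0 (R0 + 3)" UNIV] by (intro subspace_diff[OF subspace_H10_graph] gp_H10 F) blast
        show "vanishes_on ((v, G) - gp (F c)) (- closure \<Omega>)" unfolding P(3) by (intro vanishes_on_UN van) auto
      qed
      \<comment> \<open>T lies in the kernel of the divergence and is also a symmetric gradient from
        H^1_0; these spaces are orthogonal, so T = 0.\<close>
      define T where "T = S - (\<Sum>i\<in>I. c i *\<^sub>R y i)"
      have T1: "T \<in> ker_graph (Div_S \<Omega>)"
        unfolding T_def by (intro subspace_diff[OF subD S(2)] subspace_sum[OF subD] subspace_scale[OF subD] q(3))
      have "T = symL2 (snd (((v, G) - gp (F c)) + (\<Sum>i\<in>I. c i *\<^sub>R q i)))"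
        unfolding T_def sy by (simp add: symL2.diff symL2.add vG(2))
      then have "T \<bullet> T = 0" using perp[OF subspace_add[OF subspace_H10_graph z Q[of c]] T1] by simp
      then have "S = (\<Sum>i\<in>I. c i *\<^sub>R y i)" by (simp add: T_def)
      then show "S \<in> span (y ` I)" by (simp only:) (intro span_sum span_scale span_base imageI)
    qed
  qed
qed

theorem theorem11p23:
  fixes \<Omega> :: "(real^3) set" and m :: nat
  assumes "open \<Omega>" and "bounded \<Omega>" and "continuous_boundary \<Omega>"
    and "m = card (components (- closure \<Omega>))"
  shows "finite (components (- closure \<Omega>)) \<and>
    dim (harmonic_fields \<Omega>) = 6 * (m - 1) \<and>
    (\<forall>\<Xi> \<xi>. exterior_enumeration \<Omega> m \<Xi> \<and> is_cutoff_family m \<Xi> \<xi> \<longrightarrow>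
       (\<forall>l\<in>{1..m - 1}. \<forall>j\<in>{1..6}. v_field \<Omega> (\<xi> l) j \<in> H1 \<Omega>) \<and>
       independent {symGrad \<Omega> (v_field \<Omega> (\<xi> l) j) | l j. l \<in> {1..m - 1} \<and> j \<in> {1..6}} \<and>
       span {symGrad \<Omega> (v_field \<Omega> (\<xi> l) j) | l j. l \<in> {1..m - 1} \<and> j \<in> {1..6}}
         = harmonic_fields \<Omega>)"
proof (intro conjI allI impI)
  note \<Omega> = assms(1-3)
  show "finite (components (- closure \<Omega>))" by (rule finite_exterior_components[OF \<Omega>])
  \<comment> \<open>The dimension does not refer to any enumeration or cut-offs, so it is computed
    from one choice, whose existence has to be shown.\<close>
  obtain \<Xi> where en: "exterior_enumeration \<Omega> m \<Xi>" using exterior_enumeration_exists[OF \<Omega> assms(4)] by metis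
  obtain \<xi> where cf: "is_cutoff_family m \<Xi> \<xi>" using cutoff_family_exists[OF \<Omega> en] by metis
  note B = harmonic_fields_basis[OF \<Omega> en cf]
  show "dim (harmonic_fields \<Omega>) = 6 * (m - 1)"
    unfolding B(4)[symmetric] dim_span dim_eq_card_independent[OF B(3)] card_image[OF B(2)] by simp
next
  fix \<Xi> \<xi> assume "exterior_enumeration \<Omega> m \<Xi> \<and> is_cutoff_family m \<Xi> \<xi>"
  then have h: "exterior_enumeration \<Omega> m \<Xi>" "is_cutoff_family m \<Xi> \<xi>" by auto
  note B = harmonic_fields_basis[OF assms(1-3) h]
  have img: "{symGrad \<Omega> (v_field \<Omega> (\<xi> l) j) | l j. l \<in> {1..m - 1} \<and> j \<in> {1..6}}
      = (\<lambda>i. symGrad \<Omega> (v_field \<Omega> (\<xi> (fst i)) (snd i))) ` ({1..m - 1} \<times> {1..6})"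
    by force
  show "\<forall>l\<in>{1..m - 1}. \<forall>j\<in>{1..6}. v_field \<Omega> (\<xi> l) j \<in> H1 \<Omega>" using B(1) by blast
  show "independent {symGrad \<Omega> (v_field \<Omega> (\<xi> l) j) | l j. l \<in> {1..m - 1} \<and> j \<in> {1..6}}"
    unfolding img by (rule B(3))
  show "span {symGrad \<Omega> (v_field \<Omega> (\<xi> l) j) | l j. l \<in> {1..m - 1} \<and> j \<in> {1..6}} = harmonic_fields \<Omega>"
    unfolding img by (rule B(4))
qed

end
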